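(* Let $q\equiv 3\bmod 4$ be a rational prime, $p=\sqrt{-q}$, $\mathcal{O}=\mathbb{Z}[\tfrac{1+p}{2}]$. Then: (i) $L_q$ contains a (nonzero) norm zero vector fixed by $\operatorname{PGL}(3,\mathbb{F}_q)$ if and only if $q^2+q+1$ is the norm of some element of $\mathbb{Q}[\sqrt{-q}]$. (ii) Suppose $q^2+q+1$ is the norm of some element of $\mathbb{Q}[\sqrt{-q}]$. Then there is a definite $p$-modular Hermitian $\mathcal{O}$-lattice of rank $q^2+q$ whose automorphism group contains a subgroup isomorphic to $\operatorname{PGL}(3,\mathbb{F}_q)$. More precisely, if $z$ is a primitive norm zero vector in $L_q$ fixed by $\operatorname{PGL}(3,\mathbb{F}_q)$, then there exists $f\in L_q$ with $\langle z\vert f\rangle=p$, and with $H=\mathcal{O}z+\mathcal{O}f$ one has an orthogonal decomposition $L_q=\Lambda_q\oplus H$, where $\Lambda_q\simeq z^\perp/z$ is a definite $p$-modular Hermitian $\mathcal{O}$-lattice with $\operatorname{Aut}(\Lambda_q)\supseteq\operatorname{PGL}(3,\mathbb{F}_q)$. (iii) For $q=3$, $\Lambda_q$ is the Leech lattice defined over the Eisenstein integers (that is, the underlying $\mathbb{Z}$-module of $\Lambda_3$ with the form $-\tfrac{2}{3}\operatorname{Re}\langle x\vert y\rangle$ is isometric to the Leech lattice).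
   Context: Put $n=q^2+q+1$. Hermitian forms $\langle\cdot\vert\cdot\rangle$ are linear in the second variable and conjugate-linear in the first. An $\mathcal{O}$-lattice is a finitely generated projective $\mathcal{O}$-module $L$ with an $\mathcal{O}$-valued Hermitian form with $\operatorname{Rad}(L)=0$, where $\operatorname{Rad}(L)=\{x\in L: \langle y\vert x\rangle=0\ \forall y\in L\}$. The dual $L'$ is identified with $\{x\in L\otimes\operatorname{Frac}(\mathcal{O}):\langle y\vert x\rangle\in\mathcal{O}\ \forall y\in L\}$; $L$ is $p$-modular if $L'=p^{-1}L$. The norm of $v$ is $\langle v\vert v\rangle$. A nonzero vector $z\in L$ is primitive if $az\in L$ with $a\in\operatorname{Frac}(\mathcal{O})$ implies $a\in\mathcal{O}$. For a primitive norm zero vector, $z^\perp/z$ means $z^\perp/\mathcal{O}z$. $\operatorname{Aut}$ denotes the group of $\mathcal{O}$-linear isometries. The lattice $L_q$: let $\mathcal{P}$ and $\mathcal{L}$ be the sets of points and lines of $\mathbb{P}^2(\mathbb{F}_q)$ ($n$ elements each), and write $x\in l$ for incidence. Let $L_q^\circ$ be the free $\mathcal{O}$-module of rank $2n$ with basis $\mathcal{P}\cup\mathcal{L}$ and Hermitian form determined on basis vectors by: $\langle r\vert r\rangle=-q$ for all $r\in\mathcal{P}\cup\mathcal{L}$; $\langle r\vert s\rangle=p$ if $r\in\mathcal{P}$, $s\in\mathcal{L}$, $r\in s$; $\langle r\vert s\rangle=\bar p$ if $r\in\mathcal{L}$, $s\in\mathcal{P}$, $s\in r$; and $0$ otherwise.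 Then $L_q=L_q^\circ/\operatorname{Rad}(L_q^\circ)$ with the induced form, a lattice of signature $(1,n)$. The group $\operatorname{PGL}(3,\mathbb{F}_q)$ acts on $L_q$ by isometries via its permutation action on points and lines. *)

theory Defs
  imports
    "HOL-Analysis.Analysis"
    "HOL-Computational_Algebra.Polynomial"
    "HOL-Number_Theory.Cong"
    "HOL-Algebra.AbelCoset"
    "HOL-Algebra.Module"
    "HOL-Algebra.Bij"
begin

section \<open>The ring of scalars\<close>

definition rt :: "nat \<Rightarrow> complex" where
  "rt q = csqrt (- of_nat q)"

definition \<O> :: "nat \<Rightarrow> complex set" where
  "\<O> q = range (\<lambda>f :: int poly. poly (map_poly of_int f) ((1 + rt q) / 2))"

definition \<O>_ring :: "nat \<Rightarrow> complex ring" where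
  "\<O>_ring q = \<lparr>carrier = \<O> q, monoid.mult = (*), one = 1, zero = 0, add = (+)\<rparr>"

definition quadratic_field :: "nat \<Rightarrow> complex set" where
  "quadratic_field q = {of_rat a + of_rat b * rt q | a b. True}"

text \<open>The nontrivial automorphism of the field is complex conjugation, so the norm of
  \<open>x\<close> over the rationals is \<open>x * cnj x\<close>.\<close>

definition is_field_norm :: "nat \<Rightarrow> nat \<Rightarrow> bool" where
  "is_field_norm q m \<longleftrightarrow> (\<exists>x\<in>quadratic_field q. x * cnj x = of_nat m)"


section \<open>Modules with a Hermitian form\<close>

text \<open>The inherited fields \<open>mult\<close> and \<open>one\<close> play no role for modules.\<close>

record 'a hmod = "(complex, 'a) module" +
  form :: "'a \<Rightarrow> 'a \<Rightarrow> complex"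

definition lin_maps :: "nat \<Rightarrow> (complex, 'a, 'm) module_scheme \<Rightarrow> (complex, 'b, 'n) module_scheme
    \<Rightarrow> ('a \<Rightarrow> 'b) set" where
  "lin_maps q M N = {f \<in> carrier M \<rightarrow> carrier N.
     (\<forall>x\<in>carrier M. \<forall>y\<in>carrier M. f (x \<oplus>\<^bsub>M\<^esub> y) = f x \<oplus>\<^bsub>N\<^esub> f y) \<and>
     (\<forall>a\<in>\<O> q. \<forall>x\<in>carrier M. f (a \<odot>\<^bsub>M\<^esub> x) = a \<odot>\<^bsub>N\<^esub> f x)}"

definition isometries :: "nat \<Rightarrow> ('a, 'm) hmod_scheme \<Rightarrow> ('b, 'n) hmod_scheme \<Rightarrow> ('a \<Rightarrow> 'b) set" where
  "isometries q M N = {f \<in> lin_maps q M N. bij_betw f (carrier M) (carrier N) \<and>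
     (\<forall>x\<in>carrier M. \<forall>y\<in>carrier M. form N (f x) (f y) = form M x y)}"

definition isometric :: "nat \<Rightarrow> ('a, 'm) hmod_scheme \<Rightarrow> ('b, 'n) hmod_scheme \<Rightarrow> bool" where
  "isometric q M N \<longleftrightarrow> isometries q M N \<noteq> {}"

definition Aut :: "nat \<Rightarrow> ('a, 'm) hmod_scheme \<Rightarrow> ('a \<Rightarrow> 'a) monoid" where
  "Aut q M = BijGroup (carrier M) \<lparr>carrier := isometries q M M \<inter> Bij (carrier M)\<rparr>"

definition contains_copy :: "('a, 'm) monoid_scheme \<Rightarrow> ('b, 'n) monoid_scheme \<Rightarrow> bool" where
  "contains_copy A G \<longleftrightarrow> (\<exists>H. subgroup H A \<and> G \<cong> A\<lparr>carrier := H\<rparr>)"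

text \<open>The free module with basis \<open>I\<close>, for finite \<open>I\<close>.\<close>

definition free_mod :: "nat \<Rightarrow> 'i set \<Rightarrow> (complex, 'i \<Rightarrow> complex) module" where
  "free_mod q I = \<lparr>carrier = {v. (\<forall>i\<in>I. v i \<in> \<O> q) \<and> (\<forall>i. i \<notin> I \<longrightarrow> v i = 0)},
     monoid.mult = undefined, one = undefined,
     zero = (\<lambda>_. 0), add = (\<lambda>u v i. u i + v i), smult = (\<lambda>a v i. a * v i)\<rparr>"

text \<open>Finitely generated projective: a direct summand of a free module of finite rank.\<close>

definition fg_projective :: "nat \<Rightarrow> (complex, 'a, 'm) module_scheme \<Rightarrow> bool" where
  "fg_projective q M \<longleftrightarrow> (\<exists>n :: nat. \<exists>\<iota>\<in>lin_maps q M (free_mod q {..<n}).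
     \<exists>\<pi>\<in>lin_maps q (free_mod q {..<n}) M. \<forall>x\<in>carrier M. \<pi> (\<iota> x) = x)"

definition radical :: "('a, 'm) hmod_scheme \<Rightarrow> 'a set" where
  "radical M = {x \<in> carrier M. \<forall>y\<in>carrier M. form M y x = 0}"

locale hermitian_lattice = Module.module "\<O>_ring q" M
  for q :: nat and M :: "('a, 'm) hmod_scheme" (structure) +
  assumes fg_projective: "fg_projective q M"
    and form_closed: "\<lbrakk>x \<in> carrier M; y \<in> carrier M\<rbrakk> \<Longrightarrow> form M x y \<in> \<O> q"
    and form_add: "\<lbrakk>x \<in> carrier M; y \<in> carrier M; w \<in> carrier M\<rbrakk>
      \<Longrightarrow> form M x (y \<oplus> w) = form M x y + form M x w"
    and form_smult: "\<lbrakk>a \<in> \<O> q; x \<in> carrier M; y \<in> carrier M\<rbrakk>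
      \<Longrightarrow> form M x (a \<odot> y) = a * form M x y"
    and form_hermitian: "\<lbrakk>x \<in> carrier M; y \<in> carrier M\<rbrakk> \<Longrightarrow> form M y x = cnj (form M x y)"
    and radical_trivial: "radical M = {\<zero>}"

definition definite :: "('a, 'm) hmod_scheme \<Rightarrow> bool" where
  "definite M \<longleftrightarrow> (\<forall>x\<in>carrier M - {\<zero>\<^bsub>M\<^esub>}. Re (form M x x) > 0) \<or>
                  (\<forall>x\<in>carrier M - {\<zero>\<^bsub>M\<^esub>}. Re (form M x x) < 0)"

definition lin_independent :: "nat \<Rightarrow> (complex, 'a, 'm) module_scheme \<Rightarrow> 'a set \<Rightarrow> bool" where
  "lin_independent q M B \<longleftrightarrow> finite B \<and> B \<subseteq> carrier M \<and>
     (\<forall>c \<in> B \<rightarrow> \<O> q. (\<Oplus>\<^bsub>M\<^esub>x\<in>B. c x \<odot>\<^bsub>M\<^esub> x) = \<zero>\<^bsub>M\<^esub> \<longrightarrow> (\<forall>x\<in>B. c x = 0))"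

definition has_rank :: "nat \<Rightarrow> (complex, 'a, 'm) module_scheme \<Rightarrow> nat \<Rightarrow> bool" where
  "has_rank q M r \<longleftrightarrow> (\<exists>B. lin_independent q M B \<and> card B = r) \<and>
     (\<forall>B. lin_independent q M B \<longrightarrow> card B \<le> r)"

text \<open>The tensor product of \<open>M\<close> with the fraction field, realized as the module of fractions
  \<open>x / d\<close> with \<open>x\<close> in \<open>M\<close> and a nonzero scalar \<open>d\<close>.\<close>

definition frac_rel :: "nat \<Rightarrow> (complex, 'a, 'm) module_scheme
    \<Rightarrow> (('a \<times> complex) \<times> ('a \<times> complex)) set" where
  "frac_rel q M = {((x, d), (y, e)). x \<in> carrier M \<and> y \<in> carrier M \<and>
     d \<in> \<O> q - {0} \<and> e \<in> \<O> q - {0} \<and>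
     (\<exists>t \<in> \<O> q - {0}. t \<odot>\<^bsub>M\<^esub> (e \<odot>\<^bsub>M\<^esub> x) = t \<odot>\<^bsub>M\<^esub> (d \<odot>\<^bsub>M\<^esub> y))}"

definition fracs :: "nat \<Rightarrow> (complex, 'a, 'm) module_scheme \<Rightarrow> ('a \<times> complex) set set" where
  "fracs q M = (carrier M \<times> (\<O> q - {0})) // frac_rel q M"

definition frac :: "nat \<Rightarrow> (complex, 'a, 'm) module_scheme \<Rightarrow> 'a \<Rightarrow> complex
    \<Rightarrow> ('a \<times> complex) set" where
  "frac q M x d = frac_rel q M `` {(x, d)}"

definition dual :: "nat \<Rightarrow> ('a, 'm) hmod_scheme \<Rightarrow> ('a \<times> complex) set set" where
  "dual q M = {X \<in> fracs q M. \<forall>y\<in>carrier M. \<forall>(x, d)\<in>X. form M y x / d \<in> \<O> q}"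

definition p_modular :: "nat \<Rightarrow> ('a, 'm) hmod_scheme \<Rightarrow> bool" where
  "p_modular q M \<longleftrightarrow> dual q M = {frac q M x (rt q) | x. x \<in> carrier M}"

definition primitive :: "nat \<Rightarrow> (complex, 'a, 'm) module_scheme \<Rightarrow> 'a \<Rightarrow> bool" where
  "primitive q M z \<longleftrightarrow> z \<in> carrier M \<and> z \<noteq> \<zero>\<^bsub>M\<^esub> \<and>
     (\<forall>b\<in>\<O> q. \<forall>d\<in>\<O> q - {0}.
        (\<exists>x\<in>carrier M. frac q M (b \<odot>\<^bsub>M\<^esub> z) d = frac q M x 1) \<longrightarrow> b / d \<in> \<O> q)"

text \<open>The quotient by a submodule \<open>N\<close>; its form is only meaningful if \<open>N\<close> lies in the radical.\<close>

definition hquot :: "('a, 'm) hmod_scheme \<Rightarrow> 'a set \<Rightarrow> 'a set hmod" where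
  "hquot M N = \<lparr>carrier = a_rcosets\<^bsub>M\<^esub> N, monoid.mult = undefined, one = undefined,
     zero = N, add = (\<lambda>X Y. X <+>\<^bsub>M\<^esub> Y),
     smult = (\<lambda>a X. \<Union>x\<in>X. N +>\<^bsub>M\<^esub> (a \<odot>\<^bsub>M\<^esub> x)),
     form = (\<lambda>X Y. the_elem ((\<lambda>(x, y). form M x y) ` (X \<times> Y)))\<rparr>"

definition perp_quot :: "nat \<Rightarrow> ('a, 'm) hmod_scheme \<Rightarrow> 'a \<Rightarrow> 'a set hmod" where
  "perp_quot q M z = hquot (M\<lparr>carrier := {x \<in> carrier M. form M z x = 0}\<rparr>)
     {a \<odot>\<^bsub>M\<^esub> z | a. a \<in> \<O> q}"

definition orthogonal_sum :: "nat \<Rightarrow> ('a, 'm) hmod_scheme \<Rightarrow> 'a set \<Rightarrow> 'a set \<Rightarrow> bool" where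
  "orthogonal_sum q M A B \<longleftrightarrow> submodule A (\<O>_ring q) M \<and> submodule B (\<O>_ring q) M \<and>
     carrier M = A <+>\<^bsub>M\<^esub> B \<and> A \<inter> B = {\<zero>\<^bsub>M\<^esub>} \<and> (\<forall>a\<in>A. \<forall>b\<in>B. form M a b = 0)"


section \<open>The projective plane and its projective linear group\<close>

definition pts :: "('k::field ^ 3) set set" where
  "pts = {U. vec.subspace U \<and> vec.dim U = 1}"

definition lns :: "('k::field ^ 3) set set" where
  "lns = {U. vec.subspace U \<and> vec.dim U = 2}"

definition GL3 :: "('k::field ^ 3 ^ 3) monoid" where
  "GL3 = \<lparr>carrier = {A. invertible A}, monoid.mult = (**), one = mat 1\<rparr>"

definition PGL3 :: "('k::field ^ 3 ^ 3) set monoid" where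
  "PGL3 = GL3 Mod {mat c | c. c \<noteq> 0}"

definition pgl_act :: "('k::field ^ 3 ^ 3) set \<Rightarrow> ('k ^ 3) set \<Rightarrow> ('k ^ 3) set" where
  "pgl_act g U = the_elem ((\<lambda>A. (*v) A ` U) ` g)"


section \<open>The lattice of the projective plane\<close>

definition gram :: "nat \<Rightarrow> ('k::field ^ 3) set \<Rightarrow> ('k ^ 3) set \<Rightarrow> complex" where
  "gram q r s =
     (if r = s then - of_nat q
      else if r \<in> pts \<and> s \<in> lns \<and> r \<subseteq> s then rt q
      else if r \<in> lns \<and> s \<in> pts \<and> s \<subseteq> r then cnj (rt q)
      else 0)"

definition L_free :: "nat \<Rightarrow> (('k::{field,finite} ^ 3) set \<Rightarrow> complex) hmod" where
  "L_free q = module.extend (free_mod q (pts \<union> lns))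
     (hmod.fields (\<lambda>u v. \<Sum>r\<in>pts \<union> lns. \<Sum>s\<in>pts \<union> lns. cnj (u r) * gram q r s * v s))"

definition L_plane :: "nat \<Rightarrow> (('k::{field,finite} ^ 3) set \<Rightarrow> complex) set hmod" where
  "L_plane q = hquot (L_free q) (radical (L_free q))"

text \<open>The linear extension of the permutation action on the basis of points and lines (the
  coefficient of \<open>g \<cdot> v\<close> at \<open>r\<close> is that of \<open>v\<close> at the preimage of \<open>r\<close>), and the induced action on
  cosets.\<close>

definition act_free :: "('k::{field,finite} ^ 3 ^ 3) set \<Rightarrow> (('k ^ 3) set \<Rightarrow> complex)
    \<Rightarrow> (('k ^ 3) set \<Rightarrow> complex)" where
  "act_free g v = (\<lambda>r. if r \<in> pts \<union> lns then v (pgl_act (inv\<^bsub>PGL3\<^esub> g) r) else 0)"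

definition act :: "('k::{field,finite} ^ 3 ^ 3) set \<Rightarrow> (('k ^ 3) set \<Rightarrow> complex) set
    \<Rightarrow> (('k ^ 3) set \<Rightarrow> complex) set" where
  "act g X = act_free g ` X"

definition fixed_null :: "nat \<Rightarrow> (('k::{field,finite} ^ 3) set \<Rightarrow> complex) set \<Rightarrow> bool" where
  "fixed_null q z \<longleftrightarrow> z \<in> carrier (L_plane q) \<and> z \<noteq> \<zero>\<^bsub>L_plane q\<^esub> \<and>
     form (L_plane q) z z = 0 \<and> (\<forall>g\<in>carrier PGL3. act g z = z)"

text \<open>A splitting of the lattice into the hyperbolic cell spanned by \<open>z\<close> and \<open>f\<close>
  and the sublattice \<open>\<Lambda>\<close>.\<close>

definition splitting :: "nat \<Rightarrow> (('k::{field,finite} ^ 3) set \<Rightarrow> complex) set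
    \<Rightarrow> (('k ^ 3) set \<Rightarrow> complex) set \<Rightarrow> (('k ^ 3) set \<Rightarrow> complex) set set \<Rightarrow> bool" where
  "splitting q z f \<Lambda> \<longleftrightarrow> f \<in> carrier (L_plane q) \<and> form (L_plane q) z f = rt q \<and>
     orthogonal_sum q (L_plane q) \<Lambda>
       {a \<odot>\<^bsub>L_plane q\<^esub> z \<oplus>\<^bsub>L_plane q\<^esub> b \<odot>\<^bsub>L_plane q\<^esub> f | a b. a \<in> \<O> q \<and> b \<in> \<O> q}"


section \<open>The Leech lattice\<close>

text \<open>Conway's construction. The coordinates are indexed by the projective line over the field
  with 23 elements, with \<open>None\<close> as the point at infinity. The extended binary Golay code is
  spanned by the whole line and the translates of the complement of the set of squares; codewords
  are represented by their supports.\<close>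

inductive_set golay :: "23 option set set" where
  golay_empty: "{} \<in> golay"
| golay_all: "C \<in> golay \<Longrightarrow> - C \<in> golay"
| golay_step: "C \<in> golay \<Longrightarrow>
    sym_diff C (map_option (\<lambda>x. x - i) ` (- range (\<lambda>x. Some (x * x)))) \<in> golay"

definition leech :: "(real ^ 23 option) set" where
  "leech = {(1 / sqrt 8) *\<^sub>R (\<chi> i. of_int (x i)) | x :: 23 option \<Rightarrow> int.
     \<exists>m :: int. (\<forall>i. [x i = m] (mod 2)) \<and> (\<forall>k. {i. [x i = k] (mod 4)} \<in> golay) \<and>
       [(\<Sum>i\<in>UNIV. x i) = 4 * m] (mod 8)}"

definition is_leech :: "('a, 'm) hmod_scheme \<Rightarrow> bool" where
  "is_leech M \<longleftrightarrow> (\<exists>\<phi>. bij_betw \<phi> (carrier M) leech \<and>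
     (\<forall>x\<in>carrier M. \<forall>y\<in>carrier M. \<phi> (x \<oplus>\<^bsub>M\<^esub> y) = \<phi> x + \<phi> y) \<and>
     (\<forall>x\<in>carrier M. \<forall>y\<in>carrier M. \<phi> x \<bullet> \<phi> y = - (2 / 3) * Re (form M x y)))"

end

theory Submission
  imports Defs "HOL-Number_Theory.Residues"
begin

text \<open>Let \<open>B\<close> be the incidence matrix of the plane. Sending a vector \<open>(x, y)\<close> with point part \<open>x\<close> and
  line part \<open>y\<close> to \<open>(\<Sum> y; p x + B y)\<close> turns the form into \<open>\<bar>c\<bar>\<^sup>2 - \<bar>v\<bar>\<^sup>2\<close> because \<open>B\<^sup>T B = q I + J\<close>, and
  its kernel is the radical. So the lattice consists of the \<open>(c; v)\<close> for which \<open>v\<close> modulo \<open>p\<close> lies in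
  the code of the plane and \<open>c\<close> is congruent to the sum of \<open>v\<close>. It is \<open>p\<close>-modular: if all line sums
  of an integral \<open>v\<close> are congruent modulo \<open>q\<close>, then \<open>B B\<^sup>T v = q v + (\<Sum> v) 1\<close> exhibits \<open>v\<close> as a
  combination of lines after cancelling \<open>q\<close>.

  Invariant vectors are \<open>z = (a; b 1)\<close>, with norm \<open>\<bar>a\<bar>\<^sup>2 - (q\<^sup>2 + q + 1) \<bar>b\<bar>\<^sup>2\<close>, which gives (i). For such a
  null vector, \<open>v \<mapsto> v - mean v\<close> identifies the quotient of the complement of \<open>z\<close> with a lattice
  \<open>W\<close> in the sum-zero space with form \<open>- \<bar>v\<bar>\<^sup>2\<close>, on which the group permutes coordinates. All
  properties are proved for \<open>W\<close>. The ring of scalars need not be principal, so \<open>z\<close> need not have a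
  primitive multiple; instead invertibility of the ideal \<open>\<langle>z|L\<rangle>\<close> provides what is needed.

  For \<open>q = 3\<close>, \<open>W\<close> depends only on which prime above 13 divides \<open>a\<close>, and the two possibilities are
  conjugate. An explicit basis of \<open>W\<close> and an explicit family in the Leech lattice have the same
  unimodular Gram matrix, so both families are bases and the two integral lattices are isometric.\<close>

section \<open>Arithmetic of the quadratic order\<close>

text \<open>Two demands shape the work. First, projectivity has to be shown over a ring that need
  not be principal, so no basis can be expected. A dual basis replaces it: over the prime field the
  incidence matrix has a generalized inverse, which yields integral coefficient functionals on the
  coordinate lattice, and p-modularity turns each functional into the pairing with a lattice vector.
  In the shape x = sum of (<Y_i|x> / p) M_i the dual basis passes through the projection onto the
  complement of \<open>z\<close> and then onto the sum-zero vectors. Second, no characterization of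
  the Leech lattice is invoked, so an isometry must be exhibited. A Gram matrix with an integral
  inverse keeps this small: once the tabulated vectors are known to lie in the two lattices, and the
  dimensions are at most 24, generation is automatic. On the side of the plane, membership is a
  congruence modulo a prime above 13 that can be solved because 13 itself does not divide
  \<open>a\<close>.\<close>

definition \<theta> :: "nat \<Rightarrow> complex" where
  "\<theta> q = (1 + rt q) / 2"

locale quad_order =
  fixes q :: nat
  assumes prime_q: "prime q" and q_mod_4: "[q = 3] (mod 4)"
begin

lemma q_pos: "q > 0"
  using prime_q prime_gt_0_nat by blast

lemma q_odd: "odd q"
  using q_mod_4 unfolding cong_def by presburger

lemma q_ge_3: "q \<ge> 3"
  using prime_ge_2_nat[OF prime_q] q_odd by (cases "q = 2") auto

lemma rt_eq: "rt q = \<i> * of_real (sqrt (real q))"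
  unfolding rt_def by (subst csqrt_of_real_nonpos) auto

lemma rt_sq: "rt q * rt q = - of_nat q"
proof -
  have "rt q * rt q = (\<i> * \<i>) * of_real (sqrt (real q) * sqrt (real q))"
    unfolding rt_eq of_real_mult by (simp only: ac_simps)
  then show ?thesis by simp
qed

lemma rt_nz [simp]: "rt q \<noteq> 0"
  using rt_sq q_pos by fastforce

lemma cnj_rt [simp]: "cnj (rt q) = - rt q"
  by (simp add: rt_eq)

lemma Re_rt [simp]: "Re (rt q) = 0"
  by (simp add: rt_eq)

text \<open>The norm of \<open>\<theta> q\<close>, an integer because \<open>q\<close> is 3 modulo
  4.\<close>

definition th_norm :: int where "th_norm = (int q + 1) div 4"

lemma th_norm: "4 * th_norm = int q + 1"
proof -
  have "4 dvd (q + 1)"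
    using q_mod_4 unfolding cong_def by presburger
  then have "4 dvd (int q + 1)"
    by (metis of_nat_1 of_nat_add of_nat_dvd_iff of_nat_numeral)
  then show ?thesis unfolding th_norm_def by simp
qed

lemma th_sq: "\<theta> q * \<theta> q = \<theta> q - of_int th_norm"
proof -
  have "(4::complex) * of_int th_norm = of_nat q + 1"
    using arg_cong[OF th_norm, of "of_int :: int \<Rightarrow> complex"] by simp
  then have t: "of_int th_norm = ((of_nat q + 1) / 4 :: complex)" by (simp add: field_simps)
  have "\<theta> q * \<theta> q = (1 + 2 * rt q + rt q * rt q) / 4"
    unfolding \<theta>_def by (simp add: algebra_simps)
  also have "\<dots> = \<theta> q - of_int th_norm"
    unfolding t rt_sq \<theta>_def by (simp add: field_simps)
  finally show ?thesis .
qed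

lemma cnj_th: "cnj (\<theta> q) = 1 - \<theta> q"
  unfolding \<theta>_def by (simp add: field_simps)

lemma rt_th: "rt q = 2 * \<theta> q - 1"
  unfolding \<theta>_def by (simp add: field_simps)

text \<open>The relation \<theta>^2 = \<theta> - \<open>th_norm\<close> removes all higher powers,
  so a Horner induction over the polynomial leaves two integer coordinates. Closure and integrality
  facts are computed in them.\<close>

lemma O_iff: "x \<in> \<O> q \<longleftrightarrow> (\<exists>a b :: int. x = of_int a + of_int b * \<theta> q)"
proof
  have "\<exists>a b :: int. poly (map_poly of_int f) (\<theta> q) = of_int a + of_int b * \<theta> q" for f :: "int poly"
  proof (induction f)
    case 0
    show ?case by (rule exI[of _ 0], rule exI[of _ 0]) simp
  next
    case (pCons c f)
    then obtain a b :: int where ab: "poly (map_poly of_int f) (\<theta> q) = of_int a + of_int b * \<theta> q" by auto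
    have "poly (map_poly of_int (pCons c f)) (\<theta> q) = of_int c + \<theta> q * (of_int a + of_int b * \<theta> q)"
      by (simp add: map_poly_pCons ab)
    also have "\<dots> = of_int c + of_int a * \<theta> q + of_int b * (\<theta> q * \<theta> q)"
      by (simp add: algebra_simps)
    also have "\<dots> = of_int (c - b * th_norm) + of_int (a + b) * \<theta> q"
      unfolding th_sq by (simp add: algebra_simps)
    finally show ?case by blast
  qed
  moreover assume "x \<in> \<O> q"
  ultimately show "\<exists>a b :: int. x = of_int a + of_int b * \<theta> q"
    unfolding \<O>_def \<theta>_def by auto
next
  assume "\<exists>a b :: int. x = of_int a + of_int b * \<theta> q"
  then obtain a b :: int where "x = of_int a + of_int b * \<theta> q" by blast
  then have "x = poly (map_poly of_int [:a, b:]) ((1 + rt q) / 2)"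
    by (simp add: map_poly_pCons \<theta>_def algebra_simps)
  then show "x \<in> \<O> q" unfolding \<O>_def by blast
qed

lemma O_int [simp]: "of_int a \<in> \<O> q"
  unfolding O_iff by (rule exI[of _ a], rule exI[of _ 0]) simp

lemma O_nat [simp]: "of_nat a \<in> \<O> q"
  using O_int[of "int a"] by simp

lemma O_num [simp]: "numeral a \<in> \<O> q"
  using O_int[of "numeral a"] by simp

lemma O_0 [simp]: "0 \<in> \<O> q" and O_1 [simp]: "1 \<in> \<O> q"
  using O_int[of 0] O_int[of 1] by simp_all

lemma O_th [simp]: "\<theta> q \<in> \<O> q"
  unfolding O_iff by (rule exI[of _ 0], rule exI[of _ 1]) simp

lemma O_add [intro, simp]:
  assumes "x \<in> \<O> q" "y \<in> \<O> q" shows "x + y \<in> \<O> q"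
proof -
  obtain a b c d :: int where "x = of_int a + of_int b * \<theta> q" "y = of_int c + of_int d * \<theta> q"
    using assms unfolding O_iff by blast
  then have "x + y = of_int (a + c) + of_int (b + d) * \<theta> q" by (simp add: algebra_simps)
  then show ?thesis unfolding O_iff by blast
qed

lemma O_mult [intro, simp]:
  assumes "x \<in> \<O> q" "y \<in> \<O> q" shows "x * y \<in> \<O> q"
proof -
  obtain a b c d :: int where *: "x = of_int a + of_int b * \<theta> q" "y = of_int c + of_int d * \<theta> q"
    using assms unfolding O_iff by blast
  have "x * y = of_int (a * c) + of_int (a * d + b * c) * \<theta> q + of_int (b * d) * (\<theta> q * \<theta> q)"
    unfolding * by (simp add: algebra_simps)
  also have "\<dots> = of_int (a * c - b * d * th_norm) + of_int (a * d + b * c + b * d) * \<theta> q"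
    unfolding th_sq by (simp add: algebra_simps)
  finally show ?thesis unfolding O_iff by blast
qed

lemma O_minus [simp]: "x \<in> \<O> q \<Longrightarrow> - x \<in> \<O> q"
  using O_mult[of "-1" x] O_int[of "-1"] by simp

lemma O_diff [intro, simp]: "x \<in> \<O> q \<Longrightarrow> y \<in> \<O> q \<Longrightarrow> x - y \<in> \<O> q"
  using O_add[of x "- y"] by simp

lemma O_rt [simp]: "rt q \<in> \<O> q"
  unfolding rt_th by simp

lemma O_cnj [simp]: "cnj x \<in> \<O> q \<longleftrightarrow> x \<in> \<O> q"
proof -
  have *: "cnj x \<in> \<O> q" if "x \<in> \<O> q" for x
  proof -
    obtain a b :: int where "x = of_int a + of_int b * \<theta> q"
      using \<open>x \<in> \<O> q\<close> unfolding O_iff by blast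
    then show ?thesis by (simp add: cnj_th)
  qed
  show ?thesis using *[of x] *[of "cnj x"] by auto
qed

lemma O_sum [intro, simp]: "(\<And>i. i \<in> I \<Longrightarrow> f i \<in> \<O> q) \<Longrightarrow> sum f I \<in> \<O> q"
  by (induction I rule: infinite_finite_induct) auto

text \<open>The residue field at p is the prime field: p \<theta> = \<theta> - (q + 1) / 2, so
  \<theta> is congruent to (q + 1) / 2, the inverse of 2 modulo \<open>q\<close>.\<close>

lemma O_mod_rt:
  assumes "x \<in> \<O> q" obtains m :: int and y where "y \<in> \<O> q" "x = of_int m + rt q * y"
proof -
  obtain a b :: int where *: "x = of_int a + of_int b * \<theta> q"
    using assms unfolding O_iff by blast
  define h where "h = (int q + 1) div 2"
  have "2 * h = int q + 1" using q_odd unfolding h_def by simp presburger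
  then have "(2::complex) * of_int h = of_nat q + 1"
    by (metis of_int_mult of_int_numeral of_int_add of_int_1 of_int_of_nat_eq)
  then have h: "of_int h = ((of_nat q + 1) / 2 :: complex)" by (simp add: field_simps)
  have "rt q * \<theta> q + of_int h = \<theta> q"
    using rt_sq unfolding h \<theta>_def by (simp add: field_simps)
  then have "x = of_int a + of_int b * (rt q * \<theta> q + of_int h)"
    unfolding * by simp
  then have "x = of_int (a + b * h) + rt q * (of_int b * \<theta> q)"
    by (simp add: algebra_simps)
  then show ?thesis using that by (metis O_int O_mult O_th)
qed

lemma O_norm_int:
  assumes "x \<in> \<O> q" obtains k :: int where "x * cnj x = of_int k" "k \<ge> 0"
proof -
  obtain a b :: int where *: "x = of_int a + of_int b * \<theta> q"
    using assms unfolding O_iff by blast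
  have "x * cnj x = of_int (a*a + a*b + b*b) - of_int (b*b) * (\<theta> q * \<theta> q - \<theta> q + 1)"
    unfolding * by (simp add: cnj_th algebra_simps)
  also have "\<dots> = of_int (a*a + a*b + b*b*th_norm)"
    unfolding th_sq by (simp add: algebra_simps)
  finally have 1: "x * cnj x = of_int (a*a + a*b + b*b*th_norm)" .
  have "Re (x * cnj x) \<ge> 0" by (simp add: complex_mult_cnj)
  moreover have "Re (of_int k) = of_int k" for k by simp
  ultimately have "a*a + a*b + b*b*th_norm \<ge> 0" unfolding 1 by (simp only: of_int_0_le_iff)
  then show ?thesis using 1 that by blast
qed

lemma O_trace_int:
  assumes "x \<in> \<O> q" obtains k :: int where "x + cnj x = of_int k"
proof -
  obtain a b :: int where *: "x = of_int a + of_int b * \<theta> q"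
    using assms unfolding O_iff by blast
  have "x + cnj x = of_int (2 * a + b)"
    unfolding * by (simp add: cnj_th algebra_simps)
  then show ?thesis using that by blast
qed

text \<open>Taking norms gives m^2 = q * N(y), and \<open>q\<close> is prime.\<close>

lemma int_dvd_rt:
  assumes "y \<in> \<O> q" "of_int m = rt q * y" shows "int q dvd m"
proof -
  obtain k :: int where k: "y * cnj y = of_int k" using O_norm_int[OF assms(1)] by blast
  have "of_int (m * m) = (rt q * y) * cnj (rt q * y)"
    unfolding assms(2)[symmetric] by simp
  also have "\<dots> = - (rt q * rt q) * (y * cnj y)" by simp
  also have "\<dots> = of_int (int q * k)" unfolding rt_sq k by simp
  finally have "m * m = int q * k" using of_int_eq_iff by blast
  then have "int q dvd m * m" by simp
  then show ?thesis
    using prime_q prime_dvd_mult_iff[of "int q" m m] by simp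
qed

lemma rt_dvd_int:
  assumes "int q dvd m" obtains y where "y \<in> \<O> q" "of_int m = rt q * y"
proof -
  obtain k where "m = int q * k" using assms by blast
  then have "of_int m = rt q * (- rt q * of_int k)"
    using rt_sq by (simp add: mult.assoc[symmetric])
  then show ?thesis using that[of "- rt q * of_int k"] by simp
qed

section \<open>The quadratic field, its integral elements and invertible ideals\<close>

lemma K_frac:
  assumes "x \<in> quadratic_field q"
  obtains m :: int and y where "y \<in> \<O> q" "m > 0" "x = y / of_int m"
proof -
  obtain a b where x: "x = of_rat a + of_rat b * rt q"
    using assms unfolding quadratic_field_def by blast
  obtain a1 a2 where a: "a = Fract a1 a2" "a2 > 0" by (cases a) auto
  obtain b1 b2 where b: "b = Fract b1 b2" "b2 > 0" by (cases b) auto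
  have "x = (of_int (a1 * b2) + of_int (b1 * a2) * rt q) / of_int (a2 * b2)"
    using a b unfolding x by (simp add: of_rat_rat field_simps)
  then show ?thesis using that a b by (metis O_add O_int O_mult O_rt mult_pos_pos)
qed

lemma O_in_K: assumes "x \<in> \<O> q" shows "x \<in> quadratic_field q"
proof -
  obtain a b :: int where *: "x = of_int a + of_int b * \<theta> q"
    using assms unfolding O_iff by blast
  have "x = of_rat (of_int a + of_int b / 2) + of_rat (of_int b / 2) * rt q"
    unfolding * \<theta>_def by (simp add: of_rat_add of_rat_divide add_divide_distrib algebra_simps)
  then show ?thesis unfolding quadratic_field_def by blast
qed

lemma K_mult_rat: assumes "x \<in> quadratic_field q" shows "x / of_int m \<in> quadratic_field q"
proof -
  obtain a b where x: "x = of_rat a + of_rat b * rt q"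
    using assms unfolding quadratic_field_def by blast
  have "x / of_int m = of_rat (a / of_int m) + of_rat (b / of_int m) * rt q"
    unfolding x by (simp add: of_rat_divide field_simps add_divide_distrib)
  then show ?thesis unfolding quadratic_field_def by blast
qed

lemma K_quotient:
  assumes "x \<in> \<O> q" "y \<in> \<O> q" shows "x / y \<in> quadratic_field q"
proof (cases "y = 0")
  case True
  then show ?thesis using O_in_K[OF O_0] by simp
next
  case False
  obtain k where k: "y * cnj y = of_int k" using O_norm_int[OF assms(2)] by blast
  have "x / y = (x * cnj y) / (y * cnj y)" using False by simp
  then show ?thesis unfolding k using K_mult_rat O_in_K assms by (metis O_cnj O_mult)
qed

text \<open>The order is integrally closed because q is squarefree and congruent to 3 modulo 4.\<close>

lemma integrally_closed:
  assumes "x \<in> quadratic_field q" "x + cnj x = of_int t" "x * cnj x = of_int N"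
  shows "x \<in> \<O> q"
proof -
  obtain a b where x: "x = of_rat a + of_rat b * rt q"
    using assms unfolding quadratic_field_def by blast
  have cr: "cnj (of_rat r) = of_rat r" for r :: rat
    by (cases r) (simp add: of_rat_rat)
  have cx: "cnj x = of_rat a - of_rat b * rt q" unfolding x by (simp add: cr)
  have "of_rat (2 * a) = (of_rat (of_int t) :: complex)"
    using assms(2) unfolding cx unfolding x by (simp add: of_rat_mult)
  then have a2: "2 * a = of_int t" by (simp only: of_rat_eq_iff)
  have "x * cnj x = of_rat a * of_rat a - of_rat b * of_rat b * (rt q * rt q)"
    unfolding cx unfolding x by (simp add: algebra_simps)
  also have "\<dots> = of_rat (a * a + b * b * of_nat q)"
    unfolding rt_sq by (simp add: of_rat_mult of_rat_add)
  finally have "of_rat (a * a + b * b * of_nat q) = (of_rat (of_int N) :: complex)"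
    using assms(3) by simp
  then have n: "a * a + b * b * of_nat q = of_int N" by (simp only: of_rat_eq_iff)
  \<comment> \<open>With 2 a = t the norm equation becomes q s^2 = 4 N - t^2. The squared
    denominator of \<open>s\<close> then divides \<open>q\<close>, and as \<open>q\<close> is prime,
    \<open>s\<close> is an integer.\<close>
  define s where "s = 2 * b"
  have s2: "s * s * of_nat q = of_int (4 * N - t * t)"
  proof -
    have "s * s * of_nat q = 4 * (a * a + b * b * of_nat q) - (2 * a) * (2 * a)"
      unfolding s_def by (simp add: algebra_simps)
    then show ?thesis unfolding n a2 by simp
  qed
  obtain u v where uv: "s = Fract u v" "v > 0" "coprime u v" by (cases s) auto
  have "(of_int (u * u * int q) :: rat) = of_int ((4 * N - t * t) * (v * v))"
  proof -
    have s: "of_int u = s * of_int v" unfolding uv(1) using uv(2)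
      by (simp add: Fract_of_int_quotient)
    have "of_int (u * u * int q) = (s * s * of_nat q) * of_int (v * v)"
      by (simp add: s algebra_simps)
    then show ?thesis unfolding s2 by simp
  qed
  then have e: "u * u * int q = (4 * N - t * t) * (v * v)" using of_int_eq_iff by blast
  have "v * v dvd u * u * int q" unfolding e by simp
  moreover have "coprime (v * v) (u * u)" using uv(3) by (simp add: coprime_commute)
  ultimately have vq: "v * v dvd int q" using coprime_dvd_mult_right_iff by blast
  have "v = 1"
  proof -
    have "v dvd int q" using vq dvd_mult_left by blast
    moreover have "prime (int q)" using prime_q by simp
    ultimately have "v = 1 \<or> v = int q" using uv(2)
      by (metis prime_int_iff less_imp_le)
    moreover have "v \<noteq> int q"
    proof
      assume "v = int q"
      then have "int q * int q dvd int q" using vq by simp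
      then have "int q * int q \<le> int q" using zdvd_imp_le q_pos by simp
      then show False using q_ge_3 by auto
    qed
    ultimately show ?thesis by blast
  qed
  then have su: "s = of_int u" using uv(1) by (simp add: Fract_of_int_eq)
  have e1: "u * u * int q = 4 * N - t * t" using e \<open>v = 1\<close> by simp
  \<comment> \<open>From t^2 + q u^2 = 4 N with \<open>q\<close> odd, \<open>t\<close> and
    \<open>u\<close> have the same parity. This is what makes (t + u p) / 2 an integral combination
    of 1 and \<theta>.\<close>
  have "even (t - u)"
  proof -
    have "even (u * u * int q + t * t)" unfolding e1 by simp
    then show ?thesis using q_odd by auto
  qed
  then obtain k where k: "t = u + 2 * k" by (metis dvdE diff_add_cancel add.commute)
  have "x = of_int k + of_int u * \<theta> q"
  proof -
    have a: "a = of_int t / 2" and b: "b = of_int u / 2" using a2 su s_def by simp_all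
    show ?thesis unfolding x \<theta>_def k a b
      by (simp add: of_rat_divide of_rat_add of_rat_mult add_divide_distrib algebra_simps)
  qed
  then show ?thesis unfolding O_iff by blast
qed

text \<open>Every ideal generated by two elements is invertible: the norm form of \<open>X \<alpha> + Y \<beta>\<close> has
  content \<open>g\<close>, so the ideal times its conjugate is the principal ideal generated by \<open>g\<close>.\<close>

lemma invertible_ideal:
  assumes "\<alpha> \<in> \<O> q" "\<beta> \<in> \<O> q" "\<beta> \<noteq> 0"
  obtains r1 r2 where "r1 * \<alpha> + r2 * \<beta> = 1"
    "r1 * \<alpha> \<in> \<O> q" "r1 * \<beta> \<in> \<O> q" "r2 * \<alpha> \<in> \<O> q" "r2 * \<beta> \<in> \<O> q"
    "r1 \<in> quadratic_field q" "r2 \<in> quadratic_field q"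
proof -
  obtain A where A: "\<alpha> * cnj \<alpha> = of_int A" using O_norm_int[OF assms(1)] by blast
  obtain B where B: "\<beta> * cnj \<beta> = of_int B" using O_norm_int[OF assms(2)] by blast
  obtain T where T: "\<alpha> * cnj \<beta> + cnj \<alpha> * \<beta> = of_int T"
    using O_trace_int[of "\<alpha> * cnj \<beta>"] assms by (auto simp: ac_simps)
  define g where "g = gcd A (gcd B T)"
  have B0: "B \<noteq> 0" using B assms(3) by auto
  then have g0: "g \<noteq> 0" unfolding g_def by auto
  obtain u s w where g: "g = u * A + s * B + w * T"
  proof -
    obtain s' w' where 1: "gcd B T = s' * B + w' * T" using bezout_int by metis
    obtain u x where "gcd A (gcd B T) = u * A + x * gcd B T" using bezout_int by metis
    then have "g = u * A + (x * s') * B + (x * w') * T" unfolding g_def 1 by (simp add: algebra_simps)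
    then show ?thesis using that by blast
  qed
  have gdiv: "g dvd A" "g dvd B" "g dvd T" unfolding g_def
    using dvd_trans[OF gcd_dvd2] by auto
  then obtain A' B' T' where d: "A = g * A'" "B = g * B'" "T = g * T'" by (auto simp: dvd_def)
  have gc: "(of_int g :: complex) \<noteq> 0" using g0 by simp
  \<comment> \<open>\<open>m\<close> has trace T / g and norm (A / g) (B / g), hence is integral.
    The four products required below are integer combinations of \<open>m\<close>, its conjugate and
    integers.\<close>
  define m where "m = \<alpha> * cnj \<beta> / of_int g"
  have mO: "m \<in> \<O> q"
  proof (rule integrally_closed)
    show "m \<in> quadratic_field q" unfolding m_def using assms by (intro K_quotient) auto
    have "m + cnj m = (\<alpha> * cnj \<beta> + cnj \<alpha> * \<beta>) / of_int g"
      unfolding m_def by (simp add: add_divide_distrib)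
    then show "m + cnj m = of_int T'" unfolding T d using gc by simp
    have "m * cnj m = (\<alpha> * cnj \<alpha>) * (\<beta> * cnj \<beta>) / (of_int g * of_int g)"
      unfolding m_def by (simp add: ac_simps)
    then show "m * cnj m = of_int (A' * B')" unfolding A B d using gc by simp
  qed
  have cm: "cnj m = cnj \<alpha> * \<beta> / of_int g" unfolding m_def by simp
  have eA: "\<alpha> * cnj \<alpha> = of_int g * of_int A'" and eB: "\<beta> * cnj \<beta> = of_int g * of_int B'"
    unfolding A B d by simp_all
  \<comment> \<open>The Bezout identity for \<open>g\<close>, divided by \<open>g\<close>: the
    \<open>u\<close> and \<open>s\<close> terms go to \<alpha> and \<beta>, and the trace term
    \<open>w * T\<close> is split into its two conjugate halves.\<close>
  define r1 where "r1 = (of_int u * cnj \<alpha> + of_int w * cnj \<beta>) / of_int g"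
  define r2 where "r2 = (of_int s * cnj \<beta> + of_int w * cnj \<alpha>) / of_int g"
  have 1: "r1 * \<alpha> = of_int u * of_int A' + of_int w * m"
    unfolding r1_def m_def using eA gc by (simp add: field_simps)
  have 2: "r1 * \<beta> = of_int u * cnj m + of_int w * of_int B'"
    unfolding r1_def cm using eB gc by (simp add: field_simps)
  have 3: "r2 * \<alpha> = of_int s * m + of_int w * of_int A'"
    unfolding r2_def m_def using eA gc by (simp add: field_simps)
  have 4: "r2 * \<beta> = of_int s * of_int B' + of_int w * cnj m"
    unfolding r2_def cm using eB gc by (simp add: field_simps)
  have "r1 * \<alpha> + r2 * \<beta> = (of_int u * (\<alpha> * cnj \<alpha>) + of_int s * (\<beta> * cnj \<beta>)
      + of_int w * (\<alpha> * cnj \<beta> + cnj \<alpha> * \<beta>)) / of_int g"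
    unfolding r1_def r2_def using gc by (simp add: field_simps)
  also have "\<dots> = of_int g / of_int g" unfolding A B T g by simp
  finally have 5: "r1 * \<alpha> + r2 * \<beta> = 1" using gc by simp
  show ?thesis
  proof (rule that[OF 5])
    show "r1 * \<alpha> \<in> \<O> q" "r1 * \<beta> \<in> \<O> q" "r2 * \<alpha> \<in> \<O> q" "r2 * \<beta> \<in> \<O> q"
      unfolding 1 2 3 4 using mO by auto
    show "r1 \<in> quadratic_field q" "r2 \<in> quadratic_field q"
      unfolding r1_def r2_def using assms by (auto intro!: K_quotient)
  qed
qed

lemma ring_sel [simp]: "carrier (\<O>_ring q) = \<O> q" "x \<otimes>\<^bsub>\<O>_ring q\<^esub> y = x * y" "x \<oplus>\<^bsub>\<O>_ring q\<^esub> y = x + y"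
    "\<zero>\<^bsub>\<O>_ring q\<^esub> = 0" "\<one>\<^bsub>\<O>_ring q\<^esub> = 1"
  unfolding \<O>_ring_def by simp_all

lemma cring_O: "cring (\<O>_ring q)"
proof (rule cringI)
  show "abelian_group (\<O>_ring q)"
  proof (rule abelian_groupI)
    fix x assume "x \<in> carrier (\<O>_ring q)"
    then show "\<exists>y\<in>carrier (\<O>_ring q). y \<oplus>\<^bsub>\<O>_ring q\<^esub> x = \<zero>\<^bsub>\<O>_ring q\<^esub>"
      by (intro bexI[of _ "- x"]) auto
  qed (auto simp: ac_simps)
  show "Group.comm_monoid (\<O>_ring q)"
    by (rule Group.comm_monoidI) (auto simp: ac_simps)
qed (auto simp: algebra_simps)

end

section \<open>Counting in the projective plane\<close>

lemma card_subspace: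
  fixes U :: "('k::{field,finite} ^ 'n) set"
  assumes "vec.subspace U"
  shows "card U = CARD('k) ^ vec.dim U"
proof -
  obtain B where B: "B \<subseteq> U" "vec.independent B" "U \<subseteq> vec.span B" "card B = vec.dim U"
    using vec.basis_exists by blast
  have UB: "U = vec.span B" using B vec.span_minimal[OF B(1) assms] by auto
  have fin: "finite B" by simp
  let ?F = "B \<rightarrow>\<^sub>E (UNIV :: 'k set)"
  let ?f = "\<lambda>c. \<Sum>b\<in>B. c b *s b"
  have "inj_on ?f ?F"
  proof (rule inj_onI)
    fix c d assume cd: "c \<in> ?F" "d \<in> ?F" "?f c = ?f d"
    have "(\<Sum>b\<in>B. (c b - d b) *s b) = 0"
      using cd(3) by (simp add: vec.scale_left_diff_distrib sum_subtractf)
    then have "c b - d b = 0" if "b \<in> B" for b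
      using vec.independentD[OF B(2) fin subset_refl, of "\<lambda>b. c b - d b" b] that by auto
    then show "c = d" using cd(1,2) by (intro PiE_ext[of c B _ d]) auto
  qed
  moreover have "?f ` ?F = U"
  proof
    show "?f ` ?F \<subseteq> U"
      unfolding UB by (auto intro!: vec.span_sum intro: vec.span_scale[OF vec.span_base])
    show "U \<subseteq> ?f ` ?F"
    proof
      fix u assume "u \<in> U"
      then obtain c where "u = ?f c" unfolding UB vec.span_finite[OF fin] by auto
      then have "u = ?f (restrict c B)" by simp
      then show "u \<in> ?f ` ?F" by (rule image_eqI[of _ _ "restrict c B"]) auto
    qed
  qed
  ultimately have "card U = card ?F" using card_image[of ?f ?F] by simp
  then show ?thesis using B(4) by (simp add: card_PiE)
qed

locale plane = quad_order q for q +
  fixes ty :: "'k::{field,finite} itself"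
  assumes card_k: "CARD('k) = q"
begin

abbreviation P :: "('k ^ 3) set set" where "P \<equiv> pts"
abbreviation Ls :: "('k ^ 3) set set" where "Ls \<equiv> lns"

definition pts_on :: "('k ^ 3) set \<Rightarrow> ('k ^ 3) set set" where
  "pts_on l = {x \<in> P. x \<subseteq> l}"
definition lns_thru :: "('k ^ 3) set \<Rightarrow> ('k ^ 3) set set" where
  "lns_thru x = {l \<in> Ls. x \<subseteq> l}"

lemma pts_Int_lns: "P \<inter> Ls = {}"
  unfolding pts_def lns_def by auto

lemma ptsE: assumes "x \<in> P" obtains u where "u \<noteq> 0" "x = vec.span {u}" "u \<in> x"
proof -
  have x: "vec.subspace x" "vec.dim x = 1" using assms unfolding pts_def by auto
  then have "\<not> x \<subseteq> {0}" using vec.dim_eq_0[of x] by simp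
  then obtain u where u: "u \<in> x" "u \<noteq> 0" by auto
  have "vec.span {u} = x"
    using u x by (intro vec.subspace_dim_equal vec.span_minimal) auto
  then show ?thesis using that u by blast
qed

lemma span_in_pts: "u \<noteq> 0 \<Longrightarrow> vec.span {u} \<in> P"
  unfolding pts_def by simp

lemma pt_subset: "x \<in> P \<Longrightarrow> y \<in> P \<Longrightarrow> x \<subseteq> y \<Longrightarrow> x = y"
  unfolding pts_def using vec.subspace_dim_equal[of x y] by auto

lemma card_pt: "x \<in> P \<Longrightarrow> card x = q"
  unfolding pts_def by (auto simp: card_subspace card_k)

text \<open>The nonzero vectors of \<open>U\<close> are partitioned by the points in
  \<open>U\<close>, each contributing q - 1. Applied to the whole space and to a line.\<close>

lemma pts_count:
  assumes "vec.subspace (U :: ('k ^ 3) set)"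
  shows "card {x \<in> P. x \<subseteq> U} * (q - 1) = q ^ vec.dim U - 1"
proof -
  let ?A = "{x \<in> P. x \<subseteq> U}"
  have z: "0 \<in> U" using assms vec.subspace_0 by blast
  have "U - {0} = (\<Union>x\<in>?A. x - {0})"
  proof
    show "U - {0} \<subseteq> (\<Union>x\<in>?A. x - {0})"
    proof
      fix u assume u: "u \<in> U - {0}"
      then have "vec.span {u} \<in> ?A" using span_in_pts vec.span_minimal[OF _ assms, of "{u}"] by auto
      then show "u \<in> (\<Union>x\<in>?A. x - {0})" using u vec.span_base[of u "{u}"] by blast
    qed
  qed auto
  moreover have "card (\<Union>x\<in>?A. x - {0}) = (\<Sum>x\<in>?A. card (x - {0}))"
  proof (rule card_UN_disjoint)
    show "\<forall>x\<in>?A. \<forall>y\<in>?A. x \<noteq> y \<longrightarrow> (x - {0}) \<inter> (y - {0}) = {}"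
    proof (intro ballI impI)
      fix x y assume xy: "x \<in> ?A" "y \<in> ?A" "x \<noteq> y"
      { fix u assume u: "u \<in> x" "u \<in> y" "u \<noteq> 0"
        have "vec.span {u} \<subseteq> x" "vec.span {u} \<subseteq> y"
          using xy(1,2) u(1,2) vec.span_minimal[of "{u}"] unfolding pts_def by auto
        then have "x = y" using pt_subset span_in_pts[OF u(3)] xy(1,2) by blast }
      then show "(x - {0}) \<inter> (y - {0}) = {}" using xy(3) by blast
    qed
  qed auto
  moreover have "card (x - {0}) = q - 1" if "x \<in> ?A" for x
    using that card_pt[of x] vec.subspace_0[of x] unfolding pts_def by auto
  ultimately have "card (U - {0}) = card ?A * (q - 1)" by simp
  then show ?thesis using card_subspace[OF assms] z card_k by simp
qed

lemma card_pts: "card P = q^2 + q + 1"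
proof -
  have "card P * (q - 1) = q ^ 3 - 1"
    using pts_count[of UNIV] vec.dim_UNIV[where 'a='k and 'b=3]
    by (simp add: card_cart_basis)
  moreover obtain m where m: "q = Suc m" "m > 0" using q_ge_3 by (cases q) auto
  ultimately have "card P * m = ((q^2 + q + 1) * m)"
    by (simp add: algebra_simps power2_eq_square power3_eq_cube)
  then show ?thesis using m(2) by (metis mult_right_cancel neq0_conv)
qed

lemma card_pts_on: "l \<in> Ls \<Longrightarrow> card (pts_on l) = q + 1"
proof -
  assume l: "l \<in> Ls"
  then have "card (pts_on l) * (q - 1) = q ^ 2 - 1"
    using pts_count[of l] unfolding pts_on_def lns_def by auto
  moreover obtain m where m: "q = Suc m" "m > 0" using q_ge_3 by (cases q) auto
  ultimately have "card (pts_on l) * m = ((q + 1) * m)"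
    by (simp add: algebra_simps power2_eq_square)
  then show ?thesis using m(2) by (metis mult_right_cancel neq0_conv)
qed

lemma line_thru_two:
  assumes "x \<in> P" "y \<in> P" "x \<noteq> y"
  shows "card (lns_thru x \<inter> lns_thru y) = 1"
proof -
  obtain u where u: "u \<noteq> 0" "x = vec.span {u}" using ptsE[OF assms(1)] by metis
  obtain v where v: "v \<noteq> 0" "y = vec.span {v}" using ptsE[OF assms(2)] by metis
  have "v \<notin> vec.span {u}"
  proof
    assume "v \<in> vec.span {u}"
    then have "y \<subseteq> x" unfolding u v by (intro vec.span_minimal) auto
    then show False using pt_subset assms by blast
  qed
  then have d: "vec.dim {v, u} = 2" using u(1) by (simp add: vec.dim_insert)
  let ?l = "vec.span {v, u}"
  have "?l \<in> Ls" using d unfolding lns_def by simp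
  moreover have "x \<subseteq> ?l" "y \<subseteq> ?l" unfolding u v by (intro vec.span_mono; simp)+
  moreover have "m = ?l" if "m \<in> lns_thru x \<inter> lns_thru y" for m
  proof -
    have m: "vec.subspace m" "vec.dim m = 2" "x \<subseteq> m" "y \<subseteq> m"
      using that unfolding lns_thru_def lns_def by auto
    then have "{v, u} \<subseteq> m" using u v vec.span_base by blast
    then have "?l \<subseteq> m" using m(1) by (rule vec.span_minimal)
    then show ?thesis using vec.subspace_dim_equal[of ?l m] m d by simp
  qed
  ultimately have "lns_thru x \<inter> lns_thru y = {?l}" unfolding lns_thru_def by blast
  then show ?thesis by simp
qed

text \<open>Two distinct planes in a space of dimension 3 span it, so the dimension formula leaves
  dimension 1 for the intersection.\<close>

lemma meet_two:
  assumes "l \<in> Ls" "m \<in> Ls" "l \<noteq> m"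
  shows "card (pts_on l \<inter> pts_on m) = 1"
proof -
  have l: "vec.subspace l" "vec.dim l = 2" and m: "vec.subspace m" "vec.dim m = 2"
    using assms unfolding lns_def by auto
  let ?S = "{x + y |x y. x \<in> l \<and> y \<in> m}"
  have S: "vec.subspace ?S" using vec.subspace_sums[OF l(1) m(1)] .
  have 1: "vec.dim ?S + vec.dim (l \<inter> m) = 4"
    using vec.dim_sums_Int[OF l(1) m(1)] l m by simp
  have d3: "vec.dim ?S \<le> 3"
    using vec.dim_subset[of ?S UNIV] vec.dim_UNIV[where 'a='k and 'b=3] by (simp add: card_cart_basis)
  have sub: "l \<subseteq> ?S" "m \<subseteq> ?S"
    using vec.subspace_0[OF m(1)] vec.subspace_0[OF l(1)] by force+
  have "vec.dim ?S \<noteq> 2"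
    using vec.subspace_dim_equal[OF l(1) S sub(1)] vec.subspace_dim_equal[OF m(1) S sub(2)] l m assms(3)
    by auto
  moreover have "vec.dim ?S \<ge> 2" using vec.dim_subset[OF sub(1)] l by simp
  ultimately have d: "vec.dim (l \<inter> m) = 1" using 1 d3 by linarith
  then have Ip: "l \<inter> m \<in> P" using l m unfolding pts_def by (simp add: vec.subspace_inter)
  then have "pts_on l \<inter> pts_on m = {l \<inter> m}"
    unfolding pts_on_def using pt_subset by blast
  then show ?thesis by simp
qed

text \<open>Double counting: every other point lies on exactly one line through \<open>x\<close>,
  and each of these lines carries \<open>q\<close> other points.\<close>

lemma card_lns_thru:
  assumes "x \<in> P" shows "card (lns_thru x) = q + 1"
proof -
  have "(\<Sum>l\<in>lns_thru x. card (pts_on l - {x})) = (\<Sum>l\<in>lns_thru x. q)"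
  proof (rule sum.cong[OF refl])
    fix l assume "l \<in> lns_thru x"
    then have "l \<in> Ls" "x \<in> pts_on l" using assms unfolding lns_thru_def pts_on_def by auto
    then show "card (pts_on l - {x}) = q" using card_pts_on by simp
  qed
  moreover have "(\<Sum>l\<in>lns_thru x. card (pts_on l - {x}))
      = (\<Sum>l\<in>lns_thru x. \<Sum>y\<in>{y \<in> P - {x}. y \<subseteq> l}. 1)"
    by (intro sum.cong) (auto simp: pts_on_def intro!: arg_cong[of _ _ card])
  moreover have "\<dots> = (\<Sum>y\<in>P - {x}. \<Sum>l\<in>{l \<in> lns_thru x. y \<subseteq> l}. 1)"
    by (rule sum.swap_restrict) auto
  moreover have "\<dots> = (\<Sum>y\<in>P - {x}. 1)"
  proof (rule sum.cong[OF refl])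
    fix y assume y: "y \<in> P - {x}"
    have "{l \<in> lns_thru x. y \<subseteq> l} = lns_thru x \<inter> lns_thru y" unfolding lns_thru_def by auto
    then show "(\<Sum>l\<in>{l \<in> lns_thru x. y \<subseteq> l}. 1) = (1::nat)"
      using line_thru_two[OF assms, of y] y by auto
  qed
  ultimately have "card (lns_thru x) * q = card P - 1" using assms by simp
  then have "card (lns_thru x) * q = (q + 1) * q"
    unfolding card_pts by (simp add: power2_eq_square algebra_simps)
  then show ?thesis using q_pos by (metis mult_right_cancel neq0_conv)
qed

lemma sum_pts_split:
  fixes c :: "'r::comm_ring_1"
  assumes "x \<in> A" "finite A"
  shows "(\<Sum>y\<in>A. (if x = y then c else 1) * v y) = (c - 1) * v x + (\<Sum>y\<in>A. v y)"
proof -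
  have "(\<Sum>y\<in>A. (if x = y then c else 1) * v y) = (\<Sum>y\<in>A. (if x = y then (c - 1) * v y else 0) + v y)"
    by (intro sum.cong) (auto simp: algebra_simps)
  then show ?thesis using assms by (simp add: sum.distrib)
qed

text \<open>The incidence matrix \<open>B\<close> satisfies \<open>B B\<^sup>T = q I + J = B\<^sup>T B\<close>.\<close>

lemma sum_lines_points:
  fixes v :: "('k ^ 3) set \<Rightarrow> 'r::comm_ring_1"
  assumes "x \<in> P"
  shows "(\<Sum>l\<in>lns_thru x. \<Sum>y\<in>pts_on l. v y) = of_nat q * v x + (\<Sum>y\<in>P. v y)"
proof -
  have "(\<Sum>l\<in>lns_thru x. \<Sum>y\<in>pts_on l. v y) = (\<Sum>y\<in>P. \<Sum>l\<in>{l \<in> lns_thru x. y \<subseteq> l}. v y)"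
    unfolding pts_on_def by (rule sum.swap_restrict) auto
  also have "\<dots> = (\<Sum>y\<in>P. (if x = y then of_nat q + 1 else 1) * v y)"
  proof (rule sum.cong[OF refl])
    fix y assume y: "y \<in> P"
    have "{l \<in> lns_thru x. y \<subseteq> l} = lns_thru x \<inter> lns_thru y" unfolding lns_thru_def by auto
    moreover have "card (lns_thru x \<inter> lns_thru y) = (if x = y then q + 1 else 1)"
      using line_thru_two[OF assms y] card_lns_thru[OF assms] by auto
    ultimately show "(\<Sum>l\<in>{l \<in> lns_thru x. y \<subseteq> l}. v y) = (if x = y then of_nat q + 1 else 1) * v y"
      by (simp add: add.commute)
  qed
  also have "\<dots> = of_nat q * v x + (\<Sum>y\<in>P. v y)"
    by (subst sum_pts_split) (auto simp: assms)
  finally show ?thesis .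
qed

lemma sum_points_lines:
  fixes v :: "('k ^ 3) set \<Rightarrow> 'r::comm_ring_1"
  assumes "l \<in> Ls"
  shows "(\<Sum>x\<in>pts_on l. \<Sum>m\<in>lns_thru x. v m) = of_nat q * v l + (\<Sum>m\<in>Ls. v m)"
proof -
  have "(\<Sum>x\<in>pts_on l. \<Sum>m\<in>lns_thru x. v m) = (\<Sum>m\<in>Ls. \<Sum>x\<in>{x \<in> pts_on l. x \<subseteq> m}. v m)"
    unfolding lns_thru_def by (rule sum.swap_restrict) auto
  also have "\<dots> = (\<Sum>m\<in>Ls. (if l = m then of_nat q + 1 else 1) * v m)"
  proof (rule sum.cong[OF refl])
    fix m assume m: "m \<in> Ls"
    have "{x \<in> pts_on l. x \<subseteq> m} = pts_on l \<inter> pts_on m" unfolding pts_on_def by auto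
    moreover have "card (pts_on l \<inter> pts_on m) = (if l = m then q + 1 else 1)"
      using meet_two[OF assms m] card_pts_on[OF assms] by auto
    ultimately show "(\<Sum>x\<in>{x \<in> pts_on l. x \<subseteq> m}. v m) = (if l = m then of_nat q + 1 else 1) * v m"
      by (simp add: add.commute)
  qed
  also have "\<dots> = of_nat q * v l + (\<Sum>m\<in>Ls. v m)"
    by (subst sum_pts_split) (auto simp: assms)
  finally show ?thesis .
qed

lemma sum_lns_thru:
  fixes v :: "('k ^ 3) set \<Rightarrow> 'r::comm_ring_1"
  shows "(\<Sum>x\<in>P. \<Sum>m\<in>lns_thru x. v m) = (of_nat q + 1) * (\<Sum>m\<in>Ls. v m)"
proof -
  have "(\<Sum>x\<in>P. \<Sum>m\<in>lns_thru x. v m) = (\<Sum>m\<in>Ls. \<Sum>x\<in>pts_on m. v m)"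
    unfolding lns_thru_def pts_on_def by (rule sum.swap_restrict) auto
  also have "\<dots> = (\<Sum>m\<in>Ls. (of_nat q + 1) * v m)"
    by (intro sum.cong) (auto simp: card_pts_on add.commute)
  finally show ?thesis by (simp add: sum_distrib_left)
qed

lemma sum_pts_on:
  fixes v :: "('k ^ 3) set \<Rightarrow> 'r::comm_ring_1"
  shows "(\<Sum>l\<in>Ls. \<Sum>x\<in>pts_on l. v x) = (of_nat q + 1) * (\<Sum>x\<in>P. v x)"
proof -
  have "(\<Sum>l\<in>Ls. \<Sum>x\<in>pts_on l. v x) = (\<Sum>x\<in>P. \<Sum>l\<in>lns_thru x. v x)"
    unfolding lns_thru_def pts_on_def by (rule sum.swap_restrict) auto
  also have "\<dots> = (\<Sum>x\<in>P. (of_nat q + 1) * v x)"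
    by (intro sum.cong) (auto simp: card_lns_thru add.commute)
  finally show ?thesis by (simp add: sum_distrib_left)
qed

section \<open>The action of the projective linear group\<close>

lemma inv_inj: "invertible (A :: 'k^3^3) \<Longrightarrow> inj ((*v) A)"
  by (metis inj_on_inverseI invertible_def matrix_vector_mul_assoc matrix_vector_mul_lid)

lemma image_subspace:
  "vec.subspace U \<Longrightarrow> vec.subspace ((*v) (A :: 'k^3^3) ` U)"
  by (rule vec.linear_subspace_image[OF matrix_vector_mul_linear_gen])

lemma image_dim: "invertible (A :: 'k^3^3) \<Longrightarrow> vec.dim ((*v) A ` U) = vec.dim U"
  using vec.dim_image_eq[OF matrix_vector_mul_linear_gen, of A U] inv_inj inj_on_subset by blast

lemma image_pts: "invertible A \<Longrightarrow> x \<in> P \<Longrightarrow> (*v) A ` x \<in> P"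
  and image_lns: "invertible A \<Longrightarrow> x \<in> Ls \<Longrightarrow> (*v) A ` x \<in> Ls"
  unfolding pts_def lns_def by (auto simp: image_subspace image_dim)

lemma image_scalar:
  assumes "vec.subspace (U :: ('k^3) set)" "c \<noteq> 0"
  shows "(*v) (mat c) ` U = U"
proof -
  have m: "mat c *v u = c *s u" for u :: "'k^3"
    by (simp add: vec_eq_iff mat_def matrix_vector_mult_def if_distrib if_distribR cong: if_cong)
  have "u \<in> (*v) (mat c) ` U" if "u \<in> U" for u
  proof (rule image_eqI)
    show "u = mat c *v (inverse c *s u)" unfolding m using assms(2) by simp
    show "inverse c *s u \<in> U" using that assms(1) vec.subspace_scale by blast
  qed
  then show ?thesis using assms(1) vec.subspace_scale by (auto simp: m)
qed

text \<open>The matrix \<open>T s\<close> adds s f(x) (v - u) to \<open>x\<close>. At s = 1 / f(u)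
  it sends \<open>u\<close> to \<open>v\<close>, and its inverse has the same shape with parameter -
  1 / f(v).\<close>

lemma transvection:
  fixes u v w :: "'k^3"
  defines "f \<equiv> (\<lambda>x. \<Sum>i\<in>UNIV. w $ i * x $ i)"
  assumes "f u \<noteq> 0" "f v \<noteq> 0"
  shows "\<exists>A. invertible A \<and> A *v u = v"
proof -
  define T where "T s = (\<chi> i j. (if i = j then 1 else 0) + s * (v - u) $ i * w $ j)" for s
  have T: "T s *v x = x + (s * f x) *s (v - u)" for s x
  proof -
    have "(T s *v x) $ i = (x + (s * f x) *s (v - u)) $ i" for i
    proof -
      have "(T s *v x) $ i = (\<Sum>j\<in>UNIV. (if i = j then x $ j else 0) + s * (v - u) $ i * (w $ j * x $ j))"
        unfolding T_def matrix_vector_mult_def by (auto intro!: sum.cong simp: algebra_simps)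
      also have "\<dots> = x $ i + s * (v - u) $ i * f x"
        unfolding f_def by (simp add: sum.distrib sum_distrib_left)
      finally show ?thesis by (simp add: algebra_simps)
    qed
    then show ?thesis by (simp add: vec_eq_iff)
  qed
  have fl: "f (x + c *s y) = f x + c * f y" for x y c
    unfolding f_def by (simp add: algebra_simps sum.distrib sum_distrib_left)
  have fd: "f (v - u) = f v - f u"
    unfolding f_def by (simp add: algebra_simps sum_subtractf)
  let ?A = "T (1 / f u)" and ?B = "T (- 1 / f v)"
  have AB: "?A *v (?B *v x) = x" "?B *v (?A *v x) = x" for x
  proof -
    have 1: "(s * f x) + t * (f x + s * f x * (f v - f u)) = 0"
      if "s = 1 / f u \<and> t = -1 / f v \<or> s = -1 / f v \<and> t = 1 / f u" for s t
      using that assms(2,3) by (elim disjE conjE; hypsubst; simp add: field_simps)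
    have 2: "T t *v (T s *v x) = x + (s * f x + t * (f x + s * f x * (f v - f u))) *s (v - u)" for s t
      unfolding T fl fd by (simp add: vec.scale_left_distrib algebra_simps)
    show "?A *v (?B *v x) = x" "?B *v (?A *v x) = x" unfolding 2 by (subst 1; simp)+
  qed
  have "?A ** ?B = mat 1" "?B ** ?A = mat 1"
    unfolding matrix_eq by (simp_all only: matrix_vector_mul_assoc[symmetric] AB matrix_vector_mul_lid simp_thms)
  then have "invertible ?A" unfolding invertible_def by blast
  moreover have "?A *v u = v" unfolding T using assms(2) by simp
  ultimately show ?thesis by blast
qed

text \<open>A linear form that is nonzero at both vectors is needed for \<open>transvection\<close>.
  Take a coordinate where \<open>u\<close> or \<open>v\<close> is nonzero, or the sum of the two
  such coordinates if neither serves both vectors.\<close>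

lemma GL_transitive:
  fixes u v :: "'k^3"
  assumes "u \<noteq> 0" "v \<noteq> 0"
  shows "\<exists>A. invertible A \<and> A *v u = v"
proof -
  obtain i where i: "u $ i \<noteq> 0" using assms(1) by (auto simp: vec_eq_iff)
  obtain j where j: "v $ j \<noteq> 0" using assms(2) by (auto simp: vec_eq_iff)
  have ax: "(\<Sum>k\<in>UNIV. axis a 1 $ k * x $ k) = x $ a" for a and x :: "'k^3"
    by (simp add: axis_def if_distrib if_distribR cong: if_cong)
  have ax2: "(\<Sum>k\<in>UNIV. (axis a 1 + axis b 1) $ k * x $ k) = x $ a + x $ b" for a b and x :: "'k^3"
    using ax[of a x] ax[of b x] by (simp add: algebra_simps sum.distrib)
  show ?thesis
  proof (cases "v $ i = 0")
    case False
    then show ?thesis using transvection[of "axis i 1" u v] i by (simp add: ax)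
  next
    case True
    show ?thesis
    proof (cases "u $ j = 0")
      case False
      then show ?thesis using transvection[of "axis j 1" u v] j by (simp add: ax)
    next
      case uj: True
      then show ?thesis using transvection[of "axis i 1 + axis j 1" u v] i j True by (simp only: ax2) simp
    qed
  qed
qed

end

context plane begin

section \<open>Coordinates for the lattice of the plane\<close>

text \<open>The empty set, which is neither a point nor a line, indexes the coordinate that carries the
  positive part of the form.\<close>

definition J :: "('k ^ 3) set set" where "J = insert {} P"

definition hf :: "(('k ^ 3) set \<Rightarrow> complex) \<Rightarrow> (('k ^ 3) set \<Rightarrow> complex) \<Rightarrow> complex" where
  "hf u v = cnj (u {}) * v {} - (\<Sum>x\<in>P. cnj (u x) * v x)"

definition coord :: "(('k ^ 3) set \<Rightarrow> complex) \<Rightarrow> ('k ^ 3) set \<Rightarrow> complex" where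
  "coord f r = (if r = {} then \<Sum>l\<in>Ls. f l
     else if r \<in> P then rt q * f r + (\<Sum>l\<in>lns_thru r. f l) else 0)"

definition LC :: "(('k ^ 3) set \<Rightarrow> complex) set" where
  "LC = coord ` carrier (free_mod q (P \<union> Ls))"

lemma empty_notin [simp]: "{} \<notin> P" "{} \<notin> Ls"
  unfolding pts_def lns_def using vec.subspace_0 by auto

lemma free_carrier: "f \<in> carrier (free_mod q I) \<longleftrightarrow> (\<forall>i\<in>I. f i \<in> \<O> q) \<and> (\<forall>i. i \<notin> I \<longrightarrow> f i = 0)"
  unfolding free_mod_def by simp

lemma card_lns: "card Ls = q^2 + q + 1"
proof -
  have "(\<Sum>l\<in>Ls. \<Sum>x\<in>pts_on l. (1::int)) = (of_nat q + 1) * (\<Sum>x\<in>P. 1)"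
    by (rule sum_pts_on)
  moreover have "(\<Sum>l\<in>Ls. \<Sum>x\<in>pts_on l. (1::int)) = (\<Sum>l\<in>Ls. of_nat q + 1)"
    by (intro sum.cong) (auto simp: card_pts_on)
  ultimately have "int (card Ls) * (int q + 1) = (int q + 1) * int (card P)" by simp
  then have "int (card Ls) = int (card P)"
    by (metis mult.commute mult_cancel_left of_nat_Suc of_nat_eq_0_iff nat.distinct(1) add.commute)
  then have "card Ls = card P" by (simp only: of_nat_eq_iff)
  then show ?thesis by (simp only: card_pts)
qed

lemma sum_Ls_if: "(\<Sum>l\<in>Ls. if x \<subseteq> l then g l else 0) = (\<Sum>l\<in>lns_thru x. (g l :: 'r::comm_monoid_add))"
  by (simp add: lns_thru_def sum.inter_filter)

lemma sum_P_if: "(\<Sum>x\<in>P. if x \<subseteq> l then g x else 0) = (\<Sum>x\<in>pts_on l. (g x :: 'r::comm_monoid_add))"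
  by (simp add: pts_on_def sum.inter_filter)

text \<open>The all-ones part of B^T B = q I + J is absorbed by the extra coordinate. The factor p
  is kept outside because \<open>LC_form\<close> reads off from it that all values of the form are
  divisible by p.\<close>

lemma coord_form:
  "hf (coord u) (coord v) = rt q * (rt q * (\<Sum>x\<in>P. cnj (u x) * v x) + rt q * (\<Sum>l\<in>Ls. cnj (u l) * v l)
     + (\<Sum>x\<in>P. \<Sum>l\<in>lns_thru x. cnj (u x) * v l) - (\<Sum>x\<in>P. \<Sum>l\<in>lns_thru x. cnj (u l) * v x))"
proof -
  let ?S = "\<lambda>w x. \<Sum>l\<in>lns_thru x. w l"
  have 1: "(\<Sum>x\<in>P. cnj (?S u x) * ?S v x) = of_nat q * (\<Sum>l\<in>Ls. cnj (u l) * v l) + (\<Sum>l\<in>Ls. cnj (u l)) * (\<Sum>l\<in>Ls. v l)"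
  proof -
    have "(\<Sum>x\<in>P. cnj (?S u x) * ?S v x) = (\<Sum>x\<in>P. \<Sum>l\<in>lns_thru x. cnj (u l) * ?S v x)"
      by (simp add: sum_distrib_right)
    also have "\<dots> = (\<Sum>l\<in>Ls. \<Sum>x\<in>pts_on l. cnj (u l) * ?S v x)"
      unfolding lns_thru_def pts_on_def by (rule sum.swap_restrict) auto
    also have "\<dots> = (\<Sum>l\<in>Ls. cnj (u l) * (\<Sum>x\<in>pts_on l. ?S v x))"
      by (simp add: sum_distrib_left)
    also have "\<dots> = (\<Sum>l\<in>Ls. cnj (u l) * (of_nat q * v l + (\<Sum>m\<in>Ls. v m)))"
      by (intro sum.cong) (auto simp: sum_points_lines)
    also have "\<dots> = of_nat q * (\<Sum>l\<in>Ls. cnj (u l) * v l) + (\<Sum>l\<in>Ls. cnj (u l)) * (\<Sum>l\<in>Ls. v l)"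
      by (simp add: sum_distrib_left sum_distrib_right distrib_left sum.distrib ac_simps)
    finally show ?thesis .
  qed
  have nz: "x \<in> P \<Longrightarrow> x \<noteq> {}" for x using empty_notin by metis
  have "hf (coord u) (coord v) = (\<Sum>l\<in>Ls. cnj (u l)) * (\<Sum>l\<in>Ls. v l)
     - (\<Sum>x\<in>P. (- rt q * cnj (u x) + cnj (?S u x)) * (rt q * v x + ?S v x))"
    unfolding hf_def coord_def by (auto intro!: sum.cong simp: nz)
  also have "\<dots> = (\<Sum>l\<in>Ls. cnj (u l)) * (\<Sum>l\<in>Ls. v l)
     - (\<Sum>x\<in>P. - (rt q * rt q) * (cnj (u x) * v x) - rt q * (cnj (u x) * ?S v x)
          + rt q * (cnj (?S u x) * v x) + cnj (?S u x) * ?S v x)"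
    by (intro arg_cong2[of _ _ _ _ "(-)"] sum.cong) (simp_all add: algebra_simps)
  also have "\<dots> = (\<Sum>l\<in>Ls. cnj (u l)) * (\<Sum>l\<in>Ls. v l)
     + (rt q * rt q) * (\<Sum>x\<in>P. cnj (u x) * v x) + rt q * (\<Sum>x\<in>P. cnj (u x) * ?S v x)
     - rt q * (\<Sum>x\<in>P. cnj (?S u x) * v x) - (\<Sum>x\<in>P. cnj (?S u x) * ?S v x)"
    by (simp add: sum.distrib sum_subtractf sum_distrib_left sum_negf)
  also have "\<dots> = (rt q * rt q) * (\<Sum>x\<in>P. cnj (u x) * v x) + (rt q * rt q) * (\<Sum>l\<in>Ls. cnj (u l) * v l)
     + rt q * (\<Sum>x\<in>P. cnj (u x) * ?S v x) - rt q * (\<Sum>x\<in>P. cnj (?S u x) * v x)"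
    unfolding 1 rt_sq by simp
  finally show ?thesis
    by (simp add: sum_distrib_left sum_distrib_right algebra_simps)
qed

text \<open>Summing the Gram matrix over its blocks of points and lines gives the expansion in
  \<open>coord_form\<close>, once the diagonal entry - q is read as p^2.\<close>

lemma L_free_form:
  "form (L_free q) u v = hf (coord u) (coord (v :: ('k ^ 3) set \<Rightarrow> complex))"
proof -
  have g: "(\<Sum>s\<in>P \<union> Ls. cnj (u r) * gram q r s * v s) =
     (if r \<in> P then - of_nat q * (cnj (u r) * v r) + rt q * (\<Sum>l\<in>lns_thru r. cnj (u r) * v l)
      else - of_nat q * (cnj (u r) * v r) - rt q * (\<Sum>x\<in>pts_on r. cnj (u r) * v x))"
    if r: "r \<in> P \<union> Ls" for r
  proof -
    have "(\<Sum>s\<in>P \<union> Ls. cnj (u r) * gram q r s * v s)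
       = (\<Sum>s\<in>P. cnj (u r) * gram q r s * v s) + (\<Sum>s\<in>Ls. cnj (u r) * gram q r s * v s)"
      by (rule sum.union_disjoint) (auto simp: pts_Int_lns)
    also have "\<dots> = (if r \<in> P then - of_nat q * (cnj (u r) * v r) + rt q * (\<Sum>l\<in>lns_thru r. cnj (u r) * v l)
      else - of_nat q * (cnj (u r) * v r) - rt q * (\<Sum>x\<in>pts_on r. cnj (u r) * v x))"
    proof (cases "r \<in> P")
      case True
      then have nl: "r \<notin> Ls" using pts_Int_lns by blast
      have "(\<Sum>s\<in>P. cnj (u r) * gram q r s * v s) = (\<Sum>s\<in>P. if s = r then - of_nat q * (cnj (u r) * v r) else 0)"
        using pts_Int_lns nl by (intro sum.cong) (auto simp: gram_def)
      moreover have "(\<Sum>s\<in>Ls. cnj (u r) * gram q r s * v s) = (\<Sum>s\<in>Ls. if r \<subseteq> s then rt q * (cnj (u r) * v s) else 0)"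
        using pts_Int_lns nl True by (intro sum.cong) (auto simp: gram_def)
      ultimately show ?thesis using True
        by (simp only: sum_Ls_if if_True) (simp add: sum_distrib_left)
    next
      case False
      then have rl: "r \<in> Ls" using r by blast
      have "(\<Sum>s\<in>Ls. cnj (u r) * gram q r s * v s) = (\<Sum>s\<in>Ls. if s = r then - of_nat q * (cnj (u r) * v r) else 0)"
        using pts_Int_lns False by (intro sum.cong) (auto simp: gram_def)
      moreover have "(\<Sum>s\<in>P. cnj (u r) * gram q r s * v s) = (\<Sum>s\<in>P. if s \<subseteq> r then - rt q * (cnj (u r) * v s) else 0)"
        using pts_Int_lns False rl by (intro sum.cong) (auto simp: gram_def)
      ultimately show ?thesis using False rl
        by (simp only: sum_P_if if_False) (simp add: sum_distrib_left sum_negf)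
    qed
    finally show ?thesis .
  qed
  have "form (L_free q) u v = (\<Sum>r\<in>P \<union> Ls. \<Sum>s\<in>P \<union> Ls. cnj (u r) * gram q r s * v s)"
    unfolding L_free_def by (simp add: module.extend_def hmod.fields_def)
  also have "\<dots> = (\<Sum>r\<in>P \<union> Ls. if r \<in> P then - of_nat q * (cnj (u r) * v r) + rt q * (\<Sum>l\<in>lns_thru r. cnj (u r) * v l)
      else - of_nat q * (cnj (u r) * v r) - rt q * (\<Sum>x\<in>pts_on r. cnj (u r) * v x))"
    by (rule sum.cong[OF refl]) (rule g)
  also have "\<dots> = (\<Sum>x\<in>P. - of_nat q * (cnj (u x) * v x) + rt q * (\<Sum>l\<in>lns_thru x. cnj (u x) * v l))
      + (\<Sum>l\<in>Ls. - of_nat q * (cnj (u l) * v l) - rt q * (\<Sum>x\<in>pts_on l. cnj (u l) * v x))"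
    using pts_Int_lns by (subst sum.union_disjoint) (auto intro!: sum.cong arg_cong2[of _ _ _ _ "(+)"])
  also have "(\<Sum>l\<in>Ls. - of_nat q * (cnj (u l) * v l) - rt q * (\<Sum>x\<in>pts_on l. cnj (u l) * v x))
     = - of_nat q * (\<Sum>l\<in>Ls. cnj (u l) * v l) - rt q * (\<Sum>x\<in>P. \<Sum>l\<in>lns_thru x. cnj (u l) * v x)"
  proof -
    have "(\<Sum>l\<in>Ls. \<Sum>x\<in>pts_on l. cnj (u l) * v x) = (\<Sum>x\<in>P. \<Sum>l\<in>lns_thru x. cnj (u l) * v x)"
      unfolding lns_thru_def pts_on_def by (rule sum.swap_restrict) auto
    then show ?thesis by (simp add: sum_subtractf sum_distrib_left[symmetric] sum_negf)
  qed
  finally show ?thesis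
    unfolding coord_form rt_sq[symmetric] by (simp add: sum.distrib sum_distrib_left[symmetric] algebra_simps)
qed

section \<open>The coordinate lattice: generators, congruences and modularity\<close>

lemma coord_add: "coord (\<lambda>i. f i + g i) = (\<lambda>i. coord f i + coord g i)"
  by (rule ext) (simp add: coord_def sum.distrib algebra_simps)

lemma coord_smult: "coord (\<lambda>i. a * f i) = (\<lambda>i. a * coord f i)"
  by (rule ext) (simp add: coord_def sum_distrib_left algebra_simps)

lemma LC_add: "u \<in> LC \<Longrightarrow> v \<in> LC \<Longrightarrow> (\<lambda>i. u i + v i) \<in> LC"
  unfolding LC_def using coord_add[symmetric] by (auto intro!: imageI simp: free_carrier)

lemma LC_smult: "a \<in> \<O> q \<Longrightarrow> u \<in> LC \<Longrightarrow> (\<lambda>i. a * u i) \<in> LC"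
  unfolding LC_def using coord_smult[symmetric] by (auto intro!: imageI simp: free_carrier)

lemma LC_diff: "u \<in> LC \<Longrightarrow> v \<in> LC \<Longrightarrow> (\<lambda>i. u i - v i) \<in> LC"
  using LC_add[of u "\<lambda>i. - 1 * v i"] LC_smult[of "-1" v] O_int[of "-1"] by simp

lemma LC_0: "(\<lambda>_. 0) \<in> LC"
proof -
  have "coord (\<lambda>_. 0) = (\<lambda>_. 0)" by (auto simp: coord_def)
  moreover have "(\<lambda>_. 0) \<in> carrier (free_mod q (P \<union> Ls))" by (simp add: free_carrier)
  ultimately show ?thesis unfolding LC_def by (metis imageI)
qed

lemma LC_sum: "(\<And>i. i \<in> I \<Longrightarrow> f i \<in> LC) \<Longrightarrow> (\<lambda>r. \<Sum>i\<in>I. f i r) \<in> LC"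
  by (induction I rule: infinite_finite_induct) (auto intro: LC_0 LC_add)

lemma LC_O: "u \<in> LC \<Longrightarrow> u i \<in> \<O> q"
  unfolding LC_def coord_def lns_thru_def
  by (auto simp: free_carrier intro!: O_add O_mult O_sum split: if_splits)

lemma LC_supp: "u \<in> LC \<Longrightarrow> i \<notin> J \<Longrightarrow> u i = 0"
  unfolding LC_def coord_def J_def by (auto split: if_splits)

lemma nat_q: "of_nat q = - (rt q * rt q)"
  using rt_sq by simp

lemma exists_point: "\<exists>x. x \<in> P"
  using card_pts by (metis card.empty add_is_0 ex_in_conv one_neq_zero)

lemma exists_line: "\<exists>l. l \<in> Ls"
  using card_lns by (metis card.empty add_is_0 ex_in_conv one_neq_zero)

text \<open>The image under \<open>coord\<close> of the basis vector belonging to the line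
  \<open>l\<close>.\<close>

definition line_vec :: "('k ^ 3) set \<Rightarrow> ('k ^ 3) set \<Rightarrow> complex" where
  "line_vec l r = (if r = {} \<or> r \<in> pts_on l then 1 else 0)"

lemma sum_lns_delta: "x \<in> P \<Longrightarrow> l \<in> Ls \<Longrightarrow>
    (\<Sum>m\<in>lns_thru x. if m = l then c else (0::complex)) = (if x \<in> pts_on l then c else 0)"
  unfolding lns_thru_def pts_on_def by simp

lemma line_vec_LC: "l \<in> Ls \<Longrightarrow> line_vec l \<in> LC"
proof -
  assume l: "l \<in> Ls"
  let ?f = "\<lambda>r. if r = l then 1 else (0::complex)"
  have "coord ?f = line_vec l"
  proof
    fix r show "coord ?f r = line_vec l r"
      using l pts_Int_lns sum_lns_delta[of r l 1] by (auto simp: coord_def line_vec_def pts_on_def)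
  qed
  then show ?thesis using l unfolding LC_def by (intro image_eqI[of _ _ ?f]) (auto simp: free_carrier)
qed

text \<open>A point of the plane contributes p times its unit vector, which gives the point
  coordinates. For the extra coordinate one line is taken \<open>rt q * w {}\<close> times, and what
  it adds at its own points is cancelled by their point coefficients.\<close>

lemma rt_mult_LC:
  assumes "\<And>i. i \<in> J \<Longrightarrow> w i \<in> \<O> q" "\<And>i. i \<notin> J \<Longrightarrow> w i = 0"
  shows "(\<lambda>i. rt q * w i) \<in> LC"
proof -
  obtain l where l: "l \<in> Ls" using exists_line by blast
  let ?f = "\<lambda>r. if r = l then rt q * w {} else if r \<in> P then w r - (if r \<in> pts_on l then w {} else 0) else 0"
  have "coord ?f = (\<lambda>i. rt q * w i)"
  proof
    fix r
    have s: "(\<Sum>m\<in>lns_thru r. ?f m) = (if r \<in> pts_on l then rt q * w {} else 0)" if "r \<in> P"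
    proof -
      have "(\<Sum>m\<in>lns_thru r. ?f m) = (\<Sum>m\<in>lns_thru r. if m = l then rt q * w {} else 0)"
        using pts_Int_lns by (intro sum.cong) (auto simp: lns_thru_def)
      then show ?thesis using sum_lns_delta[OF that l] by simp
    qed
    have t: "(\<Sum>m\<in>Ls. ?f m) = rt q * w {}"
    proof -
      have "(\<Sum>m\<in>Ls. ?f m) = (\<Sum>m\<in>Ls. if m = l then rt q * w {} else 0)"
        using pts_Int_lns by (intro sum.cong) auto
      then show ?thesis using l by simp
    qed
    consider "r = {}" | "r \<in> P" | "r \<notin> J" unfolding J_def by blast
    then show "coord ?f r = rt q * w r"
    proof cases
      case 1 then show ?thesis using t by (simp add: coord_def)
    next
      case 2
      then have "r \<noteq> {}" "r \<noteq> l" using l pts_Int_lns empty_notin by (metis, blast)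
      then show ?thesis using 2 unfolding coord_def s[OF 2] by (simp add: algebra_simps)
    next
      case 3 then show ?thesis using assms(2) by (simp add: coord_def J_def)
    qed
  qed
  then have e: "(\<lambda>i. rt q * w i) = coord ?f" by simp
  have "?f \<in> carrier (free_mod q (P \<union> Ls))"
    using assms(1) l unfolding free_carrier J_def by auto
  then show ?thesis unfolding LC_def by (rule image_eqI[where f=coord and x="?f", OF e])
qed

text \<open>Since p times every integral vector is present, membership depends only on the residues
  modulo p: the lattice is the preimage of a code.\<close>

lemma LC_congruent:
  assumes "u \<in> LC" "\<And>i. i \<in> J \<Longrightarrow> \<exists>y\<in>\<O> q. v i = u i + rt q * y" "\<And>i. i \<notin> J \<Longrightarrow> v i = 0"
  shows "v \<in> LC"
proof -
  define w where "w i = (if i \<in> J then SOME y. y \<in> \<O> q \<and> v i = u i + rt q * y else 0)" for i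
  have w: "w i \<in> \<O> q \<and> v i = u i + rt q * w i" if "i \<in> J" for i
    using someI_ex[of "\<lambda>y. y \<in> \<O> q \<and> v i = u i + rt q * y"] assms(2)[OF that] that unfolding w_def by auto
  have "v = (\<lambda>i. u i + rt q * w i)"
  proof
    fix i show "v i = u i + rt q * w i"
      using w[of i] assms(3)[of i] LC_supp[OF assms(1), of i] by (cases "i \<in> J") (auto simp: w_def)
  qed
  moreover have "(\<lambda>i. rt q * w i) \<in> LC"
    using w by (intro rt_mult_LC) (auto simp: w_def)
  ultimately show ?thesis using LC_add assms(1) by simp
qed

definition ones :: "('k ^ 3) set \<Rightarrow> complex" where
  "ones r = (if r \<in> J then 1 else 0)"

text \<open>The sum of all lines has entry q + 1 at each point and q^2 + q + 1 at the extra
  coordinate, all congruent to 1 modulo p.\<close>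

lemma ones_LC: "ones \<in> LC"
proof (rule LC_congruent)
  show s: "(\<lambda>r. \<Sum>l\<in>Ls. line_vec l r) \<in> LC" by (intro LC_sum line_vec_LC)
  fix i assume "i \<in> J"
  have "(\<Sum>l\<in>Ls. line_vec l {}) = 1 + of_nat q * (of_nat q + 1)"
    by (simp add: line_vec_def card_lns algebra_simps power2_eq_square)
  moreover have "(\<Sum>l\<in>Ls. line_vec l x) = 1 + of_nat q" if "x \<in> P" for x
  proof -
    have "(\<Sum>l\<in>Ls. line_vec l x) = (\<Sum>l\<in>Ls. if x \<subseteq> l then 1 else 0)"
      using that empty_notin by (intro sum.cong) (auto simp: line_vec_def pts_on_def)
    also have "\<dots> = of_nat (card (lns_thru x))"
      unfolding lns_thru_def by (simp add: sum.inter_filter[symmetric])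
    finally show ?thesis using card_lns_thru[OF that] by simp
  qed
  moreover have "1 = 1 + of_nat q * (of_nat q + 1) + rt q * (rt q * (of_nat q + 1))"
      "1 = 1 + of_nat q + rt q * rt q"
    using rt_sq by (simp_all add: mult.assoc[symmetric])
  moreover have "rt q * (of_nat q + 1) \<in> \<O> q" by auto
  ultimately show "\<exists>y\<in>\<O> q. ones i = (\<Sum>l\<in>Ls. line_vec l i) + rt q * y"
    using \<open>i \<in> J\<close> O_rt unfolding ones_def J_def by (metis insertE)
qed (simp add: ones_def)

lemma hf_add: "hf u (\<lambda>i. v i + w i) = hf u v + hf u w"
  and hf_add_left: "hf (\<lambda>i. v i + w i) u = hf v u + hf w u"
  and hf_diff: "hf u (\<lambda>i. v i - w i) = hf u v - hf u w"
  and hf_diff_left: "hf (\<lambda>i. v i - w i) u = hf v u - hf w u"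
  and hf_smult: "hf u (\<lambda>i. a * v i) = a * hf u v"
  and hf_smult_left: "hf (\<lambda>i. a * v i) u = cnj a * hf v u"
  and hf_divide: "hf u (\<lambda>i. v i / a) = hf u v / a"
  unfolding hf_def
  by (simp_all add: algebra_simps sum.distrib sum_subtractf sum_distrib_left diff_divide_distrib sum_divide_distrib)

lemma hf_sum: "hf u (\<lambda>r. \<Sum>i\<in>I. f i r) = (\<Sum>i\<in>I. hf u (f i))"
proof (induction I rule: infinite_finite_induct)
  case (insert x F) then show ?case by (simp add: hf_add)
qed (simp_all add: hf_def)

lemma hf_cnj: "cnj (hf u v) = hf v u"
  unfolding hf_def by (simp add: ac_simps)

lemma LC_form:
  assumes "u \<in> LC" "v \<in> LC" shows "\<exists>y\<in>\<O> q. hf u v = rt q * y"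
proof -
  obtain f g where "f \<in> carrier (free_mod q (P \<union> Ls))" "g \<in> carrier (free_mod q (P \<union> Ls))" "u = coord f" "v = coord g"
    using assms unfolding LC_def by blast
  then show ?thesis unfolding coord_form lns_thru_def
    by (intro bexI, (rule refl | simp only: coord_form lns_thru_def))
      (auto simp: free_carrier intro!: O_add O_diff O_mult O_sum)
qed


lemma hf_rt_unit:
  "hf (\<lambda>r. if r = {} then rt q else 0) u = - (rt q * u {})"
  "x \<in> P \<Longrightarrow> hf (\<lambda>r. if r = x then rt q else 0) u = rt q * u x"
  unfolding hf_def by (auto simp: if_distrib if_distribR sum_negf cong: if_cong)

lemma rt_unit_LC: "x \<in> J \<Longrightarrow> (\<lambda>r. if r = x then rt q else 0) \<in> LC"
proof -
  assume "x \<in> J"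
  then have "(\<lambda>r. rt q * (if r = x then 1 else 0)) \<in> LC" by (intro rt_mult_LC) auto
  moreover have "(\<lambda>r. rt q * (if r = x then 1 else 0)) = (\<lambda>r. if r = x then rt q else 0)" by auto
  ultimately show ?thesis by simp
qed

lemma hf_line: "l \<in> Ls \<Longrightarrow> hf (line_vec l) u = u {} - (\<Sum>x\<in>pts_on l. u x)"
proof -
  have "(\<Sum>x\<in>P. cnj (line_vec l x) * u x) = (\<Sum>x\<in>P. if x \<subseteq> l then u x else 0)"
    using empty_notin by (intro sum.cong) (auto simp: line_vec_def pts_on_def)
  then show ?thesis unfolding hf_def pts_on_def by (simp add: line_vec_def sum.inter_filter)
qed

text \<open>Reduced modulo \<open>rt q\<close>, the vector becomes an integral vector whose line sums are
  all congruent modulo \<open>q\<close>; then \<open>B B\<^sup>T = q I + J\<close> expresses \<open>q\<close> times it through \<open>q B w\<close> and a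
  constant vector, and \<open>q\<close> cancels.\<close>

lemma LC_modular:
  assumes supp: "\<And>i. i \<notin> J \<Longrightarrow> u i = 0" and int: "\<And>w. w \<in> LC \<Longrightarrow> hf w u \<in> \<O> q"
  shows "(\<lambda>i. rt q * u i) \<in> LC"
proof -
  define U where "U i = rt q * u i" for i
  have UO: "U i \<in> \<O> q" if "i \<in> J" for i
  proof (cases "i = {}")
    case True
    then show ?thesis using int[OF rt_unit_LC[OF that]] hf_rt_unit(1)[of u] O_minus[of "- U {}"]
      unfolding U_def by simp
  next
    case False
    then show ?thesis using int[OF rt_unit_LC[OF that]] hf_rt_unit(2)[of i u] that
      unfolding U_def J_def by auto
  qed
  define m where "m i = (SOME m::int. \<exists>y\<in>\<O> q. U i = of_int m + rt q * y)" for i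
  have m: "\<exists>y\<in>\<O> q. U i = of_int (m i) + rt q * y" if "i \<in> J" for i
  proof -
    have "\<exists>m::int. \<exists>y\<in>\<O> q. U i = of_int m + rt q * y" using O_mod_rt[OF UO[OF that]] by blast
    then show ?thesis unfolding m_def by (rule someI_ex)
  qed
  define y where "y i = (U i - of_int (m i)) / rt q" for i
  have y: "y i \<in> \<O> q" "U i = of_int (m i) + rt q * y i" if "i \<in> J" for i
    using m[OF that] unfolding y_def by auto
  \<comment> \<open>Integrality of the pairing with a line vector says exactly that the sum of
    \<open>m\<close> over the line agrees with \<open>m {}\<close> modulo \<open>q\<close>;
    \<open>w\<close> records the quotients.\<close>
  have "int q dvd m {} - (\<Sum>x\<in>pts_on l. m x)" if l: "l \<in> Ls" for l
  proof (rule int_dvd_rt)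
    have pJ: "x \<in> J" if "x \<in> pts_on l" for x using that unfolding J_def pts_on_def by blast
    have "rt q * hf (line_vec l) u = U {} - (\<Sum>x\<in>pts_on l. U x)"
      unfolding hf_line[OF l] U_def by (simp add: sum_distrib_left algebra_simps)
    also have "(\<Sum>x\<in>pts_on l. U x) = (\<Sum>x\<in>pts_on l. of_int (m x) + rt q * y x)"
      by (intro sum.cong refl y(2) pJ)
    also have "U {} = of_int (m {}) + rt q * y {}" by (rule y(2)) (simp add: J_def)
    finally show "of_int (m {} - (\<Sum>x\<in>pts_on l. m x)) = rt q * (hf (line_vec l) u - y {} + (\<Sum>x\<in>pts_on l. y x))"
      by (simp add: sum.distrib sum_distrib_left algebra_simps)
    show "hf (line_vec l) u - y {} + (\<Sum>x\<in>pts_on l. y x) \<in> \<O> q"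
      using int[OF line_vec_LC[OF l]] y(1) pJ by (intro O_add O_diff O_sum) (auto simp: J_def)
  qed
  then have "\<exists>w. \<forall>l\<in>Ls. m {} - (\<Sum>x\<in>pts_on l. m x) = int q * w l"
    unfolding dvd_def by (rule bchoice[OF ballI])
  then obtain w where w: "m {} - (\<Sum>x\<in>pts_on l. m x) = int q * w l" if "l \<in> Ls" for l by blast
  have e: "int q * (m x + (\<Sum>l\<in>lns_thru x. w l)) = (int q + 1) * m {} - (\<Sum>x\<in>P. m x)" if x: "x \<in> P" for x
  proof -
    have "int q * m x + (\<Sum>x\<in>P. m x) = (\<Sum>l\<in>lns_thru x. \<Sum>y\<in>pts_on l. m y)"
      using sum_lines_points[OF x, of m] by simp
    also have "\<dots> = (\<Sum>l\<in>lns_thru x. m {} - int q * w l)"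
    proof (rule sum.cong[OF refl])
      fix l assume "l \<in> lns_thru x"
      then have "l \<in> Ls" unfolding lns_thru_def by blast
      from w[OF this] show "(\<Sum>y\<in>pts_on l. m y) = m {} - int q * w l" by linarith
    qed
    also have "\<dots> = (int q + 1) * m {} - int q * (\<Sum>l\<in>lns_thru x. w l)"
      by (simp add: sum_subtractf card_lns_thru[OF x] sum_distrib_left)
    finally show ?thesis by (simp add: algebra_simps)
  qed
  obtain x0 where x0: "x0 \<in> P" using exists_point by blast
  \<comment> \<open>By \<open>e\<close> the value \<open>m x\<close> plus the sum of
    \<open>w\<close> over the lines through \<open>x\<close>, times \<open>q\<close>, is the same
    for all points. Cancelling \<open>q\<close> makes \<open>m\<close> on the points a constant
    minus a combination of lines.\<close>
  define t where "t = m x0 + (\<Sum>l\<in>lns_thru x0. w l)"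
  have mx: "m x = t - (\<Sum>l\<in>lns_thru x. w l)" if "x \<in> P" for x
  proof -
    have "int q * (m x + (\<Sum>l\<in>lns_thru x. w l)) = int q * t" unfolding t_def e[OF that] e[OF x0] ..
    then show ?thesis using q_pos by simp
  qed
  have "(int q + 1) * m {} = int q * t + (\<Sum>x\<in>P. m x)" using e[OF x0] unfolding t_def by simp
  also have "(\<Sum>x\<in>P. m x) = (\<Sum>x\<in>P. t - (\<Sum>l\<in>lns_thru x. w l))" by (intro sum.cong) (auto simp: mx)
  also have "\<dots> = (int q * int q + int q + 1) * t - (int q + 1) * (\<Sum>l\<in>Ls. w l)"
    unfolding sum_subtractf sum_lns_thru by (simp add: card_pts power2_eq_square)
  finally have "(int q + 1) * m {} = (int q + 1) * ((int q + 1) * t - (\<Sum>l\<in>Ls. w l))"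
    by (simp add: algebra_simps)
  then have m0: "m {} = (int q + 1) * t - (\<Sum>l\<in>Ls. w l)" by simp
  \<comment> \<open>\<open>?v\<close> agrees with \<open>m\<close> at every point, and differs from
    it by \<open>q * t\<close>, a multiple of p, at the extra coordinate.\<close>
  let ?v = "\<lambda>r. of_int t * ones r - (\<Sum>l\<in>Ls. of_int (w l) * line_vec l r)"
  show ?thesis
  proof (rule LC_congruent)
    show "?v \<in> LC" by (intro LC_diff LC_smult LC_sum ones_LC line_vec_LC O_int)
    fix i assume i: "i \<in> J"
    show "\<exists>y\<in>\<O> q. rt q * u i = ?v i + rt q * y"
    proof (cases "i = {}")
      case True
      have "rt q * u i = ?v i + rt q * (y {} - rt q * of_int t)"
        using y(2)[of "{}"] True rt_sq unfolding U_def m0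
        by (simp add: J_def ones_def line_vec_def algebra_simps mult.assoc[symmetric])
      moreover have "y {} - rt q * of_int t \<in> \<O> q" using y(1)[of "{}"] by (auto simp: J_def)
      ultimately show ?thesis by blast
    next
      case False
      then have iP: "i \<in> P" using i unfolding J_def by blast
      have "(\<Sum>l\<in>Ls. of_int (w l) * line_vec l i) = (\<Sum>l\<in>Ls. if i \<subseteq> l then of_int (w l) else 0)"
        using False iP by (intro sum.cong) (auto simp: line_vec_def pts_on_def)
      also have "\<dots> = (\<Sum>l\<in>lns_thru i. of_int (w l))" unfolding lns_thru_def by (simp add: sum.inter_filter)
      finally have "rt q * u i = ?v i + rt q * y i"
        using y(2)[OF i] mx[OF iP] i unfolding U_def by (simp add: ones_def)
      then show ?thesis using y(1)[OF i] by (intro bexI)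
    qed
  qed (simp add: supp)
qed

lemma LC_trace:
  assumes "u \<in> LC" shows "\<exists>y\<in>\<O> q. u {} - (\<Sum>x\<in>P. u x) = rt q * y"
proof -
  obtain f where f: "f \<in> carrier (free_mod q (P \<union> Ls))" "u = coord f" using assms unfolding LC_def by blast
  have "(\<Sum>x\<in>P. u x) = (\<Sum>x\<in>P. rt q * f x + (\<Sum>l\<in>lns_thru x. f l))"
    unfolding f coord_def using empty_notin by (intro sum.cong) auto
  also have "\<dots> = rt q * (\<Sum>x\<in>P. f x) + (of_nat q + 1) * (\<Sum>l\<in>Ls. f l)"
    by (simp add: sum.distrib sum_distrib_left sum_lns_thru)
  finally have "u {} - (\<Sum>x\<in>P. u x) = rt q * (rt q * (\<Sum>l\<in>Ls. f l) - (\<Sum>x\<in>P. f x))"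
    unfolding nat_q by (simp add: f coord_def algebra_simps)
  then show ?thesis using f(1) by (auto simp: free_carrier)
qed

end

context plane begin

section \<open>Projectivity of the lattice of the plane\<close>

lemma CHAR_k: "CHAR('k) = q"
proof -
  have "CHAR('k) dvd q" using CHAR_dvd_CARD[where 'a='k] card_k by simp
  moreover have "CHAR('k) \<noteq> 1" by simp
  ultimately show ?thesis using prime_q prime_nat_iff by blast
qed

lemma of_int_k_eq_0: "(of_int a :: 'k) = 0 \<longleftrightarrow> int q dvd a"
  using of_int_eq_iff_cong_CHAR[of a 0, where 'a='k] by (simp add: CHAR_k cong_0_iff)

text \<open>A field with a prime number of elements is its own prime field, so linear algebra over
  it lifts to integer matrices.\<close>

lemma lift_k: "\<exists>\<sigma> :: 'k \<Rightarrow> int. \<forall>a. of_int (\<sigma> a) = a"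
proof -
  have "inj_on (of_nat :: nat \<Rightarrow> 'k) {..<q}"
  proof (rule inj_onI)
    fix a b assume "a \<in> {..<q}" "b \<in> {..<q}" "(of_nat a :: 'k) = of_nat b"
    then show "a = b" using of_nat_eq_iff_cong_CHAR[of a b, where 'a='k]
      by (simp add: CHAR_k cong_def)
  qed
  then have "card ((of_nat :: nat \<Rightarrow> 'k) ` {..<q}) = CARD('k)" by (simp add: card_image card_k)
  then have "(of_nat :: nat \<Rightarrow> 'k) ` {..<q} = UNIV" by (intro card_subset_eq) auto
  then have "\<exists>n::int. of_int n = a" for a :: 'k
    by (metis UNIV_I imageE of_int_of_nat_eq)
  then show ?thesis by metis
qed

text \<open>The incidence matrix has a generalized inverse over the prime field, hence an integral one
  modulo \<open>q\<close>.\<close>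

lemma generalized_inverse:
  "\<exists>S :: ('k ^ 3) set \<Rightarrow> ('k ^ 3) set \<Rightarrow> int. \<forall>m. \<forall>x\<in>P.
     int q dvd (\<Sum>l\<in>lns_thru x. m l) - (\<Sum>l\<in>lns_thru x. \<Sum>y\<in>P. S l y * (\<Sum>k\<in>lns_thru y. m k))"
proof -
  \<comment> \<open>Coordinates are indexed by all subsets of the space; setting \<open>F\<close> to
    0 outside the points makes the incidence map an endomorphism.\<close>
  define F :: "'k ^ (('k ^ 3) set) \<Rightarrow> 'k ^ (('k ^ 3) set)"
    where "F y = (\<chi> x. if x \<in> P then \<Sum>l\<in>lns_thru x. y $ l else 0)" for y
  have lin: "Vector_Spaces.linear (*s) (*s) F"
    by unfold_locales (auto simp: F_def vec_eq_iff sum.distrib sum_distrib_left algebra_simps)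
  obtain g where g: "Vector_Spaces.linear (*s) (*s) g" "\<And>v. F (g (F v)) = F v"
    using vec.linear_exists_right_inverse_on[OF lin vec.subspace_UNIV] by auto
  obtain \<sigma> :: "'k \<Rightarrow> int" where \<sigma>: "\<And>a. of_int (\<sigma> a) = a" using lift_k by metis
  define S where "S l y = \<sigma> (g (axis y 1) $ l)" for l y
  show ?thesis
  proof (intro exI allI ballI)
    fix m :: "('k ^ 3) set \<Rightarrow> int" and x assume x: "x \<in> P"
    define v where "v = F (\<chi> l. of_int (m l))"
    have v: "v $ y = (if y \<in> P then of_int (\<Sum>k\<in>lns_thru y. m k) else 0)" for y
      unfolding v_def F_def by simp
    have "g v $ l = of_int (\<Sum>y\<in>P. S l y * (\<Sum>k\<in>lns_thru y. m k))" for l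
    proof -
      have "g v $ l = (\<Sum>y\<in>UNIV. v $ y * (g (axis y 1) $ l))"
        by (rule linear_componentwise[OF g(1)])
      also have "\<dots> = (\<Sum>y\<in>P. v $ y * (g (axis y 1) $ l))"
        by (rule sum.mono_neutral_right) (auto simp: v)
      also have "\<dots> = (\<Sum>y\<in>P. of_int (S l y * (\<Sum>k\<in>lns_thru y. m k)))"
        by (intro sum.cong) (auto simp: v S_def \<sigma>)
      finally show ?thesis by simp
    qed
    moreover have "(\<Sum>l\<in>lns_thru x. g v $ l) = of_int (\<Sum>k\<in>lns_thru x. m k)"
    proof -
      have "(\<Sum>l\<in>lns_thru x. g v $ l) = F (g v) $ x" unfolding F_def using x by simp
      also have "\<dots> = v $ x" unfolding v_def g(2) ..
      finally show ?thesis using v[of x] x by simp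
    qed
    ultimately have "(of_int ((\<Sum>l\<in>lns_thru x. m l)
        - (\<Sum>l\<in>lns_thru x. \<Sum>y\<in>P. S l y * (\<Sum>k\<in>lns_thru y. m k))) :: 'k) = 0"
      by simp
    then show "int q dvd (\<Sum>l\<in>lns_thru x. m l)
        - (\<Sum>l\<in>lns_thru x. \<Sum>y\<in>P. S l y * (\<Sum>k\<in>lns_thru y. m k))"
      unfolding of_int_k_eq_0 .
  qed
qed

lemma sum_J: "(\<Sum>j\<in>J. f j) = f {} + (\<Sum>x\<in>P. (f x :: complex))"
  unfolding J_def by simp

text \<open>Modularity as a representation theorem: a functional with values in the order on the
  lattice is pairing with a lattice vector, up to the factor p. The sign change at the points
  compensates the negative part of the form.\<close>

lemma LC_functional:
  assumes "\<And>X. X \<in> LC \<Longrightarrow> (\<Sum>j\<in>J. k j * X j) \<in> \<O> q"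
  shows "\<exists>Y\<in>LC. \<forall>X. hf Y X = rt q * (\<Sum>j\<in>J. k j * X j)"
proof -
  define Y where "Y j = (if j = {} then cnj (rt q * k j) else if j \<in> P then - cnj (rt q * k j) else 0)" for j
  have Y: "hf Y X = rt q * (\<Sum>j\<in>J. k j * X j)" for X
  proof -
    have "(\<Sum>x\<in>P. cnj (Y x) * X x) = - (\<Sum>x\<in>P. rt q * (k x * X x))"
      unfolding sum_negf[symmetric] using empty_notin by (intro sum.cong) (auto simp: Y_def)
    then show ?thesis unfolding hf_def sum_J by (simp add: Y_def distrib_left sum_distrib_left)
  qed
  have "(\<lambda>i. rt q * (Y i / rt q)) \<in> LC"
  proof (rule LC_modular)
    show "Y i / rt q = 0" if "i \<notin> J" for i using that unfolding Y_def J_def by auto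
    fix w assume w: "w \<in> LC"
    have "hf w (\<lambda>i. Y i / rt q) = cnj (hf Y w) / rt q" unfolding hf_divide hf_cnj ..
    also have "\<dots> = - cnj (\<Sum>j\<in>J. k j * w j)" unfolding Y by simp
    finally show "hf w (\<lambda>i. Y i / rt q) \<in> \<O> q" using assms[OF w] O_cnj by (metis O_minus)
  qed
  moreover have "(\<lambda>i. rt q * (Y i / rt q)) = Y" by simp
  ultimately show ?thesis using Y by auto
qed

text \<open>The generalized inverse selects line coefficients \<open>c l X\<close> that depend
  linearly and integrally on \<open>X\<close>. The remainder \<open>D X\<close> is divisible by p at
  the points by choice of \<open>S\<close>, and at the extra coordinate by \<open>LC_trace\<close>.
  So \<open>X\<close> is the sum of \<open>c l X\<close> times line vectors and
  \<open>D X j / rt q\<close> times p-multiples of unit vectors, and \<open>LC_functional\<close>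
  represents these coefficients by lattice vectors.\<close>

lemma LC_dual_basis:
  obtains Y M where "\<forall>i\<in>insert {} (P \<union> Ls). Y i \<in> LC \<and> M i \<in> LC"
    "\<forall>X\<in>LC. X = (\<lambda>r. \<Sum>i\<in>insert {} (P \<union> Ls). hf (Y i) X / rt q * M i r)"
proof -
  obtain S :: "('k ^ 3) set \<Rightarrow> ('k ^ 3) set \<Rightarrow> int" where S: "\<And>m x. x \<in> P \<Longrightarrow>
     int q dvd (\<Sum>l\<in>lns_thru x. m l) - (\<Sum>l\<in>lns_thru x. \<Sum>y\<in>P. S l y * (\<Sum>k\<in>lns_thru y. m k))"
    using generalized_inverse by blast
  define c where "c l X = (\<Sum>y\<in>P. of_int (S l y) * X y)" for l and X :: "('k ^ 3) set \<Rightarrow> complex"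
  define D where "D X r = X r - (\<Sum>l\<in>Ls. c l X * line_vec l r)" for X r
  have cO: "c l X \<in> \<O> q" if "X \<in> LC" for l X unfolding c_def using LC_O[OF that] by auto
  have DLC: "D X \<in> LC" if "X \<in> LC" for X
    unfolding D_def using that by (intro LC_diff LC_sum LC_smult cO line_vec_LC)
  \<comment> \<open>Modulo p the points of \<open>X\<close> carry \<open>B m\<close> for an integral
    \<open>m\<close> on the lines, where \<open>S\<close> reproduces \<open>B m\<close> by its
    defining property.\<close>
  have DP: "\<exists>y\<in>\<O> q. D X x = rt q * y" if X: "X \<in> LC" and x: "x \<in> P" for X x
  proof -
    obtain f where f: "f \<in> carrier (free_mod q (P \<union> Ls))" "X = coord f" using X unfolding LC_def by blast
    have fO: "f i \<in> \<O> q" if "i \<in> P \<union> Ls" for i using f that unfolding free_carrier by blast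
    have "\<exists>m::int. \<exists>y\<in>\<O> q. f l = of_int m + rt q * y" if "l \<in> Ls" for l
      using O_mod_rt[OF fO[of l]] that by blast
    then obtain m :: "('k ^ 3) set \<Rightarrow> int" where "\<And>l. l \<in> Ls \<Longrightarrow> \<exists>y\<in>\<O> q. f l = of_int (m l) + rt q * y" by metis
    then obtain h where h: "\<And>l. l \<in> Ls \<Longrightarrow> h l \<in> \<O> q \<and> f l = of_int (m l) + rt q * h l" by metis
    have lt: "l \<in> lns_thru y \<Longrightarrow> l \<in> Ls" for l y unfolding lns_thru_def by blast
    define H where "H y = f y + (\<Sum>l\<in>lns_thru y. h l)" for y
    have HO: "H y \<in> \<O> q" if "y \<in> P" for y unfolding H_def using fO that h lt by (intro O_add O_sum) auto
    have Xy: "X y = of_int (\<Sum>l\<in>lns_thru y. m l) + rt q * H y" if "y \<in> P" for y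
    proof -
      have "(\<Sum>l\<in>lns_thru y. f l) = (\<Sum>l\<in>lns_thru y. of_int (m l) + rt q * h l)"
        using h lt by (intro sum.cong) auto
      then show ?thesis using that empty_notin unfolding f coord_def H_def
        by (auto simp: sum.distrib sum_distrib_left algebra_simps)
    qed
    have "(\<Sum>l\<in>Ls. c l X * line_vec l x) = (\<Sum>l\<in>Ls. if x \<subseteq> l then c l X else 0)"
      using x empty_notin by (intro sum.cong) (auto simp: line_vec_def pts_on_def)
    also have "\<dots> = (\<Sum>l\<in>lns_thru x. c l X)" by (rule sum_Ls_if)
    also have "\<dots> = (\<Sum>l\<in>lns_thru x. \<Sum>y\<in>P. of_int (S l y * (\<Sum>k\<in>lns_thru y. m k)) + rt q * (of_int (S l y) * H y))"
      unfolding c_def by (intro sum.cong refl) (simp add: Xy algebra_simps)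
    also have "\<dots> = of_int (\<Sum>l\<in>lns_thru x. \<Sum>y\<in>P. S l y * (\<Sum>k\<in>lns_thru y. m k))
        + rt q * (\<Sum>l\<in>lns_thru x. \<Sum>y\<in>P. of_int (S l y) * H y)"
      by (simp add: sum.distrib sum_distrib_left)
    finally have "D X x = of_int ((\<Sum>l\<in>lns_thru x. m l) - (\<Sum>l\<in>lns_thru x. \<Sum>y\<in>P. S l y * (\<Sum>k\<in>lns_thru y. m k)))
        + rt q * (H x - (\<Sum>l\<in>lns_thru x. \<Sum>y\<in>P. of_int (S l y) * H y))"
      unfolding D_def Xy[OF x] by (simp add: algebra_simps)
    moreover obtain e where "e \<in> \<O> q" "of_int ((\<Sum>l\<in>lns_thru x. m l)
        - (\<Sum>l\<in>lns_thru x. \<Sum>y\<in>P. S l y * (\<Sum>k\<in>lns_thru y. m k))) = rt q * e"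
      by (rule rt_dvd_int[OF S[OF x, of m]])
    ultimately have "D X x = rt q * (e + (H x - (\<Sum>l\<in>lns_thru x. \<Sum>y\<in>P. of_int (S l y) * H y)))"
      by (simp add: distrib_left)
    moreover have "e + (H x - (\<Sum>l\<in>lns_thru x. \<Sum>y\<in>P. of_int (S l y) * H y)) \<in> \<O> q"
      using \<open>e \<in> \<O> q\<close> HO x by (intro O_add O_diff O_sum O_mult O_int) auto
    ultimately show ?thesis by blast
  qed
  have DJ: "D X j / rt q \<in> \<O> q" if X: "X \<in> LC" and j: "j \<in> J" for X j
  proof (cases "j = {}")
    case True
    obtain y where y: "y \<in> \<O> q" "D X {} - (\<Sum>x\<in>P. D X x) = rt q * y" using LC_trace[OF DLC[OF X]] by blast
    have "D X {} / rt q = y + (\<Sum>x\<in>P. D X x / rt q)"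
      using y(2) by (simp add: sum_divide_distrib[symmetric] field_simps)
    moreover have "D X x / rt q \<in> \<O> q" if "x \<in> P" for x using DP[OF X that] by auto
    ultimately show ?thesis using y(1) True by auto
  next
    case False
    then show ?thesis using DP[OF X, of j] j unfolding J_def by auto
  qed
  \<comment> \<open>\<open>kc\<close> and \<open>kd\<close> are the coefficient vectors of the
    functionals \<open>c l\<close> and \<open>D X i / rt q\<close>, in the form that
    \<open>LC_functional\<close> takes.\<close>
  define kc where "kc l j = (if j \<in> P then of_int (S l j) else 0 :: complex)" for l j
  have kc: "(\<Sum>j\<in>J. kc l j * X j) = c l X" for l X
    unfolding sum_J c_def kc_def using empty_notin by (auto intro!: sum.cong)
  define kd where "kd i j = ((if j = i then 1 else 0) - (\<Sum>l\<in>Ls. line_vec l i * kc l j)) / rt q" for i j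
  have kd: "(\<Sum>j\<in>J. kd i j * X j) = D X i / rt q" if i: "i \<in> J" for i X
  proof -
    have "(\<Sum>j\<in>J. kd i j * X j) = ((\<Sum>j\<in>J. (if j = i then X j else 0)) - (\<Sum>j\<in>J. \<Sum>l\<in>Ls. line_vec l i * (kc l j * X j))) / rt q"
      unfolding sum_subtractf[symmetric] sum_divide_distrib kd_def
    proof (intro sum.cong refl)
      fix j
      have "(\<Sum>l\<in>Ls. line_vec l i * kc l j) * X j = (\<Sum>l\<in>Ls. line_vec l i * (kc l j * X j))"
        by (simp add: sum_distrib_right mult.assoc)
      then show "((if j = i then 1 else 0) - (\<Sum>l\<in>Ls. line_vec l i * kc l j)) / rt q * X j
        = ((if j = i then X j else 0) - (\<Sum>l\<in>Ls. line_vec l i * (kc l j * X j))) / rt q"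
        by (simp add: left_diff_distrib)
    qed
    also have "(\<Sum>j\<in>J. \<Sum>l\<in>Ls. line_vec l i * (kc l j * X j)) = (\<Sum>l\<in>Ls. line_vec l i * c l X)"
      by (subst sum.swap) (simp add: sum_distrib_left[symmetric] kc)
    finally show ?thesis using i unfolding D_def by (simp add: mult.commute)
  qed
  have "\<exists>Y\<in>LC. \<forall>X. hf Y X = rt q * c l X" for l
    using LC_functional[of "kc l"] cO unfolding kc by blast
  then have "\<forall>l. \<exists>Y. Y \<in> LC \<and> (\<forall>X. hf Y X = rt q * c l X)" by blast
  from choice[OF this] obtain Y1 where "\<forall>l. Y1 l \<in> LC \<and> (\<forall>X. hf (Y1 l) X = rt q * c l X)" ..
  then have Y1: "\<And>l. Y1 l \<in> LC" "\<And>l X. hf (Y1 l) X = rt q * c l X" by blast+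
  have "\<exists>Y\<in>LC. \<forall>X. hf Y X = rt q * (D X i / rt q)" if "i \<in> J" for i
    using LC_functional[of "kd i"] DJ that unfolding kd[OF that] by blast
  then have "\<forall>i\<in>J. \<exists>Y. Y \<in> LC \<and> (\<forall>X. hf Y X = D X i)" by simp blast
  from bchoice[OF this] obtain Y2 where "\<forall>i\<in>J. Y2 i \<in> LC \<and> (\<forall>X. hf (Y2 i) X = D X i)" ..
  then have Y2: "\<And>i. i \<in> J \<Longrightarrow> Y2 i \<in> LC" "\<And>i X. i \<in> J \<Longrightarrow> hf (Y2 i) X = D X i" by blast+
  define Y where "Y i = (if i \<in> Ls then Y1 i else Y2 i)" for i
  define M where "M i = (if i \<in> Ls then line_vec i else (\<lambda>r. if r = i then rt q else 0))" for i
  have JL: "i \<in> J \<Longrightarrow> i \<notin> Ls" for i using pts_Int_lns empty_notin unfolding J_def by auto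
  have I: "insert {} (P \<union> Ls) = Ls \<union> J" unfolding J_def by auto
  have fin: "finite Ls" "finite J" unfolding J_def by auto
  show ?thesis
  proof (rule that[of Y M], unfold I)
    have "Y i \<in> LC" if i: "i \<in> Ls \<union> J" for i using i Y1(1) Y2(1) unfolding Y_def by auto
    moreover have "M i \<in> LC" if i: "i \<in> Ls \<union> J" for i using i line_vec_LC rt_unit_LC JL unfolding M_def by auto
    ultimately show "\<forall>i\<in>Ls \<union> J. Y i \<in> LC \<and> M i \<in> LC" by blast
    show "\<forall>X\<in>LC. X = (\<lambda>r. \<Sum>i\<in>Ls \<union> J. hf (Y i) X / rt q * M i r)"
    proof
      fix X assume X: "X \<in> LC"
      show "X = (\<lambda>r. \<Sum>i\<in>Ls \<union> J. hf (Y i) X / rt q * M i r)"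
      proof
        fix r
        have "(\<Sum>i\<in>Ls \<union> J. hf (Y i) X / rt q * M i r)
            = (\<Sum>i\<in>Ls. hf (Y i) X / rt q * M i r) + (\<Sum>i\<in>J. hf (Y i) X / rt q * M i r)"
          using JL fin by (intro sum.union_disjoint) auto
        also have "(\<Sum>i\<in>Ls. hf (Y i) X / rt q * M i r) = (\<Sum>l\<in>Ls. c l X * line_vec l r)"
          by (intro sum.cong refl) (simp add: Y_def M_def Y1)
        also have "(\<Sum>i\<in>J. hf (Y i) X / rt q * M i r) = (\<Sum>i\<in>J. if i = r then D X i else 0)"
          using JL by (intro sum.cong refl) (auto simp: Y_def M_def Y2)
        also have "\<dots> = D X r" using fin LC_supp[OF DLC[OF X], of r] by auto
        finally show "X r = (\<Sum>i\<in>Ls \<union> J. hf (Y i) X / rt q * M i r)" unfolding D_def by simp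
      qed
    qed
  qed
qed

end

section \<open>The quotient by an invariant null vector\<close>

locale null_vector = plane q ty for q and ty :: "'k::{field,finite} itself" +
  fixes a b :: complex
  assumes null: "a * cnj a = of_nat (q^2 + q + 1) * (b * cnj b)" and b_nz: "b \<noteq> 0"
begin

definition z :: "('k ^ 3) set \<Rightarrow> complex" where
  "z r = (if r = {} then a else if r \<in> P then b else 0)"

definition nn :: complex where "nn = of_nat (q^2 + q + 1)"

lemma nn_nz [simp]: "nn \<noteq> 0"
  unfolding nn_def of_nat_eq_0_iff by simp

lemma cnj_nn [simp]: "cnj nn = nn"
  unfolding nn_def by (rule complex_cnj_of_nat)

lemma null': "a * cnj a = nn * (b * cnj b)"
  using null unfolding nn_def .

lemma a_nz: "a \<noteq> 0"
  using null' b_nz by auto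

lemma hf_z: "hf z X = cnj a * X {} - cnj b * (\<Sum>x\<in>P. X x)"
proof -
  have "(\<Sum>x\<in>P. cnj (z x) * X x) = (\<Sum>x\<in>P. cnj b * X x)"
    using empty_notin by (intro sum.cong) (auto simp: z_def)
  then show ?thesis unfolding hf_def by (simp add: z_def sum_distrib_left)
qed

lemma sum_z: "(\<Sum>x\<in>P. z x) = nn * b"
proof -
  have "(\<Sum>x\<in>P. z x) = (\<Sum>x\<in>P. b)" using empty_notin by (intro sum.cong) (auto simp: z_def)
  then show ?thesis unfolding nn_def using card_pts by simp
qed

lemma hf_zz: "hf z z = 0"
  unfolding hf_z sum_z using null' by (simp add: z_def algebra_simps)

definition proj :: "(('k ^ 3) set \<Rightarrow> complex) \<Rightarrow> ('k ^ 3) set \<Rightarrow> complex" where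
  "proj X r = (if r \<in> P then X r - (\<Sum>x\<in>P. X x) / nn else 0)"

definition wf :: "(('k ^ 3) set \<Rightarrow> complex) \<Rightarrow> (('k ^ 3) set \<Rightarrow> complex) \<Rightarrow> complex" where
  "wf u v = - (\<Sum>x\<in>P. cnj (u x) * v x)"

definition zperp :: "(('k ^ 3) set \<Rightarrow> complex) set" where
  "zperp = {X \<in> LC. hf z X = 0}"

definition W :: "(('k ^ 3) set \<Rightarrow> complex) set" where
  "W = proj ` zperp"

lemma proj_sum: "(\<Sum>x\<in>P. proj X x) = 0"
proof -
  have "(\<Sum>x\<in>P. proj X x) = (\<Sum>x\<in>P. X x) - of_nat (card P) * ((\<Sum>x\<in>P. X x) / nn)"
    unfolding proj_def by (simp add: sum_subtractf)
  then show ?thesis unfolding card_pts nn_def[symmetric] by simp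
qed

text \<open>Orthogonality to \<open>z\<close> determines the extra coordinate from the sum over the
  points, and the null equation turns the product of the extra coordinates into the product of the
  sums over \<open>nn\<close>. This is exactly what subtracting the means removes.\<close>

lemma proj_form:
  assumes "hf z X = 0" "hf z Y = 0" shows "hf X Y = wf (proj X) (proj Y)"
proof -
  let ?s = "\<Sum>x\<in>P. X x" and ?t = "\<Sum>x\<in>P. Y x"
  have X0: "cnj (X {}) = b * cnj ?s / a"
    using arg_cong[OF assms(1), of cnj] a_nz unfolding hf_z by (simp add: field_simps)
  have Y0: "Y {} = cnj b * ?t / cnj a" using assms(2) a_nz unfolding hf_z by (simp add: field_simps)
  have "cnj (X {}) * Y {} = (b * cnj b) * (cnj ?s * ?t) / (a * cnj a)"
    unfolding X0 Y0 by (simp add: ac_simps)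
  also have "\<dots> = cnj ?s * ?t / nn" unfolding null' using b_nz by simp
  finally have 1: "cnj (X {}) * Y {} = cnj ?s * ?t / nn" .
  have "(\<Sum>x\<in>P. cnj (proj X x) * proj Y x) = (\<Sum>x\<in>P. cnj (proj X x) * Y x) - (\<Sum>x\<in>P. cnj (proj X x) * (?t / nn))"
    unfolding sum_subtractf[symmetric] by (intro sum.cong refl) (simp add: proj_def[of Y] right_diff_distrib)
  also have "(\<Sum>x\<in>P. cnj (proj X x) * (?t / nn)) = cnj (\<Sum>x\<in>P. proj X x) * (?t / nn)"
    by (simp only: cnj_sum sum_distrib_right)
  also have "\<dots> = 0" unfolding proj_sum by simp
  also have "(\<Sum>x\<in>P. cnj (proj X x) * Y x) = (\<Sum>x\<in>P. cnj (X x) * Y x - cnj ?s / nn * Y x)"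
    by (intro sum.cong) (auto simp: proj_def algebra_simps)
  also have "\<dots> = (\<Sum>x\<in>P. cnj (X x) * Y x) - cnj ?s / nn * ?t"
    by (simp only: sum_subtractf sum_distrib_left)
  finally show ?thesis unfolding hf_def wf_def 1 by simp
qed

lemma proj_add: "proj (\<lambda>i. u i + v i) = (\<lambda>i. proj u i + proj v i)"
  by (rule ext) (simp add: proj_def sum.distrib add_divide_distrib)

lemma proj_diff: "proj (\<lambda>i. u i - v i) = (\<lambda>i. proj u i - proj v i)"
  by (rule ext) (simp add: proj_def sum_subtractf diff_divide_distrib)

lemma proj_smult: "proj (\<lambda>i. c * u i) = (\<lambda>i. c * proj u i)"
  by (rule ext) (simp add: proj_def sum_distrib_left[symmetric] algebra_simps)

lemma proj_0: "proj (\<lambda>_. 0) = (\<lambda>_. 0)"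
  by (rule ext) (simp add: proj_def)

lemma proj_Sum: "proj (\<lambda>r. \<Sum>i\<in>I. f i r) = (\<lambda>r. \<Sum>i\<in>I. proj (f i) r)"
  by (induction I rule: infinite_finite_induct) (simp_all add: proj_0 proj_add)

lemma proj_z: "proj z = (\<lambda>_. 0)"
proof
  fix r show "proj z r = 0"
    by (cases "r = {}") (simp_all add: proj_def sum_z, simp_all add: z_def)
qed

text \<open>Vanishing projection means that \<open>X\<close> is constant on the points, and
  orthogonality to \<open>z\<close> forces the extra coordinate into the ratio a : b with that
  constant. The coefficient may lie outside the order.\<close>

lemma proj_kernel:
  assumes "hf z X = 0" "proj X = (\<lambda>_. 0)" "\<And>i. i \<notin> J \<Longrightarrow> X i = 0"
  shows "X = (\<lambda>i. X {} / a * z i)"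
proof
  fix i
  let ?s = "\<Sum>x\<in>P. X x"
  have "?s = cnj a * X {} / cnj b" using assms(1) b_nz unfolding hf_z by (simp add: field_simps)
  then have "?s / nn = (a * cnj a) * X {} / (nn * cnj b * a)" using a_nz by (simp add: field_simps)
  also have "\<dots> = X {} / a * b" unfolding null' using b_nz a_nz by (simp add: field_simps)
  finally have s: "?s / nn = X {} / a * b" .
  consider "i = {}" | "i \<in> P" | "i \<notin> J" unfolding J_def by blast
  then show "X i = X {} / a * z i"
  proof cases
    case 2
    then have "X i = ?s / nn" using fun_cong[OF assms(2), of i] by (simp add: proj_def)
    then show ?thesis using 2 empty_notin unfolding s by (auto simp: z_def)
  qed (use a_nz assms(3) in \<open>auto simp: z_def J_def\<close>)
qed

end

locale null_lattice_vector = null_vector q ty a b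
  for q and ty :: "'k::{field,finite} itself" and a b +
  assumes z_LC: "z \<in> LC"
begin

lemma ab_O: "a \<in> \<O> q" "b \<in> \<O> q"
proof -
  obtain x where "x \<in> P" using exists_point by blast
  then have "b = z x" using empty_notin unfolding z_def by auto
  then show "b \<in> \<O> q" using LC_O[OF z_LC] by metis
  have "a = z {}" unfolding z_def by simp
  then show "a \<in> \<O> q" using LC_O[OF z_LC] by metis
qed

text \<open>The pairings with \<open>z\<close> form the ideal generated by two values: \<alpha> at
  any line and \<beta> at any point. This ideal is invertible, and \<open>r1\<close>,
  \<open>r2\<close> lie in its inverse.\<close>

lemma dual_z: "\<exists>r1 r2 w1 w2. w1 \<in> LC \<and> w2 \<in> LC \<and> r1 * hf z w1 + r2 * hf z w2 = 1 \<and>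
    (\<forall>X\<in>LC. r1 * hf z X \<in> \<O> q \<and> r2 * hf z X \<in> \<O> q) \<and> r1 \<in> quadratic_field q \<and> r2 \<in> quadratic_field q"
proof -
  define \<alpha> where "\<alpha> = cnj a - (of_nat q + 1) * cnj b"
  define \<beta> where "\<beta> = - cnj b * rt q"
  have ab: "\<alpha> \<in> \<O> q" "\<beta> \<in> \<O> q" "\<beta> \<noteq> 0" unfolding \<alpha>_def \<beta>_def using ab_O b_nz by auto
  obtain r1 r2 where r: "r1 * \<alpha> + r2 * \<beta> = 1" "r1 * \<alpha> \<in> \<O> q" "r1 * \<beta> \<in> \<O> q" "r2 * \<alpha> \<in> \<O> q" "r2 * \<beta> \<in> \<O> q"
      "r1 \<in> quadratic_field q" "r2 \<in> quadratic_field q"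
    using invertible_ideal[OF ab] by blast
  have gen: "hf z (coord f) = \<alpha> * (\<Sum>l\<in>Ls. f l) + \<beta> * (\<Sum>x\<in>P. f x)" for f
  proof -
    have "(\<Sum>x\<in>P. coord f x) = (\<Sum>x\<in>P. rt q * f x + (\<Sum>l\<in>lns_thru x. f l))"
      unfolding coord_def using empty_notin by (intro sum.cong) auto
    also have "\<dots> = rt q * (\<Sum>x\<in>P. f x) + (of_nat q + 1) * (\<Sum>l\<in>Ls. f l)"
      by (simp add: sum.distrib sum_distrib_left sum_lns_thru)
    finally show ?thesis unfolding hf_z \<alpha>_def \<beta>_def by (simp add: coord_def algebra_simps)
  qed
  obtain l where l: "l \<in> Ls" using exists_line by blast
  obtain x where x: "x \<in> P" using exists_point by blast
  let ?w1 = "line_vec l" and ?w2 = "\<lambda>r. if r = x then rt q else 0"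
  have "(\<Sum>y\<in>P. line_vec l y) = of_nat q + 1"
  proof -
    have "(\<Sum>y\<in>P. line_vec l y) = (\<Sum>y\<in>P. if y \<subseteq> l then 1 else 0)"
      using empty_notin by (intro sum.cong) (auto simp: line_vec_def pts_on_def)
    also have "\<dots> = of_nat (card (pts_on l))" unfolding sum_P_if by simp
    finally show ?thesis using card_pts_on[OF l] by simp
  qed
  then have 1: "hf z ?w1 = \<alpha>" unfolding hf_z \<alpha>_def by (simp add: line_vec_def algebra_simps)
  have 2: "hf z ?w2 = \<beta>" unfolding hf_z \<beta>_def using x empty_notin by auto
  have "r1 * hf z X \<in> \<O> q \<and> r2 * hf z X \<in> \<O> q" if X: "X \<in> LC" for X
  proof -
    obtain f where f: "f \<in> carrier (free_mod q (P \<union> Ls))" "X = coord f" using X unfolding LC_def by blast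
    then have "(\<Sum>l\<in>Ls. f l) \<in> \<O> q" "(\<Sum>x\<in>P. f x) \<in> \<O> q" by (auto simp: free_carrier)
    then show ?thesis unfolding f gen distrib_left mult.assoc[symmetric] using r by auto
  qed
  moreover have "?w1 \<in> LC" "?w2 \<in> LC" using line_vec_LC[OF l] rt_unit_LC[of x] x by (auto simp: J_def)
  ultimately show ?thesis using r 1 2 by metis
qed

lemma zperp_add: "u \<in> zperp \<Longrightarrow> v \<in> zperp \<Longrightarrow> (\<lambda>i. u i + v i) \<in> zperp"
  and zperp_smult: "c \<in> \<O> q \<Longrightarrow> u \<in> zperp \<Longrightarrow> (\<lambda>i. c * u i) \<in> zperp"
  unfolding zperp_def by (auto simp: hf_add hf_smult intro: LC_add LC_smult)

lemma z_zperp: "z \<in> zperp"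
  unfolding zperp_def using z_LC hf_zz by blast

lemma W_add: "u \<in> W \<Longrightarrow> v \<in> W \<Longrightarrow> (\<lambda>i. u i + v i) \<in> W"
  unfolding W_def by (auto simp: proj_add[symmetric] intro!: imageI zperp_add)

lemma W_smult: "c \<in> \<O> q \<Longrightarrow> u \<in> W \<Longrightarrow> (\<lambda>i. c * u i) \<in> W"
  unfolding W_def by (auto simp: proj_smult[symmetric] intro!: imageI zperp_smult)

lemma W_0: "(\<lambda>_. 0) \<in> W"
  unfolding W_def using z_zperp proj_z by (metis imageI)

lemma W_supp: "u \<in> W \<Longrightarrow> i \<notin> P \<Longrightarrow> u i = 0"
  unfolding W_def proj_def by auto

lemma W_sum: "u \<in> W \<Longrightarrow> (\<Sum>x\<in>P. u x) = 0"
  unfolding W_def using proj_sum by auto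

lemma W_form: "u \<in> W \<Longrightarrow> v \<in> W \<Longrightarrow> \<exists>y\<in>\<O> q. wf u v = rt q * y"
  unfolding W_def zperp_def using LC_form proj_form by fastforce

text \<open>\<open>\<lambda>X. X - \<langle>z|X\<rangle> (r1 w1 + r2 w2)\<close> is a projection of the lattice onto the complement of \<open>z\<close>,
  also when \<open>z\<close> has no primitive multiple.\<close>

lemma perp_projection:
  obtains pr \<mu> where "\<forall>w\<in>LC. pr w \<in> zperp" "\<forall>w X. hf (pr w) X = hf w X - hf w z * \<mu> X"
    "\<forall>X\<in>zperp. pr X = X"
    "\<forall>(I :: ('k ^ 3) set set) c f. pr (\<lambda>r. \<Sum>i\<in>I. c i * f i r) = (\<lambda>r. \<Sum>i\<in>I. c i * pr (f i) r)"
proof -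
  obtain r1 r2 w1 w2 where r: "w1 \<in> LC" "w2 \<in> LC" "r1 * hf z w1 + r2 * hf z w2 = 1"
      and rO: "\<And>X. X \<in> LC \<Longrightarrow> r1 * hf z X \<in> \<O> q" "\<And>X. X \<in> LC \<Longrightarrow> r2 * hf z X \<in> \<O> q" using dual_z by blast
  define pr where "pr X r = X r - (r1 * hf z X * w1 r + r2 * hf z X * w2 r)" for X r
  define \<mu> where "\<mu> X = cnj r1 * hf w1 X + cnj r2 * hf w2 X" for X
  have 1: "pr w \<in> zperp" if "w \<in> LC" for w
  proof -
    have "pr w \<in> LC" unfolding pr_def using that r rO by (intro LC_diff LC_add LC_smult) auto
    moreover have "hf z (pr w) = hf z w - hf z w * (r1 * hf z w1 + r2 * hf z w2)"
      unfolding pr_def hf_diff hf_add hf_smult by (simp add: algebra_simps)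
    ultimately show ?thesis unfolding zperp_def r(3) by simp
  qed
  have 2: "hf (pr w) X = hf w X - hf w z * \<mu> X" for w X
    unfolding pr_def \<mu>_def hf_diff_left hf_add_left hf_smult_left
    by (simp add: hf_cnj algebra_simps)
  have 3: "pr X = X" if "X \<in> zperp" for X
    using that unfolding zperp_def pr_def by simp
  have "pr (\<lambda>r. \<Sum>i\<in>I. c i * f i r) = (\<lambda>r. \<Sum>i\<in>I. c i * pr (f i) r)" for I :: "('k ^ 3) set set" and c f
    unfolding pr_def hf_sum hf_smult
    by (rule ext) (simp add: algebra_simps sum_subtractf sum.distrib sum_distrib_left)
  then show ?thesis using that[of pr \<mu>] 1 2 3 by simp
qed

text \<open>Subtracting \<open>\<mu> X\<close> times \<open>z\<close> from \<open>X\<close> changes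
  the pairing with \<open>w\<close> into the pairing of \<open>pr w\<close> with \<open>X\<close>,
  which is integral by assumption. Modularity of \<open>LC\<close> then applies, and
  \<open>proj\<close> forgets the multiple of \<open>z\<close>.\<close>

lemma W_modular:
  assumes "hf z X = 0" "\<And>i. i \<notin> J \<Longrightarrow> X i = 0" "\<And>y. y \<in> W \<Longrightarrow> wf y (proj X) \<in> \<O> q"
  shows "(\<lambda>r. rt q * proj X r) \<in> W"
proof -
  obtain pr \<mu> where pr': "\<forall>w\<in>LC. pr w \<in> zperp" "\<forall>w X. hf (pr w) X = hf w X - hf w z * \<mu> X"
    by (rule perp_projection)
  note pr = pr'[rule_format]
  define V where "V i = X i - \<mu> X * z i" for i
  have "(\<lambda>i. rt q * V i) \<in> LC"
  proof (rule LC_modular)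
    show "V i = 0" if "i \<notin> J" for i using assms(2)[OF that] that unfolding V_def z_def J_def by auto
    fix w assume w: "w \<in> LC"
    have "hf w V = hf (pr w) X" unfolding V_def hf_diff hf_smult pr(2) by simp
    also have "\<dots> = wf (proj (pr w)) (proj X)"
      using pr(1)[OF w] assms(1) by (intro proj_form) (auto simp: zperp_def)
    finally show "hf w V \<in> \<O> q" using assms(3) pr(1)[OF w] unfolding W_def by simp
  qed
  moreover have "hf z (\<lambda>i. rt q * V i) = 0"
    unfolding V_def hf_smult hf_diff hf_zz assms(1) by simp
  ultimately have "proj (\<lambda>i. rt q * V i) \<in> W" unfolding W_def zperp_def by blast
  moreover have "proj (\<lambda>i. rt q * V i) = (\<lambda>i. rt q * proj X i)"
    unfolding V_def proj_smult proj_diff proj_z by simp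
  ultimately show ?thesis by simp
qed

text \<open>The dual basis of \<open>LC\<close> is pushed through \<open>pr\<close> and
  \<open>proj\<close>. Replacing \<open>Y i\<close> by \<open>pr (Y i)\<close> changes the
  coefficients by \<open>hf (Y i) z * \<mu> X\<close>, divided by p, and these corrections add up to
  a multiple of the expansion of \<open>proj z\<close>, which is zero.\<close>

lemma W_dual_basis:
  obtains I :: "('k ^ 3) set set" and Y M where "finite I"
    "\<forall>i\<in>I. Y i \<in> W \<and> M i \<in> W" "\<forall>x\<in>W. x = (\<lambda>r. \<Sum>i\<in>I. wf (Y i) x / rt q * M i r)"
proof -
  let ?I = "insert {} (P \<union> Ls)"
  obtain Y M where YM': "\<forall>i\<in>?I. Y i \<in> LC \<and> M i \<in> LC"
    and dual': "\<forall>X\<in>LC. X = (\<lambda>r. \<Sum>i\<in>?I. hf (Y i) X / rt q * M i r)"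
    by (rule LC_dual_basis)
  have YM: "\<And>i. i \<in> ?I \<Longrightarrow> Y i \<in> LC" "\<And>i. i \<in> ?I \<Longrightarrow> M i \<in> LC" using YM' by blast+
  note dual = dual'[rule_format]
  obtain pr \<mu> where pr': "\<forall>w\<in>LC. pr w \<in> zperp" "\<forall>w X. hf (pr w) X = hf w X - hf w z * \<mu> X"
    and pri': "\<forall>X\<in>zperp. pr X = X"
    and prs': "\<forall>(I :: ('k ^ 3) set set) c f. pr (\<lambda>r. \<Sum>i\<in>I. c i * f i r) = (\<lambda>r. \<Sum>i\<in>I. c i * pr (f i) r)"
    by (rule perp_projection)
  note pr = pr'[rule_format] and pri = pri'[rule_format] and prs = prs'[rule_format]
  have "x = (\<lambda>r. \<Sum>i\<in>?I. wf (proj (pr (Y i))) x / rt q * proj (pr (M i)) r)" if x: "x \<in> W" for x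
  proof -
    obtain X where X: "X \<in> zperp" "x = proj X" using x unfolding W_def by blast
    then have XL: "X \<in> LC" "hf z X = 0" unfolding zperp_def by auto
    have e: "Z = (\<lambda>r. \<Sum>i\<in>?I. hf (Y i) Z / rt q * pr (M i) r)" if "Z \<in> zperp" for Z
    proof -
      have "Z \<in> LC" using that unfolding zperp_def by blast
      then have "pr Z = pr (\<lambda>r. \<Sum>i\<in>?I. hf (Y i) Z / rt q * M i r)" by (rule arg_cong[OF dual])
      then have "Z = pr (\<lambda>r. \<Sum>i\<in>?I. hf (Y i) Z / rt q * M i r)" unfolding pri[OF that] .
      then show ?thesis unfolding prs .
    qed
    have 1: "hf (Y i) X = wf (proj (pr (Y i))) x + hf (Y i) z * \<mu> X" if "i \<in> ?I" for i
      using pr(2)[of "Y i" X] proj_form[of "pr (Y i)" X] pr(1)[OF YM(1)[OF that]] XL X(2)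
      unfolding zperp_def by (simp add: diff_eq_eq)
    have A: "proj z = (\<lambda>r. \<Sum>i\<in>?I. hf (Y i) z / rt q * proj (pr (M i)) r)"
      by (subst e[OF z_zperp]) (simp only: proj_Sum proj_smult)
    have Z0: "(\<Sum>i\<in>?I. hf (Y i) z / rt q * proj (pr (M i)) r) = 0" for r
      using fun_cong[OF A, of r] unfolding proj_z by (rule sym)
    have "proj X = (\<lambda>r. \<Sum>i\<in>?I. hf (Y i) X / rt q * proj (pr (M i)) r)"
      by (subst e[OF X(1)]) (simp only: proj_Sum proj_smult)
    also have "\<dots> = (\<lambda>r. (\<Sum>i\<in>?I. wf (proj (pr (Y i))) x / rt q * proj (pr (M i)) r)
        + \<mu> X * (\<Sum>i\<in>?I. hf (Y i) z / rt q * proj (pr (M i)) r))"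
    proof
      fix r
      show "(\<Sum>i\<in>?I. hf (Y i) X / rt q * proj (pr (M i)) r)
         = (\<Sum>i\<in>?I. wf (proj (pr (Y i))) x / rt q * proj (pr (M i)) r)
        + \<mu> X * (\<Sum>i\<in>?I. hf (Y i) z / rt q * proj (pr (M i)) r)"
        unfolding sum_distrib_left sum.distrib[symmetric]
        by (intro sum.cong refl) (simp add: 1 field_simps)
    qed
    also have "\<dots> = (\<lambda>r. \<Sum>i\<in>?I. wf (proj (pr (Y i))) x / rt q * proj (pr (M i)) r)"
      unfolding Z0 by simp
    finally show ?thesis unfolding X(2) .
  qed
  moreover have "proj (pr (Y i)) \<in> W" "proj (pr (M i)) \<in> W" if "i \<in> ?I" for i
    unfolding W_def using pr(1) YM that by blast+
  moreover have "finite ?I" by simp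
  ultimately show ?thesis using that[of ?I "\<lambda>i. proj (pr (Y i))" "\<lambda>i. proj (pr (M i))"] by simp
qed

end

section \<open>Modules given in coordinates\<close>

text \<open>Injective coordinates reduce every module law to an identity of functions. Three modules
  are treated this way: the lattice of the plane, the summand of a splitting and the singleton copy
  of \<open>W\<close>.\<close>

locale represented = quad_order q for q +
  fixes M :: "('a, 'm) hmod_scheme" (structure)
    and \<Psi> :: "'a \<Rightarrow> 'i \<Rightarrow> complex"
    and h :: "('i \<Rightarrow> complex) \<Rightarrow> ('i \<Rightarrow> complex) \<Rightarrow> complex"
  assumes inj_\<Psi>: "inj_on \<Psi> (carrier M)"
    and zero_M: "\<zero> \<in> carrier M" "\<Psi> \<zero> = (\<lambda>_. 0)"
    and add_M: "\<And>x y. x \<in> carrier M \<Longrightarrow> y \<in> carrier M \<Longrightarrow> x \<oplus> y \<in> carrier M"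
      "\<And>x y. x \<in> carrier M \<Longrightarrow> y \<in> carrier M \<Longrightarrow> \<Psi> (x \<oplus> y) = (\<lambda>i. \<Psi> x i + \<Psi> y i)"
    and smult_M: "\<And>c x. c \<in> \<O> q \<Longrightarrow> x \<in> carrier M \<Longrightarrow> c \<odot> x \<in> carrier M"
      "\<And>c x. c \<in> \<O> q \<Longrightarrow> x \<in> carrier M \<Longrightarrow> \<Psi> (c \<odot> x) = (\<lambda>i. c * \<Psi> x i)"
    and form_M: "\<And>x y. x \<in> carrier M \<Longrightarrow> y \<in> carrier M \<Longrightarrow> form M x y = h (\<Psi> x) (\<Psi> y)"
    and h_add: "\<And>u v w. h u (\<lambda>i. v i + w i) = h u v + h u w"
    and h_smult: "\<And>c u v. h u (\<lambda>i. c * v i) = c * h u v"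
    and h_cnj: "\<And>u v. cnj (h u v) = h v u"
begin

abbreviation V where "V \<equiv> \<Psi> ` carrier M"

lemma \<Psi>_eq: "x \<in> carrier M \<Longrightarrow> y \<in> carrier M \<Longrightarrow> \<Psi> x = \<Psi> y \<Longrightarrow> x = y"
  using inj_\<Psi> by (rule inj_onD)

lemma module_M: "Module.module (\<O>_ring q) M"
proof (rule Module.moduleI[OF cring_O])
  show "abelian_group M"
  proof (rule abelian_groupI)
    fix x assume x: "x \<in> carrier M"
    have m: "- 1 \<in> \<O> q" using O_minus[OF O_1] .
    have "(- 1) \<odot> x \<oplus> x = \<zero>" using x m by (intro \<Psi>_eq) (simp_all add: zero_M add_M smult_M)
    then show "\<exists>y\<in>carrier M. y \<oplus> x = \<zero>" using smult_M(1)[OF m x] by blast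
  qed (auto intro!: \<Psi>_eq simp: zero_M add_M algebra_simps)
qed (auto intro!: \<Psi>_eq simp: smult_M add_M algebra_simps)

sublocale Module.module "\<O>_ring q" M by (rule module_M)

lemma h_zero [simp]: "h u (\<lambda>_. 0) = 0"
  using h_smult[of u 0 "\<lambda>_. 0"] by simp


lemma h_divide: "h u (\<lambda>i. v i / c) = h u v / c"
  using h_smult[of u "1 / c" v] by simp

lemma V_add: "u \<in> V \<Longrightarrow> v \<in> V \<Longrightarrow> (\<lambda>i. u i + v i) \<in> V"
  by (auto simp: add_M(2)[symmetric] add_M(1) intro!: imageI)

lemma V_smult: "c \<in> \<O> q \<Longrightarrow> u \<in> V \<Longrightarrow> (\<lambda>i. c * u i) \<in> V"
  by (auto simp: smult_M(2)[symmetric] smult_M(1) intro!: imageI)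

lemma V_zero: "(\<lambda>_. 0) \<in> V"
  using zero_M by (metis imageI)

lemma V_sum: "(\<And>i. i \<in> I \<Longrightarrow> f i \<in> V) \<Longrightarrow> (\<lambda>r. \<Sum>i\<in>I. f i r) \<in> V"
proof (induction I rule: infinite_finite_induct)
  case (insert x F)
  then show ?case using V_add[of "f x" "\<lambda>r. \<Sum>i\<in>F. f i r"] by simp
qed (simp_all only: sum.infinite sum.empty V_zero not_False_eq_True)

lemma \<Psi>_neg: assumes "x \<in> carrier M" shows "\<Psi> (\<ominus> x) = (\<lambda>i. - \<Psi> x i)"
proof
  fix i
  have "\<Psi> (\<ominus> x \<oplus> x) i = 0" using assms by (simp only: M.l_neg zero_M)
  then show "\<Psi> (\<ominus> x) i = - \<Psi> x i" using assms by (simp add: add_M eq_neg_iff_add_eq_0)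
qed

lemma \<Psi>_finsum:
  assumes "finite B" "B \<subseteq> carrier M" "\<And>x. x \<in> B \<Longrightarrow> c x \<in> \<O> q"
  shows "\<Psi> (\<Oplus>x\<in>B. c x \<odot> x) = (\<lambda>i. \<Sum>x\<in>B. c x * \<Psi> x i)" (is "_ = ?r B")
  using assms
proof (induction B)
  case empty then show ?case by (simp add: zero_M)
next
  case (insert x B)
  have c: "(\<lambda>x. c x \<odot> x) \<in> B \<rightarrow> carrier M" "c x \<odot> x \<in> carrier M" using insert.prems smult_M by auto
  then have "(\<Oplus>x\<in>insert x B. c x \<odot> x) = c x \<odot> x \<oplus> (\<Oplus>x\<in>B. c x \<odot> x)"
    using insert.hyps by (intro M.finsum_insert) auto
  moreover have "(\<Oplus>x\<in>B. c x \<odot> x) \<in> carrier M" using c by (intro M.finsum_closed) auto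
  ultimately show ?case using insert c(2) by (simp add: add_M smult_M)
qed

lemma lin_independent_iff:
  "lin_independent q M B \<longleftrightarrow> finite B \<and> B \<subseteq> carrier M \<and>
     (\<forall>c \<in> B \<rightarrow> \<O> q. (\<forall>i. (\<Sum>x\<in>B. c x * \<Psi> x i) = 0) \<longrightarrow> (\<forall>x\<in>B. c x = 0))"
proof -
  have "(\<Oplus>x\<in>B. c x \<odot> x) = \<zero> \<longleftrightarrow> (\<forall>i. (\<Sum>x\<in>B. c x * \<Psi> x i) = 0)"
    if B: "finite B" "B \<subseteq> carrier M" and c: "c \<in> B \<rightarrow> \<O> q" for c
  proof -
    have cx: "c x \<odot> x \<in> carrier M" if "x \<in> B" for x
      using B(2) that by (intro smult_M(1)[OF Pi_mem[OF c that]]) auto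
    then have cl: "(\<Oplus>x\<in>B. c x \<odot> x) \<in> carrier M" by (intro M.finsum_closed) auto
    have "(\<Oplus>x\<in>B. c x \<odot> x) = \<zero> \<longleftrightarrow> \<Psi> (\<Oplus>x\<in>B. c x \<odot> x) = \<Psi> \<zero>"
      using \<Psi>_eq[OF cl zero_M(1)] by auto
    also have "\<dots> \<longleftrightarrow> (\<forall>i. (\<Sum>x\<in>B. c x * \<Psi> x i) = 0)"
      using B c by (subst \<Psi>_finsum) (auto simp: zero_M fun_eq_iff)
    finally show ?thesis .
  qed
  then show ?thesis unfolding lin_independent_def by auto
qed

text \<open>Modules with complex coordinates are torsion-free, so the auxiliary \<open>t\<close> of
  \<open>frac_rel\<close> cancels and a fraction is just its quotient of coordinates.\<close>

lemma frac_eq: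
  assumes "x \<in> carrier M" "d \<in> \<O> q - {0}"
  shows "frac q M x d = {(y, e). y \<in> carrier M \<and> e \<in> \<O> q - {0} \<and> (\<forall>i. \<Psi> y i / e = \<Psi> x i / d)}"
proof -
  have "(\<exists>t\<in>\<O> q - {0}. t \<odot> (e \<odot> x) = t \<odot> (d \<odot> y)) \<longleftrightarrow> (\<forall>i. \<Psi> y i / e = \<Psi> x i / d)"
    if y: "y \<in> carrier M" "e \<in> \<O> q - {0}" for y e
  proof -
    have "t \<odot> (e \<odot> x) = t \<odot> (d \<odot> y) \<longleftrightarrow> (\<forall>i. \<Psi> y i / e = \<Psi> x i / d)" if t: "t \<in> \<O> q - {0}" for t
    proof -
      have cl: "e \<odot> x \<in> carrier M" "d \<odot> y \<in> carrier M" using assms y smult_M(1) by auto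
      then have cl': "t \<odot> (e \<odot> x) \<in> carrier M" "t \<odot> (d \<odot> y) \<in> carrier M" using t smult_M(1) by auto
      have "t \<odot> (e \<odot> x) = t \<odot> (d \<odot> y) \<longleftrightarrow> \<Psi> (t \<odot> (e \<odot> x)) = \<Psi> (t \<odot> (d \<odot> y))"
        using \<Psi>_eq[OF cl'] by metis
      also have "\<dots> \<longleftrightarrow> (\<forall>i. t * (e * \<Psi> x i) = t * (d * \<Psi> y i))"
        using assms y t cl by (simp add: smult_M fun_eq_iff)
      also have "\<dots> \<longleftrightarrow> (\<forall>i. \<Psi> y i / e = \<Psi> x i / d)"
        using assms y t by (auto simp: field_simps)
      finally show ?thesis .
    qed
    moreover have "1 \<in> \<O> q - {0}" by simp
    ultimately show ?thesis by blast
  qed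
  then show ?thesis using assms unfolding frac_def frac_rel_def by auto
qed

lemma fracsE:
  assumes "X \<in> fracs q M" obtains x d where "x \<in> carrier M" "d \<in> \<O> q - {0}" "X = frac q M x d"
  using assms unfolding fracs_def frac_def by (auto elim!: quotientE)

end

text \<open>The properties of \<open>W\<close> from which projectivity, definiteness and
  p-modularity follow. An element of the dual enters as a quotient \<open>x / d\<close> of
  coordinates, and \<open>dual_basis\<close> pairs through \<open>h\<close> so that
  \<open>h_rt\<close> makes its coefficients integral.\<close>

locale modular_represented = represented q M \<Psi> h
  for q and M :: "('a, 'm) hmod_scheme" (structure) and \<Psi> :: "'a \<Rightarrow> 'i \<Rightarrow> complex" and h +
  assumes h_rt: "\<And>u v. u \<in> V \<Longrightarrow> v \<in> V \<Longrightarrow> \<exists>y\<in>\<O> q. h u v = rt q * y"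
    and modular: "\<And>x d. x \<in> V \<Longrightarrow> d \<in> \<O> q - {0} \<Longrightarrow> (\<And>y. y \<in> V \<Longrightarrow> h y x / d \<in> \<O> q) \<Longrightarrow>
      (\<lambda>i. rt q * (x i / d)) \<in> V"
    and neg: "\<And>v. v \<in> V \<Longrightarrow> v \<noteq> (\<lambda>_. 0) \<Longrightarrow> Re (h v v) < 0"
    and dual_basis: "\<exists>(I :: 'i set) Y B. finite I \<and> (\<forall>i\<in>I. Y i \<in> V \<and> B i \<in> V) \<and>
      (\<forall>x\<in>V. x = (\<lambda>r. \<Sum>i\<in>I. h (Y i) x / rt q * B i r))"
begin

text \<open>The dual basis lemma: the coefficients map the module into a free one, and combining the
  vectors \<open>B i\<close> is a retraction of that map.\<close>

lemma projective: "fg_projective q M"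
proof -
  obtain I :: "'i set" and Y B where I: "finite I" "\<forall>i\<in>I. Y i \<in> V \<and> B i \<in> V"
    and dual: "\<forall>x\<in>V. x = (\<lambda>r. \<Sum>i\<in>I. h (Y i) x / rt q * B i r)"
    using dual_basis by auto
  obtain e where e: "bij_betw e {..<card I} I" using ex_bij_betw_nat_finite[OF I(1)] by (auto simp: atLeast0LessThan)
  have eI: "e k \<in> I" if "k < card I" for k using e that by (auto simp: bij_betw_def)
  define \<iota> where "\<iota> x k = (if k < card I then h (Y (e k)) (\<Psi> x) / rt q else 0)" for x k
  define \<pi> where "\<pi> v = inv_into (carrier M) \<Psi> (\<lambda>r. \<Sum>k<card I. v k * B (e k) r)" for v
  have cf: "v \<in> carrier (free_mod q {..<card I}) \<longleftrightarrow> (\<forall>k<card I. v k \<in> \<O> q) \<and> (\<forall>k. \<not> k < card I \<longrightarrow> v k = 0)" for v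
    unfolding free_mod_def by auto
  have inV: "(\<lambda>r. \<Sum>k<card I. v k * B (e k) r) \<in> V" if "v \<in> carrier (free_mod q {..<card I})" for v
    using that I(2) eI unfolding cf by (intro V_sum V_smult) auto
  have \<pi>: "\<pi> v \<in> carrier M" "\<Psi> (\<pi> v) = (\<lambda>r. \<Sum>k<card I. v k * B (e k) r)"
    if "v \<in> carrier (free_mod q {..<card I})" for v
    unfolding \<pi>_def using inV[OF that] by (auto intro: inv_into_into f_inv_into_f)
  have \<iota>c: "\<iota> x \<in> carrier (free_mod q {..<card I})" if "x \<in> carrier M" for x
  proof -
    have "h (Y (e k)) (\<Psi> x) / rt q \<in> \<O> q" if "k < card I" for k
    proof -
      have "Y (e k) \<in> V" using I(2) eI[OF that] by blast
      then obtain y where "y \<in> \<O> q" "h (Y (e k)) (\<Psi> x) = rt q * y" using h_rt \<open>x \<in> carrier M\<close> by blast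
      then show ?thesis by simp
    qed
    then show ?thesis unfolding cf \<iota>_def by auto
  qed
  have "\<iota> \<in> lin_maps q M (free_mod q {..<card I})"
    unfolding lin_maps_def using \<iota>c
    by (auto simp: free_mod_def \<iota>_def add_M smult_M h_add h_smult add_divide_distrib fun_eq_iff)
  moreover have "\<pi> \<in> lin_maps q (free_mod q {..<card I}) M"
  proof -
    let ?F = "free_mod q {..<card I}"
    have "\<pi> (x \<oplus>\<^bsub>?F\<^esub> y) = \<pi> x \<oplus> \<pi> y" if xy: "x \<in> carrier ?F" "y \<in> carrier ?F" for x y
    proof (rule \<Psi>_eq)
      have s: "x \<oplus>\<^bsub>?F\<^esub> y \<in> carrier ?F" using xy by (auto simp: free_mod_def)
      show "\<pi> (x \<oplus>\<^bsub>?F\<^esub> y) \<in> carrier M" "\<pi> x \<oplus> \<pi> y \<in> carrier M" using s xy \<pi>(1) add_M(1) by auto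
      show "\<Psi> (\<pi> (x \<oplus>\<^bsub>?F\<^esub> y)) = \<Psi> (\<pi> x \<oplus> \<pi> y)"
        unfolding \<pi>(2)[OF s] add_M(2)[OF \<pi>(1)[OF xy(1)] \<pi>(1)[OF xy(2)]] \<pi>(2)[OF xy(1)] \<pi>(2)[OF xy(2)]
        by (simp add: free_mod_def distrib_right sum.distrib)
    qed
    moreover have "\<pi> (c \<odot>\<^bsub>?F\<^esub> x) = c \<odot> \<pi> x" if c: "c \<in> \<O> q" and x: "x \<in> carrier ?F" for c x
    proof (rule \<Psi>_eq)
      have s: "c \<odot>\<^bsub>?F\<^esub> x \<in> carrier ?F" using x c by (auto simp: free_mod_def)
      show "\<pi> (c \<odot>\<^bsub>?F\<^esub> x) \<in> carrier M" "c \<odot> \<pi> x \<in> carrier M" using s x c \<pi>(1) smult_M(1) by auto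
      show "\<Psi> (\<pi> (c \<odot>\<^bsub>?F\<^esub> x)) = \<Psi> (c \<odot> \<pi> x)"
        unfolding \<pi>(2)[OF s] smult_M(2)[OF c \<pi>(1)[OF x]] \<pi>(2)[OF x]
        by (simp add: free_mod_def sum_distrib_left mult.assoc)
    qed
    ultimately show ?thesis unfolding lin_maps_def using \<pi>(1) by blast
  qed
  moreover have "\<pi> (\<iota> x) = x" if x: "x \<in> carrier M" for x
  proof (rule \<Psi>_eq[OF \<pi>(1)[OF \<iota>c[OF x]] x])
    have "\<Psi> x = (\<lambda>r. \<Sum>i\<in>I. h (Y i) (\<Psi> x) / rt q * B i r)" using dual x by blast
    also have "\<dots> = (\<lambda>r. \<Sum>k<card I. h (Y (e k)) (\<Psi> x) / rt q * B (e k) r)"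
      by (subst sum.reindex_bij_betw[OF e, symmetric]) simp
    also have "\<dots> = \<Psi> (\<pi> (\<iota> x))" unfolding \<pi>(2)[OF \<iota>c[OF x]] \<iota>_def by simp
    finally show "\<Psi> (\<pi> (\<iota> x)) = \<Psi> x" ..
  qed
  ultimately show ?thesis unfolding fg_projective_def by blast
qed

lemma form_zero_imp:
  assumes "x \<in> carrier M" "h (\<Psi> x) (\<Psi> x) = 0" shows "x = \<zero>"
proof (rule \<Psi>_eq[OF assms(1) zero_M(1)], rule ccontr)
  assume "\<Psi> x \<noteq> \<Psi> \<zero>"
  then have "Re (h (\<Psi> x) (\<Psi> x)) < 0" using neg[of "\<Psi> x"] assms(1) zero_M by auto
  then show False using assms(2) by simp
qed

lemma hermitian_lattice_M: "hermitian_lattice q M"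
proof -
  have "radical M = {\<zero>}"
    unfolding radical_def using form_zero_imp form_M zero_M by auto
  moreover have "form M x y \<in> \<O> q" if "x \<in> carrier M" "y \<in> carrier M" for x y
    using that h_rt[of "\<Psi> x" "\<Psi> y"] form_M[of x y] by auto
  ultimately show ?thesis
    using module_M projective
    unfolding hermitian_lattice_def hermitian_lattice_axioms_def
    by (auto simp: form_M add_M smult_M h_add h_smult h_cnj)
qed

lemma definite_M: "definite M"
proof -
  have "Re (form M x x) < 0" if "x \<in> carrier M - {\<zero>}" for x
    using that neg[of "\<Psi> x"] form_M[of x x] \<Psi>_eq[of x \<zero>] zero_M by auto
  then show ?thesis unfolding definite_def by blast
qed

lemma p_modular_M: "p_modular q M"
  unfolding p_modular_def
proof
  have rtd: "rt q \<in> \<O> q - {0}" by simp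
  show "dual q M \<subseteq> {frac q M x (rt q) | x. x \<in> carrier M}"
  proof
    fix X assume X: "X \<in> dual q M"
    then obtain x d where x: "x \<in> carrier M" "d \<in> \<O> q - {0}" "X = frac q M x d"
      unfolding dual_def using fracsE[of X] by blast
    have "(x, d) \<in> X" unfolding x(3) frac_eq[OF x(1,2)] using x by auto
    then have "form M y x / d \<in> \<O> q" if "y \<in> carrier M" for y
      using X that unfolding dual_def by auto
    then have "h y (\<Psi> x) / d \<in> \<O> q" if "y \<in> V" for y using that form_M x(1) by auto
    then have "(\<lambda>i. rt q * (\<Psi> x i / d)) \<in> V" using modular x by blast
    then obtain x' where x': "x' \<in> carrier M" "\<Psi> x' = (\<lambda>i. rt q * (\<Psi> x i / d))" by (metis imageE)
    have "X = frac q M x' (rt q)"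
      unfolding x(3) frac_eq[OF x(1,2)] frac_eq[OF x'(1) rtd] x'(2) by simp
    then show "X \<in> {frac q M x (rt q) | x. x \<in> carrier M}" using x'(1) by blast
  qed
  show "{frac q M x (rt q) | x. x \<in> carrier M} \<subseteq> dual q M"
  proof
    fix X assume "X \<in> {frac q M x (rt q) | x. x \<in> carrier M}"
    then obtain x where x: "x \<in> carrier M" "X = frac q M x (rt q)" by blast
    have "X \<in> fracs q M" unfolding x(2) fracs_def frac_def using x(1) rtd by (intro quotientI) auto
    moreover have "form M y w / e \<in> \<O> q" if y: "y \<in> carrier M" and we: "(w, e) \<in> X" for y w e
    proof -
      have w: "w \<in> carrier M" "e \<in> \<O> q - {0}" "\<And>i. \<Psi> w i / e = \<Psi> x i / rt q"
        using we unfolding x(2) frac_eq[OF x(1) rtd] by auto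
      have "form M y w / e = h (\<Psi> y) (\<lambda>i. \<Psi> w i / e)" using form_M[OF y w(1)] by (simp add: h_divide)
      also have "\<dots> = h (\<Psi> y) (\<Psi> x) / rt q" unfolding w(3) h_divide ..
      finally show ?thesis using h_rt[of "\<Psi> y" "\<Psi> x"] y x(1) by auto
    qed
    ultimately show "X \<in> dual q M" unfolding dual_def by blast
  qed
qed

end

section \<open>Linear relations\<close>

text \<open>Elimination without division, to stay inside the subring \<open>R\<close>: the pivot
  \<open>A b0 i\<close> cross-multiplies the remaining rows, and the coefficient of
  \<open>b0\<close> is then chosen to satisfy the equation \<open>i\<close>. It bounds ranks over
  the order from above.\<close>

lemma homogeneous_system:
  fixes R :: "'r::idom set" and A :: "'b \<Rightarrow> 'c \<Rightarrow> 'r"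
  assumes R: "0 \<in> R" "1 \<in> R" "\<And>x y. x \<in> R \<Longrightarrow> y \<in> R \<Longrightarrow> x - y \<in> R" "\<And>x y. x \<in> R \<Longrightarrow> y \<in> R \<Longrightarrow> x * y \<in> R"
    and "finite I" "finite B" "card I < card B" "\<And>b i. b \<in> B \<Longrightarrow> i \<in> I \<Longrightarrow> A b i \<in> R"
  shows "\<exists>c. (\<forall>b\<in>B. c b \<in> R) \<and> (\<exists>b\<in>B. c b \<noteq> 0) \<and> (\<forall>i\<in>I. (\<Sum>b\<in>B. c b * A b i) = 0)"
  using assms(5-8)
proof (induction I arbitrary: A B rule: finite_induct)
  case empty
  then have "B \<noteq> {}" by auto
  then show ?case using R by (intro exI[of _ "\<lambda>_. 1"]) auto
next
  case (insert i I)
  show ?case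
  proof (cases "\<forall>b\<in>B. A b i = 0")
    case True
    have "card I < card B" using insert by simp
    then obtain c where "(\<forall>b\<in>B. c b \<in> R) \<and> (\<exists>b\<in>B. c b \<noteq> 0) \<and> (\<forall>i\<in>I. (\<Sum>b\<in>B. c b * A b i) = 0)"
      using insert.IH[of B A] insert.prems by auto
    then show ?thesis using True by (intro exI[of _ c]) auto
  next
    case False
    then obtain b0 where b0: "b0 \<in> B" "A b0 i \<noteq> 0" by blast
    let ?B = "B - {b0}"
    define A' where "A' b j = A b0 i * A b j - A b i * A b0 j" for b j
    have "card I < card ?B" "finite ?B" using insert b0 by auto
    moreover have "A' b j \<in> R" if "b \<in> ?B" "j \<in> I" for b j
      unfolding A'_def using that insert.prems(3) b0(1) R by auto
    ultimately obtain c where c: "\<forall>b\<in>?B. c b \<in> R" "\<exists>b\<in>?B. c b \<noteq> 0" "\<forall>j\<in>I. (\<Sum>b\<in>?B. c b * A' b j) = 0"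
      using insert.IH[of ?B A'] by blast
    define s where "s = (\<Sum>b\<in>?B. c b * A b i)"
    define c' where "c' b = (if b = b0 then 0 - s else A b0 i * c b)" for b
    have sumR: "sum f F \<in> R" if "\<And>x. x \<in> F \<Longrightarrow> f x \<in> R" for f :: "'b \<Rightarrow> 'r" and F
    proof -
      have "x + y \<in> R" if "x \<in> R" "y \<in> R" for x y using R(3)[OF that(1) R(3)[OF R(1) that(2)]] by simp
      then show ?thesis using that R(1) by (induction F rule: infinite_finite_induct) auto
    qed
    have "s \<in> R" unfolding s_def using c(1) insert.prems(3) R(4) by (intro sumR) auto
    then have "- s \<in> R" using R(3)[OF R(1), of s] by simp
    then have "\<forall>b\<in>B. c' b \<in> R" unfolding c'_def using c(1) b0 insert.prems(3) R by auto
    moreover have "\<exists>b\<in>B. c' b \<noteq> 0" unfolding c'_def using c(2) b0 by auto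
    moreover have "(\<Sum>b\<in>B. c' b * A b j) = 0" if "j \<in> insert i I" for j
    proof -
      have "(\<Sum>b\<in>B. c' b * A b j) = - s * A b0 j + (\<Sum>b\<in>?B. c' b * A b j)"
        using sum.remove[OF insert.prems(1) b0(1), of "\<lambda>b. c' b * A b j"] by (simp add: c'_def)
      also have "(\<Sum>b\<in>?B. c' b * A b j) = (\<Sum>b\<in>?B. A b0 i * (c b * A b j))"
        by (intro sum.cong) (auto simp: c'_def)
      finally have *: "(\<Sum>b\<in>B. c' b * A b j) = A b0 i * (\<Sum>b\<in>?B. c b * A b j) - s * A b0 j"
        by (simp add: sum_distrib_left)
      show ?thesis
      proof (cases "j = i")
        case True
        then show ?thesis unfolding * by (simp add: s_def)
      next
        case False
        then have "(\<Sum>b\<in>?B. c b * A' b j) = 0" using c(3) that by auto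
        moreover have "(\<Sum>b\<in>?B. c b * A' b j) = A b0 i * (\<Sum>b\<in>?B. c b * A b j) - s * A b0 j"
          unfolding A'_def s_def
          by (simp add: sum_distrib_left sum_distrib_right sum_subtractf algebra_simps)
        ultimately show ?thesis unfolding * by simp
      qed
    qed
    ultimately show ?thesis by blast
  qed
qed

context plane begin

section \<open>The projective linear group\<close>

abbreviation Z3 :: "('k^3^3) set" where "Z3 \<equiv> {mat c | c. c \<noteq> 0}"
abbreviation PG :: "('k^3^3) set monoid" where "PG \<equiv> PGL3"
abbreviation G3 :: "('k^3^3) monoid" where "G3 \<equiv> GL3"

lemma mat_mv: "mat c *v u = c *s (u :: 'k^3)"
  by (simp add: vec_eq_iff mat_def matrix_vector_mult_def if_distrib if_distribR cong: if_cong)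

lemma mat_mult: "mat c ** A = A ** mat c" for A :: "'k^3^3"
  unfolding matrix_eq by (simp add: matrix_vector_mul_assoc[symmetric] mat_mv vec.scale)

lemma mat_mat: "mat c ** mat d = (mat (c * d) :: 'k^3^3)"
  unfolding matrix_eq by (simp add: matrix_vector_mul_assoc[symmetric] mat_mv)


lemma invertible_mat: "c \<noteq> 0 \<Longrightarrow> invertible (mat c :: 'k^3^3)"
  unfolding invertible_def by (rule exI[of _ "mat (inverse c)"]) (simp add: mat_mat)

lemma GL_sel [simp]: "carrier G3 = {A. invertible A}" "A \<otimes>\<^bsub>G3\<^esub> B = A ** B" "\<one>\<^bsub>G3\<^esub> = mat 1"
  unfolding GL3_def by simp_all

lemma group_GL: "group G3"
proof (rule groupI)
  fix A assume "A \<in> carrier G3"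
  then obtain B where "A ** B = mat 1" "B ** A = mat 1" unfolding GL_sel invertible_def by auto
  then show "\<exists>B\<in>carrier G3. B \<otimes>\<^bsub>G3\<^esub> A = \<one>\<^bsub>G3\<^esub>" by (intro bexI[of _ B]) (auto simp: invertible_def)
qed (auto simp: invertible_mult matrix_mul_assoc invertible_mat)

lemma normal_Z3: "Z3 \<lhd> G3"
proof -
  interpret group G3 by (rule group_GL)
  have inv: "inv\<^bsub>G3\<^esub> (mat c) = mat (inverse c)" if "c \<noteq> 0" for c
    using that by (intro inv_equality) (auto simp: mat_mat invertible_mat)
  have "subgroup Z3 G3"
  proof (rule subgroupI)
    show "Z3 \<subseteq> carrier G3" by (auto simp: invertible_mat)
    show "Z3 \<noteq> {}" by (auto intro: exI[of _ 1])
    show "inv\<^bsub>G3\<^esub> A \<in> Z3" if "A \<in> Z3" for A using that inv by auto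
    show "A \<otimes>\<^bsub>G3\<^esub> B \<in> Z3" if "A \<in> Z3" "B \<in> Z3" for A B
      using that by (auto simp: mat_mat)
  qed
  moreover have "A \<otimes>\<^bsub>G3\<^esub> S \<otimes>\<^bsub>G3\<^esub> inv\<^bsub>G3\<^esub> A \<in> Z3" if A: "A \<in> carrier G3" and S: "S \<in> Z3" for A S
  proof -
    have "A \<otimes>\<^bsub>G3\<^esub> S = S \<otimes>\<^bsub>G3\<^esub> A" using S by (auto simp: mat_mult)
    moreover have Sc: "S \<in> carrier G3" using S by (auto simp: invertible_mat)
    ultimately have "A \<otimes>\<^bsub>G3\<^esub> S \<otimes>\<^bsub>G3\<^esub> inv\<^bsub>G3\<^esub> A = S"
      using m_assoc[OF Sc A inv_closed[OF A]] r_inv[OF A] r_one[OF Sc] by simp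
    then show ?thesis using S by simp
  qed
  ultimately show ?thesis unfolding normal_inv_iff by blast
qed

lemma group_PG: "group PG"
  unfolding PGL3_def by (rule normal.factorgroup_is_group[OF normal_Z3])

definition cos3 :: "'k^3^3 \<Rightarrow> ('k^3^3) set" where "cos3 A = Z3 #>\<^bsub>G3\<^esub> A"

lemma cos3_eq: "cos3 A = {mat c ** A | c. c \<noteq> 0}"
  unfolding cos3_def r_coset_def by auto

lemma PG_carrier: "carrier PG = cos3 ` {A. invertible A}"
  unfolding PGL3_def FactGroup_def RCOSETS_def cos3_def by auto

lemma PG_mult: "invertible A \<Longrightarrow> invertible B \<Longrightarrow> cos3 A \<otimes>\<^bsub>PG\<^esub> cos3 B = cos3 (A ** B)"
  unfolding PGL3_def FactGroup_def cos3_def using normal.rcos_sum[OF normal_Z3, of A B] by simp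

lemma PG_one: "\<one>\<^bsub>PG\<^esub> = cos3 (mat 1)"
  unfolding PGL3_def FactGroup_def cos3_eq by simp

lemma act_cos3:
  assumes "vec.subspace U \<or> U = {}"
  shows "pgl_act (cos3 A) U = (*v) A ` U"
proof -
  have "(*v) (mat c ** A) ` U = (*v) A ` U" if "c \<noteq> 0" for c
  proof -
    have "(*v) (mat c ** A) ` U = (*v) (mat c) ` ((*v) A ` U)"
      by (simp add: image_image matrix_vector_mul_assoc)
    moreover have "(*v) (mat c) ` ((*v) A ` U) = (*v) A ` U"
      using assms image_scalar[OF image_subspace that, of U A] by (elim disjE) (simp_all only: image_empty)
    ultimately show ?thesis by simp
  qed
  then have "(\<lambda>A. (*v) A ` U) ` cos3 A = {(*v) A ` U}"
    unfolding cos3_eq by (auto intro!: image_eqI[of _ _ "mat 1 ** A"] exI[of _ 1])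
  then show ?thesis unfolding pgl_act_def by simp
qed

lemma J_cases: "U \<in> J \<union> Ls \<Longrightarrow> vec.subspace U \<or> U = {}"
  unfolding J_def pts_def lns_def by auto

lemma pgl_act_mem:
  assumes "g \<in> carrier PG"
  shows "U \<in> P \<Longrightarrow> pgl_act g U \<in> P" "U \<in> Ls \<Longrightarrow> pgl_act g U \<in> Ls" "pgl_act g {} = {}"
proof -
  obtain A where A: "invertible A" "g = cos3 A" using assms unfolding PG_carrier by blast
  show "U \<in> P \<Longrightarrow> pgl_act g U \<in> P" "U \<in> Ls \<Longrightarrow> pgl_act g U \<in> Ls" "pgl_act g {} = {}"
    unfolding A using act_cos3[of U A] act_cos3[of "{}" A] image_pts[OF A(1), of U] image_lns[OF A(1), of U] J_cases[of U]
    by (auto simp: J_def)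
qed

lemma pgl_act_mult:
  assumes "g \<in> carrier PG" "k \<in> carrier PG" "U \<in> J \<union> Ls"
  shows "pgl_act (g \<otimes>\<^bsub>PG\<^esub> k) U = pgl_act g (pgl_act k U)"
proof -
  obtain A where A: "invertible A" "g = cos3 A" using assms unfolding PG_carrier by blast
  obtain B where B: "invertible B" "k = cos3 B" using assms unfolding PG_carrier by blast
  have U: "vec.subspace U \<or> U = {}" using J_cases assms(3) by blast
  then have U': "vec.subspace ((*v) B ` U) \<or> (*v) B ` U = {}" using image_subspace by auto
  show ?thesis unfolding A B PG_mult[OF A(1) B(1)] act_cos3[OF U] act_cos3[OF U']
    by (simp add: image_image matrix_vector_mul_assoc)
qed

lemma pgl_act_one: "U \<in> J \<union> Ls \<Longrightarrow> pgl_act \<one>\<^bsub>PG\<^esub> U = U"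
  unfolding PG_one using act_cos3[of U "mat 1"] J_cases[of U] by simp

lemma pgl_act_inv:
  assumes "g \<in> carrier PG" "U \<in> J \<union> Ls"
  shows "pgl_act g (pgl_act (inv\<^bsub>PG\<^esub> g) U) = U" "pgl_act (inv\<^bsub>PG\<^esub> g) (pgl_act g U) = U"
proof -
  interpret group PG by (rule group_PG)
  show "pgl_act g (pgl_act (inv\<^bsub>PG\<^esub> g) U) = U" "pgl_act (inv\<^bsub>PG\<^esub> g) (pgl_act g U) = U"
    using assms by (simp_all add: pgl_act_mult[symmetric] pgl_act_one)
qed

lemma pgl_act_mono:
  assumes "g \<in> carrier PG" "U \<in> J \<union> Ls" "U' \<in> J \<union> Ls" "U \<subseteq> U'"
  shows "pgl_act g U \<subseteq> pgl_act g U'"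
proof -
  obtain A where A: "invertible A" "g = cos3 A" using assms unfolding PG_carrier by blast
  show ?thesis unfolding A using act_cos3[of U A] act_cos3[of U' A] J_cases[of U] J_cases[of U'] assms by auto
qed

lemma inv_PG: "g \<in> carrier PG \<Longrightarrow> inv\<^bsub>PG\<^esub> g \<in> carrier PG"
  using group.inv_closed[OF group_PG] .

lemma bij_pts: "g \<in> carrier PG \<Longrightarrow> bij_betw (pgl_act g) P P"
  by (rule bij_betw_byWitness[where f'="pgl_act (inv\<^bsub>PG\<^esub> g)"])
    (auto simp: pgl_act_inv pgl_act_mem inv_PG J_def)

lemma bij_lns: "g \<in> carrier PG \<Longrightarrow> bij_betw (pgl_act g) Ls Ls"
  by (rule bij_betw_byWitness[where f'="pgl_act (inv\<^bsub>PG\<^esub> g)"])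
    (auto simp: pgl_act_inv pgl_act_mem inv_PG)

lemma bij_lns_thru:
  assumes g: "g \<in> carrier PG" and x: "x \<in> P"
  shows "bij_betw (pgl_act g) (lns_thru x) (lns_thru (pgl_act g x))"
proof -
  have *: "pgl_act k l \<in> lns_thru (pgl_act k y)" if "l \<in> lns_thru y" "y \<in> P" "k \<in> carrier PG" for k l y
    using that pgl_act_mem(2)[OF that(3), of l] pgl_act_mono[OF that(3), of y l] unfolding lns_thru_def J_def by auto
  have gx: "pgl_act g x \<in> P" using pgl_act_mem g x by blast
  show ?thesis
  proof (rule bij_betw_byWitness[where f'="pgl_act (inv\<^bsub>PG\<^esub> g)"])
    show "pgl_act g ` lns_thru x \<subseteq> lns_thru (pgl_act g x)" using * g x by blast
    show "pgl_act (inv\<^bsub>PG\<^esub> g) ` lns_thru (pgl_act g x) \<subseteq> lns_thru x"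
      using *[OF _ gx inv_PG[OF g]] pgl_act_inv(2)[OF g, of x] x by (auto simp: J_def)
  qed (auto simp: pgl_act_inv g lns_thru_def)
qed

lemma PG_transitive:
  assumes "x \<in> P" "y \<in> P" shows "\<exists>g\<in>carrier PG. pgl_act g x = y"
proof -
  obtain u where u: "u \<noteq> 0" "x = vec.span {u}" using ptsE[OF assms(1)] by metis
  obtain v where v: "v \<noteq> 0" "y = vec.span {v}" using ptsE[OF assms(2)] by metis
  obtain A where A: "invertible A" "A *v u = v" using GL_transitive[OF u(1) v(1)] by blast
  have "y \<subseteq> (*v) A ` x"
  proof -
    have "vec.subspace ((*v) A ` x)" using image_subspace u(2) by simp
    moreover have "v \<in> (*v) A ` x" using A(2) u(2) vec.span_base[of u "{u}"] by auto
    ultimately show ?thesis unfolding v using vec.span_minimal[of "{v}"] by auto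
  qed
  moreover have "(*v) A ` x \<in> P" using image_pts A(1) assms(1) by blast
  ultimately have "(*v) A ` x = y" using pt_subset assms(2) by blast
  then have "pgl_act (cos3 A) x = y" using act_cos3[of x A] u(2) by simp
  then show ?thesis using A(1) unfolding PG_carrier by blast
qed

text \<open>Every nonzero vector is an eigenvector. Comparing the eigenvalue of the sum of two axis
  vectors with those of its terms shows that all eigenvalues agree.\<close>

lemma fixes_points_scalar:
  assumes A: "invertible (A :: 'k^3^3)" and fp: "\<And>x. x \<in> P \<Longrightarrow> (*v) A ` x = x"
  shows "\<exists>c. c \<noteq> 0 \<and> A = mat c"
proof -
  have ev: "\<exists>c. A *v u = c *s u" if "u \<noteq> 0" for u
  proof -
    have "A *v u \<in> vec.span {u}" using fp[OF span_in_pts[OF that]] vec.span_base[of u "{u}"] by blast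
    then show ?thesis unfolding vec.span_singleton by auto
  qed
  have ax: "axis i 1 \<noteq> (0 :: 'k^3)" for i by (simp add: vec_eq_iff axis_def)
  obtain c where c: "\<And>i. A *v axis i 1 = c i *s axis i 1" using ev[OF ax] by metis
  have "c i = c j" for i j
  proof (cases "i = j")
    case False
    have "axis i 1 + axis j 1 \<noteq> (0 :: 'k^3)"
    proof
      assume "axis i 1 + axis j 1 = (0 :: 'k^3)"
      then have "(axis i 1 + axis j 1 :: 'k^3) $ i = 0" by simp
      then show False using False by (simp add: axis_def)
    qed
    then obtain d where d: "A *v (axis i 1 + axis j 1) = d *s (axis i 1 + axis j 1)" using ev by blast
    then have e: "c i *s axis i 1 + c j *s axis j 1 = d *s (axis i 1 + axis j 1)"
      unfolding matrix_vector_right_distrib c .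
    have "c i = d" using arg_cong[OF e, of "\<lambda>v. v $ i"] False by (simp add: axis_def)
    moreover have "c j = d" using arg_cong[OF e, of "\<lambda>v. v $ j"] False by (simp add: axis_def)
    ultimately show ?thesis by simp
  qed simp
  then obtain d where d: "\<And>i. c i = d" by metis
  have "A $ i $ j = mat d $ i $ j" for i j
    using arg_cong[OF c[of j], of "\<lambda>v. v $ i"] d[of j]
    by (simp add: matrix_vector_mult_def axis_def mat_def if_distrib if_distribR cong: if_cong)
  then have "A = mat d" by (simp add: vec_eq_iff)
  moreover have "d \<noteq> 0"
  proof
    assume "d = 0"
    then have "A *v axis 1 1 = 0" using c[of 1] d[of 1] by simp
    then have "A *v axis 1 1 = A *v 0" by simp
    then show False using inv_inj[OF A] ax[of 1] by (metis injD)
  qed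
  ultimately show ?thesis by blast
qed

lemma PG_faithful:
  assumes "g \<in> carrier PG" "\<And>x. x \<in> P \<Longrightarrow> pgl_act g x = x" shows "g = \<one>\<^bsub>PG\<^esub>"
proof -
  obtain A where A: "invertible A" "g = cos3 A" using assms unfolding PG_carrier by blast
  have "(*v) A ` x = x" if "x \<in> P" for x
    using assms(2)[OF that] act_cos3[of x A] J_cases[of x] that unfolding A(2) by (simp add: J_def)
  then obtain c where c: "c \<noteq> 0" "A = mat c" using fixes_points_scalar[OF A(1)] by blast
  have "{(mat d :: 'k^3^3) ** mat c | d. d \<noteq> 0} = {mat d ** mat 1 | d. d \<noteq> 0}" (is "?X = ?Y")
  proof
    show "?X \<subseteq> ?Y"
    proof
      fix M assume "M \<in> ?X"
      then obtain d where "d \<noteq> 0" "M = mat (d * c) ** mat 1" by (auto simp: mat_mat)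
      moreover then have "d * c \<noteq> 0" using c(1) by simp
      ultimately show "M \<in> ?Y" by blast
    qed
    show "?Y \<subseteq> ?X"
    proof
      fix M assume "M \<in> ?Y"
      then obtain d where d: "d \<noteq> 0" "M = mat d" by (auto simp: mat_mat)
      then have "M = mat (d / c) ** mat c" using c(1) by (simp add: mat_mat)
      then show "M \<in> ?X" using c(1) d(1) by auto
    qed
  qed
  then show ?thesis unfolding A c PG_one cos3_eq .
qed

section \<open>The group action on coordinate functions\<close>

definition perm :: "('k^3^3) set \<Rightarrow> (('k^3) set \<Rightarrow> complex) \<Rightarrow> ('k^3) set \<Rightarrow> complex" where
  "perm g X r = (if r \<in> J then X (pgl_act (inv\<^bsub>PG\<^esub> g) r) else 0)"

lemma sum_perm:
  "g \<in> carrier PG \<Longrightarrow> (\<Sum>x\<in>P. f (pgl_act (inv\<^bsub>PG\<^esub> g) x)) = (\<Sum>x\<in>P. (f x :: complex))"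
  using sum.reindex_bij_betw[OF bij_pts[OF inv_PG], of g f] .

lemma perm_at: "x \<in> P \<Longrightarrow> perm g X x = X (pgl_act (inv\<^bsub>PG\<^esub> g) x)"
    "g \<in> carrier PG \<Longrightarrow> perm g X {} = X {}"
  unfolding perm_def J_def using pgl_act_mem(3)[OF inv_PG] by auto

text \<open>A group element maps the pencil of lines at a point onto the pencil at the image point,
  so the line sums are carried along; the total over all lines, which is the extra coordinate, does
  not change.\<close>

lemma perm_coord:
  assumes g: "g \<in> carrier PG" shows "coord (act_free g f) = perm g (coord f)"
proof
  fix r
  let ?i = "pgl_act (inv\<^bsub>PG\<^esub> g)"
  consider "r = {}" | "r \<in> P" | "r \<notin> J" unfolding J_def by blast
  then show "coord (act_free g f) r = perm g (coord f) r"
  proof cases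
    case 1
    have "(\<Sum>l\<in>Ls. act_free g f l) = (\<Sum>l\<in>Ls. f (?i l))" by (intro sum.cong) (auto simp: act_free_def)
    also have "\<dots> = (\<Sum>l\<in>Ls. f l)" by (rule sum.reindex_bij_betw[OF bij_lns[OF inv_PG[OF g]]])
    finally show ?thesis unfolding 1 perm_at(2)[OF g] by (simp add: coord_def)
  next
    case 2
    then have ne: "r \<noteq> {}" "?i r \<in> P" using empty_notin pgl_act_mem(1)[OF inv_PG[OF g]] by metis+
    then have ne2: "?i r \<noteq> {}" using empty_notin by metis
    have "(\<Sum>l\<in>lns_thru r. act_free g f l) = (\<Sum>l\<in>lns_thru r. f (?i l))"
      by (intro sum.cong) (auto simp: act_free_def lns_thru_def)
    also have "\<dots> = (\<Sum>l\<in>lns_thru (?i r). f l)"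
      by (rule sum.reindex_bij_betw[OF bij_lns_thru[OF inv_PG[OF g] 2]])
    finally show ?thesis unfolding perm_at(1)[OF 2] using 2 ne ne2 by (simp add: coord_def act_free_def)
  next
    case 3 then show ?thesis by (simp add: coord_def perm_def J_def)
  qed
qed

lemma act_free_closed:
  assumes g: "g \<in> carrier PG" and f: "f \<in> carrier (free_mod q (P \<union> Ls))"
  shows "act_free g f \<in> carrier (free_mod q (P \<union> Ls))"
  using f pgl_act_mem(1,2)[OF inv_PG[OF g]] unfolding free_carrier act_free_def by auto

lemma act_free_inv:
  assumes g: "g \<in> carrier PG" and f: "f \<in> carrier (free_mod q (P \<union> Ls))"
  shows "act_free g (act_free (inv\<^bsub>PG\<^esub> g) f) = f"
proof
  fix r
  interpret group PG by (rule group_PG)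
  show "act_free g (act_free (inv\<^bsub>PG\<^esub> g) f) r = f r"
  proof (cases "r \<in> P \<union> Ls")
    case True
    then have "pgl_act (inv\<^bsub>PG\<^esub> g) r \<in> P \<union> Ls" using pgl_act_mem(1,2)[OF inv_PG[OF g]] by blast
    then show ?thesis using True g pgl_act_inv(1)[OF g, of r] unfolding act_free_def
      by (auto simp: J_def)
  next
    case False
    then show ?thesis using f unfolding free_carrier act_free_def by auto
  qed
qed

lemma perm_LC: "g \<in> carrier PG \<Longrightarrow> X \<in> LC \<Longrightarrow> perm g X \<in> LC"
  unfolding LC_def using perm_coord[symmetric] act_free_closed by auto

lemma perm_mult:
  assumes "g \<in> carrier PG" "k \<in> carrier PG"
  shows "perm (g \<otimes>\<^bsub>PG\<^esub> k) X = perm g (perm k X)"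
proof
  fix r
  interpret group PG by (rule group_PG)
  have "pgl_act (inv\<^bsub>PG\<^esub> g) r \<in> J" if "r \<in> J"
    using that pgl_act_mem(1,3)[OF inv_PG[OF assms(1)]] unfolding J_def by auto
  then show "perm (g \<otimes>\<^bsub>PG\<^esub> k) X r = perm g (perm k X) r"
    using assms unfolding perm_def by (simp add: inv_mult_group pgl_act_mult)
qed

lemma perm_one: "(\<And>i. i \<notin> J \<Longrightarrow> X i = 0) \<Longrightarrow> perm \<one>\<^bsub>PG\<^esub> X = X"
  by (rule ext) (simp add: perm_def group.is_monoid[OF group_PG] monoid.inv_one pgl_act_one)

section \<open>The lattice of the plane in coordinates\<close>

text \<open>Well defined because the radical is the kernel of \<open>coord\<close>, so that
  \<open>coord\<close> sends a coset to a singleton.\<close>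

definition \<Phi> :: "(('k ^ 3) set \<Rightarrow> complex) set \<Rightarrow> ('k ^ 3) set \<Rightarrow> complex" where
  "\<Phi> X = the_elem (coord ` X)"

abbreviation LP :: "(('k ^ 3) set \<Rightarrow> complex) set hmod" where "LP \<equiv> L_plane q"

definition cls :: "(('k ^ 3) set \<Rightarrow> complex) \<Rightarrow> (('k ^ 3) set \<Rightarrow> complex) set" where
  "cls v = {u \<in> carrier (free_mod q (P \<union> Ls)). coord u = coord v}"

lemma L_free_sel: "carrier (L_free q) = carrier (free_mod q (P \<union> Ls))"
    "u \<oplus>\<^bsub>L_free q\<^esub> v = (\<lambda>i. u i + v i)" "c \<odot>\<^bsub>L_free q\<^esub> v = (\<lambda>i. c * v i)"
  unfolding L_free_def module.extend_def free_mod_def by simp_all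

lemma coord_LC: "f \<in> carrier (free_mod q (P \<union> Ls)) \<Longrightarrow> coord f \<in> LC"
  unfolding LC_def by blast

text \<open>The p-multiples of unit vectors lie in \<open>LC\<close>, and pairing with them recovers
  every coordinate up to the factor p and a sign, so \<open>hf\<close> is nondegenerate
  there.\<close>

lemma radical_eq: "radical (L_free q) = cls (\<lambda>_. 0)"
proof -
  have c0: "coord (\<lambda>_. 0) = (\<lambda>_. 0)" by (auto simp: coord_def)
  have "coord x = (\<lambda>_. 0)" if x: "\<forall>y\<in>carrier (free_mod q (P \<union> Ls)). hf (coord y) (coord x) = 0" for x
  proof
    fix i
    have *: "hf w (coord x) = 0" if "w \<in> LC" for w using x that unfolding LC_def by blast
    consider "i = {}" | "i \<in> P" | "i \<notin> J" unfolding J_def by blast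
    then show "coord x i = 0"
    proof cases
      case 1
      then show ?thesis using *[OF rt_unit_LC[of "{}"]] unfolding hf_rt_unit(1) by (simp add: J_def)
    next
      case 2
      then show ?thesis using *[OF rt_unit_LC[of i]] unfolding hf_rt_unit(2)[OF 2] by (simp add: J_def)
    next
      case 3 then show ?thesis by (simp add: coord_def J_def)
    qed
  qed
  moreover have "hf u (\<lambda>_. 0) = 0" for u by (simp add: hf_def)
  ultimately show ?thesis unfolding radical_def cls_def L_free_sel L_free_form c0 by auto
qed

lemma free_add: "u \<in> carrier (free_mod q (P \<union> Ls)) \<Longrightarrow> v \<in> carrier (free_mod q (P \<union> Ls)) \<Longrightarrow>
    (\<lambda>i. u i + v i) \<in> carrier (free_mod q (P \<union> Ls))"
  and free_diff: "u \<in> carrier (free_mod q (P \<union> Ls)) \<Longrightarrow> v \<in> carrier (free_mod q (P \<union> Ls)) \<Longrightarrow>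
    (\<lambda>i. u i - v i) \<in> carrier (free_mod q (P \<union> Ls))"
  and free_smult: "c \<in> \<O> q \<Longrightarrow> v \<in> carrier (free_mod q (P \<union> Ls)) \<Longrightarrow>
    (\<lambda>i. c * v i) \<in> carrier (free_mod q (P \<union> Ls))"
  unfolding free_carrier by auto

lemma coord_diff: "coord (\<lambda>i. f i - g i) = (\<lambda>i. coord f i - coord g i)"
  by (rule ext) (simp add: coord_def sum_subtractf algebra_simps)

lemma cls_eq_iff: "u \<in> carrier (free_mod q (P \<union> Ls)) \<Longrightarrow> cls u = cls v \<longleftrightarrow> coord u = coord v"
  unfolding cls_def by auto

lemma self_cls: "u \<in> carrier (free_mod q (P \<union> Ls)) \<Longrightarrow> u \<in> cls u"
  unfolding cls_def by auto

lemma r_coset_cls: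
  assumes "v \<in> carrier (free_mod q (P \<union> Ls))"
  shows "radical (L_free q) +>\<^bsub>L_free q\<^esub> v = cls v"
proof
  have c0: "coord (\<lambda>_. 0) = (\<lambda>_. 0)" by (auto simp: coord_def)
  show "radical (L_free q) +>\<^bsub>L_free q\<^esub> v \<subseteq> cls v"
    unfolding a_r_coset_def' radical_eq L_free_sel unfolding cls_def c0
    using assms by (auto simp: free_add coord_add)
  show "cls v \<subseteq> radical (L_free q) +>\<^bsub>L_free q\<^esub> v"
  proof
    fix u assume u: "u \<in> cls v"
    then have "(\<lambda>i. u i - v i) \<in> cls (\<lambda>_. 0)" unfolding cls_def c0 using assms by (auto simp: free_diff coord_diff)
    moreover have "u = (\<lambda>i. (u i - v i) + v i)" by simp
    ultimately show "u \<in> radical (L_free q) +>\<^bsub>L_free q\<^esub> v"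
      unfolding a_r_coset_def' radical_eq L_free_sel by blast
  qed
qed

lemma LP_carrier: "carrier LP = cls ` carrier (free_mod q (P \<union> Ls))"
proof -
  have "carrier LP = (\<lambda>v. radical (L_free q) +>\<^bsub>L_free q\<^esub> v) ` carrier (free_mod q (P \<union> Ls))"
    unfolding L_plane_def hquot_def by (auto simp: A_RCOSETS_def' L_free_sel)
  then show ?thesis using r_coset_cls by simp
qed

lemma LP_zero: "\<zero>\<^bsub>LP\<^esub> = cls (\<lambda>_. 0)"
  unfolding L_plane_def hquot_def by (simp add: radical_eq)

lemma LP_add:
  assumes "u \<in> carrier (free_mod q (P \<union> Ls))" "v \<in> carrier (free_mod q (P \<union> Ls))"
  shows "cls u \<oplus>\<^bsub>LP\<^esub> cls v = cls (\<lambda>i. u i + v i)"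
proof -
  have "cls u \<oplus>\<^bsub>LP\<^esub> cls v = {(\<lambda>i. a i + b i) | a b. a \<in> cls u \<and> b \<in> cls v}"
    unfolding L_plane_def hquot_def by (auto simp: set_add_def' L_free_sel)
  also have "\<dots> = cls (\<lambda>i. u i + v i)"
  proof
    show "{(\<lambda>i. a i + b i) | a b. a \<in> cls u \<and> b \<in> cls v} \<subseteq> cls (\<lambda>i. u i + v i)"
      unfolding cls_def by (auto simp: free_add coord_add)
    show "cls (\<lambda>i. u i + v i) \<subseteq> {(\<lambda>i. a i + b i) | a b. a \<in> cls u \<and> b \<in> cls v}"
    proof
      fix w assume w: "w \<in> cls (\<lambda>i. u i + v i)"
      have "(\<lambda>i. w i - u i) \<in> cls v" using w assms unfolding cls_def by (auto simp: free_diff coord_diff coord_add)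
      moreover have "w = (\<lambda>i. u i + (w i - u i))" by simp
      ultimately show "w \<in> {(\<lambda>i. a i + b i) | a b. a \<in> cls u \<and> b \<in> cls v}" using self_cls[OF assms(1)]
        by (intro CollectI exI[of _ u] exI[of _ "\<lambda>i. w i - u i"]) simp
    qed
  qed
  finally show ?thesis .
qed

lemma LP_smult:
  assumes "c \<in> \<O> q" "v \<in> carrier (free_mod q (P \<union> Ls))"
  shows "c \<odot>\<^bsub>LP\<^esub> cls v = cls (\<lambda>i. c * v i)"
proof -
  have "c \<odot>\<^bsub>LP\<^esub> cls v = (\<Union>x\<in>cls v. radical (L_free q) +>\<^bsub>L_free q\<^esub> (\<lambda>i. c * x i))"
    unfolding L_plane_def hquot_def by (simp add: L_free_sel)
  also have "\<dots> = (\<Union>x\<in>cls v. cls (\<lambda>i. c * x i))"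
    using assms by (intro SUP_cong refl r_coset_cls free_smult) (auto simp: cls_def)
  also have "\<dots> = (\<Union>x\<in>cls v. cls (\<lambda>i. c * v i))"
    by (intro SUP_cong refl) (auto simp: cls_def coord_smult)
  also have "\<dots> = cls (\<lambda>i. c * v i)" using self_cls[OF assms(2)] by auto
  finally show ?thesis .
qed

lemma LP_form:
  assumes "u \<in> carrier (free_mod q (P \<union> Ls))" "v \<in> carrier (free_mod q (P \<union> Ls))"
  shows "form LP (cls u) (cls v) = hf (coord u) (coord v)"
proof -
  have "form LP (cls u) (cls v) = the_elem ((\<lambda>(x, y). hf (coord x) (coord y)) ` (cls u \<times> cls v))"
    unfolding L_plane_def hquot_def by (simp add: L_free_form case_prod_unfold)
  also have "(\<lambda>(x, y). hf (coord x) (coord y)) ` (cls u \<times> cls v) = {hf (coord u) (coord v)}"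
    using self_cls[OF assms(1)] self_cls[OF assms(2)] by (auto simp: cls_def image_iff)
  finally show ?thesis by simp
qed

lemma \<Phi>_cls: "v \<in> carrier (free_mod q (P \<union> Ls)) \<Longrightarrow> \<Phi> (cls v) = coord v"
proof -
  assume "v \<in> carrier (free_mod q (P \<union> Ls))"
  then have "coord ` cls v = {coord v}" using self_cls by (auto simp: cls_def)
  then show ?thesis unfolding \<Phi>_def by simp
qed

lemma free_zero: "(\<lambda>_. 0) \<in> carrier (free_mod q (P \<union> Ls))"
  by (simp add: free_carrier)

sublocale LP: represented q LP \<Phi> hf
proof
  show "inj_on \<Phi> (carrier LP)"
  proof (rule inj_onI)
    fix X Y assume "X \<in> carrier LP" "Y \<in> carrier LP" and e: "\<Phi> X = \<Phi> Y"
    then obtain u v where "u \<in> carrier (free_mod q (P \<union> Ls))" "v \<in> carrier (free_mod q (P \<union> Ls))" "X = cls u" "Y = cls v"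
      unfolding LP_carrier by blast
    then show "X = Y" using e by (simp add: \<Phi>_cls cls_eq_iff)
  qed
  show "\<zero>\<^bsub>LP\<^esub> \<in> carrier LP" unfolding LP_zero LP_carrier using free_zero by blast
  show "\<Phi> \<zero>\<^bsub>LP\<^esub> = (\<lambda>_. 0)" unfolding LP_zero \<Phi>_cls[OF free_zero] by (auto simp: coord_def)
qed (auto simp: LP_carrier LP_add LP_smult LP_form \<Phi>_cls free_add free_smult coord_add coord_smult hf_add hf_smult hf_cnj)

lemma \<Phi>_image: "\<Phi> ` carrier LP = LC"
  unfolding LP_carrier LC_def image_image by (rule image_cong) (auto simp: \<Phi>_cls)

lemma \<Phi>_LC: "X \<in> carrier LP \<Longrightarrow> \<Phi> X \<in> LC"
  using \<Phi>_image by blast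

lemma act_closed:
  assumes g: "g \<in> carrier PG" and X: "X \<in> carrier LP"
  shows "act g X \<in> carrier LP" "\<Phi> (act g X) = perm g (\<Phi> X)"
proof -
  obtain f where f: "f \<in> carrier (free_mod q (P \<union> Ls))" "X = cls f" using X unfolding LP_carrier by blast
  have gf: "act_free g f \<in> carrier (free_mod q (P \<union> Ls))" using act_free_closed g f by blast
  have "act g X = cls (act_free g f)"
  proof
    show "act g X \<subseteq> cls (act_free g f)"
      unfolding act_def f(2) cls_def using act_free_closed[OF g] perm_coord[OF g] by auto
    show "cls (act_free g f) \<subseteq> act g X"
    proof
      fix u assume u: "u \<in> cls (act_free g f)"
      then have uc: "u \<in> carrier (free_mod q (P \<union> Ls))" "coord u = perm g (coord f)"
        unfolding cls_def perm_coord[OF g] by auto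
      let ?w = "act_free (inv\<^bsub>PG\<^esub> g) u"
      interpret group PG by (rule group_PG)
      have "coord ?w = perm (inv\<^bsub>PG\<^esub> g \<otimes>\<^bsub>PG\<^esub> g) (coord f)"
        unfolding perm_coord[OF inv_PG[OF g]] uc(2) perm_mult[OF inv_PG[OF g] g] ..
      also have "\<dots> = coord f" using g LC_supp[OF coord_LC[OF f(1)]] by (simp add: perm_one)
      finally have "?w \<in> X" unfolding f(2) cls_def using act_free_closed[OF inv_PG[OF g] uc(1)] by simp
      then show "u \<in> act g X" unfolding act_def using act_free_inv[OF g uc(1)] by (metis imageI)
    qed
  qed
  then show "act g X \<in> carrier LP" "\<Phi> (act g X) = perm g (\<Phi> X)"
    using gf f unfolding LP_carrier by (auto simp: \<Phi>_cls perm_coord[OF g])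
qed

end

section \<open>Submodules of a represented module\<close>

lemma (in represented) submoduleI:
  assumes "N \<subseteq> carrier M" "\<zero> \<in> N" "\<And>x y. x \<in> N \<Longrightarrow> y \<in> N \<Longrightarrow> x \<oplus> y \<in> N"
    "\<And>c x. c \<in> \<O> q \<Longrightarrow> x \<in> N \<Longrightarrow> c \<odot> x \<in> N"
  shows "submodule N (\<O>_ring q) M"
proof -
  have m: "- 1 \<in> \<O> q" using O_minus[OF O_1] .
  have "\<ominus> x \<in> N" if x: "x \<in> N" for x
  proof -
    have xc: "x \<in> carrier M" using assms(1) x by blast
    have "\<ominus> x = (- 1) \<odot> x"
      using xc m smult_M(1)[OF m xc] by (intro \<Psi>_eq) (simp_all add: \<Psi>_neg smult_M)
    then show ?thesis using assms(4)[OF m x] by simp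
  qed
  then have "subgroup N (add_monoid M)"
    using assms by (intro subgroup.intro) (auto simp: a_inv_def[symmetric])
  then show ?thesis using assms(4) by (intro submodule.intro submodule_axioms.intro) auto
qed

lemma (in represented) submoduleD:
  assumes "submodule N (\<O>_ring q) M"
  shows "N \<subseteq> carrier M" "\<zero> \<in> N" "\<And>x y. x \<in> N \<Longrightarrow> y \<in> N \<Longrightarrow> x \<oplus> y \<in> N"
    "\<And>c x. c \<in> \<O> q \<Longrightarrow> x \<in> N \<Longrightarrow> c \<odot> x \<in> N"
  using subgroup.subset[of N "add_monoid M"] subgroup.one_closed[of N "add_monoid M"]
    subgroup.m_closed[of N "add_monoid M"] submodule.smult_closed[OF assms] submodule.axioms(1)[OF assms]
  by auto

section \<open>Definiteness and invariance of the form on the sum-zero space\<close>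

context null_vector begin

lemma wf_add: "wf u (\<lambda>i. v i + w i) = wf u v + wf u w"
  and wf_smult: "wf u (\<lambda>i. c * v i) = c * wf u v"
  and wf_cnj: "cnj (wf u v) = wf v u"
  unfolding wf_def by (simp_all add: algebra_simps sum.distrib sum_distrib_left)

lemma wf_neg: assumes "x \<in> P" "v x \<noteq> 0" shows "Re (wf v v) < 0"
proof -
  have "Re (wf v v) = - (\<Sum>x\<in>P. (cmod (v x))\<^sup>2)"
    unfolding wf_def by (simp add: cmod_power2) (simp add: power2_eq_square)
  moreover have "(\<Sum>x\<in>P. (cmod (v x))\<^sup>2) > 0"
    using assms by (intro sum_pos2[of P x]) auto
  ultimately show ?thesis by simp
qed

lemma perm_z: "g \<in> carrier PG \<Longrightarrow> perm g z = z"
proof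
  fix r assume g: "g \<in> carrier PG"
  have z': "x \<in> P \<Longrightarrow> z x = b" for x using empty_notin unfolding z_def by auto
  consider "r = {}" | "r \<in> P" | "r \<notin> J" unfolding J_def by blast
  then show "perm g z r = z r"
  proof cases
    case 1 then show ?thesis using perm_at(2)[OF g] by simp
  next
    case 2 then show ?thesis using perm_at(1)[OF 2] z' pgl_act_mem(1)[OF inv_PG[OF g]] by simp
  next
    case 3 then show ?thesis by (simp add: perm_def z_def J_def)
  qed
qed

lemma perm_proj:
  assumes g: "g \<in> carrier PG" shows "proj (perm g X) = perm g (proj X)"
proof
  fix r
  have "(\<Sum>x\<in>P. perm g X x) = (\<Sum>x\<in>P. X (pgl_act (inv\<^bsub>PG\<^esub> g) x))"
    by (intro sum.cong) (auto simp: perm_at)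
  then have s: "(\<Sum>x\<in>P. perm g X x) = (\<Sum>x\<in>P. X x)" using sum_perm[OF g] by simp
  consider "r = {}" | "r \<in> P" | "r \<notin> J" unfolding J_def by blast
  then show "proj (perm g X) r = perm g (proj X) r"
  proof cases
    case 1 then show ?thesis unfolding 1 perm_at(2)[OF g] by (simp add: proj_def)
  next
    case 2 then show ?thesis unfolding perm_at(1)[OF 2] proj_def s using pgl_act_mem(1)[OF inv_PG[OF g] 2] by (simp add: perm_at(1))
  next
    case 3 then show ?thesis by (simp add: proj_def perm_def J_def)
  qed
qed

lemma perm_hf_z: "g \<in> carrier PG \<Longrightarrow> hf z (perm g X) = hf z X"
proof -
  assume g: "g \<in> carrier PG"
  have "(\<Sum>x\<in>P. perm g X x) = (\<Sum>x\<in>P. X (pgl_act (inv\<^bsub>PG\<^esub> g) x))"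
    by (intro sum.cong) (auto simp: perm_at)
  then show ?thesis unfolding hf_z perm_at(2)[OF g] using sum_perm[OF g, of X] by simp
qed

lemma perm_wf: "g \<in> carrier PG \<Longrightarrow> wf (perm g u) (perm g v) = wf u v"
proof -
  assume g: "g \<in> carrier PG"
  have "(\<Sum>x\<in>P. cnj (perm g u x) * perm g v x) = (\<Sum>x\<in>P. cnj (u (pgl_act (inv\<^bsub>PG\<^esub> g) x)) * v (pgl_act (inv\<^bsub>PG\<^esub> g) x))"
    by (intro sum.cong) (auto simp: perm_at)
  then show ?thesis unfolding wf_def using sum_perm[OF g, of "\<lambda>x. cnj (u x) * v x"] by simp
qed

lemma perm_linear: "perm g (\<lambda>i. u i + v i) = (\<lambda>i. perm g u i + perm g v i)"
    "perm g (\<lambda>i. c * u i) = (\<lambda>i. c * perm g u i)"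
  by (auto simp: perm_def)

end

section \<open>Modularity, rank and automorphisms of \<open>W\<close>\<close>

context null_lattice_vector begin

lemma perm_W: "g \<in> carrier PG \<Longrightarrow> u \<in> W \<Longrightarrow> perm g u \<in> W"
  unfolding W_def zperp_def by (auto simp: perm_proj[symmetric] perm_LC perm_hf_z)

lemma W_modular_represented:
  assumes "represented q M \<Psi> wf" "\<Psi> ` carrier M = W"
  shows "modular_represented q M \<Psi> wf"
proof -
  interpret M: represented q M \<Psi> wf by fact
  show ?thesis
  proof
    fix u v assume "u \<in> \<Psi> ` carrier M" "v \<in> \<Psi> ` carrier M"
    then show "\<exists>y\<in>\<O> q. wf u v = rt q * y" using W_form assms(2) by simp
  next
    fix x d assume x: "x \<in> \<Psi> ` carrier M" and d: "d \<in> \<O> q - {0}"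
      and i: "\<And>y. y \<in> \<Psi> ` carrier M \<Longrightarrow> wf y x / d \<in> \<O> q"
    obtain X where X: "X \<in> zperp" "x = proj X" using x unfolding assms(2) W_def by blast
    have pd: "proj (\<lambda>i. X i / d) = (\<lambda>i. x i / d)" using proj_smult[of "1 / d" X] X(2) by simp
    have "(\<lambda>r. rt q * proj (\<lambda>i. X i / d) r) \<in> W"
    proof (rule W_modular)
      show "hf z (\<lambda>i. X i / d) = 0" using X(1) unfolding zperp_def by (simp add: hf_divide)
      show "X i / d = 0" if "i \<notin> J" for i using X(1) LC_supp that unfolding zperp_def by simp
      show "wf y (proj (\<lambda>i. X i / d)) \<in> \<O> q" if "y \<in> W" for y
        using i[of y] that assms(2) M.h_divide[of y x d] unfolding pd by simp
    qed
    then show "(\<lambda>i. rt q * (x i / d)) \<in> \<Psi> ` carrier M" unfolding pd assms(2) .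
  next
    fix v assume v: "v \<in> \<Psi> ` carrier M" "v \<noteq> (\<lambda>_. 0)"
    then obtain i where "v i \<noteq> 0" by auto
    then show "Re (wf v v) < 0" using W_supp v(1) wf_neg[of i v] assms(2) by metis
  next
    obtain I :: "('k ^ 3) set set" and Y B where "finite I" "\<forall>i\<in>I. Y i \<in> W \<and> B i \<in> W"
      "\<forall>x\<in>W. x = (\<lambda>r. \<Sum>i\<in>I. wf (Y i) x / rt q * B i r)" by (rule W_dual_basis)
    then show "\<exists>(I :: ('k ^ 3) set set) Y B. finite I \<and> (\<forall>i\<in>I. Y i \<in> \<Psi> ` carrier M \<and> B i \<in> \<Psi> ` carrier M) \<and>
      (\<forall>x\<in>\<Psi> ` carrier M. x = (\<lambda>r. \<Sum>i\<in>I. wf (Y i) x / rt q * B i r))"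
      unfolding assms(2) by (intro exI conjI)
  qed
qed

definition diff_vec :: "('k ^ 3) set \<Rightarrow> ('k ^ 3) set \<Rightarrow> ('k ^ 3) set \<Rightarrow> complex" where
  "diff_vec x y r = (if r = x then 1 else 0) - (if r = y then 1 else 0)"

lemma sum_diff_vec: "x \<in> P \<Longrightarrow> y \<in> P \<Longrightarrow> (\<Sum>r\<in>P. diff_vec x y r) = 0"
  unfolding diff_vec_def by (simp add: sum_subtractf)

text \<open>Zero sum and zero extra coordinate make these vectors orthogonal to \<open>z\<close> and
  fixed by \<open>proj\<close>. They supply independent vectors for the rank and test vectors for
  faithfulness.\<close>

lemma rt_diff_W:
  assumes "x \<in> P" "y \<in> P" "c \<in> \<O> q" shows "(\<lambda>r. rt q * (c * diff_vec x y r)) \<in> W"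
proof -
  let ?v = "\<lambda>r. rt q * (c * diff_vec x y r)"
  have 1: "?v \<in> LC" using assms by (intro rt_mult_LC) (auto simp: diff_vec_def J_def)
  have s: "(\<Sum>r\<in>P. ?v r) = 0" using sum_diff_vec[OF assms(1,2)] by (simp add: sum_distrib_left[symmetric])
  have "{} \<noteq> x" "{} \<noteq> y" using assms empty_notin by metis+
  then have "hf z ?v = 0" unfolding hf_z s by (simp add: diff_vec_def)
  then have "proj ?v \<in> W" unfolding W_def zperp_def using 1 by blast
  moreover have "proj ?v = ?v"
  proof
    fix r show "proj ?v r = ?v r"
      unfolding proj_def s using assms by (simp add: diff_vec_def)
  qed
  ultimately show ?thesis by (simp only:)
qed

text \<open>The differences with a fixed point \<open>x0\<close>, times p, give q^2 + q independent
  vectors. For the upper bound, multiplication by \<open>nn\<close> clears the means, so more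
  vectors than points other than \<open>x0\<close> satisfy a relation there over the order; the zero
  sum extends it to \<open>x0\<close>.\<close>

lemma W_rank:
  assumes "represented q M \<Psi> wf" "\<Psi> ` carrier M = W"
  shows "has_rank q M (q^2 + q)"
proof -
  interpret M: represented q M \<Psi> wf by fact
  obtain x0 where x0: "x0 \<in> P" using exists_point by blast
  let ?I = "P - {x0}"
  have cI: "card ?I = q^2 + q" using x0 card_pts by simp
  define \<epsilon> where "\<epsilon> x = inv_into (carrier M) \<Psi> (\<lambda>r. rt q * (1 * diff_vec x x0 r))" for x
  have \<epsilon>: "\<epsilon> x \<in> carrier M" "\<Psi> (\<epsilon> x) = (\<lambda>r. rt q * (1 * diff_vec x x0 r))" if "x \<in> ?I" for x
    using rt_diff_W[of x x0 1] that x0 unfolding assms(2)[symmetric] \<epsilon>_def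
    by (auto intro: inv_into_into f_inv_into_f)
  have \<epsilon>': "\<Psi> (\<epsilon> x) y = (if x = y then rt q else 0)" if "x \<in> ?I" "y \<in> ?I" for x y
    unfolding \<epsilon>(2)[OF that(1)] using that by (simp add: diff_vec_def)
  have inj: "inj_on \<epsilon> ?I"
  proof (rule inj_onI)
    fix x y assume xy: "x \<in> ?I" "y \<in> ?I" and e: "\<epsilon> x = \<epsilon> y"
    show "x = y"
    proof (rule ccontr)
      assume "x \<noteq> y"
      then have "\<Psi> (\<epsilon> y) x = 0" using \<epsilon>'[OF xy(2,1)] by simp
      then show False using \<epsilon>'[OF xy(1,1)] unfolding e by simp
    qed
  qed
  have "lin_independent q M (\<epsilon> ` ?I)"
    unfolding M.lin_independent_iff
  proof (intro conjI ballI impI)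
    show "\<epsilon> ` ?I \<subseteq> carrier M" using \<epsilon>(1) by blast
    fix c m assume "\<forall>i. (\<Sum>x\<in>\<epsilon> ` ?I. c x * \<Psi> x i) = 0" and "m \<in> \<epsilon> ` ?I"
    then obtain y where y: "y \<in> ?I" "m = \<epsilon> y" and "(\<Sum>x\<in>\<epsilon> ` ?I. c x * \<Psi> x y) = 0"
      by blast
    then have s: "(\<Sum>x\<in>?I. c (\<epsilon> x) * \<Psi> (\<epsilon> x) y) = 0"
      unfolding sum.reindex[OF inj] by (simp add: comp_def)
    have "(\<Sum>x\<in>?I. c (\<epsilon> x) * \<Psi> (\<epsilon> x) y) = (\<Sum>x\<in>?I. if x = y then c (\<epsilon> y) * rt q else 0)"
      using y by (intro sum.cong) (auto simp: \<epsilon>')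
    then show "c m = 0" using s y by simp
  qed simp
  moreover have "card (\<epsilon> ` ?I) = q^2 + q" using card_image[OF inj] cI by simp
  moreover have "card B \<le> q^2 + q" if B: "lin_independent q M B" for B
  proof (rule ccontr)
    assume "\<not> card B \<le> q^2 + q"
    then have lt: "card ?I < card B" using cI by simp
    have B': "finite B" "B \<subseteq> carrier M" using B unfolding M.lin_independent_iff by auto
    have ent: "nn * \<Psi> m i \<in> \<O> q" if m: "m \<in> B" and "i \<in> ?I" for m i
    proof -
      have "\<Psi> m \<in> W" using m B'(2) assms(2) by blast
      then obtain X where X: "X \<in> zperp" "\<Psi> m = proj X" unfolding W_def by blast
      have XO: "X r \<in> \<O> q" for r using X(1) LC_O unfolding zperp_def by blast
      have "nn * \<Psi> m i = nn * X i - (\<Sum>x\<in>P. X x)" using that unfolding X proj_def by (simp add: algebra_simps)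
      moreover have "nn \<in> \<O> q" unfolding nn_def by (rule O_nat)
      ultimately show ?thesis using XO by auto
    qed
    obtain c where c: "\<forall>m\<in>B. c m \<in> \<O> q" "\<exists>m\<in>B. c m \<noteq> 0" "\<forall>i\<in>?I. (\<Sum>m\<in>B. c m * (nn * \<Psi> m i)) = 0"
      using homogeneous_system[of "\<O> q" ?I B "\<lambda>m i. nn * \<Psi> m i", OF _ _ _ _ _ B'(1) lt ent] by auto
    define S where "S i = (\<Sum>m\<in>B. c m * \<Psi> m i)" for i
    have S0: "S i = 0" if "i \<in> ?I" for i
    proof -
      have "nn * S i = (\<Sum>m\<in>B. c m * (nn * \<Psi> m i))" unfolding S_def by (simp add: sum_distrib_left ac_simps)
      then show ?thesis using c(3) that by simp
    qed
    have W: "\<Psi> m \<in> W" if "m \<in> B" for m using that B'(2) assms(2) by blast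
    have "(\<Sum>i\<in>P. S i) = (\<Sum>m\<in>B. c m * (\<Sum>i\<in>P. \<Psi> m i))"
      unfolding S_def by (subst sum.swap) (simp add: sum_distrib_left)
    also have "\<dots> = 0" using W_sum[OF W] by simp
    finally have "S x0 = 0" using sum.remove[of P x0 S] x0 S0 by simp
    then have "S i = 0" for i using S0[of i] W_supp[OF W, of _ i] unfolding S_def by (cases "i \<in> P"; cases "i = x0") auto
    then have "\<forall>m\<in>B. c m = 0" using B c(1) unfolding M.lin_independent_iff S_def by auto
    then show False using c(2) by blast
  qed
  ultimately show ?thesis unfolding has_rank_def by blast
qed

text \<open>The coordinate permutations preserve \<open>W\<close> and its form. A group element that
  acts trivially fixes all p-multiples of differences of two points, hence every point, and is the
  identity by \<open>PG_faithful\<close>.\<close>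

lemma W_automorphisms:
  assumes "represented q M \<Psi> wf" "\<Psi> ` carrier M = W"
  shows "contains_copy (Aut q M) PG"
proof -
  interpret M: represented q M \<Psi> wf by fact
  interpret G: group PG by (rule group_PG)
  let ?S = "carrier M"
  \<comment> \<open>The restriction to \<open>?S\<close> makes \<open>F g\<close> extensional, as
    membership in \<open>Bij\<close> demands.\<close>
  define F where "F g = (\<lambda>x\<in>?S. inv_into ?S \<Psi> (perm g (\<Psi> x)))" for g
  have W: "\<Psi> x \<in> W" if "x \<in> ?S" for x using that assms(2) by blast
  have F: "F g x \<in> ?S" "\<Psi> (F g x) = perm g (\<Psi> x)" if "g \<in> carrier PG" "x \<in> ?S" for g x
    using perm_W[OF that(1) W[OF that(2)]] that unfolding assms(2)[symmetric] F_def
    by (auto intro: inv_into_into f_inv_into_f)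
  have Fmult: "F (g \<otimes>\<^bsub>PG\<^esub> k) = compose ?S (F g) (F k)" if gk: "g \<in> carrier PG" "k \<in> carrier PG" for g k
  proof
    fix x show "F (g \<otimes>\<^bsub>PG\<^esub> k) x = compose ?S (F g) (F k) x"
    proof (cases "x \<in> ?S")
      case True
      then have "F (g \<otimes>\<^bsub>PG\<^esub> k) x = F g (F k x)" using gk F by (intro M.\<Psi>_eq) (simp_all add: perm_mult)
      then show ?thesis using True by (simp add: compose_def)
    qed (simp add: F_def compose_def)
  qed
  have W_J: "u i = 0" if "u \<in> W" "i \<notin> J" for u i using W_supp[OF that(1), of i] that(2) unfolding J_def by auto
  have Fone: "F \<one>\<^bsub>PG\<^esub> = (\<lambda>x\<in>?S. x)"
  proof
    fix x show "F \<one>\<^bsub>PG\<^esub> x = (\<lambda>x\<in>?S. x) x"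
    proof (cases "x \<in> ?S")
      case True
      then have "F \<one>\<^bsub>PG\<^esub> x = x" using F[OF G.one_closed True] W_J[OF W] by (intro M.\<Psi>_eq) (simp_all add: perm_one)
      then show ?thesis using True by simp
    qed (simp add: F_def)
  qed
  have Finv: "F g (F (inv\<^bsub>PG\<^esub> g) x) = x" "F (inv\<^bsub>PG\<^esub> g) (F g x) = x" if "g \<in> carrier PG" "x \<in> ?S" for g x
    using fun_cong[OF Fmult[OF that(1) inv_PG[OF that(1)]], of x]
      fun_cong[OF Fmult[OF inv_PG[OF that(1)] that(1)], of x] that
    by (simp_all add: Fone compose_def)
  have Fbij: "F g \<in> Bij ?S" if "g \<in> carrier PG" for g
  proof -
    have "bij_betw (F g) ?S ?S"
      using that Finv F inv_PG by (intro bij_betw_byWitness[where f'="F (inv\<^bsub>PG\<^esub> g)"]) auto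
    then show ?thesis unfolding Bij_def F_def by auto
  qed
  have Fiso: "F g \<in> isometries q M M" if g: "g \<in> carrier PG" for g
  proof -
    have "F g (x \<oplus>\<^bsub>M\<^esub> y) = F g x \<oplus>\<^bsub>M\<^esub> F g y" if "x \<in> ?S" "y \<in> ?S" for x y
      using that F[OF g] M.add_M by (intro M.\<Psi>_eq) (simp_all add: perm_linear)
    moreover have "F g (c \<odot>\<^bsub>M\<^esub> x) = c \<odot>\<^bsub>M\<^esub> F g x" if "x \<in> ?S" "c \<in> \<O> q" for x c
      using that F[OF g] M.smult_M by (intro M.\<Psi>_eq) (simp_all add: perm_linear)
    moreover have "form M (F g x) (F g y) = form M x y" if "x \<in> ?S" "y \<in> ?S" for x y
      using that F[OF g] by (simp add: M.form_M perm_wf[OF g])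
    moreover have "bij_betw (F g) ?S ?S" using Fbij[OF g] unfolding Bij_def by blast
    ultimately show ?thesis unfolding isometries_def lin_maps_def using F(1)[OF g] by blast
  qed
  have Finj: "inj_on F (carrier PG)"
  proof (rule inj_onI)
    fix g k assume g: "g \<in> carrier PG" and k: "k \<in> carrier PG" and e: "F g = F k"
    define t where "t = inv\<^bsub>PG\<^esub> k \<otimes>\<^bsub>PG\<^esub> g"
    have t: "t \<in> carrier PG" unfolding t_def using g k by simp
    have "F t = F (inv\<^bsub>PG\<^esub> k \<otimes>\<^bsub>PG\<^esub> k)" unfolding t_def Fmult[OF inv_PG[OF k] g] Fmult[OF inv_PG[OF k] k] e ..
    then have Ft: "F t = (\<lambda>x\<in>?S. x)" using k Fone by simp
    have pt: "perm t u = u" if u: "u \<in> W" for u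
    proof -
      obtain x where x: "x \<in> ?S" "u = \<Psi> x" using u assms(2) by blast
      then have "F t x = x" unfolding Ft by simp
      then show ?thesis using F(2)[OF t x(1)] x(2) by simp
    qed
    have fixpt: "pgl_act (inv\<^bsub>PG\<^esub> t) x = x" if x: "x \<in> P" for x
    proof -
      let ?y = "pgl_act (inv\<^bsub>PG\<^esub> t) x"
      have y: "?y \<in> P" using pgl_act_mem(1)[OF inv_PG[OF t] x] .
      \<comment> \<open>A third point \<open>w\<close> is needed: were \<open>?y\<close> different
        from \<open>x\<close>, the difference of \<open>x\<close> and \<open>w\<close> would take
        the value 0 at \<open>?y\<close>, although invariance forces the value it has at
        \<open>x\<close>.\<close>
      have "\<not> P \<subseteq> {x, ?y}"
      proof
        assume "P \<subseteq> {x, ?y}"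
        then have "card P \<le> card {x, ?y}" by (intro card_mono) auto
        also have "\<dots> \<le> 2" by (simp add: card_insert_le_m1)
        finally show False using card_pts q_ge_3 by simp
      qed
      then obtain w where w: "w \<in> P" "w \<noteq> x" "w \<noteq> ?y" by blast
      have "rt q * (1 * diff_vec x w ?y) = rt q * (1 * diff_vec x w x)"
        using fun_cong[OF pt[OF rt_diff_W[OF x w(1) O_1]], of x] unfolding perm_at(1)[OF x] .
      then show ?thesis using w by (auto simp: diff_vec_def split: if_splits)
    qed
    have "inv\<^bsub>PG\<^esub> t = \<one>\<^bsub>PG\<^esub>" using PG_faithful[OF inv_PG[OF t]] fixpt by blast
    then have "t = \<one>\<^bsub>PG\<^esub>" using t by (metis G.inv_inv G.inv_one)
    then show "g = k" using g k unfolding t_def by (metis G.inv_closed G.inv_equality G.inv_inv)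
  qed
  let ?A = "Aut q M"
  have Asel: "carrier ?A = isometries q M M \<inter> Bij ?S" "\<one>\<^bsub>?A\<^esub> = (\<lambda>x\<in>?S. x)"
    "\<And>f g. f \<in> Bij ?S \<Longrightarrow> g \<in> Bij ?S \<Longrightarrow> f \<otimes>\<^bsub>?A\<^esub> g = compose ?S f g"
    unfolding Aut_def BijGroup_def by auto

  have minv: "inv\<^bsub>?A\<^esub> (F g) = F (inv\<^bsub>PG\<^esub> g)" if g: "g \<in> carrier PG" for g
    unfolding m_inv_def[of ?A]
  proof (rule the_equality)
    have i: "inv\<^bsub>PG\<^esub> g \<in> carrier PG" using inv_PG g .
    show "F (inv\<^bsub>PG\<^esub> g) \<in> carrier ?A \<and> F g \<otimes>\<^bsub>?A\<^esub> F (inv\<^bsub>PG\<^esub> g) = \<one>\<^bsub>?A\<^esub> \<and> F (inv\<^bsub>PG\<^esub> g) \<otimes>\<^bsub>?A\<^esub> F g = \<one>\<^bsub>?A\<^esub>"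
      using Fiso[OF i] Fbij[OF i] Fbij[OF g] Fmult[OF g i] Fmult[OF i g] Fone g by (simp add: Asel)
    fix y assume y: "y \<in> carrier ?A \<and> F g \<otimes>\<^bsub>?A\<^esub> y = \<one>\<^bsub>?A\<^esub> \<and> y \<otimes>\<^bsub>?A\<^esub> F g = \<one>\<^bsub>?A\<^esub>"
    have yB: "y \<in> Bij ?S" using y unfolding Asel by blast
    have e: "compose ?S (F g) y = (\<lambda>x\<in>?S. x)" using y Asel(3)[OF Fbij[OF g] yB] Asel(2) by simp
    show "y = F (inv\<^bsub>PG\<^esub> g)"
    proof
      fix x show "y x = F (inv\<^bsub>PG\<^esub> g) x"
      proof (cases "x \<in> ?S")
        case True
        have yx: "y x \<in> ?S" using yB True unfolding Bij_def by (auto simp: bij_betw_def)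
        have "F g (y x) = x" using fun_cong[OF e, of x] True by (simp add: compose_def)
        then show ?thesis using Finv(2)[OF g yx] by simp
      next
        case False
        then show ?thesis using yB unfolding Bij_def F_def extensional_def by auto
      qed
    qed
  qed
  have "subgroup (F ` carrier PG) ?A"
  proof (rule subgroup.intro)
    show "F ` carrier PG \<subseteq> carrier ?A" using Fiso Fbij by (auto simp: Asel)
    show "x \<otimes>\<^bsub>?A\<^esub> y \<in> F ` carrier PG" if "x \<in> F ` carrier PG" "y \<in> F ` carrier PG" for x y
      using that Fbij by (auto simp: Asel Fmult[symmetric])
    show "\<one>\<^bsub>?A\<^esub> \<in> F ` carrier PG" unfolding Asel Fone[symmetric] by simp
    show "inv\<^bsub>?A\<^esub> x \<in> F ` carrier PG" if "x \<in> F ` carrier PG" for x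
      using that inv_PG by (auto simp: minv)
  qed
  moreover have "F \<in> iso PG (?A\<lparr>carrier := F ` carrier PG\<rparr>)"
    unfolding iso_def hom_def using Finj Fbij by (auto simp: bij_betw_def Asel Fmult)
  then have "PG \<cong> ?A\<lparr>carrier := F ` carrier PG\<rparr>" by (rule is_isoI)
  ultimately show ?thesis unfolding contains_copy_def by blast
qed

lemma W_properties:
  assumes "represented q M \<Psi> wf" "\<Psi> ` carrier M = W"
  shows "hermitian_lattice q M" "definite M" "p_modular q M" "has_rank q M (q^2 + q)"
    "contains_copy (Aut q M) PG"
  using modular_represented.hermitian_lattice_M[OF W_modular_represented[OF assms]]
    modular_represented.definite_M[OF W_modular_represented[OF assms]]
    modular_represented.p_modular_M[OF W_modular_represented[OF assms]]
    W_rank[OF assms] W_automorphisms[OF assms] by auto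

text \<open>A copy of the quotient lattice, on singletons only to match the required element type.\<close>

definition W_lattice :: "(('k ^ 3) set \<Rightarrow> complex) set hmod" where
  "W_lattice = \<lparr>carrier = (\<lambda>v. {v}) ` W, monoid.mult = undefined, one = undefined, zero = {\<lambda>_. 0},
     add = (\<lambda>X Y. {\<lambda>i. the_elem X i + the_elem Y i}), smult = (\<lambda>c X. {\<lambda>i. c * the_elem X i}),
     form = (\<lambda>X Y. wf (the_elem X) (the_elem Y))\<rparr>"

lemma W_lattice_represented: "represented q W_lattice the_elem wf"
  by unfold_locales
    (auto simp: W_lattice_def W_0 W_add W_smult wf_add wf_smult wf_cnj inj_on_def)

lemma W_lattice_image: "the_elem ` carrier W_lattice = W"
  by (auto simp: W_lattice_def image_image)

end

section \<open>Invariant null vectors\<close>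

context plane begin

definition inv_vec :: "complex \<Rightarrow> complex \<Rightarrow> ('k ^ 3) set \<Rightarrow> complex" where
  "inv_vec a b r = (if r = {} then a else if r \<in> P then b else 0)"

lemma z_inv_vec: "null_vector.z a b = inv_vec a b" if "null_vector TYPE('k) q a b" for a b
  using that by (intro ext) (simp add: null_vector.z_def inv_vec_def)

lemma hf_inv_vec: "hf (inv_vec a b) (inv_vec a b) = a * cnj a - of_nat (q^2 + q + 1) * (b * cnj b)"
proof -
  have "(\<Sum>x\<in>P. cnj (inv_vec a b x) * inv_vec a b x) = (\<Sum>x\<in>P. b * cnj b)"
    using empty_notin by (intro sum.cong) (auto simp: inv_vec_def mult.commute)
  then show ?thesis unfolding hf_def using card_pts by (simp add: inv_vec_def mult.commute)
qed

text \<open>Transitivity on the points makes an invariant vector constant on them. If that constant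
  were 0, the null condition would kill the extra coordinate as well.\<close>

lemma fixed_null_coordinates:
  assumes "fixed_null q (Z :: (('k ^ 3) set \<Rightarrow> complex) set)"
  obtains a b where "\<Phi> Z = inv_vec a b" "null_lattice_vector TYPE('k) q a b"
proof -
  have Z: "Z \<in> carrier LP" "Z \<noteq> \<zero>\<^bsub>LP\<^esub>" "form LP Z Z = 0" "\<And>g. g \<in> carrier PG \<Longrightarrow> act g Z = Z"
    using assms unfolding fixed_null_def by auto
  obtain x0 where x0: "x0 \<in> P" using exists_point by blast
  define a where "a = \<Phi> Z {}"
  define b where "b = \<Phi> Z x0"
  have e: "\<Phi> Z = inv_vec a b"
  proof
    fix r
    consider "r = {}" | "r \<in> P" | "r \<notin> J" unfolding J_def by blast
    then show "\<Phi> Z r = inv_vec a b r"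
    proof cases
      case 2
      obtain g where g: "g \<in> carrier PG" "pgl_act g r = x0" using PG_transitive[OF 2 x0] by blast
      have "perm g (\<Phi> Z) x0 = \<Phi> Z x0" using act_closed(2)[OF g(1) Z(1)] Z(4)[OF g(1)] by simp
      then have "\<Phi> Z (pgl_act (inv\<^bsub>PG\<^esub> g) x0) = \<Phi> Z x0" unfolding perm_at(1)[OF x0] .
      moreover have "pgl_act (inv\<^bsub>PG\<^esub> g) x0 = r" using pgl_act_inv(2)[OF g(1), of r] g(2) 2 by (simp add: J_def)
      ultimately show ?thesis using 2 empty_notin unfolding inv_vec_def b_def by auto
    qed (use LC_supp[OF \<Phi>_LC[OF Z(1)]] in \<open>auto simp: inv_vec_def a_def J_def\<close>)
  qed
  have n: "a * cnj a = of_nat (q^2 + q + 1) * (b * cnj b)"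
    using LP.form_M[OF Z(1) Z(1)] Z(3) hf_inv_vec[of a b] unfolding e by simp
  have "b \<noteq> 0"
  proof
    assume b: "b = 0"
    then have "a = 0" using n by simp
    then have "\<Phi> Z = \<Phi> \<zero>\<^bsub>LP\<^esub>" unfolding e LP.zero_M using b by (auto simp: inv_vec_def)
    then show False using LP.\<Psi>_eq Z(1,2) LP.zero_M(1) by blast
  qed
  then interpret N: null_vector q "TYPE('k)" a b using n by unfold_locales
  have "N.z = \<Phi> Z" unfolding e using z_inv_vec[OF N.null_vector_axioms] .
  then have "null_lattice_vector TYPE('k) q a b" using \<Phi>_LC[OF Z(1)] by unfold_locales simp
  then show ?thesis using that e by blast
qed

text \<open>Vectors (a; b 1) with nonzero \<open>b\<close> that are null correspond to field
  elements a / b of norm q^2 + q + 1.\<close>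

lemma fixed_null_iff_norm:
  "(\<exists>Z :: (('k ^ 3) set \<Rightarrow> complex) set. fixed_null q Z) \<longleftrightarrow> is_field_norm q (q^2 + q + 1)"
proof
  assume "\<exists>Z :: (('k ^ 3) set \<Rightarrow> complex) set. fixed_null q Z"
  then obtain a b where "null_lattice_vector TYPE('k) q a b" using fixed_null_coordinates by metis
  then interpret N: null_lattice_vector q "TYPE('k)" a b .
  have "a / b * cnj (a / b) = of_nat (q^2 + q + 1)"
    using N.null N.b_nz by (simp add: field_simps)
  then show "is_field_norm q (q^2 + q + 1)"
    unfolding is_field_norm_def using K_quotient[OF N.ab_O] by blast
next
  assume "is_field_norm q (q^2 + q + 1)"
  then obtain x where x: "x \<in> quadratic_field q" "x * cnj x = of_nat (q^2 + q + 1)"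
    unfolding is_field_norm_def by blast
  obtain y and m :: int where ym: "y \<in> \<O> q" "m > 0" "x = y / of_int m" using K_frac[OF x(1)] by metis
  \<comment> \<open>The factor p moves the integral vector (y; m 1) into the lattice, by
    \<open>rt_mult_LC\<close>.\<close>
  define a b where "a = rt q * y" and "b = rt q * of_int m"
  have n: "a * cnj a = of_nat (q^2 + q + 1) * (b * cnj b)"
  proof -
    have "y = x * of_int m" using ym by simp
    then have "a * cnj a = (x * cnj x) * (b * cnj b)" unfolding a_def b_def by (simp add: ac_simps)
    then show ?thesis unfolding x(2) .
  qed
  have "(\<lambda>r. rt q * inv_vec y (of_int m) r) \<in> LC"
    using ym(1) by (intro rt_mult_LC) (auto simp: inv_vec_def J_def)
  moreover have "(\<lambda>r. rt q * inv_vec y (of_int m) r) = inv_vec a b" by (auto simp: inv_vec_def a_def b_def)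
  ultimately have L: "inv_vec a b \<in> LC" by simp
  then obtain Z where Z: "Z \<in> carrier LP" "\<Phi> Z = inv_vec a b" unfolding \<Phi>_image[symmetric] by auto
  have "b \<noteq> 0" using ym(2) by (simp add: b_def)
  then interpret N: null_vector q "TYPE('k)" a b using n by unfold_locales
  have zz: "N.z = inv_vec a b" using z_inv_vec[OF N.null_vector_axioms] .
  have "fixed_null q Z"
    unfolding fixed_null_def
  proof (intro conjI ballI)
    show "Z \<in> carrier LP" by fact
    obtain x0 where "x0 \<in> P" using exists_point by blast
    then have "inv_vec a b x0 \<noteq> 0" using \<open>b \<noteq> 0\<close> empty_notin by (auto simp: inv_vec_def)
    then have "\<Phi> Z x0 \<noteq> 0" unfolding Z(2) .
    then show "Z \<noteq> \<zero>\<^bsub>LP\<^esub>" using LP.zero_M(2) by metis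
    show "form LP Z Z = 0" unfolding LP.form_M[OF Z(1) Z(1)] Z(2) zz[symmetric] by (rule N.hf_zz)
    fix g :: "('k^3^3) set" assume g: "g \<in> carrier PG"
    show "act g Z = Z"
      using act_closed[OF g Z(1)] N.perm_z[OF g] Z LP.\<Psi>_eq unfolding zz by metis
  qed
  then show "\<exists>Z :: (('k ^ 3) set \<Rightarrow> complex) set. fixed_null q Z" by blast
qed

end

section \<open>Splitting off the hyperbolic plane\<close>

lemma (in plane) LC_preimage: "X \<in> LC \<Longrightarrow> \<exists>x. x \<in> carrier LP \<and> \<Phi> x = X"
  unfolding \<Phi>_image[symmetric] by blast

locale invariant_null = null_lattice_vector q ty a b
  for q and ty :: "'k::{field,finite} itself" and a b +
  fixes Z :: "(('k ^ 3) set \<Rightarrow> complex) set"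
  assumes Z_LP: "Z \<in> carrier LP" and \<Phi>_Z: "\<Phi> Z = z"
begin

definition hyp :: "(('k ^ 3) set \<Rightarrow> complex) set \<Rightarrow> (('k ^ 3) set \<Rightarrow> complex) set set" where
  "hyp f = {\<alpha> \<odot>\<^bsub>LP\<^esub> Z \<oplus>\<^bsub>LP\<^esub> \<beta> \<odot>\<^bsub>LP\<^esub> f | \<alpha> \<beta>. \<alpha> \<in> \<O> q \<and> \<beta> \<in> \<O> q}"

lemma hyp_element:
  assumes "\<alpha> \<in> \<O> q" "\<beta> \<in> \<O> q" "f \<in> carrier LP"
  shows "\<alpha> \<odot>\<^bsub>LP\<^esub> Z \<oplus>\<^bsub>LP\<^esub> \<beta> \<odot>\<^bsub>LP\<^esub> f \<in> carrier LP"
    "\<Phi> (\<alpha> \<odot>\<^bsub>LP\<^esub> Z \<oplus>\<^bsub>LP\<^esub> \<beta> \<odot>\<^bsub>LP\<^esub> f) = (\<lambda>i. \<alpha> * z i + \<beta> * \<Phi> f i)"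
  using assms LP.smult_M Z_LP by (simp_all add: LP.add_M \<Phi>_Z)

text \<open>The summand is orthogonal to both \<open>z\<close> and \<open>f\<close>, and the
  complement of \<open>z\<close> is the summand plus multiples of \<open>z\<close>; both the
  comparison with \<open>W\<close> and the one with the quotient rest on this.\<close>

lemma splitting_facts:
  assumes "splitting q Z f \<Lambda>"
  shows "f \<in> carrier LP" "hf z (\<Phi> f) = rt q" "submodule \<Lambda> (\<O>_ring q) LP" "\<Lambda> \<subseteq> carrier LP"
    "\<And>x. x \<in> \<Lambda> \<Longrightarrow> hf z (\<Phi> x) = 0" "\<And>x. x \<in> \<Lambda> \<Longrightarrow> hf (\<Phi> f) (\<Phi> x) = 0"
    "\<And>x. x \<in> carrier LP \<Longrightarrow> hf z (\<Phi> x) = 0 \<Longrightarrow> \<exists>y\<in>\<Lambda>. \<exists>\<alpha>\<in>\<O> q. \<Phi> x = (\<lambda>i. \<alpha> * z i + \<Phi> y i)"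
proof -
  have s: "f \<in> carrier LP" "form LP Z f = rt q" "submodule \<Lambda> (\<O>_ring q) LP" "carrier LP = \<Lambda> <+>\<^bsub>LP\<^esub> hyp f"
    "\<And>x y. x \<in> \<Lambda> \<Longrightarrow> y \<in> hyp f \<Longrightarrow> form LP x y = 0"
    using assms unfolding splitting_def orthogonal_sum_def hyp_def by auto
  show f: "f \<in> carrier LP" and "submodule \<Lambda> (\<O>_ring q) LP" by fact+
  show L: "\<Lambda> \<subseteq> carrier LP" using LP.submoduleD(1)[OF s(3)] .
  show zf: "hf z (\<Phi> f) = rt q" using s(2) LP.form_M[OF Z_LP f] unfolding \<Phi>_Z by simp
  have orth: "hf (\<Phi> x) (\<lambda>i. \<alpha> * z i + \<beta> * \<Phi> f i) = 0" if x: "x \<in> \<Lambda>" and ab: "\<alpha> \<in> \<O> q" "\<beta> \<in> \<O> q" for x \<alpha> \<beta>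
  proof -
    have "\<alpha> \<odot>\<^bsub>LP\<^esub> Z \<oplus>\<^bsub>LP\<^esub> \<beta> \<odot>\<^bsub>LP\<^esub> f \<in> hyp f" unfolding hyp_def using ab by blast
    then show ?thesis
      using s(5)[OF x] LP.form_M[OF subsetD[OF L x] hyp_element(1)[OF ab f]]
      unfolding hyp_element(2)[OF ab f] by simp
  qed
  show xz: "hf z (\<Phi> x) = 0" if "x \<in> \<Lambda>" for x
    using orth[OF that, of 1 0] hf_cnj[of "\<Phi> x" z] by simp
  show "hf (\<Phi> f) (\<Phi> x) = 0" if "x \<in> \<Lambda>" for x
    using orth[OF that, of 0 1] hf_cnj[of "\<Phi> x" "\<Phi> f"] by simp
  fix x assume x: "x \<in> carrier LP" "hf z (\<Phi> x) = 0"
  then obtain y h where yh: "y \<in> \<Lambda>" "h \<in> hyp f" "x = y \<oplus>\<^bsub>LP\<^esub> h" unfolding s(4) set_add_def' by blast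
  then obtain \<alpha> \<beta> where ab: "\<alpha> \<in> \<O> q" "\<beta> \<in> \<O> q" "h = \<alpha> \<odot>\<^bsub>LP\<^esub> Z \<oplus>\<^bsub>LP\<^esub> \<beta> \<odot>\<^bsub>LP\<^esub> f" unfolding hyp_def by blast
  have e: "\<Phi> x = (\<lambda>i. \<Phi> y i + (\<alpha> * z i + \<beta> * \<Phi> f i))"
    unfolding yh(3) ab(3) LP.add_M(2)[OF subsetD[OF L yh(1)] hyp_element(1)[OF ab(1,2) f]] hyp_element(2)[OF ab(1,2) f] ..
  \<comment> \<open>Pairing with \<open>z\<close> isolates the coefficient of \<open>f\<close>,
    because \<open>z\<close> is null and orthogonal to the summand.\<close>
  have "\<beta> * rt q = 0" using x(2) unfolding e hf_add hf_smult hf_zz xz[OF yh(1)] zf by simp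
  then have "\<Phi> x = (\<lambda>i. \<alpha> * z i + \<Phi> y i)" unfolding e by auto
  then show "\<exists>y\<in>\<Lambda>. \<exists>\<alpha>\<in>\<O> q. \<Phi> x = (\<lambda>i. \<alpha> * z i + \<Phi> y i)" using yh(1) ab(1) by blast
qed

lemma hf_f_z: "hf z (\<Phi> f) = rt q \<Longrightarrow> hf (\<Phi> f) z = - rt q"
  using hf_cnj[of z "\<Phi> f"] by simp

text \<open>The kernel of \<open>proj\<close> on the complement of \<open>z\<close> consists of
  multiples of \<open>z\<close>. None but 0 lies in \<Lambda>, which is orthogonal to
  \<open>f\<close> while \<open>z\<close> is not. Surjectivity holds because multiples of
  \<open>z\<close> project to 0.\<close>

lemma splitting_represented:
  assumes "splitting q Z f \<Lambda>"
  shows "represented q (LP\<lparr>carrier := \<Lambda>\<rparr>) (\<lambda>x. proj (\<Phi> x)) wf"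
    "(\<lambda>x. proj (\<Phi> x)) ` carrier (LP\<lparr>carrier := \<Lambda>\<rparr>) = W"
proof -
  note s = splitting_facts[OF assms]
  note sub = LP.submoduleD[OF s(3)]
  show "represented q (LP\<lparr>carrier := \<Lambda>\<rparr>) (\<lambda>x. proj (\<Phi> x)) wf"
  proof
    show "inj_on (\<lambda>x. proj (\<Phi> x)) (carrier (LP\<lparr>carrier := \<Lambda>\<rparr>))"
    proof (rule inj_onI)
      fix x y assume "x \<in> carrier (LP\<lparr>carrier := \<Lambda>\<rparr>)" "y \<in> carrier (LP\<lparr>carrier := \<Lambda>\<rparr>)"
        and e: "proj (\<Phi> x) = proj (\<Phi> y)"
      then have xy: "x \<in> \<Lambda>" "y \<in> \<Lambda>" by auto
      define D where "D i = \<Phi> x i - \<Phi> y i" for i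
      have Deq: "D = (\<lambda>i. D {} / a * z i)"
      proof (rule proj_kernel)
        show "hf z D = 0" unfolding D_def hf_diff using s(5) xy by simp
        show "proj D = (\<lambda>_. 0)" unfolding D_def proj_diff e by simp
        show "D i = 0" if "i \<notin> J" for i
          unfolding D_def using LC_supp[OF \<Phi>_LC that] xy s(4) by (simp add: subset_iff)
      qed
      have "hf (\<Phi> f) D = 0" unfolding D_def hf_diff using s(6) xy by simp
      then have "D {} / a * hf (\<Phi> f) z = 0" using hf_smult[of "\<Phi> f" "D {} / a" z] Deq by simp
      then have d0: "D {} / a = 0" using hf_f_z[OF s(2)] by simp
      have "D i = 0" for i using fun_cong[OF Deq, of i] unfolding d0 by simp
      then have "\<Phi> x i = \<Phi> y i" for i unfolding D_def by simp
      then show "x = y" using xy s(4) by (intro LP.\<Psi>_eq) auto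
    qed
    fix x y assume "x \<in> carrier (LP\<lparr>carrier := \<Lambda>\<rparr>)" "y \<in> carrier (LP\<lparr>carrier := \<Lambda>\<rparr>)"
    then have xy: "x \<in> \<Lambda>" "y \<in> \<Lambda>" "x \<in> carrier LP" "y \<in> carrier LP" using s(4) by auto
    then show "form (LP\<lparr>carrier := \<Lambda>\<rparr>) x y = wf (proj (\<Phi> x)) (proj (\<Phi> y))"
      using proj_form[OF s(5)[OF xy(1)] s(5)[OF xy(2)]] LP.form_M[OF xy(3,4)] by simp
    show "x \<oplus>\<^bsub>LP\<lparr>carrier := \<Lambda>\<rparr>\<^esub> y \<in> carrier (LP\<lparr>carrier := \<Lambda>\<rparr>)" using sub(3) xy by simp
    show "proj (\<Phi> (x \<oplus>\<^bsub>LP\<lparr>carrier := \<Lambda>\<rparr>\<^esub> y)) = (\<lambda>i. proj (\<Phi> x) i + proj (\<Phi> y) i)"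
      using LP.add_M(2)[OF xy(3,4)] by (simp add: proj_add)
  next
    fix c x assume c: "c \<in> \<O> q" and "x \<in> carrier (LP\<lparr>carrier := \<Lambda>\<rparr>)"
    then have x: "x \<in> \<Lambda>" "x \<in> carrier LP" using s(4) by auto
    show "c \<odot>\<^bsub>LP\<lparr>carrier := \<Lambda>\<rparr>\<^esub> x \<in> carrier (LP\<lparr>carrier := \<Lambda>\<rparr>)" using sub(4) c x by simp
    show "proj (\<Phi> (c \<odot>\<^bsub>LP\<lparr>carrier := \<Lambda>\<rparr>\<^esub> x)) = (\<lambda>i. c * proj (\<Phi> x) i)"
      using LP.smult_M(2)[OF c x(2)] by (simp add: proj_smult)
  qed (use sub(2) LP.zero_M(2) in \<open>simp_all add: wf_add wf_smult wf_cnj proj_0\<close>)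
  show "(\<lambda>x. proj (\<Phi> x)) ` carrier (LP\<lparr>carrier := \<Lambda>\<rparr>) = W"
  proof
    show "(\<lambda>x. proj (\<Phi> x)) ` carrier (LP\<lparr>carrier := \<Lambda>\<rparr>) \<subseteq> W"
      unfolding W_def zperp_def using s(4,5) \<Phi>_LC by auto
    show "W \<subseteq> (\<lambda>x. proj (\<Phi> x)) ` carrier (LP\<lparr>carrier := \<Lambda>\<rparr>)"
    proof
      fix w assume "w \<in> W"
      then obtain X where X: "X \<in> LC" "hf z X = 0" "w = proj X" unfolding W_def zperp_def by blast
      then obtain x where x: "x \<in> carrier LP" "X = \<Phi> x" unfolding \<Phi>_image[symmetric] by blast
      then obtain y \<alpha> where y: "y \<in> \<Lambda>" "\<Phi> x = (\<lambda>i. \<alpha> * z i + \<Phi> y i)" using s(7)[of x] X(2) by blast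
      have "w = proj (\<Phi> y)" unfolding X(3) x(2) y(2) proj_add proj_smult proj_z by simp
      then show "w \<in> (\<lambda>x. proj (\<Phi> x)) ` carrier (LP\<lparr>carrier := \<Lambda>\<rparr>)" using y(1) by simp
    qed
  qed
qed

text \<open>Every coset of the multiples of \<open>z\<close> inside its complement meets \<Lambda>
  in exactly one element. The form does not see the choice of representatives because
  \<open>z\<close> is orthogonal to all of them.\<close>

lemma perp_quot_isometric:
  assumes "splitting q Z f \<Lambda>"
  shows "isometric q (LP\<lparr>carrier := \<Lambda>\<rparr>) (perp_quot q LP Z)"
proof -
  note s = splitting_facts[OF assms]
  note sub = LP.submoduleD[OF s(3)]
  let ?K = "{x \<in> carrier LP. form LP Z x = 0}"
  let ?M = "LP\<lparr>carrier := ?K\<rparr>"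
  let ?N = "{c \<odot>\<^bsub>LP\<^esub> Z | c. c \<in> \<O> q}"
  let ?Q = "perp_quot q LP Z"
  have K: "x \<in> ?K \<longleftrightarrow> x \<in> carrier LP \<and> hf z (\<Phi> x) = 0" for x
    using LP.form_M[OF Z_LP, of x] \<Phi>_Z by auto
  have LK: "\<Lambda> \<subseteq> ?K" using s(4,5) K by blast
  \<comment> \<open>The coset of \<open>y\<close> described in coordinates, where the sums and
    multiples of cosets can be compared as functions.\<close>
  define C where "C y = {u \<in> carrier LP. \<exists>c\<in>\<O> q. \<Phi> u = (\<lambda>i. c * z i + \<Phi> y i)}" for y
  have cos: "?N +>\<^bsub>?M\<^esub> y = C y" if y: "y \<in> carrier LP" for y
  proof
    show "?N +>\<^bsub>?M\<^esub> y \<subseteq> C y"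
      unfolding a_r_coset_def' C_def using y Z_LP LP.smult_M(1)
      by (auto simp: LP.add_M LP.smult_M \<Phi>_Z)
    show "C y \<subseteq> ?N +>\<^bsub>?M\<^esub> y"
    proof
      fix u assume "u \<in> C y"
      then obtain c where c: "u \<in> carrier LP" "c \<in> \<O> q" "\<Phi> u = (\<lambda>i. c * z i + \<Phi> y i)" unfolding C_def by blast
      have cZ: "c \<odot>\<^bsub>LP\<^esub> Z \<in> carrier LP" using LP.smult_M(1) c(2) Z_LP .
      have "\<Phi> u = \<Phi> (c \<odot>\<^bsub>LP\<^esub> Z \<oplus>\<^bsub>LP\<^esub> y)"
        unfolding c(3) LP.add_M(2)[OF cZ y] LP.smult_M(2)[OF c(2) Z_LP] \<Phi>_Z ..
      then have "u = c \<odot>\<^bsub>LP\<^esub> Z \<oplus>\<^bsub>LP\<^esub> y" using LP.\<Psi>_eq c(1) LP.add_M(1)[OF cZ y] by blast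
      then show "u \<in> ?N +>\<^bsub>?M\<^esub> y" unfolding a_r_coset_def' using c(2) by auto
    qed
  qed
  have self: "y \<in> C y" if "y \<in> carrier LP" for y
    unfolding C_def using that by (auto intro!: bexI[of _ 0])
  have Qc: "carrier ?Q = C ` ?K"
    unfolding perp_quot_def hquot_def by (auto simp: A_RCOSETS_def' cos)
  have Ck: "u \<in> carrier LP \<and> hf z (\<Phi> u) = 0" if "u \<in> C y" "y \<in> \<Lambda>" for u y
    using that s(5) unfolding C_def by (auto simp: hf_add hf_smult hf_zz)
  have CL: "\<exists>y\<in>\<Lambda>. C u = C y" if "u \<in> ?K" for u
  proof -
    have "u \<in> carrier LP" "hf z (\<Phi> u) = 0" using that K by auto
    then obtain y \<alpha> where y: "y \<in> \<Lambda>" "\<alpha> \<in> \<O> q" "\<Phi> u = (\<lambda>i. \<alpha> * z i + \<Phi> y i)" using s(7) by blast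
    have "(\<exists>c\<in>\<O> q. \<Phi> v = (\<lambda>i. c * z i + \<Phi> u i)) \<longleftrightarrow> (\<exists>c\<in>\<O> q. \<Phi> v = (\<lambda>i. c * z i + \<Phi> y i))" for v
    proof
      assume "\<exists>c\<in>\<O> q. \<Phi> v = (\<lambda>i. c * z i + \<Phi> u i)"
      then obtain c where "c \<in> \<O> q" "\<Phi> v = (\<lambda>i. c * z i + \<Phi> u i)" by blast
      then show "\<exists>c\<in>\<O> q. \<Phi> v = (\<lambda>i. c * z i + \<Phi> y i)"
        using y(2,3) by (intro bexI[of _ "c + \<alpha>"]) (auto simp: algebra_simps)
    next
      assume "\<exists>c\<in>\<O> q. \<Phi> v = (\<lambda>i. c * z i + \<Phi> y i)"
      then obtain c where "c \<in> \<O> q" "\<Phi> v = (\<lambda>i. c * z i + \<Phi> y i)" by blast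
      then show "\<exists>c\<in>\<O> q. \<Phi> v = (\<lambda>i. c * z i + \<Phi> u i)"
        using y(2,3) by (intro bexI[of _ "c - \<alpha>"]) (auto simp: algebra_simps)
    qed
    then have "C u = C y" unfolding C_def by simp
    then show ?thesis using y(1) by blast
  qed
  have Cinj: "inj_on C \<Lambda>"
  proof (rule inj_onI)
    fix x y assume xy: "x \<in> \<Lambda>" "y \<in> \<Lambda>" "C x = C y"
    then have xyc: "x \<in> carrier LP" "y \<in> carrier LP" using s(4) by auto
    have "x \<in> C y" using self[OF xyc(1)] xy(3) by simp
    then obtain c where c: "\<Phi> x = (\<lambda>i. c * z i + \<Phi> y i)" unfolding C_def by blast
    have "c * hf (\<Phi> f) z = 0" using s(6)[OF xy(1)] s(6)[OF xy(2)] unfolding c hf_add hf_smult by simp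
    then have "c = 0" using hf_f_z[OF s(2)] by simp
    then show "x = y" using LP.\<Psi>_eq[OF xyc] c by simp
  qed
  have add: "C (x \<oplus>\<^bsub>LP\<^esub> y) = C x <+>\<^bsub>?M\<^esub> C y" if xy: "x \<in> \<Lambda>" "y \<in> \<Lambda>" for x y
  proof
    have xyc: "x \<in> carrier LP" "y \<in> carrier LP" using xy s(4) by auto
    show "C x <+>\<^bsub>?M\<^esub> C y \<subseteq> C (x \<oplus>\<^bsub>LP\<^esub> y)"
    proof
      fix w assume "w \<in> C x <+>\<^bsub>?M\<^esub> C y"
      then obtain u v where uv: "u \<in> C x" "v \<in> C y" "w = u \<oplus>\<^bsub>LP\<^esub> v" unfolding set_add_def' by auto
      then obtain c d where cd: "u \<in> carrier LP" "v \<in> carrier LP" "c \<in> \<O> q" "d \<in> \<O> q"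
        "\<Phi> u = (\<lambda>i. c * z i + \<Phi> x i)" "\<Phi> v = (\<lambda>i. d * z i + \<Phi> y i)" unfolding C_def by blast
      have "\<Phi> w = (\<lambda>i. (c + d) * z i + \<Phi> (x \<oplus>\<^bsub>LP\<^esub> y) i)"
        unfolding uv(3) LP.add_M(2)[OF cd(1,2)] LP.add_M(2)[OF xyc] cd(5,6) by (auto simp: algebra_simps)
      then show "w \<in> C (x \<oplus>\<^bsub>LP\<^esub> y)" unfolding C_def using cd(3,4) LP.add_M(1)[OF cd(1,2)] uv(3) by blast
    qed
    show "C (x \<oplus>\<^bsub>LP\<^esub> y) \<subseteq> C x <+>\<^bsub>?M\<^esub> C y"
    proof
      fix w assume "w \<in> C (x \<oplus>\<^bsub>LP\<^esub> y)"
      then obtain c where c: "w \<in> carrier LP" "c \<in> \<O> q" "\<Phi> w = (\<lambda>i. c * z i + (\<Phi> x i + \<Phi> y i))"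
        unfolding C_def LP.add_M(2)[OF xyc] by blast
      have cZ: "c \<odot>\<^bsub>LP\<^esub> Z \<in> carrier LP" using LP.smult_M(1) c(2) Z_LP .
      let ?u = "c \<odot>\<^bsub>LP\<^esub> Z \<oplus>\<^bsub>LP\<^esub> x"
      have u: "?u \<in> carrier LP" "\<Phi> ?u = (\<lambda>i. c * z i + \<Phi> x i)"
        using LP.add_M[OF cZ xyc(1)] LP.smult_M(2)[OF c(2) Z_LP] \<Phi>_Z by auto
      then have "?u \<in> C x" unfolding C_def using c(2) by blast
      moreover have "w = ?u \<oplus>\<^bsub>LP\<^esub> y"
        using c(1) LP.add_M[OF u(1) xyc(2)] u(2) c(3) by (intro LP.\<Psi>_eq) (auto simp: algebra_simps)
      ultimately show "w \<in> C x <+>\<^bsub>?M\<^esub> C y" unfolding set_add_def' using self[OF xyc(2)] by auto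
    qed
  qed
  have smult: "C (c \<odot>\<^bsub>LP\<^esub> x) = (\<Union>u\<in>C x. ?N +>\<^bsub>?M\<^esub> (c \<odot>\<^bsub>LP\<^esub> u))" if c: "c \<in> \<O> q" and x: "x \<in> \<Lambda>" for c x
  proof -
    have xc: "x \<in> carrier LP" using x s(4) by blast
    have "?N +>\<^bsub>?M\<^esub> (c \<odot>\<^bsub>LP\<^esub> u) = C (c \<odot>\<^bsub>LP\<^esub> u)" if "u \<in> C x" for u
      using cos LP.smult_M(1)[OF c] Ck[OF that x] by blast
    moreover have "C (c \<odot>\<^bsub>LP\<^esub> u) \<subseteq> C (c \<odot>\<^bsub>LP\<^esub> x)" if u: "u \<in> C x" for u
    proof
      fix v assume "v \<in> C (c \<odot>\<^bsub>LP\<^esub> u)"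
      then obtain d where d: "v \<in> carrier LP" "d \<in> \<O> q" "\<Phi> v = (\<lambda>i. d * z i + \<Phi> (c \<odot>\<^bsub>LP\<^esub> u) i)" unfolding C_def by blast
      obtain e where e: "u \<in> carrier LP" "e \<in> \<O> q" "\<Phi> u = (\<lambda>i. e * z i + \<Phi> x i)" using u unfolding C_def by blast
      have "\<Phi> v = (\<lambda>i. (d + c * e) * z i + \<Phi> (c \<odot>\<^bsub>LP\<^esub> x) i)"
        unfolding d(3) LP.smult_M(2)[OF c e(1)] LP.smult_M(2)[OF c xc] e(3) by (auto simp: algebra_simps)
      then show "v \<in> C (c \<odot>\<^bsub>LP\<^esub> x)" unfolding C_def using d(1,2) e(2) c by blast
    qed
    ultimately show ?thesis using self[OF xc] by blast
  qed
  have Cform: "the_elem ((\<lambda>(u, v). form LP u v) ` (C x \<times> C y)) = form LP x y"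
    if xy: "x \<in> \<Lambda>" "y \<in> \<Lambda>" for x y
  proof -
    have xyc: "x \<in> carrier LP" "y \<in> carrier LP" using xy s(4) by auto
    have "form LP u v = form LP x y" if uv: "u \<in> C x" "v \<in> C y" for u v
    proof -
      obtain c d where cd: "u \<in> carrier LP" "v \<in> carrier LP"
        "\<Phi> u = (\<lambda>i. c * z i + \<Phi> x i)" "\<Phi> v = (\<lambda>i. d * z i + \<Phi> y i)" using uv unfolding C_def by blast
      have "hf (\<Phi> x) z = 0" using s(5)[OF xy(1)] hf_cnj[of z "\<Phi> x"] by simp
      then show ?thesis
        unfolding LP.form_M[OF cd(1,2)] LP.form_M[OF xyc] cd(3,4) hf_add hf_smult hf_add_left hf_smult_left hf_zz
        using s(5)[OF xy(2)] by simp
    qed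
    then have "(\<lambda>(u, v). form LP u v) ` (C x \<times> C y) = (\<lambda>_. form LP x y) ` (C x \<times> C y)"
      by (intro image_cong refl) (simp add: split_beta mem_Times_iff)
    also have "\<dots> = {form LP x y}"
      by (rule image_constant[of "(x, y)"]) (use self xyc in simp)
    finally show ?thesis by simp
  qed
  have "C \<in> isometries q (LP\<lparr>carrier := \<Lambda>\<rparr>) ?Q"
  proof -
    have "bij_betw C \<Lambda> (carrier ?Q)"
      unfolding bij_betw_def using Cinj CL LK unfolding Qc by blast
    moreover have "x \<oplus>\<^bsub>?Q\<^esub> y = x <+>\<^bsub>?M\<^esub> y" "c \<odot>\<^bsub>?Q\<^esub> x = (\<Union>u\<in>x. ?N +>\<^bsub>?M\<^esub> (c \<odot>\<^bsub>LP\<^esub> u))"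
      "form ?Q x y = the_elem ((\<lambda>(u, v). form LP u v) ` (x \<times> y))" for x y c
      unfolding perp_quot_def hquot_def by simp_all
    ultimately show ?thesis
      unfolding isometries_def lin_maps_def using add smult Cform by (auto simp: bij_betw_def)
  qed
  then show ?thesis unfolding isometric_def by blast
qed

text \<open>Primitivity enters once: p times the conjugate of \<open>r1\<close> and of
  \<open>r2\<close> takes \<open>z\<close> into the lattice, hence p \<open>r1\<close> and p
  \<open>r2\<close> are integral. Then f = p (r1 w1 + r2 w2) is a lattice vector with <z|f> = p, and
  p-divisibility of the form allows integral coefficients when splitting off \<open>z\<close> and
  \<open>f\<close>.\<close>

lemma primitive_splitting:
  assumes prim: "primitive q LP Z"
  shows "\<exists>f \<Lambda>. splitting q Z f \<Lambda>"
proof -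
  obtain r1 r2 w1 w2 where w: "w1 \<in> LC" "w2 \<in> LC" "r1 * hf z w1 + r2 * hf z w2 = 1"
    and rO: "\<And>X. X \<in> LC \<Longrightarrow> r1 * hf z X \<in> \<O> q" "\<And>X. X \<in> LC \<Longrightarrow> r2 * hf z X \<in> \<O> q"
    and rK: "r1 \<in> quadratic_field q" "r2 \<in> quadratic_field q" using dual_z by blast
  have rtO: "rt q * r \<in> \<O> q" if rK: "r \<in> quadratic_field q" and rO: "\<And>X. X \<in> LC \<Longrightarrow> r * hf z X \<in> \<O> q" for r
  proof -
    obtain y and m :: int where ym: "y \<in> \<O> q" "m > 0" "r = y / of_int m" using K_frac[OF rK] by metis
    \<comment> \<open>\<open>primitive\<close> speaks of fractions with numerator and denominator in
      the order; c / m equals p times the conjugate of \<open>r\<close>. Modularity puts this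
      multiple of \<open>z\<close> into the lattice.\<close>
    define c where "c = rt q * cnj y"
    have c: "c \<in> \<O> q" "(of_int m :: complex) \<in> \<O> q - {0}" unfolding c_def using ym by auto
    have cr: "c / of_int m = rt q * cnj r" unfolding c_def ym(3) by simp
    have "(\<lambda>i. rt q * (cnj r * z i)) \<in> LC"
    proof (rule LC_modular)
      show "cnj r * z i = 0" if "i \<notin> J" for i using that by (simp add: z_def J_def)
      fix w assume "w \<in> LC"
      then show "hf w (\<lambda>i. cnj r * z i) \<in> \<O> q"
        using O_cnj[of "r * hf z w"] rO unfolding hf_smult by (simp add: hf_cnj)
    qed
    then obtain x where x: "x \<in> carrier LP" "\<Phi> x = (\<lambda>i. rt q * (cnj r * z i))"
      by (elim exE[OF LC_preimage] conjE)
    have cZ: "c \<odot>\<^bsub>LP\<^esub> Z \<in> carrier LP" using LP.smult_M(1) c(1) Z_LP .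
    have e: "\<Phi> (c \<odot>\<^bsub>LP\<^esub> Z) i / of_int m = \<Phi> x i / 1" for i
    proof -
      have "c * z i / of_int m = (c / of_int m) * z i" by simp
      then show ?thesis unfolding LP.smult_M(2)[OF c(1) Z_LP] x(2) \<Phi>_Z cr by simp
    qed
    have "1 \<in> \<O> q - {0}" by simp
    then have "frac q LP (c \<odot>\<^bsub>LP\<^esub> Z) (of_int m) = frac q LP x 1"
      unfolding LP.frac_eq[OF cZ c(2)] using LP.frac_eq[OF x(1), of 1] e by simp
    then have "c / of_int m \<in> \<O> q" using prim c x(1) unfolding primitive_def by blast
    then have "cnj (rt q * cnj r) \<in> \<O> q" unfolding cr O_cnj .
    then show ?thesis using O_minus by fastforce
  qed
  have r: "rt q * r1 \<in> \<O> q" "rt q * r2 \<in> \<O> q" using rtO rK rO by blast+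
  have "(\<lambda>i. (rt q * r1) * w1 i + (rt q * r2) * w2 i) \<in> LC" using w r by (intro LC_add LC_smult)
  then obtain f where f: "f \<in> carrier LP" "\<Phi> f = (\<lambda>i. (rt q * r1) * w1 i + (rt q * r2) * w2 i)"
    by (elim exE[OF LC_preimage] conjE)
  have "hf z (\<Phi> f) = rt q * (r1 * hf z w1 + r2 * hf z w2)" unfolding f(2) hf_add hf_smult by (simp add: algebra_simps)
  then have zf: "hf z (\<Phi> f) = rt q" using w(3) by simp
  note fz = hf_f_z[OF zf]
  define \<Lambda> where "\<Lambda> = {x \<in> carrier LP. hf z (\<Phi> x) = 0 \<and> hf (\<Phi> f) (\<Phi> x) = 0}"
  have sL: "submodule \<Lambda> (\<O>_ring q) LP"
    by (rule LP.submoduleI) (auto simp: \<Lambda>_def LP.zero_M LP.add_M LP.smult_M hf_add hf_smult)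
  have hypD: "\<exists>\<alpha>\<in>\<O> q. \<exists>\<beta>\<in>\<O> q. x \<in> carrier LP \<and> \<Phi> x = (\<lambda>i. \<alpha> * z i + \<beta> * \<Phi> f i)" if "x \<in> hyp f" for x
    using that hyp_element[OF _ _ f(1)] unfolding hyp_def by blast
  have hypI: "x \<in> hyp f" if x: "x \<in> carrier LP" and ab: "\<alpha> \<in> \<O> q" "\<beta> \<in> \<O> q" "\<Phi> x = (\<lambda>i. \<alpha> * z i + \<beta> * \<Phi> f i)" for x \<alpha> \<beta>
  proof -
    have "x = \<alpha> \<odot>\<^bsub>LP\<^esub> Z \<oplus>\<^bsub>LP\<^esub> \<beta> \<odot>\<^bsub>LP\<^esub> f"
      using x hyp_element[OF ab(1,2) f(1)] ab(3) by (intro LP.\<Psi>_eq) auto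
    then show ?thesis unfolding hyp_def using ab by blast
  qed
  have sH: "submodule (hyp f) (\<O>_ring q) LP"
  proof (rule LP.submoduleI)
    show "hyp f \<subseteq> carrier LP" using hypD by blast
    show "\<zero>\<^bsub>LP\<^esub> \<in> hyp f" by (rule hypI[of _ 0 0]) (auto simp: LP.zero_M)
  next
    fix x y assume xy: "x \<in> hyp f" "y \<in> hyp f"
    obtain \<alpha> \<beta> where "\<alpha> \<in> \<O> q" "\<beta> \<in> \<O> q" "x \<in> carrier LP" "\<Phi> x = (\<lambda>i. \<alpha> * z i + \<beta> * \<Phi> f i)"
      using hypD[OF xy(1)] by blast
    moreover obtain \<gamma> \<delta> where "\<gamma> \<in> \<O> q" "\<delta> \<in> \<O> q" "y \<in> carrier LP" "\<Phi> y = (\<lambda>i. \<gamma> * z i + \<delta> * \<Phi> f i)"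
      using hypD[OF xy(2)] by blast
    ultimately show "x \<oplus>\<^bsub>LP\<^esub> y \<in> hyp f"
      by (intro hypI[of _ "\<alpha> + \<gamma>" "\<beta> + \<delta>"]) (auto simp: LP.add_M algebra_simps)
  next
    fix c x assume c: "c \<in> \<O> q" and x: "x \<in> hyp f"
    obtain \<alpha> \<beta> where "\<alpha> \<in> \<O> q" "\<beta> \<in> \<O> q" "x \<in> carrier LP" "\<Phi> x = (\<lambda>i. \<alpha> * z i + \<beta> * \<Phi> f i)"
      using hypD[OF x] by blast
    then show "c \<odot>\<^bsub>LP\<^esub> x \<in> hyp f"
      using c by (intro hypI[of _ "c * \<alpha>" "c * \<beta>"]) (auto simp: LP.smult_M algebra_simps)
  qed
  have "carrier LP = \<Lambda> <+>\<^bsub>LP\<^esub> hyp f"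
  proof
    show "\<Lambda> <+>\<^bsub>LP\<^esub> hyp f \<subseteq> carrier LP"
      unfolding set_add_def' using hypD LP.add_M(1) unfolding \<Lambda>_def by blast
    show "carrier LP \<subseteq> \<Lambda> <+>\<^bsub>LP\<^esub> hyp f"
    proof
      fix x assume x: "x \<in> carrier LP"
      obtain \<beta> where \<beta>: "\<beta> \<in> \<O> q" "hf z (\<Phi> x) = rt q * \<beta>" using LC_form[OF z_LC \<Phi>_LC[OF x]] by blast
      obtain e1 where e1: "e1 \<in> \<O> q" "hf (\<Phi> f) (\<Phi> x) = rt q * e1" using LC_form[OF \<Phi>_LC[OF f(1)] \<Phi>_LC[OF x]] by blast
      obtain e2 where e2: "e2 \<in> \<O> q" "hf (\<Phi> f) (\<Phi> f) = rt q * e2" using LC_form[OF \<Phi>_LC[OF f(1)] \<Phi>_LC[OF f(1)]] by blast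
      \<comment> \<open>Pairing with \<open>z\<close> fixes \<beta>. Since <f|z> = - p,
        orthogonality of the remainder to \<open>f\<close> reads e1 + \<alpha> - \<beta> e2 =
        0.\<close>
      define \<alpha> where "\<alpha> = \<beta> * e2 - e1"
      have \<alpha>: "\<alpha> \<in> \<O> q" unfolding \<alpha>_def using \<beta> e1 e2 by auto
      have "(\<lambda>i. \<Phi> x i - (\<alpha> * z i + \<beta> * \<Phi> f i)) \<in> LC"
        using \<alpha> \<beta> \<Phi>_LC[OF x] \<Phi>_LC[OF f(1)] z_LC by (intro LC_diff LC_add LC_smult)
      then obtain y where y: "y \<in> carrier LP" "\<Phi> y = (\<lambda>i. \<Phi> x i - (\<alpha> * z i + \<beta> * \<Phi> f i))"
        by (elim exE[OF LC_preimage] conjE)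
      have "y \<in> \<Lambda>" unfolding \<Lambda>_def
        using y \<beta>(2) e1(2) e2(2) by (simp add: hf_diff hf_add hf_smult hf_zz zf fz \<alpha>_def algebra_simps)
      moreover have "\<alpha> \<odot>\<^bsub>LP\<^esub> Z \<oplus>\<^bsub>LP\<^esub> \<beta> \<odot>\<^bsub>LP\<^esub> f \<in> hyp f" unfolding hyp_def using \<alpha> \<beta> by blast
      moreover have "x = y \<oplus>\<^bsub>LP\<^esub> (\<alpha> \<odot>\<^bsub>LP\<^esub> Z \<oplus>\<^bsub>LP\<^esub> \<beta> \<odot>\<^bsub>LP\<^esub> f)"
        using x y hyp_element[OF \<alpha> \<beta>(1) f(1)] by (intro LP.\<Psi>_eq) (auto simp: LP.add_M)
      ultimately show "x \<in> \<Lambda> <+>\<^bsub>LP\<^esub> hyp f" unfolding set_add_def' by blast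
    qed
  qed
  moreover have "\<Lambda> \<inter> hyp f = {\<zero>\<^bsub>LP\<^esub>}"
  proof
    show "{\<zero>\<^bsub>LP\<^esub>} \<subseteq> \<Lambda> \<inter> hyp f" using LP.submoduleD(2)[OF sL] LP.submoduleD(2)[OF sH] by simp
    show "\<Lambda> \<inter> hyp f \<subseteq> {\<zero>\<^bsub>LP\<^esub>}"
    proof
      fix x assume x: "x \<in> \<Lambda> \<inter> hyp f"
      then obtain \<alpha> \<beta> where ab: "x \<in> carrier LP" "\<Phi> x = (\<lambda>i. \<alpha> * z i + \<beta> * \<Phi> f i)" using hypD by blast
      have "hf z (\<Phi> x) = 0" "hf (\<Phi> f) (\<Phi> x) = 0" using x unfolding \<Lambda>_def by auto
      then have "\<beta> = 0" "\<alpha> = 0" unfolding ab(2) hf_add hf_smult hf_zz zf fz by auto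
      then have "x = \<zero>\<^bsub>LP\<^esub>" using ab by (intro LP.\<Psi>_eq) (auto simp: LP.zero_M)
      then show "x \<in> {\<zero>\<^bsub>LP\<^esub>}" by simp
    qed
  qed
  moreover have "form LP x y = 0" if x: "x \<in> \<Lambda>" and y: "y \<in> hyp f" for x y
  proof -
    obtain \<alpha> \<beta> where ab: "y \<in> carrier LP" "\<Phi> y = (\<lambda>i. \<alpha> * z i + \<beta> * \<Phi> f i)" using hypD[OF y] by blast
    have "hf (\<Phi> x) z = 0" "hf (\<Phi> x) (\<Phi> f) = 0"
      using x hf_cnj[of z "\<Phi> x"] hf_cnj[of "\<Phi> f" "\<Phi> x"] unfolding \<Lambda>_def by auto
    then show ?thesis using x LP.form_M[OF _ ab(1)] unfolding \<Lambda>_def ab(2) hf_add hf_smult by simp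
  qed
  moreover have "form LP Z f = rt q" using LP.form_M[OF Z_LP f(1)] zf \<Phi>_Z by simp
  ultimately have "splitting q Z f \<Lambda>"
    unfolding splitting_def orthogonal_sum_def hyp_def[symmetric] using sL sH f(1) by blast
  then show ?thesis by blast
qed

end

section \<open>Lattices with a unimodular Gram matrix\<close>

text \<open>An invertible Gram matrix makes the family independent, so by the dimension bound it
  spans \<open>X\<close>, and coordinates are recovered from inner products through the inverse
  \<open>K\<close>. As \<open>K\<close> is integral, integral inner products give integral
  coordinates.\<close>

lemma lattice_coordinates:
  fixes X :: "'u::euclidean_space set" and b :: "nat \<Rightarrow> 'u" and G K :: "nat \<Rightarrow> nat \<Rightarrow> int"
  assumes b: "\<And>i. i < N \<Longrightarrow> b i \<in> X"
    and gram: "\<And>i j. i < N \<Longrightarrow> j < N \<Longrightarrow> b i \<bullet> b j = of_int (G i j)"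
    and KG: "\<And>i j. i < N \<Longrightarrow> j < N \<Longrightarrow> (\<Sum>k<N. K i k * G k j) = (if i = j then 1 else 0)"
    and dim: "dim X \<le> N" and x: "x \<in> X"
  shows "x = (\<Sum>i<N. (\<Sum>j<N. of_int (K i j) * (b j \<bullet> x)) *\<^sub>R b i)"
proof -
  define \<phi> where "\<phi> i y = (\<Sum>j<N. of_int (K i j) * (b j \<bullet> y))" for i y
  have \<phi>b: "\<phi> i (b k) = (if i = k then 1 else 0)" if "i < N" "k < N" for i k
  proof -
    have "\<phi> i (b k) = of_int (\<Sum>j<N. K i j * G j k)"
      unfolding \<phi>_def of_int_sum of_int_mult using that gram by (intro sum.cong) auto
    then show ?thesis using KG[OF that] by simp
  qed
  have \<phi>s: "\<phi> i (\<Sum>k<N. r k *\<^sub>R b k) = r i" if i: "i < N" for i r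
  proof -
    have "\<phi> i (\<Sum>k<N. r k *\<^sub>R b k) = (\<Sum>j<N. \<Sum>k<N. r k * (of_int (K i j) * (b j \<bullet> b k)))"
      unfolding \<phi>_def inner_sum_right by (simp add: sum_distrib_left ac_simps)
    also have "\<dots> = (\<Sum>k<N. \<Sum>j<N. r k * (of_int (K i j) * (b j \<bullet> b k)))" by (rule sum.swap)
    also have "\<dots> = (\<Sum>k<N. r k * \<phi> i (b k))"
      unfolding \<phi>_def by (simp add: sum_distrib_left)
    also have "\<dots> = (\<Sum>k<N. if i = k then r k else 0)" using i by (intro sum.cong) (auto simp: \<phi>b)
    finally show ?thesis using i by simp
  qed
  have inj: "inj_on b {..<N}"
  proof (rule inj_onI)
    fix i k assume ik: "i \<in> {..<N}" "k \<in> {..<N}" "b i = b k"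
    then show "i = k" using \<phi>b[of i i] \<phi>b[of i k] by (auto split: if_splits)
  qed
  have "independent (b ` {..<N})"
    unfolding independent_explicit
  proof (intro conjI allI impI ballI)
    fix c v assume c: "(\<Sum>v\<in>b ` {..<N}. c v *\<^sub>R v) = 0" and "v \<in> b ` {..<N}"
    then obtain i where i: "i < N" "v = b i" by blast
    have "(\<Sum>k<N. c (b k) *\<^sub>R b k) = 0" using c unfolding sum.reindex[OF inj] by (simp add: comp_def)
    then show "c v = 0" using \<phi>s[OF i(1), of "\<lambda>k. c (b k)"] i(2) by (simp add: \<phi>_def)
  qed simp
  moreover have "card (b ` {..<N}) = N" using card_image[OF inj] by simp
  ultimately have "X \<subseteq> span (b ` {..<N})"
    using b dim by (intro card_ge_dim_independent) auto
  then obtain u where "x = (\<Sum>v\<in>b ` {..<N}. u v *\<^sub>R v)" using x span_finite[of "b ` {..<N}"] by auto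
  then have xr: "x = (\<Sum>k<N. u (b k) *\<^sub>R b k)" unfolding sum.reindex[OF inj] by (simp add: comp_def)
  have "\<phi> i x = u (b i)" if "i < N" for i unfolding xr by (rule \<phi>s[OF that])
  then have "(\<Sum>i<N. \<phi> i x *\<^sub>R b i) = x" using xr by simp
  then show ?thesis unfolding \<phi>_def by simp
qed

definition int_lattice :: "'u::real_inner set \<Rightarrow> bool" where
  "int_lattice X \<longleftrightarrow> 0 \<in> X \<and> (\<forall>x\<in>X. - x \<in> X) \<and> (\<forall>x\<in>X. \<forall>y\<in>X. x + y \<in> X \<and> x \<bullet> y \<in> \<int>)"

lemma int_lattice_combination:
  assumes "int_lattice X" "\<And>i. i \<in> I \<Longrightarrow> n i \<in> \<int>" "\<And>i. i \<in> I \<Longrightarrow> b i \<in> X"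
  shows "(\<Sum>i\<in>I. n i *\<^sub>R b i) \<in> X"
proof -
  have nat: "real k *\<^sub>R x \<in> X" if "x \<in> X" for k x
    using that assms(1) unfolding int_lattice_def by (induction k) (auto simp: scaleR_left_distrib)
  have "m *\<^sub>R x \<in> X" if "m \<in> \<int>" and x: "x \<in> X" for m x
  proof -
    obtain k :: int where k: "m = of_int k" using \<open>m \<in> \<int>\<close> by (auto elim: Ints_cases)
    show ?thesis
    proof (cases "k \<ge> 0")
      case True
      then show ?thesis using nat[OF x, of "nat k"] k by simp
    next
      case False
      then have "m *\<^sub>R x = real (nat (- k)) *\<^sub>R (- x)" using k by simp
      moreover have "- x \<in> X" using assms(1) x unfolding int_lattice_def by blast
      ultimately show ?thesis using nat by metis
    qed
  qed
  then show ?thesis using assms unfolding int_lattice_def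
    by (induction I rule: infinite_finite_induct) auto
qed

text \<open>Both families are integral bases by \<open>lattice_coordinates\<close>, although neither
  was assumed to generate. Mapping one onto the other preserves inner products because the Gram
  matrices coincide.\<close>

lemma lattice_isometry:
  fixes X :: "'u::euclidean_space set" and Y :: "'v::euclidean_space set"
  assumes X: "int_lattice X" and Y: "int_lattice Y"
    and b: "\<And>i. i < N \<Longrightarrow> b i \<in> X" and c: "\<And>i. i < N \<Longrightarrow> c i \<in> Y"
    and gb: "\<And>i j. i < N \<Longrightarrow> j < N \<Longrightarrow> b i \<bullet> b j = of_int (G i j)"
    and gc: "\<And>i j. i < N \<Longrightarrow> j < N \<Longrightarrow> c i \<bullet> c j = of_int (G i j)"
    and KG: "\<And>i j. i < N \<Longrightarrow> j < N \<Longrightarrow> (\<Sum>k<N. K i k * G k j) = (if i = j then 1 else 0)"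
    and dX: "dim X \<le> N" and dY: "dim Y \<le> N"
  shows "\<exists>\<phi>. bij_betw \<phi> X Y \<and> (\<forall>x\<in>X. \<forall>y\<in>X. \<phi> (x + y) = \<phi> x + \<phi> y \<and> \<phi> x \<bullet> \<phi> y = x \<bullet> y)"
proof -
  define n where "n i x = (\<Sum>j<N. of_int (K i j) * (b j \<bullet> x))" for i x
  define m where "m i y = (\<Sum>j<N. of_int (K i j) * (c j \<bullet> y))" for i y
  define \<phi> where "\<phi> x = (\<Sum>i<N. n i x *\<^sub>R c i)" for x
  have xn: "x = (\<Sum>i<N. n i x *\<^sub>R b i)" if "x \<in> X" for x
    unfolding n_def by (rule lattice_coordinates[OF b gb KG dX that])
  have ym: "y = (\<Sum>i<N. m i y *\<^sub>R c i)" if "y \<in> Y" for y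
    unfolding m_def by (rule lattice_coordinates[OF c gc KG dY that])
  have nZ: "n i x \<in> \<int>" if "x \<in> X" for i x
    unfolding n_def using X b that unfolding int_lattice_def by (intro Ints_sum Ints_mult) auto
  have mZ: "m i y \<in> \<int>" if "y \<in> Y" for i y
    unfolding m_def using Y c that unfolding int_lattice_def by (intro Ints_sum Ints_mult) auto
  have \<phi>Y: "\<phi> x \<in> Y" if "x \<in> X" for x
    unfolding \<phi>_def using nZ[OF that] c by (intro int_lattice_combination[OF Y]) auto
  have same: "c j \<bullet> (\<Sum>i<N. r i *\<^sub>R c i) = b j \<bullet> (\<Sum>i<N. r i *\<^sub>R b i)" if "j < N" for j r
    using that by (simp add: inner_sum_right gb gc)
  have c\<phi>: "c j \<bullet> \<phi> x = b j \<bullet> x" if "j < N" "x \<in> X" for j x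
    using same[OF that(1), of "\<lambda>i. n i x"] xn[OF that(2)] unfolding \<phi>_def by simp
  have "\<phi> (x + y) = \<phi> x + \<phi> y" for x y
    unfolding \<phi>_def n_def by (simp add: inner_add_right distrib_left sum.distrib scaleR_left_distrib)
  moreover have "\<phi> x \<bullet> \<phi> y = x \<bullet> y" if "x \<in> X" "y \<in> X" for x y
  proof -
    have "\<phi> x \<bullet> \<phi> y = (\<Sum>i<N. n i x * (c i \<bullet> \<phi> y))" unfolding \<phi>_def[of x] by (simp add: inner_sum_left)
    also have "\<dots> = (\<Sum>i<N. n i x *\<^sub>R b i) \<bullet> y" using c\<phi>[OF _ that(2)] by (simp add: inner_sum_left)
    finally show ?thesis using xn[OF that(1)] by simp
  qed
  moreover have "inj_on \<phi> X"
  proof (rule inj_onI)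
    fix x y assume xy: "x \<in> X" "y \<in> X" "\<phi> x = \<phi> y"
    have "b j \<bullet> x = b j \<bullet> y" if "j < N" for j using c\<phi>[OF that xy(1)] c\<phi>[OF that xy(2)] xy(3) by simp
    then have "n i x = n i y" for i unfolding n_def by simp
    then show "x = y" using xn[OF xy(1)] xn[OF xy(2)] by simp
  qed
  moreover have "y \<in> \<phi> ` X" if y: "y \<in> Y" for y
  proof -
    let ?x = "\<Sum>i<N. m i y *\<^sub>R b i"
    have xX: "?x \<in> X" using mZ[OF y] b by (intro int_lattice_combination[OF X]) auto
    have "b j \<bullet> ?x = c j \<bullet> y" if "j < N" for j using same[OF that, of "\<lambda>i. m i y"] ym[OF y] by simp
    then have "n i ?x = m i y" for i unfolding n_def m_def by simp
    then have "\<phi> ?x = y" using ym[OF y] unfolding \<phi>_def by simp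
    then show ?thesis using xX by (metis imageI)
  qed
  ultimately show ?thesis using \<phi>Y unfolding bij_betw_def by blast
qed

section \<open>The Golay code and the Leech lattice\<close>

definition golay_gen :: "23 \<Rightarrow> 23 option set" where
  "golay_gen i = map_option (\<lambda>x. x - i) ` (- range (\<lambda>x. Some (x * x)))"

text \<open>Adding \<open>D\<close> commutes with complementation and with adding a generator, so it
  passes through each inductive rule.\<close>

lemma golay_sym_diff: "C \<in> golay \<Longrightarrow> D \<in> golay \<Longrightarrow> sym_diff C D \<in> golay"
proof (induction rule: golay.induct)
  case golay_empty then show ?case by simp
next
  case (golay_all C)
  have "sym_diff (- C) D = - sym_diff C D" by auto
  then show ?case using golay.golay_all[OF golay_all.IH[OF golay_all.prems]] by (simp only:)
next
  case (golay_step C i)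
  have "sym_diff (sym_diff C (golay_gen i)) D = sym_diff (sym_diff C D) (golay_gen i)" by auto
  then show ?case using golay.golay_step[OF golay_step.IH[OF golay_step.prems], of i] unfolding golay_gen_def by simp
qed

lemma golay_gen_in: "golay_gen i \<in> golay"
  using golay.golay_step[OF golay.golay_empty, of i] unfolding golay_gen_def by simp

text \<open>Enumerates the projective line with infinity last, so that vectors and codewords become
  lists of length 24.\<close>

definition el :: "nat \<Rightarrow> 23 option" where
  "el k = (if k < 23 then Some (of_nat k) else None)"

lemma of_nat_23_eq: "(of_nat a :: 23) = of_nat b \<longleftrightarrow> a mod 23 = b mod 23"
  using of_nat_eq_iff_cong_CHAR[of a b, where 'a=23] by (simp add: cong_def)

lemma range_of_nat_23: "of_nat ` {..<23} = (UNIV :: 23 set)"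
proof -
  have "inj_on (of_nat :: nat \<Rightarrow> 23) {..<23}" by (rule inj_onI) (simp add: of_nat_23_eq)
  then have "card ((of_nat :: nat \<Rightarrow> 23) ` {..<23}) = CARD(23)" by (simp add: card_image)
  then show ?thesis by (intro card_subset_eq) auto
qed

lemma bij_el: "bij_betw el {..<24} UNIV"
proof -
  have "inj_on el {..<24}"
  proof (rule inj_onI)
    fix j k assume "j \<in> {..<24}" "k \<in> {..<24}" "el j = el k"
    then show "j = k" unfolding el_def by (auto simp: of_nat_23_eq split: if_splits)
  qed
  moreover have "card (UNIV :: 23 option set) = 24" by (simp add: card_UNIV_option)
  ultimately show ?thesis unfolding bij_betw_def
    by (intro conjI card_subset_eq) (auto simp: card_image)
qed

lemma el_surj: obtains k where "k < 24" "a = el k"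
proof -
  have "a \<in> el ` {..<24}" using bij_el unfolding bij_betw_def by simp
  then show ?thesis using that by auto
qed

lemma sum_el: "(\<Sum>i\<in>UNIV. f i) = (\<Sum>k<24. f (el k))"
  by (rule sum.reindex_bij_betw[OF bij_el, symmetric])

text \<open>Marks the quadratic nonresidues modulo 23, with 0 counted as a square.\<close>

definition nonres :: "bool list" where
  "nonres = [False, False, False, False, False, True, False, True, False, False, True, True, False, False, True, True, False, True, False, True, True, True, True]"

text \<open>The generators \<open>golay_gen j\<close> in the order of \<open>el\<close>: the cyclic
  shifts of \<open>nonres\<close>, followed by the entry for infinity, which lies in every
  generator.\<close>

definition golay_rows :: "bool list list" where
  "golay_rows = [
    [False, False, False, False, False, True, False, True, False, False, True, True, False, False, True, True, False, True, False, True, True, True, True, True],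
    [False, False, False, False, True, False, True, False, False, True, True, False, False, True, True, False, True, False, True, True, True, True, False, True],
    [False, False, False, True, False, True, False, False, True, True, False, False, True, True, False, True, False, True, True, True, True, False, False, True],
    [False, False, True, False, True, False, False, True, True, False, False, True, True, False, True, False, True, True, True, True, False, False, False, True],
    [False, True, False, True, False, False, True, True, False, False, True, True, False, True, False, True, True, True, True, False, False, False, False, True],
    [True, False, True, False, False, True, True, False, False, True, True, False, True, False, True, True, True, True, False, False, False, False, False, True],
    [False, True, False, False, True, True, False, False, True, True, False, True, False, True, True, True, True, False, False, False, False, False, True, True],
    [True, False, False, True, True, False, False, True, True, False, True, False, True, True, True, True, False, False, False, False, False, True, False, True],
    [False, False, True, True, False, False, True, True, False, True, False, True, True, True, True, False, False, False, False, False, True, False, True, True],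
    [False, True, True, False, False, True, True, False, True, False, True, True, True, True, False, False, False, False, False, True, False, True, False, True],
    [True, True, False, False, True, True, False, True, False, True, True, True, True, False, False, False, False, False, True, False, True, False, False, True],
    [True, False, False, True, True, False, True, False, True, True, True, True, False, False, False, False, False, True, False, True, False, False, True, True],
    [False, False, True, True, False, True, False, True, True, True, True, False, False, False, False, False, True, False, True, False, False, True, True, True],
    [False, True, True, False, True, False, True, True, True, True, False, False, False, False, False, True, False, True, False, False, True, True, False, True],
    [True, True, False, True, False, True, True, True, True, False, False, False, False, False, True, False, True, False, False, True, True, False, False, True],
    [True, False, True, False, True, True, True, True, False, False, False, False, False, True, False, True, False, False, True, True, False, False, True, True],
    [False, True, False, True, True, True, True, False, False, False, False, False, True, False, True, False, False, True, True, False, False, True, True, True],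
    [True, False, True, True, True, True, False, False, False, False, False, True, False, True, False, False, True, True, False, False, True, True, False, True],
    [False, True, True, True, True, False, False, False, False, False, True, False, True, False, False, True, True, False, False, True, True, False, True, True],
    [True, True, True, True, False, False, False, False, False, True, False, True, False, False, True, True, False, False, True, True, False, True, False, True],
    [True, True, True, False, False, False, False, False, True, False, True, False, False, True, True, False, False, True, True, False, True, False, True, True],
    [True, True, False, False, False, False, False, True, False, True, False, False, True, True, False, False, True, True, False, True, False, True, True, True],
    [True, False, False, False, False, False, True, False, True, False, False, True, True, False, False, True, True, False, True, False, True, True, True, True]]"

definition golay_mem :: "nat \<Rightarrow> nat \<Rightarrow> bool" where
  "golay_mem j k \<longleftrightarrow> golay_rows ! j ! k"

lemma golay_rows_rotate: "golay_rows = map (\<lambda>j. rotate j nonres @ [True]) [0..<23]"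
  by code_simp

lemma nonres_iff: assumes "m < 23" shows "nonres ! m \<longleftrightarrow> (\<forall>t<23. (t * t) mod 23 \<noteq> m)"
proof -
  let ?sq = "[0, 1, 4, 9, 16, 2, 13, 3, 18, 12, 8, 6, 6, 8, 12, 18, 3, 13, 2, 16, 9, 4, 1 :: nat]"
  have "map (\<lambda>t. (t * t) mod 23) [0..<23] = ?sq" by (simp add: upt_rec)
  then have "set (map (\<lambda>t. (t * t) mod 23) [0..<23]) = set ?sq" by (rule arg_cong)
  then have S: "(\<lambda>t. (t * t) mod 23) ` {..<23} = set ?sq" unfolding set_map set_upt atLeast0LessThan .
  have "(\<forall>t<23. (t * t) mod 23 \<noteq> m) \<longleftrightarrow> m \<notin> (\<lambda>t. (t * t) mod 23) ` {..<23}" by auto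
  then have "(\<forall>t<23. (t * t) mod 23 \<noteq> m) \<longleftrightarrow> m \<notin> set ?sq" unfolding S .
  moreover have "list_all (\<lambda>m. nonres ! m = (m \<notin> set ?sq)) [0..<23]" by code_simp
  then have "nonres ! m = (m \<notin> set ?sq)" using assms unfolding list_all_iff by auto
  ultimately show ?thesis by blast
qed

lemma golay_mem_eq:
  assumes "j < 23" shows "golay_mem j 23" "k < 23 \<Longrightarrow> golay_mem j k \<longleftrightarrow> nonres ! ((j + k) mod 23)"
proof -
  have l: "length nonres = 23" by (simp add: nonres_def)
  show "golay_mem j 23" "k < 23 \<Longrightarrow> golay_mem j k \<longleftrightarrow> nonres ! ((j + k) mod 23)"
    unfolding golay_mem_def golay_rows_rotate using assms l by (simp_all add: nth_append nth_rotate)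
qed

lemma el_golay_gen: assumes "k < 24" "j < 23" shows "el k \<in> golay_gen (of_nat j) \<longleftrightarrow> golay_mem j k"
proof (cases "k = 23")
  case True
  have "None \<in> golay_gen (of_nat j)"
    unfolding golay_gen_def by (rule image_eqI[of _ _ None]) auto
  then show ?thesis using True golay_mem_eq(1)[OF assms(2)] by (simp add: el_def)
next
  case False
  then have k: "k < 23" using assms(1) by simp
  have "Some y \<in> golay_gen i \<longleftrightarrow> (\<forall>x. x * x \<noteq> y + i)" for y i
  proof
    assume "Some y \<in> golay_gen i"
    then obtain w where "w \<notin> range (\<lambda>x. Some (x * x))" "Some y = map_option (\<lambda>x. x - i) w"
      unfolding golay_gen_def by blast
    then have "w \<notin> range (\<lambda>x. Some (x * x))" "map_option (\<lambda>x. x - i) w = Some y" by simp_all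
    then show "\<forall>x. x * x \<noteq> y + i" by auto
  next
    assume "\<forall>x. x * x \<noteq> y + i"
    then have "Some (y + i) \<in> - range (\<lambda>x. Some (x * x))" by auto
    then show "Some y \<in> golay_gen i" unfolding golay_gen_def by (intro image_eqI[of _ _ "Some (y + i)"]) auto
  qed
  then have "el k \<in> golay_gen (of_nat j) \<longleftrightarrow> (\<forall>x. x * x \<noteq> (of_nat k + of_nat j :: 23))"
    using k by (simp add: el_def)
  also have "\<dots> \<longleftrightarrow> (\<forall>x\<in>of_nat ` {..<23}. x * x \<noteq> (of_nat k + of_nat j :: 23))"
    unfolding range_of_nat_23 by simp
  also have "\<dots> \<longleftrightarrow> (\<forall>t<23. (of_nat (t * t) :: 23) \<noteq> of_nat (k + j))" by auto
  also have "\<dots> \<longleftrightarrow> nonres ! ((j + k) mod 23)"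
    unfolding of_nat_23_eq by (subst nonres_iff) (auto simp: add.commute)
  finally show ?thesis using golay_mem_eq(2)[OF assms(2) k] by simp
qed

lemma card_el: "card C = length (filter (\<lambda>k. el k \<in> C) [0..<24])"
proof -
  have "bij_betw el {k. k < 24 \<and> el k \<in> C} C"
  proof (rule bij_betw_subset[OF bij_el])
    show "{k. k < 24 \<and> el k \<in> C} \<subseteq> {..<24}" by auto
    have "a \<in> el ` {k. k < 24 \<and> el k \<in> C}" if a: "a \<in> C" for a
      by (rule el_surj[of a]) (use a in auto)
    then show "el ` {k. k < 24 \<and> el k \<in> C} = C" by blast
  qed
  then have "card C = card {k. k < 24 \<and> el k \<in> C}" using bij_betw_same_card by metis
  also have "\<dots> = card (set (filter (\<lambda>k. el k \<in> C) [0..<24]))" by (intro arg_cong[of _ _ card]) auto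
  also have "\<dots> = length (filter (\<lambda>k. el k \<in> C) [0..<24])" by (intro distinct_card) simp
  finally show ?thesis .
qed

text \<open>Self-orthogonality of the code starts from this finite check on the 23 generators; a
  generator paired with itself gives the evenness of its size.\<close>

lemma golay_gen_even: "even (card (golay_gen i \<inter> golay_gen j))" "even (card (golay_gen i))"
proof -
  have *: "list_all (\<lambda>u. list_all (\<lambda>v. even (length (filter id (map2 (\<and>) u v)))) golay_rows) golay_rows"
    by code_simp
  have **: "even (length (filter (\<lambda>k. golay_mem s k \<and> golay_mem t k) [0..<24]))" if "s < 23" "t < 23" for s t
  proof -
    have len: "length golay_rows = 23" "length (golay_rows ! s) = 24" "length (golay_rows ! t) = 24"
      using that unfolding golay_rows_rotate by (simp_all add: nonres_def)
    have "map2 (\<and>) (golay_rows ! s) (golay_rows ! t) = map (\<lambda>k. golay_mem s k \<and> golay_mem t k) [0..<24]"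
      using len by (intro nth_equalityI) (auto simp: golay_mem_def)
    moreover have "even (length (filter id (map2 (\<and>) (golay_rows ! s) (golay_rows ! t))))"
      using * len that nth_mem unfolding list_all_iff by metis
    ultimately show ?thesis by (simp add: filter_map comp_def)
  qed
  obtain i' where i: "i' < 23" "i = of_nat i'" using range_of_nat_23 by auto
  obtain j' where j: "j' < 23" "j = of_nat j'" using range_of_nat_23 by auto
  have e: "card (golay_gen (of_nat s) \<inter> golay_gen (of_nat t)) = length (filter (\<lambda>k. golay_mem s k \<and> golay_mem t k) [0..<24])" if "s < 23" "t < 23" for s t
    using that unfolding card_el by (intro arg_cong[of _ _ length] filter_cong) (auto simp: el_golay_gen)
  show "even (card (golay_gen i \<inter> golay_gen j))" using **[OF i(1) j(1)] e[OF i(1) j(1)] unfolding i j by simp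
  have "even (card (golay_gen i \<inter> golay_gen i))" using **[OF i(1) i(1)] e[OF i(1) i(1)] unfolding i by simp
  then show "even (card (golay_gen i))" by simp
qed

lemma even_card_sym_diff:
  assumes "even (card (A \<inter> (E :: 'x::finite set)))" "even (card (B \<inter> E))"
  shows "even (card (sym_diff A B \<inter> E))"
proof -
  have s: "sym_diff A B \<inter> E = (A \<inter> E - B) \<union> (B \<inter> E - A)" by auto
  have "card (sym_diff A B \<inter> E) = card (A \<inter> E - B) + card (B \<inter> E - A)"
    unfolding s by (rule card_Un_disjoint) auto
  moreover have "card (A \<inter> E) = card (A \<inter> E - B) + card (A \<inter> B \<inter> E)"
    by (subst card_Un_disjoint[symmetric]) (auto intro: arg_cong[of _ _ card])
  moreover have "card (B \<inter> E) = card (B \<inter> E - A) + card (A \<inter> B \<inter> E)"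
    by (subst card_Un_disjoint[symmetric]) (auto intro: arg_cong[of _ _ card])
  ultimately show ?thesis using assms by presburger
qed

lemma even_card_Compl:
  assumes "even (card (A \<inter> (E :: 'x::finite set)))" "even (card E)"
  shows "even (card (- A \<inter> E))"
proof -
  have "card E = card (A \<inter> E) + card (- A \<inter> E)"
    by (subst card_Un_disjoint[symmetric]) (auto intro: arg_cong[of _ _ card])
  then show ?thesis using assms by presburger
qed

text \<open>Parity of intersections is additive under symmetric difference, and complementation
  preserves it for sets of even size. The generators are extended to codewords in one argument
  first, then in the other.\<close>

lemma golay_even:
  assumes "C \<in> golay" "D \<in> golay" shows "even (card (C \<inter> D))"
proof -
  have U: "even (card (UNIV :: 23 option set))" by (simp add: card_UNIV_option)
  have 1: "even (card (C \<inter> golay_gen i)) \<and> even (card C)" if "C \<in> golay" for C i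
    using that
  proof (induction rule: golay.induct)
    case (golay_all C)
    then show ?case using even_card_Compl[of C "golay_gen i"] even_card_Compl[of C UNIV] golay_gen_even(2) U by simp
  next
    case (golay_step C j)
    then show ?case using even_card_sym_diff[of C "golay_gen i" "golay_gen j"] even_card_sym_diff[of C UNIV "golay_gen j"]
        golay_gen_even unfolding golay_gen_def[symmetric] by simp
  qed simp
  show ?thesis using assms(2)
  proof (induction rule: golay.induct)
    case (golay_all D)
    then show ?case using even_card_Compl[of D C] 1[OF assms(1)] by (simp add: Int_commute)
  next
    case (golay_step D j)
    then show ?case using even_card_sym_diff[of D C "golay_gen j"] 1[OF assms(1)]
      unfolding golay_gen_def[symmetric] by (simp add: Int_commute)
  qed simp
qed

section \<open>Integrality of the Leech lattice\<close>

definition leech_vec :: "(23 option \<Rightarrow> int) \<Rightarrow> real ^ 23 option" where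
  "leech_vec x = (1 / sqrt 8) *\<^sub>R (\<chi> i. of_int (x i))"

text \<open>The conditions on all residue classes modulo 4 are condensed to one codeword
  \<open>C\<close>: coordinates are m + 2 on \<open>C\<close> and m off it, modulo 4. This is the
  form in which sums and products can be computed.\<close>

definition leech_rep :: "(23 option \<Rightarrow> int) \<Rightarrow> int \<Rightarrow> 23 option set \<Rightarrow> bool" where
  "leech_rep x m C \<longleftrightarrow> C \<in> golay \<and> (\<forall>i. [x i = m + (if i \<in> C then 2 else 0)] (mod 4)) \<and> [(\<Sum>i\<in>UNIV. x i) = 4 * m] (mod 8)"

lemma cong4_cases:
  fixes x :: int
  assumes "[x = m + (if p then 2 else 0)] (mod 4)"
  shows "[x = m] (mod 2)" "[k = m] (mod 4) \<Longrightarrow> [x = k] (mod 4) \<longleftrightarrow> \<not> p"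
    "[k = m + 2] (mod 4) \<Longrightarrow> [x = k] (mod 4) \<longleftrightarrow> p"
    "\<not> [k = m] (mod 4) \<Longrightarrow> \<not> [k = m + 2] (mod 4) \<Longrightarrow> \<not> [x = k] (mod 4)"
    "[- x = - m + (if p then 2 else 0)] (mod 4)"
  using assms unfolding cong_iff_dvd_diff by (cases p; simp; presburger)+

lemma cong4_of_cong2:
  fixes x :: int
  assumes "[x = m] (mod 2)"
  shows "[x = m + (if [x = m + 2] (mod 4) then 2 else 0)] (mod 4)"
  using assms unfolding cong_iff_dvd_diff by (cases "4 dvd x - (m + 2)"; simp; presburger)

lemma cong4_add:
  fixes x y :: int
  assumes "[x = m + (if p then 2 else 0)] (mod 4)" "[y = n + (if s then 2 else 0)] (mod 4)"
  shows "[x + y = (m + n) + (if p \<noteq> s then 2 else 0)] (mod 4)"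
  using assms unfolding cong_iff_dvd_diff by (cases p; cases s; simp; presburger)

text \<open>Only the classes of \<open>m\<close> and m + 2 modulo 4 occur. One is the codeword, the
  other its complement, and every other class gives the empty codeword.\<close>

lemma leech_iff: "v \<in> leech \<longleftrightarrow> (\<exists>x m C. v = leech_vec x \<and> leech_rep x m C)"
proof
  assume "v \<in> leech"
  then obtain x m where x: "v = leech_vec x" "\<And>i. [x i = m] (mod 2)" "\<And>k. {i. [x i = k] (mod 4)} \<in> golay"
    "[(\<Sum>i\<in>UNIV. x i) = 4 * m] (mod 8)"
    unfolding leech_def leech_vec_def by auto
  note cong4_of_cong2[OF x(2)]
  then have "leech_rep x m {i. [x i = m + 2] (mod 4)}"
    unfolding leech_rep_def mem_Collect_eq using x(3,4) by blast
  then show "\<exists>x m C. v = leech_vec x \<and> leech_rep x m C" using x(1) by blast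
next
  assume "\<exists>x m C. v = leech_vec x \<and> leech_rep x m C"
  then obtain x m C where v: "v = leech_vec x" and C: "C \<in> golay"
    and x: "\<And>i. [x i = m + (if i \<in> C then 2 else 0)] (mod 4)" "[(\<Sum>i\<in>UNIV. x i) = 4 * m] (mod 8)"
    unfolding leech_rep_def by blast
  have "[x i = m] (mod 2)" for i using cong4_cases(1)[OF x(1)] .
  moreover have "{i. [x i = k] (mod 4)} \<in> golay" for k
  proof -
    consider "[k = m] (mod 4)" | "[k = m + 2] (mod 4)" | "\<not> [k = m] (mod 4)" "\<not> [k = m + 2] (mod 4)" by blast
    then show ?thesis
    proof cases
      case 1
      have "[x i = k] (mod 4) \<longleftrightarrow> i \<notin> C" for i
        by (rule cong4_cases(2)[OF x(1) 1])
      then have "{i. [x i = k] (mod 4)} = - C" by auto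
      then show ?thesis using C golay.golay_all by simp
    next
      case 2
      have "[x i = k] (mod 4) \<longleftrightarrow> i \<in> C" for i
        by (rule cong4_cases(3)[OF x(1) 2])
      then show ?thesis using C by simp
    next
      case 3
      have "\<not> [x i = k] (mod 4)" for i
        by (rule cong4_cases(4)[OF x(1) 3])
      then show ?thesis using golay.golay_empty by simp
    qed
  qed
  ultimately show "v \<in> leech" unfolding leech_def v leech_vec_def using x(2) by blast
qed

lemma leech_vec_inner: "leech_vec x \<bullet> leech_vec y = of_int (\<Sum>i\<in>UNIV. x i * y i) / 8"
proof -
  have 1: "(\<chi> i. real_of_int (x i)) \<bullet> (\<chi> i. real_of_int (y i)) = of_int (\<Sum>i\<in>UNIV. x i * y i)"
    by (simp add: inner_vec_def)
  have 2: "1 / sqrt 8 * (1 / sqrt 8) = (1 / 8 :: real)" by simp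
  show ?thesis
    unfolding leech_vec_def inner_scaleR_left inner_scaleR_right 1 mult.assoc[symmetric] 2 by simp
qed

lemma sum_indicator: "(\<Sum>i\<in>UNIV. if i \<in> C then 1 else 0) = int (card (C :: 'x::finite set))"
  by (simp add: sum.If_cases)

text \<open>Write x = m + 2 c + 4 r and y = m' + 2 c' + 4 r' with indicators c, c'. Modulo 8 the two
  sum conditions contribute 4 m m' - 20 m m' = - 16 m m', and the remaining 4 * (sum of c c')
  vanishes because codewords meet in an even number of places.\<close>

lemma leech_rep_inner:
  assumes "leech_rep x m C" "leech_rep y m' C'"
  shows "8 dvd (\<Sum>i\<in>UNIV. x i * y i)"
proof -
  define c where "c i = (if i \<in> C then 1 else 0 :: int)" for i
  define c' where "c' i = (if i \<in> C' then 1 else 0 :: int)" for i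
  define r where "r i = (x i - m - 2 * c i) div 4" for i
  define r' where "r' i = (y i - m' - 2 * c' i) div 4" for i
  have "4 dvd x i - m - 2 * c i" for i
  proof -
    have "4 dvd x i - (m + (if i \<in> C then 2 else 0))"
      using assms(1) unfolding leech_rep_def cong_iff_dvd_diff by blast
    moreover have "x i - (m + (if i \<in> C then 2 else 0)) = x i - m - 2 * c i" by (simp add: c_def)
    ultimately show ?thesis by simp
  qed
  then have x: "x i = m + 2 * c i + 4 * r i" for i unfolding r_def by simp
  have "4 dvd y i - m' - 2 * c' i" for i
  proof -
    have "4 dvd y i - (m' + (if i \<in> C' then 2 else 0))"
      using assms(2) unfolding leech_rep_def cong_iff_dvd_diff by blast
    moreover have "y i - (m' + (if i \<in> C' then 2 else 0)) = y i - m' - 2 * c' i" by (simp add: c'_def)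
    ultimately show ?thesis by simp
  qed
  then have y: "y i = m' + 2 * c' i + 4 * r' i" for i unfolding r'_def by simp
  have card24: "CARD(23 option) = 24" by (simp add: card_UNIV_option)
  obtain k where k: "(\<Sum>i\<in>UNIV. x i) = 4 * m + 8 * k"
    using assms(1) unfolding leech_rep_def cong_iff_dvd_diff by (metis add_diff_cancel_left' diff_add_cancel dvdE add.commute)
  obtain k' where k': "(\<Sum>i\<in>UNIV. y i) = 4 * m' + 8 * k'"
    using assms(2) unfolding leech_rep_def cong_iff_dvd_diff by (metis add_diff_cancel_left' diff_add_cancel dvdE add.commute)
  have "even (card (C \<inter> C'))" using golay_even assms unfolding leech_rep_def by blast
  moreover have "(\<Sum>i\<in>UNIV. c i * c' i) = int (card (C \<inter> C'))"
    unfolding sum_indicator[symmetric] by (intro sum.cong) (auto simp: c_def c'_def)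
  ultimately obtain l where l: "(\<Sum>i\<in>UNIV. c i * c' i) = 2 * l" by (metis evenE of_nat_mult of_nat_numeral)
  have sx: "24 * m + 2 * sum c UNIV + 4 * sum r UNIV = 4 * m + 8 * k"
    unfolding k[symmetric] x by (simp add: sum.distrib sum_distrib_left card24)
  have "(\<Sum>i\<in>UNIV. x i * y i) = (\<Sum>i\<in>UNIV. m * y i + m' * (2 * c i + 4 * r i) + 4 * (c i * c' i)
      + 8 * (c i * r' i + r i * c' i + 2 * (r i * r' i)))"
    unfolding x by (intro sum.cong refl) (simp add: y algebra_simps)
  also have "\<dots> = m * (\<Sum>i\<in>UNIV. y i) + m' * (2 * sum c UNIV + 4 * sum r UNIV) + 4 * (\<Sum>i\<in>UNIV. c i * c' i)
      + 8 * (\<Sum>i\<in>UNIV. c i * r' i + r i * c' i + 2 * (r i * r' i))"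
    by (simp only: sum.distrib sum_distrib_left[symmetric])
  also have "2 * sum c UNIV + 4 * sum r UNIV = 8 * k - 20 * m" using sx by simp
  finally have "(\<Sum>i\<in>UNIV. x i * y i) = 8 * (m * k' + m' * k - 2 * m * m' + l
      + (\<Sum>i\<in>UNIV. c i * r' i + r i * c' i + 2 * (r i * r' i)))"
    unfolding k' l by (simp add: algebra_simps)
  then show ?thesis by simp
qed

lemma int_lattice_leech: "int_lattice leech"
proof -
  have "leech_vec (\<lambda>_. 0) = 0" unfolding leech_vec_def by (simp add: vec_eq_iff)
  moreover have "leech_rep (\<lambda>_. 0) 0 {}" unfolding leech_rep_def using golay.golay_empty by simp
  ultimately have 0: "0 \<in> leech" unfolding leech_iff by metis
  have "leech_rep (\<lambda>i. - x i) (- m) C" if "leech_rep x m C" for x m C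
  proof -
    have "[- x i = - m + (if i \<in> C then 2 else 0)] (mod 4)" for i
      using that unfolding leech_rep_def by (intro cong4_cases(5)) blast
    then show ?thesis using that unfolding leech_rep_def by (auto simp: sum_negf cong_minus_minus_iff)
  qed
  moreover have "- leech_vec x = leech_vec (\<lambda>i. - x i)" for x
    unfolding leech_vec_def by (simp add: vec_eq_iff)
  ultimately have "- v \<in> leech" if "v \<in> leech" for v using that unfolding leech_iff by metis
  moreover have "v + w \<in> leech" "v \<bullet> w \<in> \<int>" if vw: "v \<in> leech" "w \<in> leech" for v w
  proof -
    obtain x m C where x: "v = leech_vec x" "leech_rep x m C" using vw unfolding leech_iff by blast
    obtain y m' C' where y: "w = leech_vec y" "leech_rep y m' C'" using vw unfolding leech_iff by blast
    have "[x i + y i = (m + m') + (if i \<in> sym_diff C C' then 2 else 0)] (mod 4)" for i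
    proof -
      have "[x i = m + (if i \<in> C then 2 else 0)] (mod 4)" "[y i = m' + (if i \<in> C' then 2 else 0)] (mod 4)"
        using x(2) y(2) unfolding leech_rep_def by blast+
      from cong4_add[OF this] show ?thesis by (rule back_subst[of "\<lambda>t. [x i + y i = (m + m') + t] (mod 4)"]) auto
    qed
    moreover have "[(\<Sum>i\<in>UNIV. x i + y i) = 4 * (m + m')] (mod 8)"
      using x(2) y(2) cong_add[of "sum x UNIV" "4 * m" 8 "sum y UNIV" "4 * m'"] unfolding leech_rep_def
      by (simp add: sum.distrib distrib_left)
    ultimately have "leech_rep (\<lambda>i. x i + y i) (m + m') (sym_diff C C')"
      using x(2) y(2) golay_sym_diff unfolding leech_rep_def by blast
    moreover have "v + w = leech_vec (\<lambda>i. x i + y i)"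
      unfolding x(1) y(1) leech_vec_def by (simp add: vec_eq_iff add_divide_distrib)
    ultimately show "v + w \<in> leech" unfolding leech_iff by blast
    obtain t where "(\<Sum>i\<in>UNIV. x i * y i) = 8 * t" using leech_rep_inner[OF x(2) y(2)] by blast
    then have "v \<bullet> w = of_int t" unfolding x(1) y(1) leech_vec_inner by simp
    then show "v \<bullet> w \<in> \<int>" by simp
  qed
  ultimately show ?thesis unfolding int_lattice_def using 0 by blast
qed

section \<open>Matching bases\<close>

text \<open>A pair \<open>(a, b)\<close> stands for \<open>a + b \<theta>\<close>. A member of \<open>lattice_basis\<close> lists the coefficients of a
  vector at the 13 lines and, divided by \<open>rt q\<close>, at the 13 points; \<open>basis_values\<close> lists its
  coordinates at the points. Index 23 of \<open>leech_basis\<close> is the point at infinity, and \<open>golay_words\<close>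
  lists for each of these vectors the translates that add up to its Golay codeword. The two bases
  were found by a computer search for minimal vectors with the same Gram matrix.\<close>

definition lattice_basis :: "((nat \<times> int \<times> int) list \<times> (nat \<times> int \<times> int) list) list" where
  "lattice_basis = [
    ([(11, 0, 1), (4, 0, 1)], [(7, -2, 1), (5, -1, 1)]),
    ([(9, 1, 0), (0, 1, 0)], [(9, -1, 2), (0, 0, 1)]),
    ([], [(9, 0, 1), (7, 0, -1)]),
    ([(12, 1, 0), (6, 1, 0)], [(2, -1, 2), (9, 0, 1)]),
    ([(2, 1, 0), (1, -1, 0)], []),
    ([(12, 0, 1), (2, 0, 1)], [(2, -2, 1), (12, -1, 1)]),
    ([(11, 1, 0), (7, 1, 0)], [(7, -1, 2), (10, 0, 1)]),
    ([(11, 1, 0), (4, 1, 0)], [(7, -1, 2), (1, 0, 1)]),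
    ([(12, 1, 0), (2, -1, 0)], []),
    ([(9, 0, 1), (6, 0, 1)], [(9, -2, 1), (5, -1, 1)]),
    ([(10, 1, 0), (0, 1, 0)], [(0, -1, 2), (6, 0, 1)]),
    ([(8, 1, 0), (5, 1, 0)], [(8, -1, 2), (4, 0, 1)]),
    ([(8, 1, 0), (1, 1, 0)], [(4, -1, 2), (2, 0, 1)]),
    ([(8, 0, 1), (6, 0, -1)], []),
    ([], [(10, 0, 1), (4, 0, -1)]),
    ([(9, 1, 0), (1, 1, 0)], [(10, -1, 2), (9, 0, 1)]),
    ([(6, 1, 0), (5, -1, 0)], []),
    ([(5, 0, 1), (4, 0, 1)], [(5, -2, 1), (6, -1, 1)]),
    ([(10, 1, 0), (1, 1, 0)], [(10, -1, 2), (1, 0, 1)]),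
    ([(12, 1, 0), (9, 1, 0)], [(12, -1, 2), (8, 0, 1)]),
    ([(7, 1, 0), (0, -1, 0)], []),
    ([(6, 1, 0), (1, 1, 0)], [(2, -1, 2), (4, 0, 1)]),
    ([(11, 1, 0), (3, 1, 0)], [(12, -1, 2), (4, 0, 1)]),
    ([(8, 0, 1), (7, 0, -1)], [])]"

definition basis_values :: "(int \<times> int) list list" where
  "basis_values = [
    [(0, 1), (0, 1), (0, 0), (0, 0), (0, 1), (-1, 0), (0, 0), (0, -1), (0, 0), (0, 0), (0, 0), (0, 1), (0, 1)],
    [(-1, 1), (1, 0), (0, 0), (1, 0), (0, 0), (1, 0), (0, 0), (0, 0), (0, 0), (-1, 0), (1, 0), (0, 0), (1, 0)],
    [(0, 0), (0, 0), (0, 0), (0, 0), (0, 0), (0, 0), (0, 0), (2, -1), (0, 0), (-2, 1), (0, 0), (0, 0), (0, 0)],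
    [(1, 0), (0, 0), (-1, 0), (0, 0), (0, 0), (0, 0), (1, 0), (1, 0), (1, 0), (-1, 1), (0, 0), (0, 0), (1, 0)],
    [(0, 0), (-1, 0), (0, 0), (1, 0), (-1, 0), (1, 0), (0, 0), (0, 0), (0, 0), (0, 0), (-1, 0), (1, 0), (0, 0)],
    [(0, 1), (0, 0), (0, -1), (0, 1), (0, 0), (0, 1), (0, 0), (0, 0), (0, 1), (0, 0), (0, 0), (0, 1), (-1, 0)],
    [(0, 0), (1, 0), (0, 0), (1, 0), (0, 0), (0, 0), (0, 0), (-1, 0), (1, 0), (0, 0), (-1, 1), (1, 0), (1, 0)],
    [(1, 0), (-1, 1), (0, 0), (0, 0), (1, 0), (1, 0), (0, 0), (-1, 0), (0, 0), (0, 0), (0, 0), (1, 0), (1, 0)],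
    [(1, 0), (0, 0), (0, 0), (-1, 0), (0, 0), (-1, 0), (0, 0), (0, 0), (1, 0), (0, 0), (0, 0), (-1, 0), (1, 0)],
    [(0, 0), (0, 0), (0, 1), (0, 0), (0, 0), (-1, 0), (0, 1), (0, 1), (0, 0), (0, -1), (0, 1), (0, 0), (0, 1)],
    [(-1, 0), (1, 0), (0, 0), (1, 0), (0, 0), (0, 0), (-1, 1), (0, 0), (0, 0), (1, 0), (1, 0), (1, 0), (0, 0)],
    [(0, 0), (1, 0), (0, 0), (0, 0), (-1, 1), (1, 0), (1, 0), (0, 0), (-1, 0), (1, 0), (0, 0), (1, 0), (0, 0)],
    [(0, 0), (1, 0), (-1, 1), (0, 0), (-1, 0), (0, 0), (0, 0), (0, 0), (1, 0), (1, 0), (1, 0), (1, 0), (0, 0)],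
    [(0, 0), (0, 0), (0, -1), (0, 0), (0, 1), (0, 0), (0, -1), (0, -1), (0, 1), (0, 0), (0, 0), (0, 1), (0, 0)],
    [(0, 0), (0, 0), (0, 0), (0, 0), (2, -1), (0, 0), (0, 0), (0, 0), (0, 0), (0, 0), (-2, 1), (0, 0), (0, 0)],
    [(0, 0), (1, 0), (1, 0), (0, 0), (1, 0), (1, 0), (0, 0), (0, 0), (0, 0), (-1, 1), (-1, 0), (0, 0), (1, 0)],
    [(0, 0), (-1, 0), (1, 0), (0, 0), (0, 0), (-1, 0), (0, 0), (1, 0), (-1, 0), (1, 0), (0, 0), (0, 0), (0, 0)],
    [(0, 1), (0, 1), (0, 0), (0, 0), (0, 1), (0, -1), (-1, 0), (0, 1), (0, 1), (0, 0), (0, 0), (0, 0), (0, 0)],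
    [(1, 0), (-1, 1), (1, 0), (0, 0), (1, 0), (0, 0), (1, 0), (0, 0), (0, 0), (0, 0), (-1, 0), (1, 0), (0, 0)],
    [(1, 0), (0, 0), (1, 0), (0, 0), (0, 0), (1, 0), (0, 0), (0, 0), (-1, 1), (1, 0), (1, 0), (0, 0), (-1, 0)],
    [(-1, 0), (-1, 0), (0, 0), (0, 0), (0, 0), (0, 0), (0, 0), (1, 0), (1, 0), (-1, 0), (1, 0), (0, 0), (0, 0)],
    [(0, 0), (1, 0), (-1, 0), (0, 0), (-1, 1), (0, 0), (1, 0), (1, 0), (0, 0), (1, 0), (1, 0), (0, 0), (0, 0)],
    [(0, 0), (1, 0), (0, 0), (1, 0), (-1, 1), (0, 0), (1, 0), (1, 0), (0, 0), (0, 0), (0, 0), (1, 0), (-1, 0)],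
    [(0, 0), (0, 0), (0, 0), (0, -1), (0, 1), (0, 0), (0, 0), (0, -1), (0, 0), (0, 1), (0, -1), (0, 1), (0, 0)]]"

definition leech_basis :: "int list list" where
  "leech_basis = [
    [2, 2, 0, 0, 0, 0, 2, 0, 0, 0, -2, -2, 2, 0, 0, 0, 0, 0, 0, 0, 2, 2, 0, 0],
    [2, 2, 0, 2, 0, 0, 0, 0, 0, 0, 0, 0, -2, 0, 0, 2, 0, 0, 0, 0, 0, -2, 2, 2],
    [0, 0, 0, 0, 0, -2, 0, -2, 0, 0, 0, 0, 2, -2, 0, 2, 0, 0, 0, 2, 0, -2, 0, 2],
    [0, 0, 0, 0, 0, 0, 0, -2, 0, 0, 0, 0, 2, 0, -2, 2, 0, -2, 2, 2, -2, 0, 0, 0],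
    [0, 0, 0, -2, 0, 0, 0, 0, 0, -2, 0, 0, -2, -2, -2, 0, -2, 0, -2, 0, -2, 0, 0, 0],
    [2, 0, 2, 0, 0, -2, 0, 0, 2, -2, 0, 2, 0, 0, -2, -2, 0, 0, 0, 0, 0, 0, 0, 0],
    [1, 3, 1, -1, 1, 1, 1, -1, -1, -1, 1, -1, -1, 1, -1, 1, 1, 1, -1, -1, -1, 1, 1, -1],
    [1, 1, -1, -1, -1, 1, 1, 1, -1, -1, 1, -1, -1, -1, -1, -1, 1, -3, -1, 1, 1, 1, 1, -1],
    [0, 0, 0, 0, 0, 0, 0, -2, 0, 2, 0, -2, 2, 2, 0, 0, 0, -2, 2, 0, 0, 0, 0, -2],
    [0, 0, -2, 0, 2, 0, -2, 0, 0, 0, 0, -2, 0, 2, 2, 2, 0, 0, 0, 0, 0, 0, -2, 0],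
    [1, -1, 1, 1, 1, 1, 1, 1, -1, -1, 1, 1, -1, 1, 1, 1, -1, 3, -1, -1, 1, 1, 1, 1],
    [-1, 1, 1, 1, 1, 1, 1, 3, -1, 1, -1, 1, -1, -1, -1, -1, -1, 1, -1, 1, -1, 1, -1, 1],
    [0, 0, 0, 2, 0, 0, 2, 0, 0, 0, 2, 0, 0, 2, 0, 0, -2, 2, 0, 0, -2, 2, 0, 0],
    [1, 1, 1, 1, 1, -1, 3, -1, 1, -1, -1, 1, 1, -1, -1, -1, 1, -1, -1, -1, 1, 1, 1, -1],
    [0, 0, 0, -4, 0, 0, 0, 0, 0, 0, 0, 0, 0, 0, 0, 0, 4, 0, 0, 0, 0, 0, 0, 0],
    [0, 2, 0, -2, 0, 0, 0, 0, -2, 2, 0, 0, 0, -2, 0, 0, 2, 0, 0, 0, 0, -2, 2, 0],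
    [-2, -2, 0, -2, 0, 0, 0, 0, 0, 0, -2, 0, 0, 0, 2, 0, -2, 0, 0, 0, 2, 0, -2, 0],
    [0, 0, 0, 0, 0, -2, 0, 0, 2, 2, 0, 0, 0, 0, 0, 2, 0, 0, 0, 0, 2, 2, 2, -2],
    [-1, 1, -1, -3, -1, -1, -1, 1, -1, -1, -1, -1, 1, -1, -1, -1, 1, -1, -1, 1, 1, 1, -1, -1],
    [-1, -1, 1, 1, -1, -1, -1, 1, 1, 1, 1, 1, -1, -1, 1, -3, -1, -1, -1, -1, 1, 1, -1, 1],
    [0, -2, -2, 2, 0, -2, 0, -2, 0, -2, 0, 0, 0, 0, 0, 2, 0, 0, 0, 0, 0, -2, 0, 0],
    [-1, -1, 1, 3, 1, 1, 1, 1, 1, 1, -1, 1, 1, 1, -1, 1, -1, 1, 1, 1, -1, 1, -1, 1],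
    [-1, 1, 1, 1, 1, -1, -1, 1, 1, -1, -1, 1, 1, -1, -1, 1, -1, 3, -1, 1, -1, 1, -1, 1],
    [0, 0, 0, 0, 0, 0, 2, 0, -2, 0, -2, 0, 2, -2, 0, -2, 0, 0, 0, 0, 0, 2, 2, 0]]"

definition gram_mat :: "int list list" where
  "gram_mat = [
    [4, 0, 0, 0, -1, 0, 1, 1, 1, 0, 0, 0, 0, 2, 0, 0, 0, 1, 1, -1, -1, 0, 0, 2],
    [0, 4, 1, 0, 0, 0, 1, 0, -1, 0, 1, 0, 0, 0, -1, 1, -2, 0, -2, -1, 1, 0, 0, -1],
    [0, 1, 4, 2, 0, 0, -1, -1, 0, 0, -1, -1, -1, 0, 0, 1, 0, 0, 0, -1, 2, 0, 1, 0],
    [0, 0, 2, 4, 0, 0, 0, 0, 2, 0, -2, -1, 0, 0, 0, 0, -1, 0, 0, -2, 1, 1, 0, 0],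
    [-1, 0, 0, 0, 4, 1, 1, 1, -2, -1, 0, 1, 0, 0, 0, 0, 0, -1, 1, 0, 0, -1, 1, 0],
    [0, 0, 0, 0, 1, 4, 0, 0, -1, -2, 0, 0, 0, 2, 0, -1, -1, 0, 0, 1, 0, 0, 1, 0],
    [1, 1, -1, 0, 1, 0, 4, 1, 0, 0, 1, 0, 1, 1, 1, 1, -2, 0, 0, -2, -1, -1, 0, 0],
    [1, 0, -1, 0, 1, 0, 1, 4, 0, -1, -1, 0, -1, 1, 1, 1, -1, 0, 2, 0, -1, -2, -2, 1],
    [1, -1, 0, 2, -2, -1, 0, 0, 4, 1, -2, -2, 0, 0, 0, 0, 0, 1, 0, -1, 0, 0, -2, 0],
    [0, 0, 0, 0, -1, -2, 0, -1, 1, 4, 0, -1, 0, -2, 0, -1, 1, 0, 0, -1, 1, 0, 0, -2],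
    [0, 1, -1, -2, 0, 0, 1, -1, -2, 0, 4, 1, 2, 0, -1, -1, 0, 0, -2, 0, 0, 1, 1, 0],
    [0, 0, -1, -1, 1, 0, 0, 0, -2, -1, 1, 4, 1, 0, -1, 0, 0, -1, 0, 1, -2, 2, 2, 1],
    [0, 0, -1, 0, 0, 0, 1, -1, 0, 0, 2, 1, 4, 0, -2, -2, -1, 0, -2, 0, 0, 2, 1, 0],
    [2, 0, 0, 0, 0, 2, 1, 1, 0, -2, 0, 0, 0, 4, 0, 0, -1, 1, 0, 0, 0, 0, 0, 2],
    [0, -1, 0, 0, 0, 0, 1, 1, 0, 0, -1, -1, -2, 0, 4, 2, 0, 0, 2, -1, -1, -2, -1, 0],
    [0, 1, 1, 0, 0, -1, 1, 1, 0, -1, -1, 0, -2, 0, 2, 4, -1, 0, 1, -1, -1, -2, -1, 1],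
    [0, -2, 0, -1, 0, -1, -2, -1, 0, 1, 0, 0, -1, -1, 0, -1, 4, 0, 1, 1, 0, 0, 0, 0],
    [1, 0, 0, 0, -1, 0, 0, 0, 1, 0, 0, -1, 0, 1, 0, 0, 0, 4, 0, 0, 0, 0, 0, 0],
    [1, -2, 0, 0, 1, 0, 0, 2, 0, 0, -2, 0, -2, 0, 2, 1, 1, 0, 4, 0, -1, -2, 0, 1],
    [-1, -1, -1, -2, 0, 1, -2, 0, -1, -1, 0, 1, 0, 0, -1, -1, 1, 0, 0, 4, -1, 0, 0, 0],
    [-1, 1, 2, 1, 0, 0, -1, -1, 0, 1, 0, -2, 0, 0, -1, -1, 0, 0, -1, -1, 4, 0, 0, -1],
    [0, 0, 0, 1, -1, 0, -1, -2, 0, 0, 1, 2, 2, 0, -2, -2, 0, 0, -2, 0, 0, 4, 2, 0],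
    [0, 0, 1, 0, 1, 1, 0, -2, -2, 0, 1, 2, 1, 0, -1, -1, 0, 0, 0, 0, 0, 2, 4, 0],
    [2, -1, 0, 0, 0, 0, 0, 1, 0, -2, 0, 1, 0, 2, 0, 1, 0, 0, 1, 0, -1, 0, 0, 4]]"

definition gram_inv :: "int list list" where
  "gram_inv = [
    [16, 14, -37, 21, 7, -6, -29, 31, 41, -5, 19, -3, 13, 7, 28, 32, 19, -15, -25, 22, 25, -19, 63, -13],
    [14, 32, -51, 32, 10, -22, -57, 36, 76, -15, 37, 11, 17, 23, 48, 23, 20, -23, -30, 24, 28, -53, 97, -21],
    [-37, -51, 106, -62, -20, 28, 97, -84, -133, 20, -63, -2, -37, -32, -87, -75, -50, 45, 67, -57, -65, 75, -189, 39],
    [21, 32, -62, 42, 10, -24, -64, 42, 83, -17, 42, 14, 19, 24, 54, 31, 24, -26, -39, 30, 36, -63, 112, -26],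
    [7, 10, -20, 10, 6, -4, -18, 17, 25, -2, 12, -4, 8, 6, 16, 18, 10, -9, -11, 12, 12, -8, 35, -7],
    [-6, -22, 28, -24, -4, 26, 45, -10, -54, 18, -29, -26, -5, -22, -33, 9, -2, 13, 17, -7, -12, 60, -59, 17],
    [-29, -57, 97, -64, -18, 45, 112, -65, -144, 31, -72, -28, -30, -45, -91, -39, -34, 43, 60, -43, -53, 111, -184, 43],
    [31, 36, -84, 42, 17, -10, -65, 80, 98, -8, 42, -16, 33, 16, 65, 79, 49, -36, -57, 51, 56, -33, 150, -26],
    [41, 76, -133, 83, 25, -54, -144, 98, 196, -39, 94, 30, 42, 54, 124, 64, 53, -59, -86, 64, 78, -137, 254, -55],
    [-5, -15, 20, -17, -2, 18, 31, -8, -39, 14, -20, -20, -3, -14, -24, 7, -2, 9, 14, -5, -10, 44, -43, 12],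
    [19, 37, -63, 42, 12, -29, -72, 42, 94, -20, 48, 18, 19, 29, 59, 26, 22, -28, -38, 29, 35, -71, 119, -28],
    [-3, 11, -2, 14, -4, -26, -28, -16, 30, -20, 18, 44, -8, 17, 17, -43, -15, -1, -5, -11, -3, -66, 17, -10],
    [13, 17, -37, 19, 8, -5, -30, 33, 42, -3, 19, -8, 16, 9, 28, 35, 21, -16, -22, 22, 23, -14, 64, -12],
    [7, 23, -32, 24, 6, -22, -45, 16, 54, -14, 29, 17, 9, 22, 33, 3, 7, -15, -17, 11, 14, -50, 63, -17],
    [28, 48, -87, 54, 16, -33, -91, 65, 124, -24, 59, 17, 28, 33, 80, 45, 36, -38, -57, 43, 52, -85, 164, -35],
    [32, 23, -75, 31, 18, 9, -39, 79, 64, 7, 26, -43, 35, 3, 45, 102, 53, -31, -46, 54, 53, 15, 119, -18],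
    [19, 20, -50, 24, 10, -2, -34, 49, 53, -2, 22, -15, 21, 7, 36, 53, 32, -21, -33, 32, 34, -11, 86, -14],
    [-15, -23, 45, -26, -9, 13, 43, -36, -59, 9, -28, -1, -16, -15, -38, -31, -21, 20, 28, -24, -27, 33, -82, 17],
    [-25, -30, 67, -39, -11, 17, 60, -57, -86, 14, -38, -5, -22, -17, -57, -46, -33, 28, 50, -36, -44, 52, -124, 24],
    [22, 24, -57, 30, 12, -7, -43, 51, 64, -5, 29, -11, 22, 11, 43, 54, 32, -24, -36, 36, 38, -21, 98, -18],
    [25, 28, -65, 36, 12, -12, -53, 56, 78, -10, 35, -3, 23, 14, 52, 53, 34, -27, -44, 38, 44, -37, 115, -22],
    [-19, -53, 75, -63, -8, 60, 111, -33, -137, 44, -71, -66, -14, -50, -85, 15, -11, 33, 52, -21, -37, 152, -156, 42],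
    [63, 97, -189, 112, 35, -59, -184, 150, 254, -43, 119, 17, 64, 63, 164, 119, 86, -82, -124, 98, 115, -156, 350, -72],
    [-13, -21, 39, -26, -7, 17, 43, -26, -55, 12, -28, -10, -12, -17, -35, -18, -14, 17, 24, -18, -22, 42, -72, 18]]"

definition golay_words :: "nat list list" where
  "golay_words = [
    [1, 3, 4, 6, 8, 10],
    [2, 3, 4, 5, 6, 7, 10],
    [1, 3, 5, 6, 7, 8, 9],
    [0, 1, 3, 5, 6, 10],
    [0, 1, 2, 3, 4, 5, 6, 7, 8, 9, 10, 11],
    [1, 2, 3, 4, 5, 9],
    [1, 3, 5, 6, 8, 9, 10],
    [2, 3, 4, 7, 8, 9, 11],
    [0, 1, 2, 3, 8],
    [1, 2, 4, 7, 8, 10],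
    [1, 3, 4, 7, 8, 11],
    [6, 10],
    [0, 1, 2, 3, 4, 5, 6, 7],
    [1, 3, 5, 6, 7, 10, 11],
    [],
    [3, 4, 6, 9],
    [1, 2, 3, 6, 9, 10],
    [1, 2, 6, 7, 8, 9, 11],
    [0, 9, 10],
    [1, 4, 5, 9, 10, 11],
    [1, 3, 7, 8, 9, 11],
    [1, 2, 3, 6, 9, 10],
    [1, 5, 6, 9],
    [0, 1, 2, 6, 8, 9]]"

text \<open>Integral homogeneous coordinates in a cyclic numbering of the plane of order 3: in the
  numbering of \<open>line_vecs\<close>, line \<open>j\<close> consists of the points j, j + 1, j +
  3 and j + 9 modulo 13.\<close>

definition point_vecs :: "(int \<times> int \<times> int) list" where
  "point_vecs = [
    (1, 0, 0),
    (0, 1, 0),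
    (0, 0, 1),
    (1, 1, 0),
    (0, 1, 1),
    (1, 1, 1),
    (1, 2, 1),
    (1, 2, 2),
    (2, 0, 2),
    (2, 1, 0),
    (0, 2, 1),
    (1, 1, 2),
    (2, 0, 1)]"

definition line_vecs :: "(int \<times> int \<times> int) list" where
  "line_vecs = [
    (0, 0, 1),
    (1, 0, 0),
    (1, 2, 0),
    (1, 2, 1),
    (0, 1, 2),
    (1, 0, 2),
    (1, 1, 0),
    (1, 2, 2),
    (1, 1, 2),
    (1, 1, 1),
    (0, 1, 1),
    (1, 0, 1),
    (0, 1, 0)]"

text \<open>Twice the real part of the product of the conjugate of \<open>x\<close> with
  \<open>y\<close>, when pairs stand for Eisenstein integers.\<close>

definition eis_trace :: "int \<times> int \<Rightarrow> int \<times> int \<Rightarrow> int" where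
  "eis_trace x y = 2 * fst x * fst y + 2 * snd x * snd y + fst x * snd y + snd x * fst y"

definition eis_sum :: "(int \<times> int) list \<Rightarrow> int \<times> int" where
  "eis_sum u = (sum_list (map fst u), sum_list (map snd u))"

text \<open>The factor 13 clears the mean subtracted by \<open>proj\<close>; division by 39 turns
  the value into the inner product in the normalization of the Leech lattice.\<close>

definition gram_val :: "(int \<times> int) list \<Rightarrow> (int \<times> int) list \<Rightarrow> int" where
  "gram_val u v = 13 * sum_list (map2 eis_trace u v) - eis_trace (eis_sum u) (eis_sum v)"

definition dot :: "int list \<Rightarrow> int list \<Rightarrow> int" where
  "dot u v = sum_list (map2 (*) u v)"

lemma leech_basis_gram: "map (\<lambda>u. map (dot u) leech_basis) leech_basis = map (map ((*) 8)) gram_mat"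
  by code_simp

lemma lattice_basis_gram: "map (\<lambda>u. map (gram_val u) basis_values) basis_values = map (map ((*) 39)) gram_mat"
  by code_simp

lemma gram_inv_gram: "map (\<lambda>u. map (\<lambda>i. dot u (map (\<lambda>r. r ! i) gram_mat)) [0..<24]) gram_inv = map (\<lambda>i. map (\<lambda>j. if i = j then 1 else 0) [0..<24]) [0..<24]"
  by code_simp


definition list_vec :: "int list \<Rightarrow> 23 option \<Rightarrow> int" where
  "list_vec ys i = ys ! inv_into {..<24} el i"

lemma list_vec_el: "k < 24 \<Longrightarrow> list_vec ys (el k) = ys ! k"
  unfolding list_vec_def using bij_el by (simp add: bij_betw_def)

lemma lengths: "list_all (\<lambda>v. length v = 24) leech_basis" "length leech_basis = 24"
    "list_all (\<lambda>v. length v = 24) gram_mat" "length gram_mat = 24" "length golay_words = 24"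
    "list_all (\<lambda>v. length v = 13) basis_values" "length basis_values = 24" "length lattice_basis = 24"
    "list_all (\<lambda>v. length v = 24) gram_inv" "length gram_inv = 24"
  by code_simp+

lemma dot_sum: "length u = n \<Longrightarrow> length v = n \<Longrightarrow> dot u v = (\<Sum>k<n. u ! k * v ! k)"
  unfolding dot_def by (simp add: sum_list_sum_nth atLeast0LessThan)

lemma leech_gram:
  assumes "i < 24" "j < 24"
  shows "leech_vec (list_vec (leech_basis ! i)) \<bullet> leech_vec (list_vec (leech_basis ! j)) = of_int (gram_mat ! i ! j)"
proof -
  have l: "length (leech_basis ! i) = 24" "length (leech_basis ! j) = 24" "length (gram_mat ! i) = 24"
    using lengths(1-4) assms unfolding list_all_iff by auto
  have "dot (leech_basis ! i) (leech_basis ! j) = 8 * gram_mat ! i ! j"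
    using arg_cong[OF leech_basis_gram, of "\<lambda>m. m ! i ! j"] assms l lengths(2,4) by simp
  moreover have "(\<Sum>a\<in>UNIV. list_vec (leech_basis ! i) a * list_vec (leech_basis ! j) a) = dot (leech_basis ! i) (leech_basis ! j)"
    unfolding sum_el dot_sum[OF l(1,2)] by (intro sum.cong) (auto simp: list_vec_el)
  ultimately show ?thesis unfolding leech_vec_inner by simp
qed

lemma gram_inverse:
  assumes "i < 24" "j < 24"
  shows "(\<Sum>k<24. gram_inv ! i ! k * gram_mat ! k ! j) = (if i = j then 1 else 0)"
proof -
  have l: "length (gram_inv ! i) = 24" using lengths(9,10) assms unfolding list_all_iff by auto
  have "dot (gram_inv ! i) (map (\<lambda>r. r ! j) gram_mat) = (if i = j then 1 else 0)"
    using arg_cong[OF gram_inv_gram, of "\<lambda>m. m ! i ! j"] assms lengths(10) by simp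
  then show ?thesis using l lengths(4) by (subst (asm) dot_sum[where n=24]) auto
qed

definition golay_word :: "nat list \<Rightarrow> bool list" where
  "golay_word w = foldr (\<lambda>j acc. map2 (\<noteq>) (golay_rows ! j) acc) w (replicate 24 False)"

lemma golay_word:
  assumes "\<forall>j\<in>set w. j < 23"
  shows "length (golay_word w) = 24"
    "k < 24 \<Longrightarrow> golay_word w ! k \<longleftrightarrow> el k \<in> foldr (\<lambda>j S. sym_diff (golay_gen (of_nat j)) S) w {}"
proof -
  have row: "length (golay_rows ! j) = 24" if "j < 23" for j
    using that unfolding golay_rows_rotate by (simp add: nonres_def)
  show l: "length (golay_word w) = 24"
    using assms by (induction w) (auto simp: golay_word_def row)
  show "k < 24 \<Longrightarrow> golay_word w ! k \<longleftrightarrow> el k \<in> foldr (\<lambda>j S. sym_diff (golay_gen (of_nat j)) S) w {}"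
    using assms
  proof (induction w)
    case (Cons j w)
    have e: "golay_word (j # w) = map2 (\<noteq>) (golay_rows ! j) (golay_word w)" by (simp add: golay_word_def)
    have "length (golay_word w) = 24"
      using Cons.prems(2) by (induction w) (auto simp: golay_word_def row)
    then have "golay_word (j # w) ! k \<longleftrightarrow> golay_mem j k \<noteq> golay_word w ! k"
      unfolding e using Cons.prems row[of j] by (simp add: golay_mem_def)
    then show ?case using Cons el_golay_gen[of k j] by auto
  qed (simp add: golay_word_def)
qed

lemma leech_basis_in:
  assumes "i < 24" shows "leech_vec (list_vec (leech_basis ! i)) \<in> leech"
proof -
  let ?y = "leech_basis ! i" and ?w = "golay_words ! i"
  \<comment> \<open>For each tabulated vector \<open>m\<close> is the common parity
    \<open>y ! 0 mod 2\<close>. The checks concern the range of the generator indices, the residues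
    modulo 4 against the codeword, and the coordinate sum modulo 8.\<close>
  have *: "list_all (\<lambda>(y, w). list_all (\<lambda>j. j < 23) w \<and>
      list_all (\<lambda>(s, c). (s - y ! 0 mod 2 - (if c then 2 else 0)) mod 4 = 0) (zip y (golay_word w)) \<and>
      (sum_list y - 4 * (y ! 0 mod 2)) mod 8 = 0) (zip leech_basis golay_words)"
    by code_simp
  have yw: "(?y, ?w) \<in> set (zip leech_basis golay_words)"
    using assms lengths(2,5) by (auto simp: set_zip intro!: exI[of _ i])
  note yw_props = bspec[OF *[unfolded list_all_iff[of _ "zip leech_basis golay_words"]] yw, unfolded case_prod_conv]
  have w: "\<forall>j\<in>set ?w. j < 23"
    using yw_props[THEN conjunct1] unfolding list_all_iff .
  note c' = yw_props[THEN conjunct2, THEN conjunct1] and s = yw_props[THEN conjunct2, THEN conjunct2]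
  have ly: "length ?y = 24" using lengths(1,2) assms unfolding list_all_iff by auto
  define C where "C = foldr (\<lambda>j S. sym_diff (golay_gen (of_nat j)) S) ?w {}"
  have "foldr (\<lambda>j S. sym_diff (golay_gen (of_nat j)) S) w {} \<in> golay" for w :: "nat list"
    by (induction w) (auto intro: golay.golay_empty golay_sym_diff golay_gen_in)
  then have CG: "C \<in> golay" unfolding C_def .
  have c: "(?y ! k - ?y ! 0 mod 2 - (if el k \<in> C then 2 else 0)) mod 4 = 0" if "k < 24" for k
  proof -
    have "(?y ! k, golay_word ?w ! k) \<in> set (zip ?y (golay_word ?w))"
      using that ly golay_word(1)[OF w] by (auto simp: set_zip intro!: exI[of _ k])
    from bspec[OF c'[unfolded list_all_iff[of _ "zip ?y (golay_word ?w)"]] this, unfolded case_prod_conv]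
    show ?thesis unfolding golay_word(2)[OF w that] C_def .
  qed
  have "[list_vec ?y a = ?y ! 0 mod 2 + (if a \<in> C then 2 else 0)] (mod 4)" for a
  proof -
    obtain k where k: "k < 24" "a = el k" by (rule el_surj)
    show ?thesis using c[OF k(1)] unfolding k(2) list_vec_el[OF k(1)] cong_iff_dvd_diff
      by (simp only: mod_eq_0_iff_dvd diff_diff_eq)
  qed
  moreover have "(\<Sum>a\<in>UNIV. list_vec ?y a) = sum_list ?y"
  proof -
    show ?thesis unfolding sum_el using ly by (simp add: sum_list_sum_nth atLeast0LessThan list_vec_el)
  qed
  then have "[(\<Sum>a\<in>UNIV. list_vec ?y a) = 4 * (?y ! 0 mod 2)] (mod 8)"
    using s by (simp add: cong_iff_dvd_diff mod_0_imp_dvd)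
  ultimately have "leech_rep (list_vec ?y) (?y ! 0 mod 2) C" unfolding leech_rep_def using CG by blast
  then show ?thesis unfolding leech_iff by blast
qed

section \<open>The case of the plane of order three\<close>

definition eis_add :: "int \<times> int \<Rightarrow> int \<times> int \<Rightarrow> int \<times> int" where
  "eis_add x y = (fst x + fst y, snd x + snd y)"

text \<open>Multiplication by p = 2 \<theta> - 1 for q = 3, where \<theta>^2 = \<theta> - 1.\<close>

definition eis_rt :: "int \<times> int \<Rightarrow> int \<times> int" where
  "eis_rt x = (- fst x - 2 * snd x, 2 * fst x + snd x)"

definition dot3 :: "int \<times> int \<times> int \<Rightarrow> int \<times> int \<times> int \<Rightarrow> int" where
  "dot3 x y = fst x * fst y + fst (snd x) * fst (snd y) + snd (snd x) * snd (snd y)"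

definition inc :: "nat \<Rightarrow> nat \<Rightarrow> bool" where
  "inc i j \<longleftrightarrow> dot3 (point_vecs ! i) (line_vecs ! j) mod 3 = 0"

definition line_part :: "nat \<Rightarrow> (nat \<times> int \<times> int) list \<Rightarrow> int \<times> int" where
  "line_part i = (\<lambda>ys. foldr (\<lambda>(j, c) acc. if inc i j then eis_add c acc else acc) ys (0, 0))"

definition point_part :: "nat \<Rightarrow> (nat \<times> int \<times> int) list \<Rightarrow> int \<times> int" where
  "point_part i = (\<lambda>xs. foldr (\<lambda>(k, c) acc. if k = i then eis_add (eis_rt c) acc else acc) xs (0, 0))"

text \<open>Points with different incidence rows are different, which yields that the 13 listed
  points are all points.\<close>

lemma inc_rows: "distinct (map (\<lambda>i. map (inc i) [0..<13]) [0..<13])"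
  by code_simp

text \<open>Two points on and one point off each line: enough to see that the solution set of its
  equation has dimension exactly 2.\<close>

lemma inc_near: "list_all (\<lambda>j. inc j j \<and> inc ((j + 1) mod 13) j \<and> \<not> inc ((j + 2) mod 13) j) [0..<13]"
  by code_simp

lemma basis_values_eq:
  "map (\<lambda>L. map (\<lambda>i. eis_add (line_part i (fst L)) (point_part i (snd L))) [0..<13]) lattice_basis = basis_values"
  by code_simp

lemma basis_indices: "list_all (\<lambda>L. list_all (\<lambda>x. fst x < 13) (fst L) \<and> list_all (\<lambda>x. fst x < 13) (snd L)) lattice_basis"
  by code_simp

text \<open>Since \<theta> is congruent to -3 modulo the prime 3 + \<theta>, the test says that this
  prime divides the coordinate sum of each basis vector.\<close>

lemma basis_sums: "list_all (\<lambda>v. (fst (eis_sum v) - 3 * snd (eis_sum v)) mod 13 = 0) basis_values"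
  by code_simp

locale plane3 = plane q ty for q and ty :: "'k::{field,finite} itself" +
  assumes q3: "q = 3"
begin

lemma th_norm_1: "th_norm = 1"
  using th_norm q3 by simp

lemma th_sq3: "\<theta> q * \<theta> q = \<theta> q - 1"
  using th_sq unfolding th_norm_1 by simp

lemma Re_th: "Re (\<theta> q) = 1 / 2"
  unfolding \<theta>_def by simp

lemma rt_sq3: "rt q * rt q = - 3"
  using rt_sq unfolding q3 by simp

definition ev :: "int \<times> int \<Rightarrow> complex" where
  "ev c = of_int (fst c) + of_int (snd c) * \<theta> q"

lemma ev_add: "ev (eis_add c d) = ev c + ev d"
  unfolding ev_def eis_add_def by (simp add: algebra_simps)

lemma ev_rt: "ev (eis_rt c) = rt q * ev c"
proof -
  have "rt q * ev c = of_int (fst c) * (2 * \<theta> q - 1) + of_int (snd c) * (2 * (\<theta> q * \<theta> q) - \<theta> q)"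
    unfolding ev_def rt_th by (simp add: algebra_simps)
  then show ?thesis unfolding th_sq3 unfolding ev_def eis_rt_def by (simp add: algebra_simps)
qed

lemma ev_O: "ev c \<in> \<O> q"
  unfolding ev_def by auto

lemma ev_zero: "ev (0, 0) = 0"
  by (simp add: ev_def)

lemma ev_trace: "Re (cnj (ev c) * ev d) = of_int (eis_trace c d) / 2"
proof -
  obtain x y where c: "c = (x, y)" by (cases c)
  obtain u v where d: "d = (u, v)" by (cases d)
  have "cnj (ev c) * ev d = (of_int x + of_int y) * of_int u + (of_int x + of_int y) * of_int v * \<theta> q
      - of_int y * of_int u * \<theta> q - of_int y * of_int v * (\<theta> q * \<theta> q)"
    unfolding ev_def c d by (simp add: cnj_th algebra_simps)
  also have "\<dots> = of_int (x * u + y * u + y * v) + of_int (x * v - y * u) * \<theta> q"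
    unfolding th_sq3 by (simp add: algebra_simps)
  finally have e: "cnj (ev c) * ev d = of_int (x * u + y * u + y * v) + of_int (x * v - y * u) * \<theta> q" .
  show ?thesis unfolding e unfolding c d eis_trace_def by (simp add: Re_th field_simps)
qed

lemma ev_eis_sum: "ev (eis_sum v) = (\<Sum>i<length v. ev (v ! i))"
proof -
  have "ev (eis_sum v) = sum_list (map ev v)"
    by (induction v) (auto simp: eis_sum_def ev_def algebra_simps)
  then show ?thesis by (simp add: sum_list_sum_nth atLeast0LessThan)
qed

section \<open>The two primes above 13\<close>

definition pi1 :: complex where "pi1 = 3 + \<theta> q"
definition pi2 :: complex where "pi2 = 4 - \<theta> q"

lemma pi_O: "pi1 \<in> \<O> q" "pi2 \<in> \<O> q"
  unfolding pi1_def pi2_def by auto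

lemma pi_mult: "pi1 * pi2 = 13" "pi2 * pi1 = 13"
  unfolding pi1_def pi2_def using th_sq3 by (simp_all add: algebra_simps)

lemma cnj_pi: "cnj pi1 = pi2" "cnj pi2 = pi1"
  unfolding pi1_def pi2_def by (simp_all add: cnj_th)

text \<open>\<theta> is congruent to -3 modulo \<open>pi1\<close> and to 4 modulo
  \<open>pi2\<close>, so integers represent all residues.\<close>

lemma O_mod_pi:
  assumes "x \<in> \<O> q"
  shows "\<exists>m::int. \<exists>y\<in>\<O> q. x = of_int m + pi1 * y" "\<exists>m::int. \<exists>y\<in>\<O> q. x = of_int m + pi2 * y"
proof -
  obtain c d :: int where x: "x = of_int c + of_int d * \<theta> q" using assms unfolding O_iff by blast
  have "x = of_int (c - 3 * d) + pi1 * of_int d" "x = of_int (c + 4 * d) + pi2 * of_int (- d)"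
    unfolding x pi1_def pi2_def by (simp_all add: algebra_simps)
  then show "\<exists>m::int. \<exists>y\<in>\<O> q. x = of_int m + pi1 * y" "\<exists>m::int. \<exists>y\<in>\<O> q. x = of_int m + pi2 * y"
    using O_int by blast+
qed

text \<open>Modulo 13 the norm form c^2 + c d + d^2 factors as (c - 3 d) (c + 4 d), and the two
  factors are the residues of \<open>x\<close> modulo \<open>pi1\<close> and
  \<open>pi2\<close>.\<close>

lemma norm_13:
  assumes "x \<in> \<O> q" "x * cnj x = of_int (13 * k)"
  shows "(\<exists>y\<in>\<O> q. x = pi1 * y) \<or> (\<exists>y\<in>\<O> q. x = pi2 * y)"
proof -
  obtain c d :: int where x: "x = of_int c + of_int d * \<theta> q" using assms unfolding O_iff by blast
  have "x * cnj x = of_int (c*c + c*d + d*d) - of_int (d*d) * (\<theta> q * \<theta> q - \<theta> q + 1)"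
    unfolding x by (simp add: cnj_th algebra_simps)
  then have "(of_int (c*c + c*d + d*d) :: complex) = of_int (13 * k)" unfolding th_sq3 assms(2) by simp
  then have "c*c + c*d + d*d = 13 * k" by (simp only: of_int_eq_iff)
  then have "(c - 3 * d) * (c + 4 * d) = 13 * (k - d * d)" by (simp add: algebra_simps)
  then have "13 dvd (c - 3 * d) * (c + 4 * d)" by simp
  moreover have "prime (13 :: int)" by simp
  ultimately consider "13 dvd c - 3 * d" | "13 dvd c + 4 * d" using prime_dvd_mult_iff by blast
  then show ?thesis
  proof cases
    case 1
    then obtain e where "c - 3 * d = 13 * e" by blast
    then have c: "c = 13 * e + 3 * d" by simp
    have "x = 13 * of_int e + of_int d * pi1" unfolding x pi1_def c by (simp add: algebra_simps)
    then have "x = pi1 * (pi2 * of_int e + of_int d)" unfolding pi_mult(1)[symmetric] by (simp add: algebra_simps)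
    moreover have "pi2 * of_int e + of_int d \<in> \<O> q" using pi_O by auto
    ultimately show ?thesis by blast
  next
    case 2
    then obtain e where e: "c + 4 * d = 13 * e" by blast
    then have c: "c = 13 * e - 4 * d" by simp
    have "x = 13 * of_int e - of_int d * pi2" unfolding x pi2_def c by (simp add: algebra_simps)
    then have "x = pi2 * (pi1 * of_int e - of_int d)" unfolding pi_mult(2)[symmetric] by (simp add: algebra_simps)
    moreover have "pi1 * of_int e - of_int d \<in> \<O> q" using pi_O by auto
    ultimately show ?thesis by blast
  qed
qed

section \<open>The plane of order three matched with the tables\<close>

definition V3 :: "int \<times> int \<times> int \<Rightarrow> 'k ^ 3" where
  "V3 v = vector [of_int (fst v), of_int (fst (snd v)), of_int (snd (snd v))]"

definition ptk :: "nat \<Rightarrow> ('k ^ 3) set" where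
  "ptk i = vec.span {V3 (point_vecs ! i)}"

definition lnk :: "nat \<Rightarrow> ('k ^ 3) set" where
  "lnk j = {x. (\<Sum>k\<in>UNIV. x $ k * V3 (line_vecs ! j) $ k) = 0}"

lemma lnk_subspace: "vec.subspace (lnk j)"
  unfolding lnk_def vec.subspace_def
  by (auto simp: distrib_right sum.distrib mult.assoc sum_distrib_left[symmetric])

lemma ptk_lnk: "ptk i \<subseteq> lnk j \<longleftrightarrow> inc i j"
proof -
  have "ptk i \<subseteq> lnk j \<longleftrightarrow> V3 (point_vecs ! i) \<in> lnk j"
    unfolding ptk_def using vec.span_minimal[OF _ lnk_subspace, of "{V3 (point_vecs ! i)}" j]
      vec.span_base[of "V3 (point_vecs ! i)" "{V3 (point_vecs ! i)}"] by blast
  also have "\<dots> \<longleftrightarrow> (of_int (dot3 (point_vecs ! i) (line_vecs ! j)) :: 'k) = 0"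
    unfolding lnk_def V3_def dot3_def by (simp add: sum_3 vector_3)
  also have "\<dots> \<longleftrightarrow> inc i j" unfolding of_int_k_eq_0 inc_def q3 by (simp add: dvd_eq_mod_eq_0)
  finally show ?thesis .
qed

lemma inc_facts: "j < 13 \<Longrightarrow> inc j j" "j < 13 \<Longrightarrow> inc ((j + 1) mod 13) j" "j < 13 \<Longrightarrow> \<not> inc ((j + 2) mod 13) j"
  using inc_near unfolding list_all_iff by auto

lemma ptk_P: assumes "i < 13" shows "ptk i \<in> P"
proof -
  \<comment> \<open>Adding 11 is subtracting 2 modulo 13, so \<open>i\<close> is the point that
    \<open>inc_near\<close> places off the line \<open>?j\<close>; hence its vector is not
    zero.\<close>
  let ?j = "(i + 11) mod 13"
  have "(?j + 2) mod 13 = i" using assms by (simp add: mod_simps)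
  then have "\<not> inc i ?j" using inc_facts(3)[of ?j] by simp
  then have "\<not> ptk i \<subseteq> lnk ?j" unfolding ptk_lnk .
  then have "V3 (point_vecs ! i) \<noteq> 0" using vec.subspace_0[OF lnk_subspace] unfolding ptk_def by auto
  then show ?thesis unfolding ptk_def by (rule span_in_pts)
qed

lemma ptk_inj: "inj_on ptk {..<13}"
proof (rule inj_onI)
  fix i k assume ik: "i \<in> {..<13}" "k \<in> {..<13}" "ptk i = ptk k"
  then have "inc i j = inc k j" for j using ptk_lnk by metis
  then have "map (inc i) [0..<13] = map (inc k) [0..<13]" by simp
  then have "map (\<lambda>i. map (inc i) [0..<13]) [0..<13] ! i = map (\<lambda>i. map (inc i) [0..<13]) [0..<13] ! k"
    using ik by simp
  then show "i = k" using ik inc_rows by (subst (asm) nth_eq_iff_index_eq) auto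
qed

lemma ptk_bij: "bij_betw ptk {..<13} P"
proof -
  have "ptk ` {..<13} = P"
    using ptk_P ptk_inj card_pts unfolding q3 by (intro card_subset_eq) (auto simp: card_image)
  then show ?thesis using ptk_inj unfolding bij_betw_def by blast
qed

lemma sum_ptk: "(\<Sum>x\<in>P. f x) = (\<Sum>i<13. f (ptk i))"
  by (rule sum.reindex_bij_betw[OF ptk_bij, symmetric])

lemma lnk_Ls: assumes "j < 13" shows "lnk j \<in> Ls"
proof -
  let ?i = "(j + 1) mod 13" and ?k = "(j + 2) mod 13"
  have p: "ptk j \<in> P" "ptk ?i \<in> P" "ptk ?k \<in> P" using ptk_P assms by simp_all
  have s: "ptk j \<subseteq> lnk j" "ptk ?i \<subseteq> lnk j" "\<not> ptk ?k \<subseteq> lnk j" using inc_facts assms unfolding ptk_lnk by auto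
  have "?i \<noteq> j" using assms by presburger
  then have ne: "ptk j \<noteq> ptk ?i" using inj_onD[OF ptk_inj, of ?i j] assms by auto
  have pd: "vec.subspace (ptk j)" "vec.dim (ptk j) = 1" "vec.subspace (ptk ?i)" "vec.dim (ptk ?i) = 1"
    using p unfolding pts_def by auto
  have "vec.dim (lnk j) \<ge> 2"
  proof (rule ccontr)
    assume "\<not> vec.dim (lnk j) \<ge> 2"
    then have "vec.dim (lnk j) \<le> 1" by simp
    then have "ptk j = lnk j" "ptk ?i = lnk j"
      using vec.subspace_dim_equal[OF pd(1) lnk_subspace s(1)] vec.subspace_dim_equal[OF pd(3) lnk_subspace s(2)] pd by auto
    then show False using ne by simp
  qed
  moreover have "vec.dim (lnk j) \<le> 2"
  proof (rule ccontr)
    assume "\<not> vec.dim (lnk j) \<le> 2"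
    then have "vec.dim (UNIV :: ('k^3) set) \<le> vec.dim (lnk j)"
      using vec.dim_UNIV[where 'a='k and 'b=3] by (simp add: card_cart_basis)
    then have "lnk j = UNIV" using vec.subspace_dim_equal[OF lnk_subspace vec.subspace_UNIV] by simp
    then show False using s(3) by simp
  qed
  ultimately show ?thesis unfolding lns_def using lnk_subspace by simp
qed

definition bv :: "nat \<Rightarrow> ('k ^ 3) set \<Rightarrow> complex" where
  "bv t r = sum_list (map (\<lambda>(j, c). ev c * line_vec (lnk j) r) (fst (lattice_basis ! t)))
     + sum_list (map (\<lambda>(k, c). ev c * (if r = ptk k then rt q else 0)) (snd (lattice_basis ! t)))"

lemma bv_LC: assumes "t < 24" shows "bv t \<in> LC"
proof -
  have i: "\<forall>x\<in>set (fst (lattice_basis ! t)). fst x < 13" "\<forall>x\<in>set (snd (lattice_basis ! t)). fst x < 13"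
    using basis_indices assms lengths(8) unfolding list_all_iff by auto
  have "(\<lambda>r. sum_list (map (\<lambda>(j, c). ev c * line_vec (lnk j) r) ys)) \<in> LC"
    if "\<forall>x\<in>set ys. fst x < 13" for ys
    using that
  proof (induction ys)
    case (Cons x ys)
    then show ?case using LC_add[OF LC_smult[OF ev_O[of "snd x"] line_vec_LC[OF lnk_Ls[of "fst x"]]]]
      by (simp add: case_prod_unfold)
  qed (simp add: LC_0)
  moreover have "(\<lambda>r. sum_list (map (\<lambda>(k, c). ev c * (if r = ptk k then rt q else 0)) xs)) \<in> LC"
    if "\<forall>x\<in>set xs. fst x < 13" for xs
    using that
  proof (induction xs)
    case (Cons x xs)
    have "ptk (fst x) \<in> J" using ptk_P Cons.prems by (simp add: J_def)
    then show ?case using LC_add[OF LC_smult[OF ev_O[of "snd x"] rt_unit_LC]] Cons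
      by (simp add: case_prod_unfold)
  qed (simp add: LC_0)
  ultimately show ?thesis using LC_add i unfolding bv_def[abs_def] by blast
qed

lemma bv_value: assumes "t < 24" "i < 13" shows "bv t (ptk i) = ev (basis_values ! t ! i)"
proof -
  have ix: "\<forall>x\<in>set (fst (lattice_basis ! t)). fst x < 13" "\<forall>x\<in>set (snd (lattice_basis ! t)). fst x < 13"
    using basis_indices assms lengths(8) unfolding list_all_iff by auto
  have ne: "ptk i \<noteq> {}" using ptk_P[OF assms(2)] empty_notin by metis
  have l: "line_vec (lnk j) (ptk i) = (if inc i j then 1 else 0)" for j
    unfolding line_vec_def pts_on_def using ne ptk_P[OF assms(2)] ptk_lnk by auto
  have "sum_list (map (\<lambda>(j, c). ev c * line_vec (lnk j) (ptk i)) ys) = ev (line_part i ys)" for ys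
    unfolding line_part_def by (induction ys) (auto simp: l ev_add ev_zero)
  moreover have "sum_list (map (\<lambda>(k, c). ev c * (if ptk i = ptk k then rt q else 0)) xs) = ev (point_part i xs)"
    if "\<forall>x\<in>set xs. fst x < 13" for xs
    using that
  proof (induction xs)
    case (Cons x xs)
    have "ptk i = ptk (fst x) \<longleftrightarrow> fst x = i" using inj_onD[OF ptk_inj, of i "fst x"] Cons.prems assms(2) by auto
    then show ?case using Cons by (auto simp: point_part_def case_prod_unfold ev_add ev_rt mult.commute)
  qed (simp add: point_part_def ev_zero)
  ultimately have "bv t (ptk i) = ev (eis_add (line_part i (fst (lattice_basis ! t))) (point_part i (snd (lattice_basis ! t))))"
    unfolding bv_def ev_add using ix by simp
  moreover have "basis_values ! t ! i = eis_add (line_part i (fst (lattice_basis ! t))) (point_part i (snd (lattice_basis ! t)))"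
    using assms lengths(8) unfolding basis_values_eq[symmetric] by simp
  ultimately show ?thesis by simp
qed

lemma basis_len: "t < 24 \<Longrightarrow> length (basis_values ! t) = 13"
  using lengths(6,7) unfolding list_all_iff by auto

lemma bv_sum: assumes "t < 24" shows "(\<Sum>x\<in>P. bv t x) = ev (eis_sum (basis_values ! t))"
  unfolding sum_ptk ev_eis_sum basis_len[OF assms] by (intro sum.cong) (auto simp: bv_value[OF assms])

lemma bv_sum_pi: assumes "t < 24" shows "\<exists>c\<in>\<O> q. (\<Sum>x\<in>P. bv t x) = pi1 * c"
proof -
  let ?s = "eis_sum (basis_values ! t)"
  have "(fst ?s - 3 * snd ?s) mod 13 = 0" using basis_sums assms lengths(7) unfolding list_all_iff by auto
  then obtain e where "fst ?s - 3 * snd ?s = 13 * e" by (auto simp: mod_eq_0_iff_dvd)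
  then have "fst ?s = 13 * e + 3 * snd ?s" by simp
  then have "ev ?s = 13 * of_int e + of_int (snd ?s) * pi1" unfolding ev_def pi1_def by (simp add: algebra_simps)
  also have "\<dots> = pi1 * (pi2 * of_int e + of_int (snd ?s))" unfolding pi_mult(1)[symmetric] by (simp add: algebra_simps)
  finally have e: "ev ?s = pi1 * (pi2 * of_int e + of_int (snd ?s))" .
  have "pi2 * of_int e + of_int (snd ?s) \<in> \<O> q" using pi_O by auto
  then show ?thesis unfolding bv_sum[OF assms] using e by blast
qed

text \<open>Conjugation negates p, so conjugating the coefficients and changing the sign of those at
  points conjugates the vector. This carries the tables from one prime above 13 to the
  other.\<close>

lemma LC_cnj: assumes "X \<in> LC" shows "(\<lambda>r. cnj (X r)) \<in> LC"
proof -
  obtain f where f: "f \<in> carrier (free_mod q (P \<union> Ls))" "X = coord f" using assms unfolding LC_def by blast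
  define g where "g r = (if r \<in> P then - cnj (f r) else cnj (f r))" for r
  have "coord g = (\<lambda>r. cnj (X r))"
  proof
    fix r
    have "(\<Sum>l\<in>A. g l) = (\<Sum>l\<in>A. cnj (f l))" if "A \<subseteq> Ls" for A
      using that pts_Int_lns by (intro sum.cong) (auto simp: g_def)
    then show "coord g r = cnj (X r)" unfolding f coord_def by (simp add: lns_thru_def g_def)
  qed
  moreover have "g \<in> carrier (free_mod q (P \<union> Ls))" using f(1) unfolding free_carrier g_def by auto
  ultimately show ?thesis using coord_LC by metis
qed

end

section \<open>The quotient lattice and the Leech lattice\<close>

locale null3 = null_lattice_vector q ty a b + plane3 q ty
  for q and ty :: "'k::{field,finite} itself" and a b
begin

lemma nn13: "nn = 13"
proof -
  have "q^2 + q + 1 = 13" using q3 by simp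
  then show ?thesis using nn_def by simp
qed

text \<open>\<open>X\<close> may be altered by \<open>k\<close> times the constant vector on the
  points, which \<open>proj\<close> does not see, and by a new extra coordinate
  \<open>cnj b * t'\<close>. Orthogonality to \<open>z\<close> then becomes \<alpha> t' = s +
  \<sigma> k, solvable because \<alpha> is a unit modulo \<sigma>.\<close>

lemma W_contains:
  assumes "\<rho> \<in> \<O> q" "\<sigma> \<in> \<O> q" "\<rho> * \<sigma> = 13" "cnj a = \<rho> * \<alpha>" "y \<in> \<O> q" "\<alpha> = of_int m + \<sigma> * y" "\<not> 13 dvd m"
    and X: "X \<in> LC" "s \<in> \<O> q" "(\<Sum>x\<in>P. X x) = \<rho> * s"
  shows "proj X \<in> W"
proof -
  have "\<not> 13 dvd 27 * m" using assms(7) prime_dvd_mult_iff[of "13 :: int" 27 m] by simp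
  then have "coprime (27 * m) 13" using prime_imp_coprime[of "13 :: int" "27 * m"] by (simp add: coprime_commute)
  then obtain n where n: "[27 * m * n = 1] (mod 13)" using cong_solve_coprime_int by blast
  then obtain k' where k': "27 * m * n = 1 + 13 * k'" by (metis cong_iff_lin cong_sym mult.commute)
  \<comment> \<open>The factor 27, a multiple of 3 and prime to 13, makes \<open>t'\<close>
    divisible by p. By \<open>LC_trace\<close> the altered extra coordinate then keeps its residue
    modulo p, and the vector stays in the lattice.\<close>
  define t' where "t' = 27 * of_int n * s"
  define k where "k = s * (\<rho> * of_int k' + 27 * of_int n * y)"
  have kO: "k \<in> \<O> q" "t' \<in> \<O> q" unfolding k_def t'_def using assms by auto
  have "\<alpha> * t' = s * (of_int (27 * m * n) + \<sigma> * (27 * of_int n * y))"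
    unfolding assms(6) t'_def by (simp add: algebra_simps)
  also have "\<dots> = s + \<sigma> * k" unfolding k' k_def by (simp add: assms(3)[symmetric] algebra_simps)
  finally have at: "\<alpha> * t' = s + \<sigma> * k" .
  have sum: "\<rho> * s + 13 * k = cnj a * t'"
    unfolding assms(4) mult.assoc at by (simp add: assms(3)[symmetric] algebra_simps)
  define Y where "Y r = (if r = {} then cnj b * t' else X r + k * ones r)" for r
  have Ysum: "(\<Sum>x\<in>P. Y x) = cnj a * t'"
  proof -
    have "(\<Sum>x\<in>P. Y x) = (\<Sum>x\<in>P. X x + k)" using empty_notin by (intro sum.cong) (auto simp: Y_def ones_def J_def)
    also have "\<dots> = \<rho> * s + 13 * k" using card_pts unfolding sum.distrib X(3) q3 by simp
    finally show ?thesis unfolding sum .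
  qed
  have L: "(\<lambda>r. X r + k * ones r) \<in> LC" using X(1) ones_LC kO by (intro LC_add LC_smult)
  have "Y \<in> LC"
  proof (rule LC_congruent[OF L])
    show "Y i = 0" if "i \<notin> J" for i using that LC_supp[OF X(1) that] by (auto simp: Y_def ones_def J_def)
    fix i assume i: "i \<in> J"
    show "\<exists>y\<in>\<O> q. Y i = X i + k * ones i + rt q * y"
    proof (cases "i = {}")
      case True
      obtain e where e: "e \<in> \<O> q" "(X {} + k * ones {}) - (\<Sum>x\<in>P. X x + k * ones x) = rt q * e" using LC_trace[OF L] by blast
      have "(\<Sum>x\<in>P. X x + k * ones x) = cnj a * t'"
        unfolding Ysum[symmetric] using empty_notin by (intro sum.cong) (auto simp: Y_def)
      then have "Y i = X i + k * ones i + (cnj b * t' - cnj a * t' - rt q * e)" using e(2) True by (simp add: Y_def algebra_simps)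
      also have "t' = rt q * (- (9 * rt q * of_int n * s))"
      proof -
        have "rt q * (- (9 * rt q * of_int n * s)) = - 9 * (rt q * rt q) * of_int n * s" by simp
        then show ?thesis unfolding rt_sq3 t'_def by simp
      qed
      finally have "Y i = X i + k * ones i + rt q * (cnj b * (- (9 * rt q * of_int n * s)) - cnj a * (- (9 * rt q * of_int n * s)) - e)"
        by (simp add: algebra_simps)
      moreover have "cnj b * (- (9 * rt q * of_int n * s)) - cnj a * (- (9 * rt q * of_int n * s)) - e \<in> \<O> q"
        using e(1) ab_O X(2) by auto
      ultimately show ?thesis by blast
    next
      case False
      then show ?thesis by (intro bexI[of _ 0]) (simp_all add: Y_def)
    qed
  qed
  moreover have "hf z Y = 0" unfolding hf_z Ysum by (simp add: Y_def)
  ultimately have "proj Y \<in> W" unfolding W_def zperp_def by blast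
  moreover have "proj Y = proj X"
  proof
    fix r
    have d: "cnj a * t' / 13 = (\<Sum>x\<in>P. X x) / 13 + k" unfolding X(3) sum[symmetric] by (simp add: add_divide_distrib)
    have "Y r = X r + k" if "r \<in> P" using that empty_notin by (auto simp: Y_def ones_def J_def)
    then show "proj Y r = proj X r" unfolding proj_def Ysum nn13 d by simp
  qed
  ultimately show ?thesis by simp
qed

text \<open>Exactly one of the two primes above 13 divides \<open>cnj a\<close> to a higher power than \<open>b\<close>; it
  determines the lattice.\<close>

lemma W_contains_cases:
  assumes f: "X0 \<in> LC" "hf z X0 = rt q"
  shows "(\<forall>X\<in>LC. \<forall>s\<in>\<O> q. (\<Sum>x\<in>P. X x) = pi1 * s \<longrightarrow> proj X \<in> W) \<or>
    (\<forall>X\<in>LC. \<forall>s\<in>\<O> q. (\<Sum>x\<in>P. X x) = pi2 * s \<longrightarrow> proj X \<in> W)"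
proof -
  \<comment> \<open>If 13 divided \<open>cnj a\<close>, the null equation would make one prime
    \<tau> above 13 divide \<open>b\<close>, and then the conjugate of \<tau> would divide every
    pairing with \<open>z\<close>. The value p of norm 3, attained at \<open>X0\<close>, excludes
    this.\<close>
  have no13: False if e: "e \<in> \<O> q" "cnj a = 13 * e" for e
  proof -
    obtain Ne where Ne: "e * cnj e = of_int Ne" using O_norm_int[OF e(1)] by blast
    have a13: "a = 13 * cnj e" using arg_cong[OF e(2), of cnj] by simp
    have "cnj a * a = (13 * e) * (13 * cnj e)" unfolding e(2) using a13 by simp
    then have "cnj a * a = 169 * of_int Ne" unfolding Ne[symmetric] by simp
    then have "13 * (b * cnj b) = 13 * of_int (13 * Ne)" using null' unfolding nn13 by (simp add: mult.commute)
    then have "b * cnj b = of_int (13 * Ne)" by simp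
    then obtain \<tau> c where tc: "\<tau> = pi1 \<or> \<tau> = pi2" "c \<in> \<O> q" "b = \<tau> * c" using norm_13 ab_O(2) by blast
    have t13: "cnj \<tau> * \<tau> = 13" "\<tau> \<in> \<O> q" using tc(1) pi_mult cnj_pi pi_O by auto
    define w where "w = \<tau> * e * X0 {} - cnj c * (\<Sum>x\<in>P. X0 x)"
    have wO: "w \<in> \<O> q" unfolding w_def using e tc t13 LC_O[OF f(1)] by auto
    have hz: "rt q = cnj a * X0 {} - cnj b * (\<Sum>x\<in>P. X0 x)" using f(2) unfolding hf_z by simp
    have cb: "cnj b = cnj \<tau> * cnj c" using tc(3) by simp
    have "rt q = cnj \<tau> * w"
      unfolding hz e(2) cb w_def by (simp add: right_diff_distrib mult.assoc[symmetric] t13(1))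
    then have "rt q * cnj (rt q) = (cnj \<tau> * \<tau>) * (w * cnj w)" by (simp only: complex_cnj_mult complex_cnj_cnj ac_simps)
    moreover obtain Nw where "w * cnj w = of_int Nw" using O_norm_int[OF wO] by blast
    ultimately have "(3 :: complex) = of_int (13 * Nw)" using rt_sq3 unfolding t13(1) by simp
    then have "of_int 3 = (of_int (13 * Nw) :: complex)" by simp
    then have "3 = 13 * Nw" unfolding of_int_eq_iff .
    then show False by presburger
  qed
  obtain Nb where Nb: "b * cnj b = of_int Nb" using O_norm_int[OF ab_O(2)] by blast
  have "cnj a * cnj (cnj a) = of_int (13 * Nb)" using null' Nb unfolding nn13 by (simp add: mult.commute)
  then consider \<alpha> where "\<alpha> \<in> \<O> q" "cnj a = pi1 * \<alpha>" | \<alpha> where "\<alpha> \<in> \<O> q" "cnj a = pi2 * \<alpha>"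
    using norm_13[of "cnj a"] ab_O by auto
  then show ?thesis
  proof cases
    case 1
    obtain m y where my: "y \<in> \<O> q" "\<alpha> = of_int m + pi2 * y" using O_mod_pi(2)[OF 1(1)] by blast
    have "\<not> 13 dvd m"
    proof
      assume "13 dvd m"
      then obtain k where "m = 13 * k" by blast
      then have "cnj a = 13 * (pi1 * of_int k + y)" unfolding 1(2) my(2) by (simp add: distrib_left mult.assoc[symmetric] pi_mult)
      then show False using no13[of "pi1 * of_int k + y"] my(1) pi_O by auto
    qed
    then show ?thesis using W_contains[OF pi_O(1,2) pi_mult(1) 1(2) my] by blast
  next
    case 2
    obtain m y where my: "y \<in> \<O> q" "\<alpha> = of_int m + pi1 * y" using O_mod_pi(1)[OF 2(1)] by blast
    have "\<not> 13 dvd m"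
    proof
      assume "13 dvd m"
      then obtain k where "m = 13 * k" by blast
      then have "cnj a = 13 * (pi2 * of_int k + y)" unfolding 2(2) my(2) by (simp add: distrib_left mult.assoc[symmetric] pi_mult)
      then show False using no13[of "pi2 * of_int k + y"] my(1) pi_O by auto
    qed
    then show ?thesis using W_contains[OF pi_O(2,1) pi_mult(2) 2(2) my] by blast
  qed
qed

definition emb :: "(('k ^ 3) set \<Rightarrow> complex) \<Rightarrow> complex ^ (('k ^ 3) set)" where
  "emb u = sqrt (2 / 3) *\<^sub>R (\<chi> r. u r)"

lemma emb_inner:
  assumes "\<And>r. r \<notin> P \<Longrightarrow> u r = 0" shows "emb u \<bullet> emb v = - (2 / 3) * Re (wf u v)"
proof -
  have "(\<chi> r. u r) \<bullet> (\<chi> r. v r) = (\<Sum>r\<in>UNIV. Re (cnj (u r) * v r))"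
    by (simp add: inner_vec_def inner_complex_def)
  also have "\<dots> = (\<Sum>r\<in>P. Re (cnj (u r) * v r))" by (rule sum.mono_neutral_right) (auto simp: assms)
  also have "\<dots> = - Re (wf u v)" unfolding wf_def by simp
  finally have 1: "(\<chi> r. u r) \<bullet> (\<chi> r. v r) = - Re (wf u v)" .
  have 2: "sqrt (2 / 3) * sqrt (2 / 3) = (2 / 3 :: real)" by (rule real_sqrt_mult_self[THEN trans]) simp
  show ?thesis unfolding emb_def inner_scaleR_left inner_scaleR_right 1 mult.assoc[symmetric] 2 by simp
qed

lemma emb_linear: "emb (\<lambda>i. u i + v i) = emb u + emb v" "emb (\<lambda>i. - 1 * u i) = - emb u" "emb (\<lambda>_. 0) = 0"
  unfolding emb_def by (simp_all add: vec_eq_iff scaleR_add_right)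

lemma emb_inj: "inj emb"
  unfolding emb_def by (rule injI) (simp add: vec_eq_iff fun_eq_iff)

lemma int_lattice_W: "int_lattice (emb ` W)"
  unfolding int_lattice_def
proof (intro conjI ballI)
  show "0 \<in> emb ` W" using W_0 emb_linear(3) by (metis imageI)
  show "- x \<in> emb ` W" if "x \<in> emb ` W" for x
    using that W_smult[of "-1"] O_int[of "-1"] emb_linear(2)[symmetric] by auto
next
  fix x y assume "x \<in> emb ` W" "y \<in> emb ` W"
  then obtain u v where uv: "u \<in> W" "v \<in> W" "x = emb u" "y = emb v" by blast
  show "x + y \<in> emb ` W" unfolding uv(3,4) emb_linear(1)[symmetric] using W_add uv by blast
  obtain y' where y': "y' \<in> \<O> q" "wf u v = rt q * y'" using W_form uv by blast
  obtain c d :: int where cd: "y' = of_int c + of_int d * \<theta> q" using y'(1) unfolding O_iff by blast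
  have "rt q * \<theta> q = (rt q + rt q * rt q) / 2" unfolding \<theta>_def by (simp add: algebra_simps)
  then have rth: "rt q * \<theta> q = (rt q + - 3) / 2" unfolding rt_sq3 .
  \<comment> \<open>As p is purely imaginary, only the \<theta>-coordinate of \<open>y'\<close>
    contributes to the real part, and the factor 2/3 makes the contribution an integer.\<close>
  have "Re (rt q * \<theta> q) = - 3 / 2" unfolding rth by simp
  moreover have "rt q * y' = of_int c * rt q + of_int d * (rt q * \<theta> q)" unfolding cd by (simp add: algebra_simps)
  ultimately have "Re (wf u v) = - (3 / 2) * of_int d" unfolding y'(2) by simp
  then have "x \<bullet> y = of_int d" unfolding uv(3,4) using emb_inner[of u v] W_supp[OF uv(1)] by simp
  then show "x \<bullet> y \<in> \<int>" by simp
qed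

text \<open>Sum-zero functions on 13 points are spanned over the complex numbers by 12 differences
  with a fixed point; these and their multiples by \<i> span over the reals.\<close>

lemma dim_W: "dim (emb ` W) \<le> 24"
proof -
  obtain x0 where x0: "x0 \<in> P" using exists_point by blast
  let ?I = "P - {x0}"
  let ?B = "(\<lambda>x. emb (diff_vec x x0)) ` ?I \<union> (\<lambda>x. emb (\<lambda>r. \<i> * diff_vec x x0 r)) ` ?I"
  have cI: "card ?I = 12" using x0 card_pts unfolding q3 by simp
  have "emb ` W \<subseteq> span ?B"
  proof
    fix v assume "v \<in> emb ` W"
    then obtain u where u: "u \<in> W" "v = emb u" by blast
    have eu: "emb u = (\<Sum>x\<in>?I. Re (u x) *\<^sub>R emb (diff_vec x x0) + Im (u x) *\<^sub>R emb (\<lambda>r. \<i> * diff_vec x x0 r))"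
    proof -
      have ur: "u r = (\<Sum>x\<in>?I. u x * diff_vec x x0 r)" for r
      proof -
        have "(\<Sum>x\<in>?I. u x * diff_vec x x0 r) = (\<Sum>x\<in>?I. if x = r then u r else 0) - (\<Sum>x\<in>?I. if r = x0 then u x else 0)"
          unfolding sum_subtractf[symmetric] by (intro sum.cong) (auto simp: diff_vec_def)
        moreover have "u x0 + (\<Sum>x\<in>?I. u x) = 0" using sum.remove[of P x0 u] x0 W_sum[OF u(1)] by simp
        then have "(\<Sum>x\<in>?I. u x) = - u x0" by (simp add: eq_neg_iff_add_eq_0 add.commute)
        ultimately show ?thesis using W_supp[OF u(1), of r] by (cases "r = x0"; cases "r \<in> P") auto
      qed
      have cx: "w * d = Re w *\<^sub>R d + Im w *\<^sub>R (\<i> * d)" for w d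
        by (simp add: complex_eq_iff algebra_simps)
      have urr: "u r = (\<Sum>x\<in>?I. Re (u x) *\<^sub>R diff_vec x x0 r + Im (u x) *\<^sub>R (\<i> * diff_vec x x0 r))" for r
        unfolding cx[symmetric] by (rule ur)
      have "(\<chi> r. u r) = (\<Sum>x\<in>?I. Re (u x) *\<^sub>R (\<chi> r. diff_vec x x0 r) + Im (u x) *\<^sub>R (\<chi> r. \<i> * diff_vec x x0 r))"
        unfolding vec_eq_iff sum_component vector_add_component vector_scaleR_component vec_lambda_beta
        by (rule allI) (rule urr)
      then show ?thesis unfolding emb_def by (simp add: scaleR_sum_right scaleR_add_right ac_simps)
    qed
    show "v \<in> span ?B" unfolding u(2) eu
      by (intro span_sum span_add span_scale span_base) auto
  qed
  then have "dim (emb ` W) \<le> card ?B" by (rule dim_le_card) simp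
  also have "\<dots> \<le> card ?I + card ?I"
    by (rule order_trans[OF card_Un_le]) (intro add_mono card_image_le, auto)
  finally show ?thesis unfolding cI by simp
qed

lemma proj_inner: "wf (proj X) (proj Y) = - ((\<Sum>x\<in>P. cnj (X x) * Y x) - cnj (\<Sum>x\<in>P. X x) * (\<Sum>x\<in>P. Y x) / 13)"
proof -
  let ?s = "\<Sum>x\<in>P. X x" and ?t = "\<Sum>x\<in>P. Y x"
  have g: "(A - S) * (B - T) = A * B - A * T - S * B + S * T" for A S B T :: complex
    by (simp add: algebra_simps)
  have pX: "cnj (proj X x) = cnj (X x) - cnj ?s / 13" and pY: "proj Y x = Y x - ?t / 13" if "x \<in> P" for x
    using that by (simp_all add: proj_def nn13)
  have "(\<Sum>x\<in>P. cnj (proj X x) * proj Y x) = (\<Sum>x\<in>P. (cnj (X x) - cnj ?s / 13) * (Y x - ?t / 13))"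
    by (intro sum.cong refl arg_cong2[of _ _ _ _ "(*)"] pX pY)
  also have "\<dots> = (\<Sum>x\<in>P. cnj (X x) * Y x - cnj (X x) * (?t / 13) - (cnj ?s / 13) * Y x + (cnj ?s / 13) * (?t / 13))"
    unfolding g ..
  also have "\<dots> = (\<Sum>x\<in>P. cnj (X x) * Y x) - cnj ?s * (?t / 13) - (cnj ?s / 13) * ?t + of_nat (card P) * ((cnj ?s / 13) * (?t / 13))"
    by (simp only: sum.distrib sum_subtractf sum_distrib_left[symmetric] sum_distrib_right[symmetric] sum_constant cnj_sum)
      (simp only: mult.left_commute)
  finally show ?thesis unfolding wf_def card_pts q3 by simp
qed

lemma bv_gram:
  assumes "s < 24" "t < 24"
  shows "- (2 / 3) * Re (wf (proj (bv s)) (proj (bv t))) = of_int (gram_mat ! s ! t)"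
proof -
  let ?u = "basis_values ! s" and ?v = "basis_values ! t"
  have l: "length ?u = 13" "length ?v = 13" "length (gram_mat ! s) = 24" "length gram_mat = 24"
    using basis_len assms lengths(3,4) unfolding list_all_iff by auto
  have g: "gram_val ?u ?v = 39 * gram_mat ! s ! t"
    using arg_cong[OF lattice_basis_gram, of "\<lambda>m. m ! s ! t"] assms l lengths(7) by simp
  have "(\<Sum>x\<in>P. cnj (bv s x) * bv t x) = (\<Sum>i<13. cnj (ev (?u ! i)) * ev (?v ! i))"
    unfolding sum_ptk using assms by (intro sum.cong) (auto simp: bv_value)
  then have "Re (\<Sum>x\<in>P. cnj (bv s x) * bv t x) = (\<Sum>i<13. of_int (eis_trace (?u ! i) (?v ! i)) / 2)"
    by (simp only: Re_sum ev_trace)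
  also have "\<dots> = of_int (sum_list (map2 eis_trace ?u ?v)) / 2"
    using l by (simp add: sum_list_sum_nth atLeast0LessThan sum_divide_distrib)
  finally have 1: "Re (\<Sum>x\<in>P. cnj (bv s x) * bv t x) = of_int (sum_list (map2 eis_trace ?u ?v)) / 2" .
  have 2: "Re (cnj (\<Sum>x\<in>P. bv s x) * (\<Sum>x\<in>P. bv t x)) = of_int (eis_trace (eis_sum ?u) (eis_sum ?v)) / 2"
    unfolding bv_sum[OF assms(1)] bv_sum[OF assms(2)] ev_trace ..
  have "Re (wf (proj (bv s)) (proj (bv t))) = - (Re (\<Sum>x\<in>P. cnj (bv s x) * bv t x) - Re (cnj (\<Sum>x\<in>P. bv s x) * (\<Sum>x\<in>P. bv t x)) / 13)"
    unfolding proj_inner by (simp only: uminus_complex.sel minus_complex.sel Re_divide_numeral)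
  then have "- (2 / 3) * Re (wf (proj (bv s)) (proj (bv t))) = of_int (gram_val ?u ?v) / 39"
    unfolding 1 2 gram_val_def by (simp add: field_simps)
  then show ?thesis unfolding g by simp
qed

text \<open>The sums of the tabulated vectors are divisible by \<open>pi1\<close>, so according to
  the prime that governs \<open>W\<close> either they or their conjugates project into it.
  Conjugation leaves the real part of the form unchanged, hence the Gram matrix is the same in both
  cases.\<close>

lemma W_leech:
  assumes rep: "represented q M \<Psi> wf" and im: "\<Psi> ` carrier M = W" and f: "X0 \<in> LC" "hf z X0 = rt q"
  shows "is_leech M"
proof -
  interpret M: represented q M \<Psi> wf by fact
  define \<kappa> :: "complex \<Rightarrow> complex" where "\<kappa> = (if \<forall>X\<in>LC. \<forall>s\<in>\<O> q. (\<Sum>x\<in>P. X x) = pi1 * s \<longrightarrow> proj X \<in> W then id else cnj)"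
  have \<kappa>: "\<kappa> = id \<or> \<kappa> = cnj" unfolding \<kappa>_def by simp
  define B where "B t = proj (\<lambda>r. \<kappa> (bv t r))" for t
  have BW: "B t \<in> W" if t: "t < 24" for t
  proof (cases "\<forall>X\<in>LC. \<forall>s\<in>\<O> q. (\<Sum>x\<in>P. X x) = pi1 * s \<longrightarrow> proj X \<in> W")
    case True
    then have "\<kappa> = id" unfolding \<kappa>_def by simp
    then show ?thesis using True bv_LC[OF t] bv_sum_pi[OF t] unfolding B_def by auto
  next
    case False
    then have k: "\<kappa> = cnj" and c: "\<forall>X\<in>LC. \<forall>s\<in>\<O> q. (\<Sum>x\<in>P. X x) = pi2 * s \<longrightarrow> proj X \<in> W"
      using W_contains_cases[OF f] unfolding \<kappa>_def by auto
    obtain c' where c': "c' \<in> \<O> q" "(\<Sum>x\<in>P. bv t x) = pi1 * c'" using bv_sum_pi[OF t] by blast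
    have "(\<Sum>x\<in>P. cnj (bv t x)) = pi2 * cnj c'" using arg_cong[OF c'(2), of cnj] by (simp add: cnj_pi)
    from c[rule_format, OF LC_cnj[OF bv_LC[OF t]] _ this] show ?thesis using c'(1) unfolding B_def k by simp
  qed
  have proj_cnj: "proj (\<lambda>r. cnj (X r)) = (\<lambda>r. cnj (proj X r))" for X
    by (auto simp: proj_def)
  have wf_cnj2: "Re (wf (\<lambda>r. cnj (u r)) (\<lambda>r. cnj (v r))) = Re (wf u v)" for u v
    unfolding wf_def by simp
  have Bgram: "emb (B s) \<bullet> emb (B t) = of_int (gram_mat ! s ! t)" if "s < 24" "t < 24" for s t
  proof -
    have "Re (wf (B s) (B t)) = Re (wf (proj (bv s)) (proj (bv t)))"
      using \<kappa> unfolding B_def by (elim disjE) (simp_all add: proj_cnj wf_cnj2)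
    then show ?thesis using emb_inner[of "B s" "B t"] W_supp[OF BW[OF that(1)]] bv_gram[OF that] by simp
  qed
  have "\<exists>\<phi>. bij_betw \<phi> (emb ` W) leech \<and> (\<forall>x\<in>emb ` W. \<forall>y\<in>emb ` W. \<phi> (x + y) = \<phi> x + \<phi> y \<and> \<phi> x \<bullet> \<phi> y = x \<bullet> y)"
  proof (rule lattice_isometry[OF int_lattice_W int_lattice_leech, where N=24 and b="\<lambda>t. emb (B t)"
        and c="\<lambda>t. leech_vec (list_vec (leech_basis ! t))" and G="\<lambda>i j. gram_mat ! i ! j" and K="\<lambda>i j. gram_inv ! i ! j"])
    show "dim leech \<le> 24"
      using dim_subset_UNIV[of leech] by (simp add: card_UNIV_option)
  qed (use BW Bgram leech_basis_in leech_gram gram_inverse dim_W in auto)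
  then obtain \<phi> where \<phi>: "bij_betw \<phi> (emb ` W) leech"
    "\<And>x y. x \<in> emb ` W \<Longrightarrow> y \<in> emb ` W \<Longrightarrow> \<phi> (x + y) = \<phi> x + \<phi> y"
    "\<And>x y. x \<in> emb ` W \<Longrightarrow> y \<in> emb ` W \<Longrightarrow> \<phi> x \<bullet> \<phi> y = x \<bullet> y" by blast
  have WM: "\<Psi> x \<in> W" if "x \<in> carrier M" for x using that im by blast
  have "bij_betw \<Psi> (carrier M) W" using M.inj_\<Psi> im unfolding bij_betw_def by blast
  moreover have "bij_betw emb W (emb ` W)" using inj_on_subset[OF emb_inj subset_UNIV] unfolding bij_betw_def by simp
  ultimately have "bij_betw (\<phi> \<circ> (emb \<circ> \<Psi>)) (carrier M) leech"
    by (intro bij_betw_trans[OF bij_betw_trans \<phi>(1)])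
  moreover have "(\<phi> \<circ> (emb \<circ> \<Psi>)) (x \<oplus>\<^bsub>M\<^esub> y) = (\<phi> \<circ> (emb \<circ> \<Psi>)) x + (\<phi> \<circ> (emb \<circ> \<Psi>)) y"
    if "x \<in> carrier M" "y \<in> carrier M" for x y
    using \<phi>(2) WM that by (simp add: M.add_M emb_linear)
  moreover have "(\<phi> \<circ> (emb \<circ> \<Psi>)) x \<bullet> (\<phi> \<circ> (emb \<circ> \<Psi>)) y = - (2 / 3) * Re (form M x y)"
    if xy: "x \<in> carrier M" "y \<in> carrier M" for x y
    using \<phi>(3) WM[OF xy(1)] WM[OF xy(2)] emb_inner[of "\<Psi> x" "\<Psi> y"] W_supp[OF WM[OF xy(1)]] M.form_M[OF xy] by simp
  ultimately show ?thesis unfolding is_leech_def by blast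
qed

end

theorem mainTheorem4:
  fixes q :: nat
  assumes "prime q" and "[q = 3] (mod 4)" and "CARD('k::{field,finite}) = q"
  shows
    "((\<exists>z :: (('k ^ 3) set \<Rightarrow> complex) set. fixed_null q z) \<longleftrightarrow> is_field_norm q (q^2 + q + 1))
     \<and>
     (is_field_norm q (q^2 + q + 1) \<longrightarrow>
       (\<exists>M :: (('k ^ 3) set \<Rightarrow> complex) set hmod.
          hermitian_lattice q M \<and> definite M \<and> p_modular q M \<and> has_rank q M (q^2 + q) \<and>
          contains_copy (Aut q M) (PGL3 :: ('k ^ 3 ^ 3) set monoid)) \<and>
       (\<forall>z :: (('k ^ 3) set \<Rightarrow> complex) set. fixed_null q z \<and> primitive q (L_plane q) z \<longrightarrow>
          (\<exists>f \<Lambda>. splitting q z f \<Lambda> \<and>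
             isometric q ((L_plane q)\<lparr>carrier := \<Lambda>\<rparr>) (perp_quot q (L_plane q) z) \<and>
             hermitian_lattice q ((L_plane q)\<lparr>carrier := \<Lambda>\<rparr>) \<and>
             definite ((L_plane q)\<lparr>carrier := \<Lambda>\<rparr>) \<and>
             p_modular q ((L_plane q)\<lparr>carrier := \<Lambda>\<rparr>) \<and>
             has_rank q ((L_plane q)\<lparr>carrier := \<Lambda>\<rparr>) (q^2 + q) \<and>
             contains_copy (Aut q ((L_plane q)\<lparr>carrier := \<Lambda>\<rparr>)) (PGL3 :: ('k ^ 3 ^ 3) set monoid))))
     \<and>
     (q = 3 \<longrightarrow>
       (\<forall>(z :: (('k ^ 3) set \<Rightarrow> complex) set) f \<Lambda>.
          fixed_null q z \<and> primitive q (L_plane q) z \<and> splitting q z f \<Lambda> \<longrightarrow>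
          is_leech ((L_plane q)\<lparr>carrier := \<Lambda>\<rparr>)))"
proof -
  interpret plane q "TYPE('k)" using assms by unfold_locales
  have inv: "\<exists>a b. invariant_null q a b Z" if Z: "fixed_null q Z" for Z :: "(('k ^ 3) set \<Rightarrow> complex) set"
  proof -
    obtain a b where ab: "\<Phi> Z = inv_vec a b" "null_lattice_vector TYPE('k) q a b"
      by (rule fixed_null_coordinates[OF Z])
    interpret N: null_lattice_vector q "TYPE('k)" a b by (rule ab(2))
    have "invariant_null q a b Z"
      using ab(1) z_inv_vec[OF N.null_vector_axioms] Z unfolding fixed_null_def
      by unfold_locales auto
    then show ?thesis by blast
  qed
  show ?thesis
  proof (intro conjI impI allI)
    show "(\<exists>z :: (('k ^ 3) set \<Rightarrow> complex) set. fixed_null q z) \<longleftrightarrow> is_field_norm q (q^2 + q + 1)"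
      by (rule fixed_null_iff_norm)
  next
    assume "is_field_norm q (q^2 + q + 1)"
    then obtain Z :: "(('k ^ 3) set \<Rightarrow> complex) set" where "fixed_null q Z" using fixed_null_iff_norm by blast
    then obtain a b where "invariant_null q a b Z" using inv by blast
    then interpret N: invariant_null q "TYPE('k)" a b Z .
    show "\<exists>M :: (('k ^ 3) set \<Rightarrow> complex) set hmod.
          hermitian_lattice q M \<and> definite M \<and> p_modular q M \<and> has_rank q M (q^2 + q) \<and>
          contains_copy (Aut q M) (PGL3 :: ('k ^ 3 ^ 3) set monoid)"
      using N.W_properties[OF N.W_lattice_represented N.W_lattice_image] by blast
  next
    fix z :: "(('k ^ 3) set \<Rightarrow> complex) set"
    assume z: "fixed_null q z \<and> primitive q (L_plane q) z"
    then obtain a b where "invariant_null q a b z" using inv by blast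
    then interpret N: invariant_null q "TYPE('k)" a b z .
    obtain f \<Lambda> where s: "splitting q z f \<Lambda>" using N.primitive_splitting z by blast
    show "\<exists>f \<Lambda>. splitting q z f \<Lambda> \<and>
             isometric q ((L_plane q)\<lparr>carrier := \<Lambda>\<rparr>) (perp_quot q (L_plane q) z) \<and>
             hermitian_lattice q ((L_plane q)\<lparr>carrier := \<Lambda>\<rparr>) \<and>
             definite ((L_plane q)\<lparr>carrier := \<Lambda>\<rparr>) \<and>
             p_modular q ((L_plane q)\<lparr>carrier := \<Lambda>\<rparr>) \<and>
             has_rank q ((L_plane q)\<lparr>carrier := \<Lambda>\<rparr>) (q^2 + q) \<and>
             contains_copy (Aut q ((L_plane q)\<lparr>carrier := \<Lambda>\<rparr>)) (PGL3 :: ('k ^ 3 ^ 3) set monoid)"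
      using s N.perp_quot_isometric[OF s] N.W_properties[OF N.splitting_represented[OF s]] by blast
  next
    fix z :: "(('k ^ 3) set \<Rightarrow> complex) set" and f \<Lambda>
    assume q: "q = 3" and z: "fixed_null q z \<and> primitive q (L_plane q) z \<and> splitting q z f \<Lambda>"
    then obtain a b where "invariant_null q a b z" using inv by blast
    then interpret N: invariant_null q "TYPE('k)" a b z .
    interpret N3: null3 q "TYPE('k)" a b using q by unfold_locales
    have s: "splitting q z f \<Lambda>" using z by blast
    \<comment> \<open>The vector with pairing p that \<open>W_leech\<close> asks for is the image of
      \<open>f\<close>.\<close>
    show "is_leech ((L_plane q)\<lparr>carrier := \<Lambda>\<rparr>)"
      using N3.W_leech[OF N.splitting_represented[OF s]] \<Phi>_LC N.splitting_facts(1,2)[OF s] by blast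
  qed
qed

end
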